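(* Let $d\in\{1,2,\ldots\}$, and let $0<p\le 1$, $0<q<\infty$, $s>0$. The Haar system $H^d$ (equipped with any of its natural enumerations) is a Schauder basis in the Besov space $\mathbf{B}_{p,q,1}^s(I^d)$ if either $$ d(1/p-1)<s<1/p,\quad (d-1)/d<p\le 1,\quad 0<q<\infty, $$ or if $$ s=d(1/p-1),\quad (d-1)/d<p<1,\quad 0<q\le p. $$ In all other cases, $H^d$ cannot be a Schauder basis in $\mathbf{B}_{p,q,1}^s(I^d)$. More precisely: (i) Let $0<q<\infty$. If $0<s<\min(d(1/p-1),1/p)$, then $\mathbf{B}_{p,q,1}^s(I^d)$ has a trivial dual (every bounded linear functional on it is $0$), while for $s\ge 1/p$ the space $\mathbf{B}_{p,q,1}^s(I^d)$ contains only constant functions. (ii) If $s=d(1/p-1)$ and $(d-1)/d<p<1$, then: (a) if $1<q<\infty$, then the coefficient functionals $c_h$ of the Haar expansion, which are uniquely defined on $\mathrm{span}(H^d)$, cannot be extended to bounded linear functionals on $\mathbf{B}_{p,q,1}^{d(1/p-1)}(I^d)$; (b) if $p<q\le 1$, then the partial sum operators of the Haar expansion are not uniformly bounded on $\mathbf{B}_{p,q,1}^{d(1/p-1)}(I^d)$.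
   Context: $I=[0,1]$, $I^d$ is the unit cube in $\mathbb{R}^d$, functions are real-valued. **Haar system.** For $k=0,1,\ldots$ and $i=1,\ldots,2^k$ let $\Delta_{k,i}=[(i-1)2^{-k},i2^{-k})$. For $k\ge 1$ and $i=1,\ldots,2^{k-1}$ let $h_{\Delta_{k-1,i}}=2^{(k-1)/2}(\chi_{\Delta_{k,2i-1}}-\chi_{\Delta_{k,2i}})$, where $\chi$ denotes characteristic functions. For $\mathbf{i}=(i_1,\ldots,i_d)\in\{1,\ldots,2^{k-1}\}^d$ let $H^d_{k,\mathbf{i}}$ be the set of the $2^d-1$ functions $\psi_{k,i_1}(x_1)\cdots\psi_{k,i_d}(x_d)$, where each $\psi_{k,i}$ is either $h_{\Delta_{k-1,i}}$ or $2^{(k-1)/2}\chi_{\Delta_{k-1,i}}$, and at least one factor is of the form $h_{\Delta_{k-1,i}}$. Set $H^d_0=\{\chi_{I^d}\}$, $H_k^d=\bigcup_{\mathbf{i}\in\{1,\ldots,2^{k-1}\}^d}H^d_{k,\mathbf{i}}$ for $k\ge 1$ (Haar functions of level $k$), and $H^d=\bigcup_{k\ge 0}H_k^d$. This is a complete orthonormal system in $L_2(I^d)$. A natural enumeration of $H^d$ is any enumeration that lists all of $H^d_k$ before any element of $H^d_{k+1}$, for every $k$; the order within each block $H^d_k$ is arbitrary. **Haar expansion.** Every $g\in\mathrm{span}(H^d)$ has the unique (finite) Haar expansion $g=\sum_{h\in H^d}c_h(g)h$ with coefficient functionals $c_h(g)=\int_{I^d}gh\,dx$; the same formula defines $c_h$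 on $L_1(I^d)$. For $p<q\le1$ and $s=d(1/p-1)$ as in (ii)(b), the Besov space embeds continuously into $L_1(I^d)$, so the coefficient functionals and partial sum operators are defined on it. The partial sum operators are the operators mapping $f$ to the partial sums, with respect to the chosen natural enumeration, of $\sum_h c_h(f)h$; among them are the level $k$ partial sum operators $P_kf=\sum_{l=0}^k\sum_{h\in H_l^d}c_h(f)h$, $k=0,1,\ldots$. **Besov space.** For $s>0$, $0<p,q<\infty$, $\mathbf{B}_{p,q,1}^s(I^d)$ is the set of all (equivalence classes of) Lebesgue measurable $f:I^d\to\mathbb{R}$ for which the quasi-norm $$\|f\|_{\mathbf{B}_{p,q,1}^s}=\|f\|_{L_p(I^d)}+\|t^{-s-1/q}\omega(t,f)_p\|_{L_q(I)}$$ is finite, where $\omega(t,f)_p=\sup_{0<|y|\le t}\|f(\cdot+y)-f\|_{L_p(I^d_y)}$ and $I^d_y=\{z\in I^d: z+y\in I^d\}$. **Schauder basis.** A sequence $(e_m)$ in a quasi-Banach space $X$ is a Schauder basis if every $f\in X$ has a unique representation $f=\sum_{m}c_me_m$ with convergence in $X$; the coefficient functionals are then bounded linear functionals on $X$ and the partial sum operators are uniformly bounded on $X$. *)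

theory Defs
  imports "HOL-Analysis.Analysis"
begin

section \<open>Function spaces with an extended quasi-norm\<close>

text \<open>
  Equivalence classes of functions are represented by functions: a space is a set \<open>X\<close> of functions
  with an extended quasi-norm \<open>N\<close>, and two elements are identified iff \<open>N\<close> vanishes on their
  difference.  Bounded functionals respect this identification, and so does convergence with
  respect to \<open>N\<close>.
\<close>

definition schauder_basis ::
    "('a \<Rightarrow> real) set \<Rightarrow> (('a \<Rightarrow> real) \<Rightarrow> ennreal) \<Rightarrow> (nat \<Rightarrow> 'a \<Rightarrow> real) \<Rightarrow> bool" where
  "schauder_basis X N e \<longleftrightarrow>
     (\<forall>m. e m \<in> X) \<and>
     (\<forall>f\<in>X. \<exists>!c::nat \<Rightarrow> real. (\<lambda>M. N (\<lambda>x. f x - (\<Sum>m<M. c m * e m x))) \<longlonglongrightarrow> 0)"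

definition bounded_functional ::
    "('a \<Rightarrow> real) set \<Rightarrow> (('a \<Rightarrow> real) \<Rightarrow> ennreal) \<Rightarrow> (('a \<Rightarrow> real) \<Rightarrow> real) \<Rightarrow> bool" where
  "bounded_functional X N \<phi> \<longleftrightarrow>
     (\<forall>f\<in>X. \<forall>g\<in>X. \<phi> (\<lambda>x. f x + g x) = \<phi> f + \<phi> g) \<and>
     (\<forall>f\<in>X. \<forall>a::real. \<phi> (\<lambda>x. a * f x) = a * \<phi> f) \<and>
     (\<exists>C::real. \<forall>f\<in>X. ennreal \<bar>\<phi> f\<bar> \<le> ennreal C * N f)"

definition uniformly_bounded ::
    "('a \<Rightarrow> real) set \<Rightarrow> (('a \<Rightarrow> real) \<Rightarrow> ennreal) \<Rightarrow>
      (nat \<Rightarrow> ('a \<Rightarrow> real) \<Rightarrow> ('a \<Rightarrow> real)) \<Rightarrow> bool" where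
  "uniformly_bounded X N T \<longleftrightarrow> (\<exists>C::real. \<forall>m. \<forall>f\<in>X. N (T m f) \<le> ennreal C * N f)"


section \<open>Lebesgue and Besov quasi-norms on the unit cube\<close>

text \<open>Only used with a positive exponent.\<close>

definition ennreal_powr :: "ennreal \<Rightarrow> real \<Rightarrow> ennreal" where
  "ennreal_powr x a = (if x = \<infinity> then \<infinity> else ennreal (enn2real x powr a))"

definition Lnorm :: "'a measure \<Rightarrow> real \<Rightarrow> ('a \<Rightarrow> ennreal) \<Rightarrow> ennreal" where
  "Lnorm M p f = ennreal_powr (\<integral>\<^sup>+ x. ennreal_powr (f x) p \<partial>M) (1 / p)"

definition unit_cube :: "(real^'n) set" where
  "unit_cube = cbox 0 1"

definition modulus :: "real \<Rightarrow> (real^'n \<Rightarrow> real) \<Rightarrow> real \<Rightarrow> ennreal" where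
  "modulus p f t =
     (SUP y\<in>{y. 0 < norm y \<and> norm y \<le> t}.
        Lnorm (lebesgue_on {z \<in> unit_cube. z + y \<in> unit_cube}) p (\<lambda>z. ennreal \<bar>f (z + y) - f z\<bar>))"

definition besov_norm :: "real \<Rightarrow> real \<Rightarrow> real \<Rightarrow> (real^'n \<Rightarrow> real) \<Rightarrow> ennreal" where
  "besov_norm p q s f =
     Lnorm (lebesgue_on unit_cube) p (\<lambda>x. ennreal \<bar>f x\<bar>) +
     Lnorm (lebesgue_on {0..1}) q (\<lambda>t. ennreal (t powr (- s - 1 / q)) * modulus p f t)"

text \<open>The values of the functions outside the unit cube are irrelevant.\<close>

definition besov_space :: "real \<Rightarrow> real \<Rightarrow> real \<Rightarrow> (real^'n \<Rightarrow> real) set" where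
  "besov_space p q s =
     {f. f \<in> borel_measurable (lebesgue_on unit_cube) \<and> besov_norm p q s f < \<infinity>}"


section \<open>The Haar system\<close>

definition dyadic :: "nat \<Rightarrow> nat \<Rightarrow> real set" where
  "dyadic k i = {(real i - 1) / 2^k ..< real i / 2^k}"

text \<open>
  For \<open>k \<ge> 1\<close> and \<open>1 \<le> i \<le> 2^(k-1)\<close>, the following two functions are the univariate Haar function
  and the normalized characteristic function of the interval \<open>dyadic (k-1) i\<close>.
\<close>

definition haar_wave :: "nat \<Rightarrow> nat \<Rightarrow> real \<Rightarrow> real" where
  "haar_wave k i x = 2 powr ((real k - 1) / 2) *
     (indicator (dyadic k (2 * i - 1)) x - indicator (dyadic k (2 * i)) x)"

definition haar_box :: "nat \<Rightarrow> nat \<Rightarrow> real \<Rightarrow> real" where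
  "haar_box k i x = 2 powr ((real k - 1) / 2) * indicator (dyadic (k - 1) i) x"

text \<open>The set \<open>S\<close> consists of the coordinates in which the factor is a Haar function.\<close>

definition haar_block :: "nat \<Rightarrow> ('n \<Rightarrow> nat) \<Rightarrow> (real^'n \<Rightarrow> real) set" where
  "haar_block k i =
     {\<lambda>x. \<Prod>j\<in>UNIV. if j \<in> S then haar_wave k (i j) (x $ j) else haar_box k (i j) (x $ j) | S.
       S \<noteq> {}}"

definition haar_level :: "nat \<Rightarrow> (real^'n \<Rightarrow> real) set" where
  "haar_level k =
     (if k = 0 then {indicator unit_cube}
      else (\<Union>i\<in>{i. \<forall>j. i j \<in> {1..2^(k-1)}}. haar_block k i))"

definition haar_system :: "(real^'n \<Rightarrow> real) set" where
  "haar_system = (\<Union>k. haar_level k)"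

definition natural_enumeration :: "(nat \<Rightarrow> real^'n \<Rightarrow> real) \<Rightarrow> bool" where
  "natural_enumeration e \<longleftrightarrow>
     bij_betw e UNIV haar_system \<and>
     (\<forall>k m n. e m \<in> haar_level k \<longrightarrow> e n \<in> haar_level (Suc k) \<longrightarrow> m < n)"

definition haar_span :: "(real^'n \<Rightarrow> real) set" where
  "haar_span = {\<lambda>x. \<Sum>h\<in>F. a h * h x | F a. finite F \<and> F \<subseteq> haar_system}"

definition haar_coeff :: "(real^'n \<Rightarrow> real) \<Rightarrow> (real^'n \<Rightarrow> real) \<Rightarrow> real" where
  "haar_coeff h g = (\<integral>x. g x * h x \<partial>lebesgue_on unit_cube)"

definition haar_partial_sum ::
    "(nat \<Rightarrow> real^'n \<Rightarrow> real) \<Rightarrow> nat \<Rightarrow> (real^'n \<Rightarrow> real) \<Rightarrow> real^'n \<Rightarrow> real" where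
  "haar_partial_sum e M f = (\<lambda>x. \<Sum>m<M. haar_coeff (e m) f * e m x)"

end

theory Submission
  imports Defs
begin

text \<open>
  Put \<open>\<sigma> = s p\<close>, \<open>r = q / p\<close> and \<open>\<delta> = d (1 - p)\<close>, and work with \<open>p\<close>-th powers of \<open>L\<^sub>p\<close> quasi-norms, which
  are subadditive.  For \<open>\<sigma> < 1\<close> the Besov quasi-norm is governed by approximation by step functions
  on dyadic cells: a Jackson inequality (averaging the differences over a cell) and a Bernstein inequality
  (a step function only varies near the cell boundaries) show that it is comparable to the
  \<open>\<ell>\<^sub>r\<close>-norm of \<open>2 powr (\<sigma> j)\<close> times the error of approximation by step functions of level \<open>j\<close>.
  For a step function of level \<open>j\<close> the \<open>L\<^sub>1\<close> norm is at most \<open>2 powr (\<delta> j / p)\<close> times the \<open>L\<^sub>p\<close> quasi-norm, so for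
  \<open>\<sigma> > \<delta>\<close>, or \<open>\<sigma> = \<delta>\<close> and \<open>r \<le> 1\<close>, cell averages exist, are stable and converge; since the Haar partial sum of
  level \<open>k\<close> is the cell average, the Haar expansion converges.

  The negative results come from explicit functions.  If \<open>\<sigma> < \<delta>\<close>, normalized characteristic functions of small
  cells tend to \<open>0\<close>: functionals vanish, and the formal expansion of a point mass converges to \<open>0\<close>.
  If \<open>\<sigma> = \<delta>\<close>, sums of such spikes with one cell per level have norm comparable to the \<open>\<ell>\<^sub>q\<close>-norm of the
  weights.  For \<open>q > 1\<close>, nested spikes have unbounded integrals, and a sum of nested spikes with weights in \<open>\<ell>\<^sub>q\<close>
  but not in \<open>\<ell>\<^sub>1\<close> has no expansion once expansions are unique.  For \<open>p < q \<le> 1\<close>, averaging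
  moves spikes from different levels in disjoint cells to one level, which replaces the \<open>\<ell>\<^sub>q\<close>-norm by the larger \<open>\<ell>\<^sub>p\<close>-norm.
  If \<open>\<sigma> \<ge> 1\<close>, the moduli \<open>\<omega>(2t)\<close> and \<open>\<omega>(t)\<close> are too close to each other to decay at the required rate,
  so they vanish.
\<close>

section \<open>Powers and series in the extended nonnegative reals\<close>

text \<open>For p < 1 a function in L_p need not be integrable, so the Jackson inequality cannot use
  cell means; it samples f at a well chosen point of each cell. Cell means, and with them Haar
  coefficients, become available only after an embedding into L_1. The thresholds have different
  origins. \<sigma> = 1 comes from cell boundaries: a shift y moves a fraction of order |y| 2^k of
  each cell of level k out of that cell. \<delta> comes from comparing l_1 and l_p norms of values
  on cells of volume 2^(-k d). On the line \<sigma> = \<delta> integrability asks for q \<le> 1,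
  convergence of averages for q \<le> p. Between the two the coefficients are still determined, so
  the failure of the averages rules out a basis. The notion of basis used here demands existence and
  uniqueness of expansions, with no continuity of coefficients. For q > 1 on this line the
  coefficients therefore have no a priori meaning and are recovered from uniqueness by localising to
  cells. The order inside a level is free, so partial blocks must be dominated by full ones with a
  constant independent of the level.\<close>

notation ennreal_powr (infixr "powe" 80)

lemma powe_ennreal [simp]: "0 \<le> x \<Longrightarrow> ennreal x powe a = ennreal (x powr a)"
  by (simp add: ennreal_powr_def)

lemma powe_top [simp]: "top powe a = top"
  by (simp add: ennreal_powr_def)

lemma powe_zero [simp]: "0 powe a = 0"
  by (simp add: ennreal_powr_def)

lemma powe_one [simp]: "1 powe a = 1"
  by (simp add: ennreal_powr_def)

lemma powe_mono: "x \<le> y \<Longrightarrow> 0 \<le> a \<Longrightarrow> x powe a \<le> y powe a"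
  by (cases x; cases y) (auto simp: top_unique intro!: ennreal_leI powr_mono2)

lemma powe_eq_0_iff [simp]: "x powe a = 0 \<longleftrightarrow> x = 0"
  by (cases x) auto

lemma powe_eq_top_iff [simp]: "x powe a = top \<longleftrightarrow> x = top"
  by (cases x) auto

lemma powe_less_top_iff [simp]: "x powe a < top \<longleftrightarrow> x < top"
  using powe_eq_top_iff[of x a] by (metis less_top top.not_eq_extremum)

lemma powe_powe [simp]: "(x powe a) powe b = x powe (a * b)"
  by (cases x) (auto simp: powr_powr)

lemma powe_1 [simp]: "x powe 1 = x"
  by (cases x) auto

lemma powe_mult: "(x * y) powe a = x powe a * y powe a"
proof (cases x; cases y)
  fix r s assume "x = ennreal r" "0 \<le> r" "y = ennreal s" "0 \<le> s"
  then show ?thesis by (simp add: ennreal_mult[symmetric] powr_mult)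
next
  fix r assume "x = ennreal r" "0 \<le> r" "y = top"
  then show ?thesis
    by (cases "r = 0") (auto simp: ennreal_mult_top)
next
  fix r assume "y = ennreal r" "0 \<le> r" "x = top"
  then show ?thesis
    by (cases "r = 0") (auto simp: ennreal_top_mult)
qed (auto simp: ennreal_top_mult)

lemma powe_measurable [measurable]: "(\<lambda>x. x powe a) \<in> borel_measurable borel"
  unfolding ennreal_powr_def by measurable

text \<open>After division by (x + y) powr a it remains to use t \<le> t powr a for two fractions t
  in [0,1] that sum to 1.\<close>

lemma powr_add_le:
  fixes x y a :: real
  assumes "0 \<le> x" "0 \<le> y" "0 < a" "a \<le> 1"
  shows "(x + y) powr a \<le> x powr a + y powr a"
proof (cases "x + y = 0")
  case False
  then have p: "x + y > 0" using assms by linarith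
  have *: "t \<le> t powr a" if "0 \<le> t" "t \<le> 1" for t :: real
  proof (cases "t = 0")
    case False
    with that have "t powr 1 \<le> t powr a" using assms by (intro powr_mono') auto
    with that show ?thesis by simp
  qed simp
  have "x / (x+y) \<le> (x / (x+y)) powr a" "y / (x+y) \<le> (y / (x+y)) powr a"
    by (rule *; use p assms in simp)+
  moreover have "x / (x+y) + y / (x+y) = 1" using p by (simp add: add_divide_distrib[symmetric])
  ultimately have "1 \<le> (x / (x+y)) powr a + (y / (x+y)) powr a" by linarith
  also have "\<dots> = (x powr a + y powr a) / (x+y) powr a"
    using assms by (simp add: powr_divide add_divide_distrib)
  finally show ?thesis using p by (simp add: le_divide_eq)
qed (use assms in auto)

lemma powe_add_le:
  assumes "0 < a" "a \<le> 1"
  shows "(x + y) powe a \<le> x powe a + y powe a"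
proof (cases x; cases y)
  fix r s assume "x = ennreal r" "0 \<le> r" "y = ennreal s" "0 \<le> s"
  then show ?thesis
    using powr_add_le[of r s a] assms by (simp flip: ennreal_plus)
qed auto

text \<open>The exponent r = q / p may exceed 1, where subadditivity fails; bounding the sum by
  twice the maximum costs 2 powr a, which becomes the quasi-triangle constant of
  \<open>rho\<close>.\<close>

lemma powe_add_le2:
  assumes "0 < a"
  shows "(x + y) powe a \<le> ennreal (2 powr a) * (x powe a + y powe a)"
proof -
  have "(x + y) powe a \<le> (2 * max x y) powe a"
    using assms
    by (intro powe_mono) (auto simp: mult_2 intro: add_mono)
  also have "\<dots> = ennreal (2 powr a) * max x y powe a"
    using powe_ennreal[of 2 a] by (simp add: powe_mult)
  also have "\<dots> \<le> ennreal (2 powr a) * (x powe a + y powe a)"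
    by (intro mult_left_mono) (auto simp: max_def)
  finally show ?thesis .
qed

lemma powe_sum_le:
  assumes "finite A" "0 < a" "a \<le> 1"
  shows "(\<Sum>i\<in>A. f i) powe a \<le> (\<Sum>i\<in>A. f i powe a)"
  using assms(1)
proof induction
  case (insert i A)
  have "(\<Sum>i\<in>insert i A. f i) powe a \<le> f i powe a + (\<Sum>i\<in>A. f i) powe a"
    using insert powe_add_le[OF assms(2,3)] by simp
  also have "\<dots> \<le> f i powe a + (\<Sum>i\<in>A. f i powe a)"
    by (intro add_left_mono insert)
  finally show ?case using insert by simp
qed simp

lemma powe_LIMSEQ:
  assumes "X \<longlonglongrightarrow> L" "0 < a"
  shows "(\<lambda>n. X n powe a) \<longlonglongrightarrow> L powe a"
proof (cases L)
  case (real l)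
  then have "eventually (\<lambda>n. X n < top) sequentially"
    using order_tendstoD(2)[OF assms(1), of top] by auto
  then have ev: "eventually (\<lambda>n. X n powe a = ennreal (enn2real (X n) powr a)) sequentially"
    by eventually_elim (metis ennreal_enn2real enn2real_nonneg powe_ennreal)
  have "(\<lambda>n. enn2real (X n)) \<longlonglongrightarrow> l"
    using assms(1) real by (intro tendsto_enn2real) auto
  then have "(\<lambda>n. enn2real (X n) powr a) \<longlonglongrightarrow> l powr a"
    using assms by (intro tendsto_powr2) auto
  then have "(\<lambda>n. ennreal (enn2real (X n) powr a)) \<longlonglongrightarrow> ennreal (l powr a)"
    by (intro tendsto_ennrealI)
  then show ?thesis using real ev
    by (simp add: tendsto_cong)
next
  case top
  show ?thesis unfolding top powe_top
  proof (rule order_tendstoI)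
    fix y :: ennreal assume "y < top"
    then have "y powe (1/a) < top" by simp
    from order_tendstoD(1)[OF assms(1)[unfolded top] this]
    show "eventually (\<lambda>n. y < X n powe a) sequentially"
    proof eventually_elim
      case (elim n)
      have "y \<le> X n powe a"
        using powe_mono[OF less_imp_le[OF elim], of a] assms by simp
      moreover have "y \<noteq> X n powe a"
        using elim assms by auto
      ultimately show ?case by simp
    qed
  qed auto
qed

lemma powe_LIMSEQ_0:
  assumes "X \<longlonglongrightarrow> 0" "0 < a"
  shows "(\<lambda>n. X n powe a) \<longlonglongrightarrow> 0"
  using powe_LIMSEQ[OF assms] by simp

lemma ennreal_term_le_suminf: "f n \<le> (\<Sum>i. f i :: ennreal)"
  using sum_le_suminf[of f "{n}"] by auto

lemma ennreal_suminf_le: "(\<And>n. f n \<le> g n) \<Longrightarrow> (\<Sum>i. f i) \<le> (\<Sum>i. g i :: ennreal)"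
  by (intro suminf_le) auto

lemma ennreal_suminf_swap: "(\<Sum>i. \<Sum>j. f i j :: ennreal) = (\<Sum>j. \<Sum>i. f i j)"
proof -
  have "(\<Sum>i. \<Sum>j. f i j) = (\<integral>\<^sup>+i. (\<Sum>j. f i j) \<partial>count_space UNIV)"
    by (simp add: nn_integral_count_space_nat)
  also have "\<dots> = (\<Sum>j. \<Sum>i. f i j)"
    by (subst nn_integral_suminf) (auto simp: nn_integral_count_space_nat)
  finally show ?thesis .
qed

lemma powe_suminf_le:
  assumes "0 < a" "a \<le> 1"
  shows "(\<Sum>i. f i) powe a \<le> (\<Sum>i. f i powe a)"
proof -
  have "(\<lambda>n. (\<Sum>i<n. f i) powe a) \<longlonglongrightarrow> (\<Sum>i. f i) powe a"
    using assms by (intro powe_LIMSEQ) (simp_all add: summable_LIMSEQ)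
  moreover have "(\<Sum>i<n. f i) powe a \<le> (\<Sum>i. f i powe a)" for n
    by (rule order_trans[OF powe_sum_le]) (use assms in \<open>auto intro: sum_le_suminf\<close>)
  ultimately show ?thesis
    by (intro LIMSEQ_le_const2) auto
qed

text \<open>The inclusion of l_r into l_1 with norm 1: subadditivity of the r-th power, followed by
  the r-th root.\<close>

lemma suminf_le_powe_suminf:
  assumes "0 < r" "r \<le> 1"
  shows "(\<Sum>i. f i) \<le> (\<Sum>i. f i powe r) powe (1 / r)"
proof -
  have "((\<Sum>i. f i) powe r) powe (1/r) \<le> (\<Sum>i. f i powe r) powe (1 / r)"
    using assms by (intro powe_mono powe_suminf_le) auto
  then show ?thesis using assms by simp
qed

lemma ennreal_suminf_tail:
  assumes "(\<Sum>i. f i :: ennreal) < top"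
  shows "(\<lambda>k. \<Sum>i. f (i + k)) \<longlonglongrightarrow> 0"
proof -
  have fin: "f i < top" for i
    using ennreal_term_le_suminf[of f i] assms by (rule le_less_trans)
  define g where "g i = enn2real (f i)" for i
  have fg: "f i = ennreal (g i)" for i using fin[of i] by (simp add: g_def)
  have g0: "0 \<le> g i" for i by (simp add: g_def)
  have sg: "summable g"
    by (rule summable_suminf_not_top) (use assms g0 in \<open>auto simp: fg\<close>)
  have "(\<lambda>k. \<Sum>i. g (i + k)) \<longlonglongrightarrow> 0"
    by (rule suminf_exist_split2[OF sg])
  then have "(\<lambda>k. ennreal (\<Sum>i. g (i + k))) \<longlonglongrightarrow> ennreal 0"
    by (intro tendsto_ennrealI)
  moreover have "(\<Sum>i. f (i + k)) = ennreal (\<Sum>i. g (i + k))" for k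
    unfolding fg using g0 sg by (subst suminf_ennreal2) auto
  ultimately show ?thesis by simp
qed

lemma ennreal_suminf_terms_to_0:
  assumes "(\<Sum>i. f i :: ennreal) < top"
  shows "f \<longlonglongrightarrow> 0"
proof (rule tendsto_sandwich[OF _ _ tendsto_const ennreal_suminf_tail[OF assms]])
  show "eventually (\<lambda>k. f k \<le> (\<Sum>i. f (i + k))) sequentially"
    using ennreal_term_le_suminf[of "\<lambda>i. f (i + k)" 0 for k] by auto
qed auto

lemma ennreal_suminf_split: "(\<Sum>i. f i :: ennreal) = (\<Sum>i. f (i + k)) + (\<Sum>i<k. f i)"
  by (rule suminf_offset) auto

lemma ennreal_suminf_add: "(\<Sum>i. f i + g i :: ennreal) = (\<Sum>i. f i) + (\<Sum>i. g i)"
  by (intro suminf_add[symmetric]) auto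

section \<open>Geometric series and a discrete Hardy inequality\<close>

lemma geometric_ennreal:
  assumes "0 < \<theta>"
  shows "(\<Sum>i. ennreal (2 powr (- \<theta> * real i))) = ennreal (1 / (1 - 2 powr - \<theta>))"
proof -
  have lt: "2 powr - \<theta> < (1::real)" using assms by (simp add: powr_less_one)
  have "(\<lambda>i. (2 powr - \<theta>) ^ i) sums (1 / (1 - 2 powr - \<theta>))"
    using lt by (intro geometric_sums) auto
  moreover have "2 powr (- \<theta> * real i) = (2 powr - \<theta>) ^ i" for i
    by (simp add: powr_powr flip: powr_realpow)
  ultimately show ?thesis
    by (intro suminf_ennreal_eq) auto
qed

lemma geometric_ennreal_two_sided:
  assumes "0 < \<theta>"
  shows "(\<Sum>i. ennreal (2 powr (- \<theta> * \<bar>real m - real i\<bar>))) \<le> ennreal (2 / (1 - 2 powr - \<theta>))"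
proof -
  define G where "G = ennreal (1 / (1 - 2 powr - \<theta>))"
  have lt: "2 powr - \<theta> < (1::real)" using assms by (simp add: powr_less_one)
  \<comment> \<open>Reflecting i to m - Suc i turns the distance m - i into Suc i, so the head is a
    shifted one-sided geometric series.\<close>
  have "(\<Sum>i<m. ennreal (2 powr (- \<theta> * \<bar>real m - real i\<bar>)))
      = (\<Sum>i<m. ennreal (2 powr (- \<theta> * real (Suc i))))"
    by (rule sum.reindex_bij_witness[of _ "\<lambda>i. m - Suc i" "\<lambda>i. m - Suc i"]) (auto simp: of_nat_diff)
  also have "\<dots> \<le> (\<Sum>i<m. ennreal (2 powr (- \<theta> * real i)))"
    using assms by (intro sum_mono ennreal_leI) (auto intro!: powr_mono simp: field_simps)
  also have "\<dots> \<le> G"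
    unfolding G_def geometric_ennreal[OF assms, symmetric] by (rule sum_le_suminf) auto
  finally have "(\<Sum>i<m. ennreal (2 powr (- \<theta> * \<bar>real m - real i\<bar>))) \<le> G" .
  moreover have "(\<Sum>i. ennreal (2 powr (- \<theta> * \<bar>real m - real (i + m)\<bar>))) = G"
    using geometric_ennreal[OF assms] by (simp add: G_def)
  ultimately have "(\<Sum>i. ennreal (2 powr (- \<theta> * \<bar>real m - real i\<bar>))) \<le> G + G"
    by (subst ennreal_suminf_split[of _ m]) (auto intro: add_mono)
  also have "\<dots> = ennreal (2 / (1 - 2 powr - \<theta>))"
    using lt by (simp add: G_def flip: ennreal_plus add_divide_distrib)
  finally show ?thesis .
qed

text \<open>Splitting the kernel as \<open>2 powr (- \<theta> n / 2) * 2 powr (- \<theta> n / 2)\<close> bounds the sum by a constant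
  times a supremum, and the \<open>r\<close>-th power of a supremum by a sum; this works for every \<open>r > 0\<close>.\<close>

lemma geometric_Hardy:
  assumes "0 < \<theta>" "0 < r"
  shows "\<exists>C\<ge>0. \<forall>x :: nat \<Rightarrow> ennreal.
    (\<Sum>m. (\<Sum>j. ennreal (2 powr (- \<theta> * \<bar>real m - real j\<bar>)) * x j) powe r)
      \<le> ennreal C * (\<Sum>j. x j powe r)"
proof -
  define w where "w a m j = ennreal (2 powr (- a * \<bar>real m - real j\<bar>))" for a and m j :: nat
  define G where "G a = (2 / (1 - 2 powr - a) :: real)" for a
  have G0: "0 \<le> G a" if "0 < a" for a
    using that powr_less_one[of 2 "-a"] unfolding G_def by (auto intro!: divide_nonneg_nonneg)
  have w2: "w \<theta> m j = w (\<theta>/2) m j * w (\<theta>/2) m j" for m j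
    by (simp add: w_def field_simps flip: ennreal_mult powr_add)
  have wr: "w a m j powe r = w (a * r) m j" for a m j
    by (simp add: w_def powr_powr algebra_simps)
  have wsym: "w a m j = w a j m" for a m j by (simp add: w_def abs_minus_commute)
  have "(\<Sum>m. (\<Sum>j. w \<theta> m j * x j) powe r) \<le> ennreal (G (\<theta>/2) powr r * G (\<theta>/2*r)) * (\<Sum>j. x j powe r)" for x
  proof -
    define s where "s m = (SUP j. w (\<theta>/2) m j * x j)" for m
    have 1: "(\<Sum>j. w \<theta> m j * x j) \<le> ennreal (G (\<theta>/2)) * s m" for m
    proof -
      have "(\<Sum>j. w \<theta> m j * x j) \<le> (\<Sum>j. w (\<theta>/2) m j * s m)"
        unfolding w2 mult.assoc s_def
        by (intro ennreal_suminf_le mult_left_mono SUP_upper) auto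
      also have "\<dots> = (\<Sum>j. w (\<theta>/2) m j) * s m" by simp
      also have "\<dots> \<le> ennreal (G (\<theta>/2)) * s m"
        unfolding w_def G_def using assms
        by (intro mult_right_mono geometric_ennreal_two_sided) auto
      finally show ?thesis .
    qed
    have 2: "s m powe r \<le> (\<Sum>j. w (\<theta>/2*r) m j * x j powe r)" for m
    proof -
      have "s m \<le> (\<Sum>j. w (\<theta>/2*r) m j * x j powe r) powe (1/r)"
        unfolding s_def
      proof (rule SUP_least)
        fix j
        have "(w (\<theta>/2) m j * x j) powe r \<le> (\<Sum>j. w (\<theta>/2*r) m j * x j powe r)"
          unfolding powe_mult wr by (rule ennreal_term_le_suminf)
        from powe_mono[OF this, of "1/r"] assms
        show "w (\<theta>/2) m j * x j \<le> (\<Sum>j. w (\<theta>/2*r) m j * x j powe r) powe (1/r)"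
          by simp
      qed
      from powe_mono[OF this, of r] assms show ?thesis by simp
    qed
    have "(\<Sum>m. (\<Sum>j. w \<theta> m j * x j) powe r) \<le> (\<Sum>m. ennreal (G (\<theta>/2) powr r) * (\<Sum>j. w (\<theta>/2*r) m j * x j powe r))"
    proof (rule ennreal_suminf_le)
      fix m
      have "(\<Sum>j. w \<theta> m j * x j) powe r \<le> (ennreal (G (\<theta>/2)) * s m) powe r"
        using 1 assms by (intro powe_mono) auto
      also have "\<dots> = ennreal (G (\<theta>/2) powr r) * s m powe r"
        using G0[of "\<theta>/2"] assms by (simp add: powe_mult)
      also have "\<dots> \<le> ennreal (G (\<theta>/2) powr r) * (\<Sum>j. w (\<theta>/2*r) m j * x j powe r)"
        by (intro mult_left_mono 2) auto
      finally show "(\<Sum>j. w \<theta> m j * x j) powe r \<le> \<dots>" .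
    qed
    also have "\<dots> = ennreal (G (\<theta>/2) powr r) * (\<Sum>j. \<Sum>m. w (\<theta>/2*r) m j * x j powe r)"
      unfolding ennreal_suminf_cmult ennreal_suminf_swap[of "\<lambda>m j. w (\<theta>/2*r) m j * x j powe r"] ..
    also have "\<dots> \<le> ennreal (G (\<theta>/2) powr r) * (\<Sum>j. ennreal (G (\<theta>/2*r)) * x j powe r)"
    proof (intro mult_left_mono ennreal_suminf_le)
      fix j
      have "(\<Sum>m. w (\<theta>/2*r) j m) \<le> ennreal (G (\<theta>/2*r))"
        unfolding w_def G_def using assms by (intro geometric_ennreal_two_sided) auto
      then show "(\<Sum>m. w (\<theta>/2*r) m j * x j powe r) \<le> ennreal (G (\<theta>/2*r)) * x j powe r"
        by (auto simp: wsym[of _ _ j] intro: mult_right_mono)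
    qed auto
    also have "\<dots> = ennreal (G (\<theta>/2) powr r * G (\<theta>/2*r)) * (\<Sum>j. x j powe r)"
      using G0[of "\<theta>/2*r"] assms by (simp add: ennreal_mult mult.assoc)
    finally show ?thesis .
  qed
  then show ?thesis unfolding w_def
    by (intro exI[of _ "G (\<theta>/2) powr r * G (\<theta>/2*r)"]) (use G0[of "\<theta>/2*r"] assms in auto)
qed

section \<open>Dyadic cells\<close>

definition half_open_box :: "real^'n \<Rightarrow> real^'n \<Rightarrow> (real^'n) set" where
  "half_open_box a b = {x. \<forall>j. a $ j \<le> x $ j \<and> x $ j < b $ j}"

text \<open>Half-open, so that the cells of each level partition it exactly; it differs from
  \<open>unit_cube\<close> by a null set.\<close>

definition hcube :: "(real^'n) set" where
  "hcube = half_open_box 0 1"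

text \<open>Zero-based, against the one-based \<open>dyadic\<close>. Negative coordinates are
  truncated to 0 by \<open>nat\<close>, so membership in \<open>hcube\<close> has to be stated
  separately.\<close>

definition idx :: "nat \<Rightarrow> real^'n \<Rightarrow> 'n \<Rightarrow> nat" where
  "idx k x = (\<lambda>j. nat \<lfloor>2^k * x $ j\<rfloor>)"

definition Idx :: "nat \<Rightarrow> ('n \<Rightarrow> nat) set" where
  "Idx k = {i. \<forall>j. i j < 2^k}"

definition cell :: "nat \<Rightarrow> ('n \<Rightarrow> nat) \<Rightarrow> (real^'n) set" where
  "cell k i = {x \<in> hcube. idx k x = i}"

definition corner :: "nat \<Rightarrow> ('n \<Rightarrow> nat) \<Rightarrow> real^'n" where
  "corner k i = (\<chi> j. real (i j) / 2^k)"

text \<open>Step functions of level k, with values in any type so that integrands are covered as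
  well; values off \<open>hcube\<close> are unconstrained.\<close>

definition pconst :: "nat \<Rightarrow> (real^'n \<Rightarrow> 'b) \<Rightarrow> bool" where
  "pconst k f \<longleftrightarrow> (\<forall>x\<in>hcube. \<forall>y\<in>hcube. idx k x = idx k y \<longrightarrow> f x = f y)"

abbreviation cdim :: "'n::finite itself \<Rightarrow> real" where
  "cdim _ \<equiv> real CARD('n)"

lemma powr_half_nat: "(2 powr (- real k)) powr real n = ((1::real) / 2^k) ^ n"
proof -
  have "2 powr (- real k) = (1::real) / 2^k"
    using powr_realpow[of 2 k] powr_minus[of "2::real" "real k"] by (simp add: inverse_eq_divide)
  then show ?thesis using powr_realpow[of "1 / 2^k" n] by simp
qed

lemma half_open_box_borel [measurable]: "half_open_box a b \<in> sets borel"
  unfolding half_open_box_def by measurable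

lemma hcube_borel [measurable]: "hcube \<in> sets borel"
  unfolding hcube_def by measurable

lemma hcube_iff: "x \<in> hcube \<longleftrightarrow> (\<forall>j. 0 \<le> x $ j \<and> x $ j < 1)"
  by (auto simp: hcube_def half_open_box_def)

text \<open>Squeezed between the open and the closed box, which have the same volume.\<close>

lemma emeasure_half_open_box:
  fixes a b :: "real^'n"
  assumes "\<And>j. a $ j \<le> b $ j"
  shows "emeasure lborel (half_open_box a b) = ennreal (\<Prod>j\<in>UNIV. b $ j - a $ j)"
proof -
  have P: "(\<Prod>v\<in>Basis. (b - a) \<bullet> v) = (\<Prod>j\<in>UNIV. b $ j - a $ j)"
    by (simp add: Basis_vec_def cart_eq_inner_axis axis_eq_axis prod.UNION_disjoint inner_diff_left)
  have le: "a \<bullet> v \<le> b \<bullet> v" if "v \<in> Basis" for v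
    using that assms by (auto simp: Basis_vec_def cart_eq_inner_axis)
  have sub: "box a b \<subseteq> half_open_box a b" "half_open_box a b \<subseteq> cbox a b"
    by (auto simp: half_open_box_def mem_box_cart) (meson less_imp_le)+
  have "emeasure lborel (half_open_box a b) \<le> emeasure lborel (cbox a b)"
       "emeasure lborel (box a b) \<le> emeasure lborel (half_open_box a b)"
    using sub by (auto intro!: emeasure_mono)
  then show ?thesis
    using emeasure_lborel_cbox[OF le] emeasure_lborel_box[OF le] P by (simp add: antisym)
qed

lemma emeasure_hcube [simp]: "emeasure lborel (hcube :: (real^'n) set) = 1"
  unfolding hcube_def by (subst emeasure_half_open_box) auto

lemma nat_floor_less_iff:
  "0 \<le> t \<Longrightarrow> nat \<lfloor>t\<rfloor> = n \<longleftrightarrow> real n \<le> t \<and> t < real n + 1"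
  by (auto simp: nat_eq_iff floor_eq_iff)

lemma finite_Idx [simp]: "finite (Idx k :: ('n::finite \<Rightarrow> nat) set)"
proof -
  have "Idx k = PiE (UNIV :: 'n set) (\<lambda>_. {..<2^k})" by (auto simp: Idx_def PiE_def)
  then show ?thesis by (simp add: finite_PiE)
qed

lemma card_Idx: "card (Idx k :: ('n::finite \<Rightarrow> nat) set) = 2 ^ (k * CARD('n))"
proof -
  have "Idx k = PiE (UNIV :: 'n set) (\<lambda>_. {..<2^k})" by (auto simp: Idx_def PiE_def)
  then show ?thesis by (simp add: card_PiE power_mult)
qed

lemma idx_in_Idx: "x \<in> hcube \<Longrightarrow> idx k x \<in> Idx k"
  by (auto simp: hcube_iff idx_def Idx_def nat_less_iff floor_less_iff)

lemma idx_eq_iff: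
  assumes "\<And>j. 0 \<le> x $ j"
  shows "idx k x = i \<longleftrightarrow> (\<forall>j. real (i j) / 2^k \<le> x $ j \<and> x $ j < (real (i j) + 1) / 2^k)"
  unfolding idx_def fun_eq_iff using assms
  by (subst nat_floor_less_iff) (auto simp: field_simps)

lemma cell_iff:
  assumes "i \<in> Idx k"
  shows "x \<in> cell k i \<longleftrightarrow> (\<forall>j. real (i j) / 2^k \<le> x $ j \<and> x $ j < (real (i j) + 1) / 2^k)"
proof -
  have i: "real (i j) + 1 \<le> 2^k" for j
  proof -
    have "i j + 1 \<le> 2^k" using assms by (auto simp: Idx_def Suc_le_eq)
    then have "real (i j + 1) \<le> real (2^k)" by (rule of_nat_mono)
    then show ?thesis by simp
  qed
  have *: "0 \<le> x $ j \<and> x $ j < 1" if "\<forall>j. real (i j) / 2^k \<le> x $ j \<and> x $ j < (real (i j) + 1) / 2^k" for j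
  proof -
    have "0 \<le> real (i j) / 2^k" by simp
    also have "\<dots> \<le> x $ j" using that by auto
    finally have 1: "0 \<le> x $ j" .
    have "x $ j < (real (i j) + 1) / 2^k" using that by auto
    also have "\<dots> \<le> 1" using i[of j] by simp
    finally show ?thesis using 1 by simp
  qed
  then show ?thesis
    unfolding cell_def using idx_eq_iff[of x k i] by (auto simp: hcube_iff)
qed

lemma cell_eq_box:
  assumes "i \<in> Idx k"
  shows "cell k i = half_open_box (corner k i) (\<chi> j. (real (i j) + 1) / 2^k)"
  unfolding set_eq_iff cell_iff[OF assms] by (auto simp: half_open_box_def corner_def)

lemma cell_empty: "i \<notin> Idx k \<Longrightarrow> cell k i = {}"
  using idx_in_Idx by (auto simp: cell_def)

lemma cell_borel [measurable]: "cell k i \<in> sets borel"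
  by (cases "i \<in> Idx k") (auto simp: cell_eq_box cell_empty)

lemma cell_subset: "cell k i \<subseteq> hcube"
  by (auto simp: cell_def)

lemma emeasure_cell:
  fixes i :: "'n::finite \<Rightarrow> nat"
  assumes "i \<in> Idx k"
  shows "emeasure lborel (cell k i) = ennreal (2 powr (- real k * cdim TYPE('n)))"
proof -
  have "(\<Prod>j\<in>(UNIV::'n set). (real (i j) + 1) / 2^k - real (i j) / 2^k) = (1 / 2^k) ^ CARD('n)"
    by (simp add: diff_divide_distrib[symmetric])
  also have "\<dots> = (2 powr (- real k)) powr CARD('n)"
    by (simp add: powr_half_nat)
  also have "\<dots> = 2 powr (- real k * CARD('n))" by (simp add: powr_powr)
  finally show ?thesis
    unfolding cell_eq_box[OF assms]
    by (subst emeasure_half_open_box) (auto simp: corner_def divide_right_mono)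
qed

lemma corner_in_cell: "i \<in> Idx k \<Longrightarrow> corner k i \<in> cell k i"
  by (auto simp: cell_iff corner_def divide_strict_right_mono)

lemma corner_in_hcube: "i \<in> Idx k \<Longrightarrow> corner k i \<in> hcube"
  using corner_in_cell[of i k] cell_subset[of k i] by auto

lemma idx_corner: "i \<in> Idx k \<Longrightarrow> idx k (corner k i) = i"
  using corner_in_cell by (auto simp: cell_def)

text \<open>The floor of a quotient by a positive integer depends only on the floor of the
  numerator, so passing to the ancestor m levels up is integer division. The nesting of cells is
  read off from this.\<close>

lemma idx_div: "idx k x j = idx (k + m) x j div 2^m"
proof -
  have "\<lfloor>2^k * x $ j\<rfloor> = \<lfloor>(2^(k+m) * x $ j) / real_of_int (2^m)\<rfloor>"
    by (simp add: power_add)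
  also have "\<dots> = \<lfloor>2^(k+m) * x $ j\<rfloor> div 2^m"
    by (rule floor_divide_real_eq_div) simp
  finally show ?thesis
    by (simp add: idx_def nat_div_distrib' nat_power_eq)
qed

lemma idx_eq_mono: "k \<le> l \<Longrightarrow> idx l x = idx l y \<Longrightarrow> idx k x = idx k y"
proof
  fix j assume "k \<le> l" "idx l x = idx l y"
  then show "idx k x j = idx k y j"
    using idx_div[of k x j "l - k"] idx_div[of k y j "l - k"] by simp
qed

lemma idx_0: "x \<in> hcube \<Longrightarrow> idx 0 x = (\<lambda>_. 0)"
  by (auto simp: idx_def hcube_iff fun_eq_iff floor_eq_iff)

lemma pconstD: "pconst k f \<Longrightarrow> x \<in> hcube \<Longrightarrow> y \<in> hcube \<Longrightarrow> idx k x = idx k y \<Longrightarrow> f x = f y"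
  unfolding pconst_def by blast

lemma pconst_corner: "pconst k f \<Longrightarrow> x \<in> hcube \<Longrightarrow> f x = f (corner k (idx k x))"
  by (rule pconstD[of k f]) (auto simp: idx_corner idx_in_Idx corner_in_hcube)

lemma pconst_cell: "pconst k f \<Longrightarrow> x \<in> cell k i \<Longrightarrow> f x = f (corner k i)"
  unfolding cell_def using pconst_corner[of k f x] by blast

lemma pconst_mono: "pconst k f \<Longrightarrow> k \<le> l \<Longrightarrow> pconst l f"
  unfolding pconst_def using idx_eq_mono by blast

lemma pconst_const [simp]: "pconst k (\<lambda>x. c)"
  by (simp add: pconst_def)

lemma pconst_comp: "pconst k f \<Longrightarrow> pconst k (\<lambda>x. g (f x))"
  unfolding pconst_def by (intro ballI impI arg_cong[of _ _ g]) blast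

lemma pconst_comp2: "pconst k f \<Longrightarrow> pconst k g \<Longrightarrow> pconst k (\<lambda>x. h (f x) (g x))"
  unfolding pconst_def by (intro ballI impI arg_cong2[of _ _ _ _ h]) blast+

lemma pconst_diff: "pconst k f \<Longrightarrow> pconst k g \<Longrightarrow> pconst k (\<lambda>x. f x - g x)"
  by (rule pconst_comp2[of k f g "(-)"])

lemma pconst_sum: "(\<And>a. a \<in> A \<Longrightarrow> pconst k (f a)) \<Longrightarrow> pconst k (\<lambda>x. \<Sum>a\<in>A. f a x)"
  unfolding pconst_def by (intro ballI impI sum.cong) blast+

lemma pconst_idx: "pconst k (\<lambda>x. F (idx k x))"
  unfolding pconst_def by (intro ballI impI arg_cong[of _ _ F])

lemma pconst_indicator_cell:
  "k \<le> l \<Longrightarrow> pconst l (indicator (cell k i) :: real^'n \<Rightarrow> 'b::zero_neq_one)"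
  unfolding pconst_def
proof (intro ballI impI)
  fix x y :: "real^'n" assume "k \<le> l" "x \<in> hcube" "y \<in> hcube" "idx l x = idx l y"
  then show "indicator (cell k i) x = (indicator (cell k i) y :: 'b)"
    using idx_eq_mono[of k l x y] by (simp add: indicator_def cell_def)
qed

lemma indicator_hcube_cells: "(indicator hcube x :: ennreal) = (\<Sum>i\<in>Idx k. indicator (cell k i) x)"
proof (cases "x \<in> hcube")
  case True
  have "(\<Sum>i\<in>Idx k. indicator (cell k i) x) = (\<Sum>i\<in>Idx k. if i = idx k x then 1 else 0 :: ennreal)"
    using True by (intro sum.cong) (auto simp: cell_def)
  with True show ?thesis by (simp add: idx_in_Idx)
qed (auto simp: cell_def)

lemma nn_integral_hcube_cells:
  assumes [measurable]: "F \<in> borel_measurable borel"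
  shows "(\<integral>\<^sup>+x\<in>hcube. F x \<partial>lborel) = (\<Sum>i\<in>Idx k. \<integral>\<^sup>+x\<in>cell k i. F x \<partial>lborel)"
  unfolding indicator_hcube_cells[of _ k] sum_distrib_left by (subst nn_integral_sum) auto

lemma nn_integral_cell_pconst:
  fixes F :: "real^'n \<Rightarrow> ennreal"
  assumes "pconst k F" "i \<in> Idx k"
  shows "(\<integral>\<^sup>+x\<in>cell k i. F x \<partial>lborel) = F (corner k i) * ennreal (2 powr (- real k * cdim TYPE('n)))"
proof -
  have "(\<integral>\<^sup>+x\<in>cell k i. F x \<partial>lborel) = (\<integral>\<^sup>+x\<in>cell k i. F (corner k i) \<partial>lborel)"
    using pconst_cell[OF assms(1)] by (intro nn_integral_cong) (auto simp: indicator_def)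
  then show ?thesis using assms by (simp add: nn_integral_cmult_indicator emeasure_cell)
qed

lemma nn_integral_hcube_pconst:
  fixes F :: "real^'n \<Rightarrow> ennreal"
  assumes "pconst k F" "F \<in> borel_measurable borel"
  shows "(\<integral>\<^sup>+x\<in>hcube. F x \<partial>lborel)
    = (\<Sum>i\<in>Idx k. F (corner k i)) * ennreal (2 powr (- real k * cdim TYPE('n)))"
  by (subst nn_integral_hcube_cells[of _ k])
     (simp_all add: assms nn_integral_cell_pconst sum_distrib_right)

text \<open>A table of values on the finitely many cells is a finite combination of cell indicators.
  Samples, averages and Haar functions are shown to be Borel in this way.\<close>

lemma borel_idx_fun [measurable]:
  fixes v :: "('n::finite \<Rightarrow> nat) \<Rightarrow> real"
  shows "(\<lambda>x. if x \<in> hcube then v (idx k x) else 0) \<in> borel_measurable borel"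
proof -
  have "(if x \<in> hcube then v (idx k x) else 0) = (\<Sum>i\<in>Idx k. v i * indicator (cell k i) x)" for x
  proof (cases "x \<in> hcube")
    case True
    have "(\<Sum>i\<in>Idx k. v i * indicator (cell k i) x) = (\<Sum>i\<in>Idx k. if i = idx k x then v i else 0)"
      using True by (intro sum.cong) (auto simp: cell_def)
    with True show ?thesis by (simp add: idx_in_Idx)
  qed (auto simp: cell_def)
  then have eq: "(\<lambda>x. if x \<in> hcube then v (idx k x) else 0) = (\<lambda>x. \<Sum>i\<in>Idx k. v i * indicator (cell k i) x)"
    by (rule ext)
  show ?thesis unfolding eq by measurable
qed

text \<open>The set is a slab of thickness |t| along one face of the cell; the face has measure
  2^(-k (d - 1)), written here as 2^k times the cell measure. For |t| \<ge> 2^(-k) the bound is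
  already at least the measure of the whole cell.\<close>

lemma emeasure_cell_strip:
  fixes i :: "'n::finite \<Rightarrow> nat" and t :: real
  assumes i: "i \<in> Idx k"
  shows "emeasure lborel {x \<in> cell k i. x $ j + t < real (i j) / 2^k \<or> (real (i j) + 1) / 2^k \<le> x $ j + t}
    \<le> ennreal (\<bar>t\<bar> * 2^k * 2 powr (- real k * cdim TYPE('n)))" (is "emeasure lborel ?A \<le> _")
proof (cases "\<bar>t\<bar> * 2^k \<ge> 1")
  case True
  have "emeasure lborel ?A \<le> emeasure lborel (cell k i)"
    by (intro emeasure_mono) auto
  also have "\<dots> \<le> ennreal (\<bar>t\<bar> * 2^k * 2 powr (- real k * cdim TYPE('n)))"
    unfolding emeasure_cell[OF i] using True mult_right_mono[OF True] by (intro ennreal_leI) auto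
  finally show ?thesis .
next
  case False
  \<comment> \<open>The slab lies at the upper face for t \<ge> 0 and at the lower face for t < 0; t
    = 0 gives a degenerate box.\<close>
  define a where "a = (\<chi> l. if l = j \<and> t \<ge> 0 then (real (i j) + 1) / 2^k - t else real (i l) / 2^k)"
  define b where "b = (\<chi> l. if l = j \<and> t < 0 then real (i j) / 2^k - t else (real (i l) + 1) / 2^k)"
  have t: "\<bar>t\<bar> < 1 / 2^k" using False by (simp add: field_simps)
  have *: "real n / 2^k = (real n + 1) / 2^k - 1 / 2^k" for n by (simp add: diff_divide_distrib[symmetric])
  have ab: "a $ l \<le> b $ l" for l
    using t *[of "i j"] by (auto simp: a_def b_def divide_right_mono)
  have "?A \<subseteq> half_open_box a b"
  proof
    fix x assume x: "x \<in> ?A"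
    then have c: "real (i l) / 2^k \<le> x $ l" "x $ l < (real (i l) + 1) / 2^k" for l
      using cell_iff[OF i] by auto
    from x consider "x $ j + t < real (i j) / 2^k" | "(real (i j) + 1) / 2^k \<le> x $ j + t" by auto
    then show "x \<in> half_open_box a b"
    proof cases
      case 1
      then have "t < 0" using c(1)[of j] by linarith
      with 1 c show ?thesis by (simp add: half_open_box_def a_def b_def)
    next
      case 2
      then have "t > 0" using c(2)[of j] by linarith
      with 2 c show ?thesis by (simp add: half_open_box_def a_def b_def)
    qed
  qed
  then have "emeasure lborel ?A \<le> emeasure lborel (half_open_box a b)"
    by (intro emeasure_mono) auto
  also have "\<dots> = ennreal (\<Prod>l\<in>UNIV. b $ l - a $ l)"
    by (rule emeasure_half_open_box) (rule ab)
  also have "(\<Prod>l\<in>UNIV. b $ l - a $ l) = (\<Prod>l\<in>UNIV. if l = j then \<bar>t\<bar> else 1 / 2^k)"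
    using *  by (intro prod.cong) (auto simp: a_def b_def)
  also have "\<dots> = \<bar>t\<bar> * (1 / 2^k) ^ (CARD('n) - 1)"
    by (simp add: prod.remove[of UNIV j] card_Diff_singleton)
  also have "(1 / 2^k) ^ (CARD('n) - 1) = (2::real)^k * (1 / 2^k) ^ CARD('n)"
    by (cases "CARD('n)") (auto simp: field_simps)
  also have "(1 / 2^k) ^ CARD('n) = (2 powr (- real k)) powr CARD('n)"
    by (simp add: powr_half_nat)
  also have "\<dots> = 2 powr (- real k * CARD('n))" by (simp add: powr_powr)
  finally show ?thesis by (simp add: mult.assoc)
qed

text \<open>A point leaves its cell only through the range of some coordinate, so d slabs of
  thickness at most \<open>norm y\<close> cover the set.\<close>

lemma emeasure_cell_shift:
  fixes i :: "'n::finite \<Rightarrow> nat" and y :: "real^'n"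
  assumes i: "i \<in> Idx k"
  shows "emeasure lborel {x \<in> cell k i. x + y \<notin> cell k i}
    \<le> ennreal (cdim TYPE('n) * norm y * 2^k * 2 powr (- real k * cdim TYPE('n)))"
proof -
  define A where "A j = {x \<in> cell k i. x $ j + y $ j < real (i j) / 2^k \<or> (real (i j) + 1) / 2^k \<le> x $ j + y $ j}" for j
  have [measurable]: "A j \<in> sets borel" for j unfolding A_def by measurable
  have "{x \<in> cell k i. x + y \<notin> cell k i} \<subseteq> (\<Union>j. A j)"
    unfolding A_def using cell_iff[OF i] by (auto simp: not_le not_less)
  then have "emeasure lborel {x \<in> cell k i. x + y \<notin> cell k i} \<le> emeasure lborel (\<Union>j. A j)"
    by (intro emeasure_mono) auto
  also have "\<dots> \<le> (\<Sum>j\<in>UNIV. emeasure lborel (A j))"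
    by (rule emeasure_subadditive_finite) auto
  also have "\<dots> \<le> (\<Sum>j\<in>(UNIV::'n set). ennreal (norm y * 2^k * 2 powr (- real k * cdim TYPE('n))))"
  proof (rule sum_mono)
    fix j
    have "emeasure lborel (A j) \<le> ennreal (\<bar>y $ j\<bar> * 2^k * 2 powr (- real k * cdim TYPE('n)))"
      unfolding A_def by (rule emeasure_cell_strip[OF i])
    also have "\<dots> \<le> ennreal (norm y * 2^k * 2 powr (- real k * cdim TYPE('n)))"
      using component_le_norm_cart[of y j] by (intro ennreal_leI mult_right_mono) auto
    finally show "emeasure lborel (A j) \<le> \<dots>" .
  qed
  also have "\<dots> = ennreal (cdim TYPE('n) * norm y * 2^k * 2 powr (- real k * cdim TYPE('n)))"
    by (simp add: ennreal_mult mult.assoc ennreal_of_nat_eq_real_of_nat)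
  finally show ?thesis .
qed

section \<open>Moduli of smoothness and approximation by step functions\<close>

definition pint :: "real \<Rightarrow> (real^'n \<Rightarrow> real) \<Rightarrow> ennreal" where
  "pint p f = (\<integral>\<^sup>+x\<in>hcube. ennreal (\<bar>f x\<bar> powr p) \<partial>lborel)"

definition dint :: "real \<Rightarrow> (real^'n \<Rightarrow> real) \<Rightarrow> real^'n \<Rightarrow> ennreal" where
  "dint p f y =
    (\<integral>\<^sup>+x. ennreal (\<bar>f (x + y) - f x\<bar> powr p) * (indicator hcube x * indicator hcube (x + y)) \<partial>lborel)"

text \<open>The p-th power of the modulus of smoothness. The shift y = 0, excluded in
  \<open>modulus\<close>, contributes 0.\<close>

definition omod :: "real \<Rightarrow> (real^'n \<Rightarrow> real) \<Rightarrow> real \<Rightarrow> ennreal" where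
  "omod p f t = (SUP y\<in>{y. norm y \<le> t}. dint p f y)"

lemma abs_powr_add_le:
  fixes a b :: real
  assumes "0 < p" "p \<le> 1"
  shows "ennreal (\<bar>a + b\<bar> powr p) \<le> ennreal (\<bar>a\<bar> powr p) + ennreal (\<bar>b\<bar> powr p)"
proof -
  have "\<bar>a + b\<bar> powr p \<le> (\<bar>a\<bar> + \<bar>b\<bar>) powr p"
    using assms by (intro powr_mono2) auto
  also have "\<dots> \<le> \<bar>a\<bar> powr p + \<bar>b\<bar> powr p"
    using assms by (intro powr_add_le) auto
  finally show ?thesis by (simp flip: ennreal_plus)
qed

lemma nn_integral_translate:
  fixes F :: "real^'n \<Rightarrow> ennreal"
  assumes [measurable]: "F \<in> borel_measurable borel"
  shows "(\<integral>\<^sup>+x. F (x + y) \<partial>lborel) = (\<integral>\<^sup>+x. F x \<partial>lborel)"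
proof -
  have "(\<integral>\<^sup>+x. F x \<partial>lborel) = (\<integral>\<^sup>+x. F x \<partial>distr lborel borel ((+) y))"
    by (simp add: lborel_distr_plus)
  also have "\<dots> = (\<integral>\<^sup>+x. F (x + y) \<partial>lborel)"
    by (subst nn_integral_distr) (auto simp: add.commute)
  finally show ?thesis ..
qed

lemma nn_integral_hcube_translate_le:
  assumes [measurable]: "F \<in> borel_measurable borel"
  shows "(\<integral>\<^sup>+x. F (x + y) * (indicator hcube x * indicator hcube (x + y)) \<partial>lborel)
    \<le> (\<integral>\<^sup>+x\<in>hcube. F x \<partial>lborel)"
proof -
  have "(\<integral>\<^sup>+x. F (x + y) * (indicator hcube x * indicator hcube (x + y)) \<partial>lborel)
      \<le> (\<integral>\<^sup>+x. F (x + y) * indicator hcube (x + y) \<partial>lborel)"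
    by (intro nn_integral_mono) (auto simp: indicator_def)
  also have "\<dots> = (\<integral>\<^sup>+x\<in>hcube. F x \<partial>lborel)"
    by (rule nn_integral_translate[where F = "\<lambda>x. F x * indicator hcube x"]) auto
  finally show ?thesis .
qed

lemma pint_mono:
  assumes "\<And>x. x \<in> hcube \<Longrightarrow> \<bar>f x\<bar> \<le> \<bar>g x\<bar>" "0 < p"
  shows "pint p f \<le> pint p g"
  unfolding pint_def using assms
  by (intro nn_integral_mono) (auto simp: indicator_def intro!: ennreal_leI powr_mono2)

lemma pint_cong: "(\<And>x. x \<in> hcube \<Longrightarrow> f x = g x) \<Longrightarrow> pint p f = pint p g"
  unfolding pint_def by (intro nn_integral_cong) (auto simp: indicator_def)

lemma dint_cong: "(\<And>x. x \<in> hcube \<Longrightarrow> f x = g x) \<Longrightarrow> dint p f y = dint p g y"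
  unfolding dint_def by (intro nn_integral_cong) (auto simp: indicator_def)

lemma omod_cong: "(\<And>x. x \<in> hcube \<Longrightarrow> f x = g x) \<Longrightarrow> omod p f t = omod p g t"
  unfolding omod_def using dint_cong[of f g p] by simp

lemma pint_add:
  assumes "0 < p" "p \<le> 1" and [measurable]: "f \<in> borel_measurable borel" "g \<in> borel_measurable borel"
  shows "pint p (\<lambda>x. f x + g x) \<le> pint p f + pint p g"
  unfolding pint_def
  by (subst nn_integral_add[symmetric])
     (auto intro!: nn_integral_mono abs_powr_add_le assms simp: indicator_def)

lemma pint_uminus: "pint p (\<lambda>x. - f x) = pint p f"
  by (simp add: pint_def)

lemma pint_diff:
  assumes "0 < p" "p \<le> 1" and [measurable]: "f \<in> borel_measurable borel" "g \<in> borel_measurable borel"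
  shows "pint p (\<lambda>x. f x - g x) \<le> pint p f + pint p g"
  using pint_add[OF assms(1,2,3), of "\<lambda>x. - g x"] by (simp add: pint_uminus)

lemma pint_cmult:
  assumes [measurable]: "f \<in> borel_measurable borel"
  shows "pint p (\<lambda>x. c * f x) = ennreal (\<bar>c\<bar> powr p) * pint p f"
  unfolding pint_def
  by (subst nn_integral_cmult[symmetric])
     (auto simp: abs_mult powr_mult ennreal_mult mult.assoc)

lemma pint_zero [simp]: "pint p (\<lambda>x. 0) = 0"
  by (simp add: pint_def)

lemma pint_pconst:
  fixes g :: "real^'n \<Rightarrow> real"
  assumes "pconst k g" "g \<in> borel_measurable borel"
  shows "pint p g = (\<Sum>i\<in>Idx k. ennreal (\<bar>g (corner k i)\<bar> powr p)) * ennreal (2 powr (- real k * cdim TYPE('n)))"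
  unfolding pint_def using assms
  by (intro nn_integral_hcube_pconst pconst_comp[where f = g and g = "\<lambda>u. ennreal (\<bar>u\<bar> powr p)"]) auto

lemma dint_add:
  assumes "0 < p" "p \<le> 1" and [measurable]: "f \<in> borel_measurable borel" "g \<in> borel_measurable borel"
  shows "dint p (\<lambda>x. f x + g x) y \<le> dint p f y + dint p g y"
proof -
  have "ennreal (\<bar>f (x + y) + g (x + y) - (f x + g x)\<bar> powr p)
      \<le> ennreal (\<bar>f (x + y) - f x\<bar> powr p) + ennreal (\<bar>g (x + y) - g x\<bar> powr p)" for x
    using abs_powr_add_le[OF assms(1,2), of "f (x + y) - f x" "g (x + y) - g x"]
    by (simp add: algebra_simps)
  then show ?thesis unfolding dint_def
    by (subst nn_integral_add[symmetric]) (auto intro!: nn_integral_mono simp: indicator_def)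
qed

lemma dint_uminus: "dint p (\<lambda>x. - f x) y = dint p f y"
  unfolding dint_def by (simp add: abs_minus_commute)

lemma dint_le:
  assumes "0 < p" "p \<le> 1" and [measurable]: "f \<in> borel_measurable borel"
  shows "dint p f y \<le> 2 * pint p f"
proof -
  have "ennreal (\<bar>f (x + y) - f x\<bar> powr p) \<le> ennreal (\<bar>f (x + y)\<bar> powr p) + ennreal (\<bar>f x\<bar> powr p)" for x
    using abs_powr_add_le[OF assms(1,2), of "f (x + y)" "- f x"] by simp
  then have "dint p f y \<le> (\<integral>\<^sup>+x. ennreal (\<bar>f (x + y)\<bar> powr p) * (indicator hcube x * indicator hcube (x + y))
      + ennreal (\<bar>f x\<bar> powr p) * indicator hcube x \<partial>lborel)"
    unfolding dint_def by (intro nn_integral_mono) (auto simp: indicator_def)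
  also have "\<dots> = (\<integral>\<^sup>+x. ennreal (\<bar>f (x + y)\<bar> powr p) * (indicator hcube x * indicator hcube (x + y)) \<partial>lborel) + pint p f"
    unfolding pint_def by (rule nn_integral_add) auto
  also have "\<dots> \<le> pint p f + pint p f"
    unfolding pint_def
    by (intro add_mono order_refl nn_integral_hcube_translate_le[where F = "\<lambda>x. ennreal (\<bar>f x\<bar> powr p)"]) auto
  finally show ?thesis by (simp add: mult_2)
qed

lemma omod_add:
  assumes "0 < p" "p \<le> 1" and [measurable]: "f \<in> borel_measurable borel" "g \<in> borel_measurable borel"
  shows "omod p (\<lambda>x. f x + g x) t \<le> omod p f t + omod p g t"
  unfolding omod_def
  by (rule SUP_least, rule order_trans[OF dint_add[OF assms]]) (auto intro!: add_mono SUP_upper)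

lemma omod_uminus: "omod p (\<lambda>x. - f x) t = omod p f t"
  unfolding omod_def by (simp add: dint_uminus)

lemma omod_le:
  assumes "0 < p" "p \<le> 1" "f \<in> borel_measurable borel"
  shows "omod p f t \<le> 2 * pint p f"
  unfolding omod_def using dint_le[OF assms] by (intro SUP_least)

lemma omod_mono: "t \<le> u \<Longrightarrow> omod p f t \<le> omod p f u"
  unfolding omod_def by (intro SUP_subset_mono) auto

lemma dint_le_omod: "norm y \<le> t \<Longrightarrow> dint p f y \<le> omod p f t"
  unfolding omod_def by (intro SUP_upper) auto

lemma omod_zero [simp]: "omod p (\<lambda>x. c) t = 0"
  by (auto simp: omod_def dint_def intro!: antisym SUP_least)

section \<open>The Bernstein inequality for step functions\<close>

lemma dint_pconst_half:
  fixes g :: "real^'n \<Rightarrow> real"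
  assumes g: "pconst k g" and [measurable]: "g \<in> borel_measurable borel"
  shows "(\<integral>\<^sup>+x. ennreal (\<bar>g x\<bar> powr p) * (indicator hcube x * (if idx k (x + y) \<noteq> idx k x \<or> x + y \<notin> hcube then 1 else 0)) \<partial>lborel)
    \<le> ennreal (cdim TYPE('n) * norm y * 2^k) * pint p g"
proof -
  define M where "M = ennreal (2 powr (- real k * cdim TYPE('n)))"
  define B where "B = ennreal (cdim TYPE('n) * norm y * 2^k)"
  define G where "G i = ennreal (\<bar>g (corner k i)\<bar> powr p)" for i
  have [measurable]: "{x \<in> cell k i. x + y \<notin> cell k i} \<in> sets borel" for i by measurable
  have "(\<integral>\<^sup>+x. ennreal (\<bar>g x\<bar> powr p) * (indicator hcube x * (if idx k (x + y) \<noteq> idx k x \<or> x + y \<notin> hcube then 1 else 0)) \<partial>lborel)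
    = (\<integral>\<^sup>+x. (\<Sum>i\<in>Idx k. G i * indicator {x \<in> cell k i. x + y \<notin> cell k i} x) \<partial>lborel)"
  proof (rule nn_integral_cong)
    fix x
    show "ennreal (\<bar>g x\<bar> powr p) * (indicator hcube x * (if idx k (x + y) \<noteq> idx k x \<or> x + y \<notin> hcube then 1 else 0))
      = (\<Sum>i\<in>Idx k. G i * indicator {x \<in> cell k i. x + y \<notin> cell k i} x)"
    proof (cases "x \<in> hcube")
      case True
      have "(\<Sum>i\<in>Idx k. G i * indicator {x \<in> cell k i. x + y \<notin> cell k i} x)
         = (\<Sum>i\<in>Idx k. if i = idx k x then G i * (if idx k (x + y) \<noteq> idx k x \<or> x + y \<notin> hcube then 1 else 0) else 0)"
        using True by (intro sum.cong) (auto simp: cell_def)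
      also have "\<dots> = G (idx k x) * (if idx k (x + y) \<noteq> idx k x \<or> x + y \<notin> hcube then 1 else 0)"
        using True by (simp add: idx_in_Idx)
      finally show ?thesis using True pconst_corner[OF g True] by (simp add: G_def)
    qed (auto simp: cell_def)
  qed
  also have "\<dots> = (\<Sum>i\<in>Idx k. G i * emeasure lborel {x \<in> cell k i. x + y \<notin> cell k i})"
    by (subst nn_integral_sum) (auto simp: nn_integral_cmult_indicator)
  \<comment> \<open>M is the cell measure and B bounds the fraction of a cell that the shift moves
    out of it.\<close>
  also have "\<dots> \<le> (\<Sum>i\<in>Idx k. G i * (B * M))"
    using emeasure_cell_shift[of _ k y] unfolding B_def M_def
    by (intro sum_mono mult_left_mono) (auto simp flip: ennreal_mult)
  also have "\<dots> = B * pint p g"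
    unfolding pint_pconst[OF assms] by (simp only: sum_distrib_right sum_distrib_left G_def M_def mult.left_commute)
  finally show ?thesis by (simp add: B_def)
qed

text \<open>A difference of g is nonzero only where the shift changes the cell. There it is bounded
  by the p-th powers of both values; translating the term at x + y turns it into the same kind of
  integral for the shift -y, so \<open>dint_pconst_half\<close> applies twice.\<close>

lemma Bernstein:
  fixes g :: "real^'n \<Rightarrow> real"
  assumes p: "0 < p" "p \<le> 1" and g: "pconst k g" and [measurable]: "g \<in> borel_measurable borel"
  shows "omod p g t \<le> ennreal (2 * cdim TYPE('n) * t * 2^k) * pint p g"
  unfolding omod_def
proof (rule SUP_least)
  fix y :: "real^'n" assume "y \<in> {y. norm y \<le> t}"
  then have y: "norm y \<le> t" by simp
  define bd where "bd x y = (if idx k (x + y) \<noteq> idx k x \<or> x + y \<notin> hcube then 1 else 0 :: ennreal)" for x y :: "real^'n"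
  define F where "F y x = ennreal (\<bar>g x\<bar> powr p) * (indicator hcube x * bd x y)" for x y
  have meas: "(\<lambda>x. F y x) \<in> borel_measurable borel" for y
  proof -
    have [measurable]: "{x. idx k (x + y) = idx k x} \<in> sets borel"
    proof -
      \<comment> \<open>Equality of multi-indices is tested coordinatewise by real-valued Borel
        functions; the maximum with 0 imitates \<open>nat\<close>.\<close>
      have n: "nat a = nat b \<longleftrightarrow> max 0 (real_of_int a) = max 0 (real_of_int b)" for a b :: int
        by (auto simp: max_def)
      have "{x. idx k (x + y) = idx k x} =
          {x. \<forall>j. max 0 (real_of_int \<lfloor>2^k * (x $ j + y $ j)\<rfloor>) = max 0 (real_of_int \<lfloor>2^k * x $ j\<rfloor>)}"
        by (simp add: idx_def fun_eq_iff n)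
      also have "\<dots> = (\<Inter>j. {x \<in> space borel. max 0 (real_of_int \<lfloor>2^k * (x $ j + y $ j)\<rfloor>) = max 0 (real_of_int \<lfloor>2^k * x $ j\<rfloor>)})"
        by auto
      also have "\<dots> \<in> sets borel"
        by (intro sets.finite_INT borel_measurable_eq borel_measurable_max borel_measurable_real_floor) auto
      finally show ?thesis .
    qed
    have [measurable]: "(\<lambda>x. x + y) -` hcube \<in> sets borel"
      by (rule measurable_sets_borel[of _ borel]) auto
    have bd: "(\<lambda>x. bd x y) = indicator (- ({x. idx k (x + y) = idx k x} \<inter> ((\<lambda>x. x + y) -` hcube)))"
      by (auto simp: bd_def indicator_def)
    have [measurable]: "(\<lambda>x. bd x y) \<in> borel_measurable borel" unfolding bd by measurable
    show ?thesis unfolding F_def by measurable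
  qed
  have half: "(\<integral>\<^sup>+x. F y x \<partial>lborel) \<le> ennreal (cdim TYPE('n) * norm y * 2^k) * pint p g" for y
    unfolding F_def bd_def by (rule dint_pconst_half[OF g]) simp
  have "dint p g y \<le> (\<integral>\<^sup>+x. F y x + F (- y) (x + y) \<partial>lborel)"
    unfolding dint_def
  proof (rule nn_integral_mono)
    fix x
    show "ennreal (\<bar>g (x + y) - g x\<bar> powr p) * (indicator hcube x * indicator hcube (x + y)) \<le> F y x + F (- y) (x + y)"
    proof (cases "x \<in> hcube \<and> x + y \<in> hcube \<and> idx k (x + y) \<noteq> idx k x")
      case True
      then show ?thesis
        using abs_powr_add_le[OF p, of "g (x + y)" "- g x"] by (auto simp: F_def bd_def add.commute)
    next
      case False
      then have "x \<in> hcube \<Longrightarrow> x + y \<in> hcube \<Longrightarrow> g (x + y) = g x"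
        using pconstD[OF g, of "x + y" x] by auto
      then show ?thesis by (auto simp: indicator_def)
    qed
  qed
  also have "\<dots> = (\<integral>\<^sup>+x. F y x \<partial>lborel) + (\<integral>\<^sup>+x. F (- y) (x + y) \<partial>lborel)"
    using meas by (intro nn_integral_add) auto
  also have "(\<integral>\<^sup>+x. F (- y) (x + y) \<partial>lborel) = (\<integral>\<^sup>+x. F (- y) x \<partial>lborel)"
    using meas by (intro nn_integral_translate) auto
  also have "(\<integral>\<^sup>+x. F y x \<partial>lborel) + (\<integral>\<^sup>+x. F (- y) x \<partial>lborel)
      \<le> ennreal (cdim TYPE('n) * norm y * 2^k) * pint p g + ennreal (cdim TYPE('n) * norm (- y) * 2^k) * pint p g"
    by (intro add_mono half)
  also have "\<dots> = ennreal (2 * cdim TYPE('n) * norm y * 2^k) * pint p g"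
    by (simp flip: distrib_right ennreal_plus)
  also have "\<dots> \<le> ennreal (2 * cdim TYPE('n) * t * 2^k) * pint p g"
    using y by (intro mult_right_mono ennreal_leI) auto
  finally show "dint p g y \<le> \<dots>" .
qed

section \<open>The Jackson inequality by sampling\<close>

lemma exists_le_average:
  assumes [measurable]: "F \<in> borel_measurable M" "A \<in> sets M"
    and pos: "emeasure M A \<noteq> 0" and fin: "emeasure M A < top"
  shows "\<exists>y\<in>A. F y * emeasure M A \<le> (\<integral>\<^sup>+x\<in>A. F x \<partial>M)"
proof (rule ccontr)
  define m where "m = emeasure M A"
  define I where "I = (\<integral>\<^sup>+x\<in>A. F x \<partial>M)"
  assume "\<not> ?thesis"
  then have lt: "I < F y * m" if "y \<in> A" for y using that by (auto simp: I_def m_def not_le)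
  have ne: "A \<noteq> {}" using pos by auto
  have Ifin: "I < top" using lt ne less_le_trans[OF _ top_greatest] by blast
  have Im: "I / m * m = I"
    using pos fin by (simp add: ennreal_divide_times m_def)
  \<comment> \<open>F would exceed its mean everywhere on A; integrating this over a set of positive
    finite measure yields a strict inequality of the integral with itself.\<close>
  have lt': "I / m < F y" if "y \<in> A" for y
  proof (rule ccontr)
    assume "\<not> ?thesis"
    then have "F y * m \<le> I / m * m" by (intro mult_right_mono) (auto simp: not_less)
    with lt[OF that] Im show False by simp
  qed
  have "(\<integral>\<^sup>+x. I / m * indicator A x \<partial>M) < (\<integral>\<^sup>+x. F x * indicator A x \<partial>M)"
  proof (rule nn_integral_less)
    show "(\<integral>\<^sup>+x. I / m * indicator A x \<partial>M) \<noteq> \<infinity>"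
      using Im Ifin by (simp add: nn_integral_cmult_indicator m_def)
    show "AE x in M. I / m * indicator A x \<le> F x * indicator A x"
      using lt' by (auto simp: indicator_def intro: less_imp_le)
    show "\<not> (AE x in M. F x * indicator A x \<le> I / m * indicator A x)"
    proof
      assume "AE x in M. F x * indicator A x \<le> I / m * indicator A x"
      then have "AE x in M. x \<notin> A"
        by (rule eventually_mono) (use lt' in \<open>auto simp: indicator_def not_le[symmetric] split: if_splits\<close>)
      then have "emeasure M A = 0"
        by (subst (asm) AE_iff_measurable[of A]) (use sets.sets_into_space[OF assms(2)] in auto)
      with pos show False by simp
    qed
  qed auto
  then show False
    using Im by (simp add: nn_integral_cmult_indicator flip: I_def m_def)
qed

text \<open>After the substitution x = y + h and an exchange of integrals, the cells together
  contribute at most \<open>dint p f h\<close> for each h. The differences h lie in a cube of side 2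
  / 2^k; its volume is the factor on the right, and its points have l_1 norm, hence norm, at most d
  / 2^k.\<close>

lemma cells_oscillation_le:
  fixes f :: "real^'n \<Rightarrow> real"
  assumes [measurable]: "f \<in> borel_measurable borel"
  shows "(\<Sum>i\<in>Idx k. \<integral>\<^sup>+y\<in>cell k i. (\<integral>\<^sup>+x\<in>cell k i. ennreal (\<bar>f x - f y\<bar> powr p) \<partial>lborel) \<partial>lborel)
    \<le> omod p f (cdim TYPE('n) / 2^k) * ennreal (2 powr cdim TYPE('n) * 2 powr (- real k * cdim TYPE('n)))"
proof -
  define B where "B = (half_open_box (\<chi> j. - (1 / 2^k)) (\<chi> j. 1 / 2^k) :: (real^'n) set)"
  define D where "D y h = ennreal (\<bar>f (y + h) - f y\<bar> powr p)" for y h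
  have [measurable]: "(\<lambda>(y, h). D y h) \<in> borel_measurable (borel \<Otimes>\<^sub>M borel)"
    unfolding D_def by measurable
  have [measurable]: "(\<lambda>(y, h). indicator A (y + h) :: ennreal) \<in> borel_measurable (borel \<Otimes>\<^sub>M borel)"
    if [measurable]: "A \<in> sets borel" for A :: "(real^'n) set" by measurable
  have [measurable]: "B \<in> sets borel" by (simp add: B_def)
  have emB: "emeasure lborel B = ennreal (2 powr cdim TYPE('n) * 2 powr (- real k * cdim TYPE('n)))"
  proof -
    have "emeasure lborel B = ennreal (\<Prod>j\<in>(UNIV::'n set). 2 * (1 / 2^k))"
      unfolding B_def by (subst emeasure_half_open_box) auto
    also have "(\<Prod>j\<in>(UNIV::'n set). 2 * (1 / 2^k)) = 2 ^ CARD('n) * ((1::real) / 2^k) ^ CARD('n)"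
      by (simp only: prod_constant power_mult_distrib)
    also have "\<dots> = 2 powr cdim TYPE('n) * 2 powr (- real k * cdim TYPE('n))"
      by (simp add: powr_realpow powr_half_nat[symmetric] powr_powr)
    finally show ?thesis .
  qed
  have "(\<Sum>i\<in>Idx k. \<integral>\<^sup>+y\<in>cell k i. (\<integral>\<^sup>+x\<in>cell k i. ennreal (\<bar>f x - f y\<bar> powr p) \<partial>lborel) \<partial>lborel)
     = (\<Sum>i\<in>Idx k. \<integral>\<^sup>+y. (\<integral>\<^sup>+h. D y h * (indicator (cell k i) y * indicator (cell k i) (y + h)) \<partial>lborel) \<partial>lborel)"
  proof (intro sum.cong refl nn_integral_cong)
    fix i y
    have "(\<integral>\<^sup>+x\<in>cell k i. ennreal (\<bar>f x - f y\<bar> powr p) \<partial>lborel) =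
        (\<integral>\<^sup>+h. D y h * indicator (cell k i) (y + h) \<partial>lborel)"
      using nn_integral_translate[of "\<lambda>x. ennreal (\<bar>f x - f y\<bar> powr p) * indicator (cell k i) x" y]
      by (simp add: D_def add.commute)
    then have "(\<integral>\<^sup>+x\<in>cell k i. ennreal (\<bar>f x - f y\<bar> powr p) \<partial>lborel) * indicator (cell k i) y =
        (\<integral>\<^sup>+h. D y h * indicator (cell k i) (y + h) \<partial>lborel) * indicator (cell k i) y" by simp
    also have "\<dots> = (\<integral>\<^sup>+h. D y h * (indicator (cell k i) y * indicator (cell k i) (y + h)) \<partial>lborel)"
      by (auto simp: indicator_def)
    finally show "(\<integral>\<^sup>+x\<in>cell k i. ennreal (\<bar>f x - f y\<bar> powr p) \<partial>lborel) * indicator (cell k i) y = \<dots>" .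
  qed
  also have "\<dots> = (\<Sum>i\<in>Idx k. \<integral>\<^sup>+h. (\<integral>\<^sup>+y. D y h * (indicator (cell k i) y * indicator (cell k i) (y + h)) \<partial>lborel) \<partial>lborel)"
    by (intro sum.cong refl lborel_pair.Fubini') measurable
  also have "\<dots> = (\<integral>\<^sup>+h. (\<integral>\<^sup>+y. (\<Sum>i\<in>Idx k. D y h * (indicator (cell k i) y * indicator (cell k i) (y + h))) \<partial>lborel) \<partial>lborel)"
  proof -
    have [measurable]: "(\<lambda>h. \<integral>\<^sup>+y. D y h * (indicator (cell k i) y * indicator (cell k i) (y + h)) \<partial>lborel)
        \<in> borel_measurable lborel" for i by measurable
    have "(\<integral>\<^sup>+h. (\<integral>\<^sup>+y. (\<Sum>i\<in>Idx k. D y h * (indicator (cell k i) y * indicator (cell k i) (y + h))) \<partial>lborel) \<partial>lborel)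
      = (\<integral>\<^sup>+h. (\<Sum>i\<in>Idx k. \<integral>\<^sup>+y. D y h * (indicator (cell k i) y * indicator (cell k i) (y + h)) \<partial>lborel) \<partial>lborel)"
      by (intro nn_integral_cong nn_integral_sum) measurable
    also have "\<dots> = (\<Sum>i\<in>Idx k. \<integral>\<^sup>+h. (\<integral>\<^sup>+y. D y h * (indicator (cell k i) y * indicator (cell k i) (y + h)) \<partial>lborel) \<partial>lborel)"
      by (rule nn_integral_sum) measurable
    finally show ?thesis ..
  qed
  also have "\<dots> \<le> (\<integral>\<^sup>+h. dint p f h * indicator B h \<partial>lborel)"
  proof (rule nn_integral_mono)
    fix h
    have *: "(\<Sum>i\<in>Idx k. indicator (cell k i) y * indicator (cell k i) (y + h))
        \<le> (indicator hcube y * indicator hcube (y + h) * indicator B h :: ennreal)" for y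
    proof (cases "y \<in> hcube \<and> y + h \<in> hcube \<and> idx k (y + h) = idx k y")
      case True
      then have "h \<in> B"
      proof -
        have "- (1 / 2^k) \<le> h $ j \<and> h $ j < 1 / 2^k" for j
        proof -
          have "real (idx k y j) / 2^k \<le> y $ j" "y $ j < (real (idx k y j) + 1) / 2^k"
            using True idx_eq_iff[of y k "idx k y"] by (auto simp: hcube_iff)
          moreover have "real (idx k y j) / 2^k \<le> y $ j + h $ j" "y $ j + h $ j < (real (idx k y j) + 1) / 2^k"
            using True idx_eq_iff[of "y + h" k "idx k y"] by (auto simp: hcube_iff)
          ultimately show ?thesis by (auto simp: add_divide_distrib)
        qed
        then show ?thesis by (simp add: B_def half_open_box_def)
      qed
      have "(\<Sum>i\<in>Idx k. indicator (cell k i) y * indicator (cell k i) (y + h)) = (\<Sum>i\<in>Idx k. if i = idx k y then 1 else 0 :: ennreal)"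
        using True by (intro sum.cong) (auto simp: cell_def)
      with \<open>h \<in> B\<close> True show ?thesis by (simp add: idx_in_Idx)
    next
      case False
      then have "(\<Sum>i\<in>Idx k. indicator (cell k i) y * indicator (cell k i) (y + h)) = (0::ennreal)"
        by (intro sum.neutral) (auto simp: cell_def indicator_def)
      then show ?thesis by simp
    qed
    have "(\<integral>\<^sup>+y. (\<Sum>i\<in>Idx k. D y h * (indicator (cell k i) y * indicator (cell k i) (y + h))) \<partial>lborel)
       \<le> (\<integral>\<^sup>+y. D y h * (indicator hcube y * indicator hcube (y + h)) * indicator B h \<partial>lborel)"
      unfolding sum_distrib_left[symmetric] mult.assoc[of "D _ _"]
      by (intro nn_integral_mono mult_left_mono *) auto
    also have "\<dots> = dint p f h * indicator B h"
      unfolding dint_def D_def by (rule nn_integral_multc) simp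
    finally show "(\<integral>\<^sup>+y. (\<Sum>i\<in>Idx k. D y h * (indicator (cell k i) y * indicator (cell k i) (y + h))) \<partial>lborel) \<le> dint p f h * indicator B h" .
  qed
  also have "\<dots> \<le> (\<integral>\<^sup>+h. omod p f (cdim TYPE('n) / 2^k) * indicator B h \<partial>lborel)"
  proof (intro nn_integral_mono)
    fix h
    show "dint p f h * indicator B h \<le> omod p f (cdim TYPE('n) / 2^k) * indicator B h"
    proof (cases "h \<in> B")
      case True
      then have "- (1 / 2^k) \<le> h $ j \<and> h $ j < 1 / 2^k" for j by (simp add: B_def half_open_box_def)
      then have "\<bar>h $ j\<bar> \<le> 1 / 2^k" for j by (smt (verit, best))
      then have "(\<Sum>j\<in>UNIV. \<bar>h $ j\<bar>) \<le> (\<Sum>j\<in>(UNIV::'n set). 1 / 2^k)" by (intro sum_mono)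
      then have "norm h \<le> cdim TYPE('n) / 2^k" using norm_le_l1_cart[of h] by simp
      then show ?thesis by (intro mult_right_mono dint_le_omod) auto
    qed simp
  qed
  also have "\<dots> = omod p f (cdim TYPE('n) / 2^k) * ennreal (2 powr cdim TYPE('n) * 2 powr (- real k * cdim TYPE('n)))"
    by (simp add: nn_integral_cmult_indicator emB)
  finally show ?thesis .
qed

text \<open>Cell means may not exist for p < 1. Instead f is sampled at a point of the cell whose
  mean p-th power distance to the other values is at most the average over the cell, so the error is
  controlled by \<open>cells_oscillation_le\<close>.\<close>

lemma Jackson:
  fixes f :: "real^'n \<Rightarrow> real"
  assumes [measurable]: "f \<in> borel_measurable borel"
  shows "\<exists>V. pconst k V \<and> V \<in> borel_measurable borel \<and>
    pint p (\<lambda>x. f x - V x) \<le> ennreal (2 powr cdim TYPE('n)) * omod p f (cdim TYPE('n) / 2^k)"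
proof -
  define \<mu> where "\<mu> = ennreal (2 powr (- real k * cdim TYPE('n)))"
  define F where "F i y = (\<integral>\<^sup>+x\<in>cell k i. ennreal (\<bar>f x - f y\<bar> powr p) \<partial>lborel)" for i y
  have \<mu>: "\<mu> \<noteq> 0" "\<mu> \<noteq> top" by (auto simp: \<mu>_def)
  have [measurable]: "F i \<in> borel_measurable borel" for i
    unfolding F_def by measurable
  have "\<forall>i\<in>Idx k. \<exists>y\<in>cell k i. F i y * \<mu> \<le> (\<integral>\<^sup>+y\<in>cell k i. F i y \<partial>lborel)"
  proof
    fix i :: "'n \<Rightarrow> nat" assume i: "i \<in> Idx k"
    show "\<exists>y\<in>cell k i. F i y * \<mu> \<le> (\<integral>\<^sup>+y\<in>cell k i. F i y \<partial>lborel)"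
      using exists_le_average[of "F i" lborel "cell k i"] emeasure_cell[OF i] \<mu>
      by (auto simp: \<mu>_def)
  qed
  then obtain y where y: "\<And>i. i \<in> Idx k \<Longrightarrow> F i (y i) * \<mu> \<le> (\<integral>\<^sup>+y\<in>cell k i. F i y \<partial>lborel)"
    by metis
  define V where "V x = (if x \<in> hcube then f (y (idx k x)) else 0)" for x
  have V [measurable]: "V \<in> borel_measurable borel"
    unfolding V_def by (rule borel_idx_fun[where v = "\<lambda>i. f (y i)"])
  have pV: "pconst k V" by (simp add: pconst_def V_def)
  have "pint p (\<lambda>x. f x - V x) = (\<Sum>i\<in>Idx k. F i (y i))"
    unfolding pint_def
    by (subst nn_integral_hcube_cells[of _ k], simp, unfold F_def)
       (intro sum.cong refl nn_integral_cong, auto simp: V_def cell_def indicator_def)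
  then have "pint p (\<lambda>x. f x - V x) * \<mu> \<le> (\<Sum>i\<in>Idx k. \<integral>\<^sup>+y\<in>cell k i. F i y \<partial>lborel)"
    using y by (auto simp: sum_distrib_right intro: sum_mono)
  also have "\<dots> \<le> omod p f (cdim TYPE('n) / 2^k) * ennreal (2 powr cdim TYPE('n) * 2 powr (- real k * cdim TYPE('n)))"
    unfolding F_def by (rule cells_oscillation_le) simp
  also have "\<dots> = (ennreal (2 powr cdim TYPE('n)) * omod p f (cdim TYPE('n) / 2^k)) * \<mu>"
    by (simp add: \<mu>_def ennreal_mult mult_ac)
  finally have "pint p (\<lambda>x. f x - V x) \<le> ennreal (2 powr cdim TYPE('n)) * omod p f (cdim TYPE('n) / 2^k)"
    using \<mu> by (simp add: ennreal_mult_le_mult_iff mult.commute[of _ \<mu>])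
  then show ?thesis using V pV by blast
qed

section \<open>The Besov modular and its description by step functions\<close>

lemma ennreal_LIMSEQ_0_le:
  fixes X Y :: "nat \<Rightarrow> ennreal"
  assumes "X \<longlonglongrightarrow> 0" "\<And>k. Y k \<le> X k"
  shows "Y \<longlonglongrightarrow> 0"
  by (rule tendsto_sandwich[of "\<lambda>_. 0" Y sequentially X]) (use assms in auto)

lemma ennreal_suminf_shift_le: "(\<Sum>j. f (j + l)) \<le> (\<Sum>j. f j :: ennreal)"
  unfolding ennreal_suminf_split[of f l] by simp

text \<open>For \<theta> > 0 the weights are summable and a supremum bound suffices for every r; for
  \<theta> = 0 this is the inclusion of l_r into l_1. The two admissible parameter ranges of the
  theorem go back to this alternative.\<close>

lemma weighted_sum_le:
  assumes "0 < r" "0 < \<theta> \<or> (\<theta> = 0 \<and> r \<le> 1)"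
  shows "\<exists>C\<ge>0. \<forall>z :: nat \<Rightarrow> ennreal.
    (\<Sum>j. ennreal (2 powr (- \<theta> * real j)) * z j) \<le> ennreal C * (\<Sum>j. z j powe r) powe (1 / r)"
proof (cases "0 < \<theta>")
  case True
  define C where "C = 1 / (1 - 2 powr - \<theta>)"
  have "2 powr - \<theta> < 1" using True by (simp add: powr_less_one)
  then have "0 \<le> C" by (simp add: C_def)
  moreover have "(\<Sum>j. ennreal (2 powr (- \<theta> * real j)) * z j) \<le> ennreal C * (\<Sum>j. z j powe r) powe (1 / r)" for z
  proof -
    have "z j \<le> (\<Sum>j. z j powe r) powe (1 / r)" for j
      using powe_mono[OF ennreal_term_le_suminf[of "\<lambda>j. z j powe r" j], of "1/r"] assms by simp
    then have "(\<Sum>j. ennreal (2 powr (- \<theta> * real j)) * z j)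
      \<le> (\<Sum>j. ennreal (2 powr (- \<theta> * real j)) * (\<Sum>j. z j powe r) powe (1 / r))"
      by (intro ennreal_suminf_le mult_left_mono) auto
    then show ?thesis using geometric_ennreal[OF True] by (simp add: C_def)
  qed
  ultimately show ?thesis by blast
next
  case False
  then have "\<theta> = 0" "r \<le> 1" using assms by auto
  then show ?thesis using suminf_le_powe_suminf[of r] assms by (intro exI[of _ 1]) auto
qed

text \<open>The weights grow geometrically, so the weight at level k controls the whole head below
  it.\<close>

lemma geometric_head_le:
  assumes "0 < \<sigma>" "0 < r"
  shows "(\<Sum>j<k. (ennreal (2 powr (\<sigma> * real j)) * x) powe r)
    \<le> ennreal (2 / (1 - 2 powr - (\<sigma> * r))) * (ennreal (2 powr (\<sigma> * real k)) * x) powe r"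
proof -
  have e: "ennreal (2 powr (\<sigma> * real j)) powe r
      = ennreal (2 powr (- (\<sigma> * r) * \<bar>real k - real j\<bar>)) * ennreal (2 powr (\<sigma> * real k)) powe r" if "j < k" for j
    using that by (simp add: powr_powr algebra_simps flip: ennreal_mult powr_add)
  have "(\<Sum>j<k. (ennreal (2 powr (\<sigma> * real j)) * x) powe r)
    = (\<Sum>j<k. ennreal (2 powr (- (\<sigma> * r) * \<bar>real k - real j\<bar>))) * (ennreal (2 powr (\<sigma> * real k)) * x) powe r"
    unfolding sum_distrib_right powe_mult by (intro sum.cong) (auto simp only: e lessThan_iff mult.assoc)
  also have "(\<Sum>j<k. ennreal (2 powr (- (\<sigma> * r) * \<bar>real k - real j\<bar>)))
      \<le> (\<Sum>j. ennreal (2 powr (- (\<sigma> * r) * \<bar>real k - real j\<bar>)))"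
    by (rule sum_le_suminf) auto
  also have "\<dots> \<le> ennreal (2 / (1 - 2 powr - (\<sigma> * r)))"
    by (rule geometric_ennreal_two_sided) (use assms in auto)
  finally show ?thesis by (simp add: mult_right_mono)
qed

text \<open>No infimum over V is taken: upper bounds choose V freely, and \<open>analysis\<close>
  supplies a good choice.\<close>

definition apx :: "real \<Rightarrow> real \<Rightarrow> real \<Rightarrow> (real^'n \<Rightarrow> real) \<Rightarrow> (nat \<Rightarrow> real^'n \<Rightarrow> real) \<Rightarrow> ennreal" where
  "apx p \<sigma> r f V = (\<Sum>j. (ennreal (2 powr (\<sigma> * real j)) * pint p (\<lambda>x. f x - V j x)) powe r)"

definition bes :: "real \<Rightarrow> real \<Rightarrow> real \<Rightarrow> (real^'n \<Rightarrow> real) \<Rightarrow> ennreal" where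
  "bes p \<sigma> r f = (\<Sum>m. (ennreal (2 powr (\<sigma> * real m)) * omod p f (1 / 2^m)) powe r)"

text \<open>For \<sigma> = s p and r = q / p this is comparable to the q-th power of the Besov
  quasi-norm: the first term is the q-th power of the L_p quasi-norm, and \<open>bes\<close> samples
  the integral over t at t = 2^(-m).\<close>

definition rho :: "real \<Rightarrow> real \<Rightarrow> real \<Rightarrow> (real^'n \<Rightarrow> real) \<Rightarrow> ennreal" where
  "rho p \<sigma> r f = pint p f powe r + bes p \<sigma> r f"

definition step_seq :: "(nat \<Rightarrow> real^'n \<Rightarrow> real) \<Rightarrow> bool" where
  "step_seq V \<longleftrightarrow> (\<forall>j. pconst j (V j) \<and> V j \<in> borel_measurable borel)"

lemma step_seqD: "step_seq V \<Longrightarrow> pconst j (V j)" "step_seq V \<Longrightarrow> V j \<in> borel_measurable borel"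
  by (auto simp: step_seq_def)

lemma pint_diff_triangle:
  assumes "0 < p" "p \<le> 1" and "f \<in> borel_measurable borel" "g \<in> borel_measurable borel" "h \<in> borel_measurable borel"
  shows "pint p (\<lambda>x. g x - h x) \<le> pint p (\<lambda>x. f x - g x) + pint p (\<lambda>x. f x - h x)"
  using pint_diff[OF assms(1,2), of "\<lambda>x. f x - h x" "\<lambda>x. f x - g x"] assms(3,4,5)
  by (simp add: add.commute)

text \<open>Telescoping from V 0, which is constant on the cube and has zero modulus; each increment
  is a step function of level Suc j, to which \<open>Bernstein\<close> applies.\<close>

lemma step_seq_omod_le:
  fixes V :: "nat \<Rightarrow> real^'n \<Rightarrow> real"
  assumes p: "0 < p" "p \<le> 1" and V: "step_seq V" and t: "0 \<le> t"
  shows "omod p (V m) t \<le> (\<Sum>j<m. ennreal (2 * cdim TYPE('n) * t * 2^(Suc j)) * pint p (\<lambda>x. V (Suc j) x - V j x))"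
proof (induction m)
  case 0
  have "omod p (V 0) t = omod p (\<lambda>x :: real^'n. V 0 0) t"
  proof (rule omod_cong)
    fix x :: "real^'n" assume "x \<in> hcube"
    moreover have "0 \<in> (hcube :: (real^'n) set)" by (simp add: hcube_iff)
    ultimately show "V 0 x = V 0 0"
      using pconstD[OF step_seqD(1)[OF V, of 0], of x 0] by (simp add: idx_0)
  qed
  then show ?case by simp
next
  case (Suc m)
  note [measurable] = step_seqD(2)[OF V]
  have "omod p (V (Suc m)) t \<le> omod p (V m) t + omod p (\<lambda>x. V (Suc m) x - V m x) t"
    using omod_add[OF p, of "V m" "\<lambda>x. V (Suc m) x - V m x" t] by simp
  also have "omod p (\<lambda>x. V (Suc m) x - V m x) t
      \<le> ennreal (2 * cdim TYPE('n) * t * 2^(Suc m)) * pint p (\<lambda>x. V (Suc m) x - V m x)"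
    by (intro Bernstein p pconst_diff step_seqD(1)[OF V] pconst_mono[OF step_seqD(1)[OF V, of m]]) auto
  finally show ?case using Suc by (auto intro: order_trans add_mono)
qed

text \<open>Split f into f - V m and V m. The first part costs the factor 2 of
  \<open>omod_le\<close>. In the second the Bernstein constant 2 d meets two consecutive errors per
  increment, with weights 1 and 2 after reindexing, which gives 6 d.\<close>

lemma synthesis_pointwise:
  fixes f :: "real^'n \<Rightarrow> real"
  assumes p: "0 < p" "p \<le> 1" and V: "step_seq V" and [measurable]: "f \<in> borel_measurable borel"
  shows "omod p f (1 / 2^m) \<le> ennreal (2 + 6 * cdim TYPE('n)) *
    (\<Sum>j\<le>m. ennreal (2 powr (real j - real m)) * pint p (\<lambda>x. f x - V j x))"
proof -
  note [measurable] = step_seqD(2)[OF V]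
  define d where "d = cdim TYPE('n)"
  have d0: "0 \<le> d" by (simp add: d_def)
  define e where "e j = pint p (\<lambda>x. f x - V j x)" for j
  define T where "T = (\<Sum>j\<le>m. ennreal (2 powr (real j - real m)) * e j)"
  have w: "ennreal (2 * d * (1 / 2^m) * 2^(Suc j)) = ennreal (2 * d) * ennreal (2 powr (real (Suc j) - real m))" for j
    using d0 by (simp add: powr_diff powr_realpow powr_add flip: ennreal_mult)
  have w2: "ennreal (2 powr (real (Suc j) - real m)) = 2 * ennreal (2 powr (real j - real m))" for j
  proof -
    have "2 powr (real (Suc j) - real m) = 2 * 2 powr (real j - real m)"
      by (simp add: powr_diff powr_add)
    then show ?thesis by (simp add: ennreal_mult)
  qed
  have "omod p f (1 / 2^m) \<le> omod p (\<lambda>x. f x - V m x) (1 / 2^m) + omod p (V m) (1 / 2^m)"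
    using omod_add[OF p, of "\<lambda>x. f x - V m x" "V m"] by simp
  also have "omod p (\<lambda>x. f x - V m x) (1 / 2^m) \<le> 2 * e m"
    unfolding e_def by (rule omod_le[OF p]) simp
  also have "\<dots> \<le> 2 * T"
    unfolding T_def
    by (intro mult_left_mono order_trans[OF _ member_le_sum[of m]]) auto
  also have "omod p (V m) (1 / 2^m) \<le> (\<Sum>j<m. ennreal (2 * d * (1 / 2^m) * 2^(Suc j)) * pint p (\<lambda>x. V (Suc j) x - V j x))"
    unfolding d_def by (rule step_seq_omod_le[OF p V]) simp
  also have "\<dots> \<le> (\<Sum>j<m. ennreal (2 * d) * ennreal (2 powr (real (Suc j) - real m)) * (e (Suc j) + e j))"
    unfolding w e_def by (intro sum_mono mult_left_mono pint_diff_triangle p) auto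
  also have "\<dots> = ennreal (2 * d) * ((\<Sum>j<m. ennreal (2 powr (real (Suc j) - real m)) * e (Suc j))
      + 2 * (\<Sum>j<m. ennreal (2 powr (real j - real m)) * e j))"
    by (simp only: sum_distrib_left distrib_left sum.distrib mult.assoc w2 mult.left_commute)
  also have "\<dots> \<le> ennreal (2 * d) * (T + 2 * T)"
  proof (intro mult_left_mono add_mono)
    show "(\<Sum>j<m. ennreal (2 powr (real (Suc j) - real m)) * e (Suc j)) \<le> T"
      unfolding T_def lessThan_Suc_atMost[symmetric] sum.lessThan_Suc_shift by simp
    show "(\<Sum>j<m. ennreal (2 powr (real j - real m)) * e j) \<le> T"
      unfolding T_def by (intro sum_mono2) auto
  qed auto
  also have "T + 2 * T = ennreal 3 * T"
  proof -
    have "T + 2 * T = (1 + 2) * T" by (simp only: distrib_right mult_1)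
    then show ?thesis by simp
  qed
  also have "ennreal (2 * d) * (ennreal 3 * T) = ennreal (6 * d) * T"
  proof -
    have "ennreal (6 * d) = ennreal (2 * d) * ennreal 3" using d0 by (subst ennreal_mult[symmetric]) auto
    then show ?thesis by (simp only: mult.assoc)
  qed
  also have "2 * T + ennreal (6 * d) * T = ennreal (2 + 6 * d) * T"
    using d0 by (simp add: distrib_right)
  finally show ?thesis unfolding T_def e_def d_def by (simp add: add_right_mono add_left_mono)
qed

text \<open>Multiplying \<open>synthesis_pointwise\<close> by 2^(\<sigma> m) leaves the kernel
  2^(-(1 - \<sigma>) |m - j|), which decays because \<sigma> < 1; \<open>geometric_Hardy\<close>
  then works for every r.\<close>

lemma synthesis:
  assumes p: "0 < p" "p \<le> 1" and \<sigma>: "\<sigma> < 1" and r: "0 < r"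
  shows "\<exists>C\<ge>0. \<forall>f V. step_seq V \<longrightarrow> f \<in> borel_measurable borel \<longrightarrow>
    bes p \<sigma> r (f :: real^'n \<Rightarrow> real) \<le> ennreal C * apx p \<sigma> r f V"
proof -
  define D where "D = 2 + 6 * cdim TYPE('n)"
  have D0: "0 \<le> D" by (simp add: D_def)
  obtain C where C: "C \<ge> 0" "\<And>x :: nat \<Rightarrow> ennreal. (\<Sum>m. (\<Sum>j. ennreal (2 powr (- (1 - \<sigma>) * \<bar>real m - real j\<bar>)) * x j) powe r)
      \<le> ennreal C * (\<Sum>j. x j powe r)"
    using geometric_Hardy[of "1 - \<sigma>" r] \<sigma> r by auto
  have "bes p \<sigma> r f \<le> ennreal (D powr r * C) * apx p \<sigma> r f V"
    if V: "step_seq V" and f: "f \<in> borel_measurable borel" for f :: "real^'n \<Rightarrow> real" and V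
  proof -
    define x where "x j = ennreal (2 powr (\<sigma> * real j)) * pint p (\<lambda>x. f x - V j x)" for j
    have 1: "ennreal (2 powr (\<sigma> * real m)) * omod p f (1 / 2^m)
        \<le> ennreal D * (\<Sum>j. ennreal (2 powr (- (1 - \<sigma>) * \<bar>real m - real j\<bar>)) * x j)" for m
    proof -
      have "ennreal (2 powr (\<sigma> * real m)) * omod p f (1 / 2^m)
          \<le> ennreal (2 powr (\<sigma> * real m)) * (ennreal D * (\<Sum>j\<le>m. ennreal (2 powr (real j - real m)) * pint p (\<lambda>x. f x - V j x)))"
        unfolding D_def by (intro mult_left_mono synthesis_pointwise p V f) auto
      also have "\<dots> = ennreal D * (\<Sum>j\<le>m. ennreal (2 powr (\<sigma> * real m)) * ennreal (2 powr (real j - real m)) * pint p (\<lambda>x. f x - V j x))"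
        by (simp add: sum_distrib_left mult_ac)
      also have "\<dots> = ennreal D * (\<Sum>j\<le>m. ennreal (2 powr (- (1 - \<sigma>) * \<bar>real m - real j\<bar>)) * x j)"
      proof -
        have "ennreal (2 powr (\<sigma> * real m)) * ennreal (2 powr (real j - real m)) * pint p (\<lambda>x. f x - V j x)
            = ennreal (2 powr (- (1 - \<sigma>) * \<bar>real m - real j\<bar>)) * x j" if "j \<in> {..m}" for j
        proof -
        from that have "\<sigma> * real m + (real j - real m) = - (1 - \<sigma>) * \<bar>real m - real j\<bar> + \<sigma> * real j"
          by (simp add: algebra_simps)
        then have "ennreal (2 powr (\<sigma> * real m)) * ennreal (2 powr (real j - real m)) =
            ennreal (2 powr (- (1 - \<sigma>) * \<bar>real m - real j\<bar>)) * ennreal (2 powr (\<sigma> * real j))"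
          by (simp flip: ennreal_mult powr_add)
        then show ?thesis by (simp only: x_def mult.assoc[symmetric])
        qed
        then show ?thesis by (metis (mono_tags, lifting) sum.cong)
      qed
      also have "\<dots> \<le> ennreal D * (\<Sum>j. ennreal (2 powr (- (1 - \<sigma>) * \<bar>real m - real j\<bar>)) * x j)"
        by (intro mult_left_mono sum_le_suminf) auto
      finally show ?thesis .
    qed
    have "bes p \<sigma> r f \<le> (\<Sum>m. (ennreal D * (\<Sum>j. ennreal (2 powr (- (1 - \<sigma>) * \<bar>real m - real j\<bar>)) * x j)) powe r)"
      unfolding bes_def using r by (intro ennreal_suminf_le powe_mono 1) auto
    also have "\<dots> = ennreal (D powr r) * (\<Sum>m. (\<Sum>j. ennreal (2 powr (- (1 - \<sigma>) * \<bar>real m - real j\<bar>)) * x j) powe r)"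
      unfolding powe_mult using D0 by simp
    also have "\<dots> \<le> ennreal (D powr r) * (ennreal C * (\<Sum>j. x j powe r))"
      by (intro mult_left_mono C) auto
    finally show ?thesis using C(1) by (simp add: apx_def x_def ennreal_mult mult.assoc)
  qed
  then show ?thesis using C(1) by (intro exI[of _ "D powr r * C"]) auto
qed

text \<open>Jackson sees the modulus at radius d / 2^j. Since d \<le> 2^d, level i + d can be
  compared with radius 1 / 2^i; the first d levels are bounded by the L_p part.\<close>

lemma analysis:
  assumes p: "0 < p" "p \<le> 1" and \<sigma>: "0 < \<sigma>" and r: "0 < r"
  shows "\<exists>C\<ge>0. \<forall>f \<in> borel_measurable borel. \<exists>V. step_seq V \<and>
    apx p \<sigma> r (f :: real^'n \<Rightarrow> real) V \<le> ennreal C * rho p \<sigma> r f"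
proof -
  define d where "d = CARD('n)"
  define C1 where "C1 = (2 powr real d * 2 powr (\<sigma> * real d)) powr r"
  define C2 where "C2 = real d * (2 powr (\<sigma> * real d) * (2 powr real d * 2)) powr r"
  have C0: "0 \<le> C1" "0 \<le> C2" by (auto simp: C1_def C2_def)
  have dd: "real d \<le> 2 ^ d" by (metis less_imp_le of_nat_le_iff of_nat_less_two_power of_nat_power of_nat_numeral)
  have "\<exists>V. step_seq V \<and> apx p \<sigma> r f V \<le> ennreal (C1 + C2) * rho p \<sigma> r f"
    if f [measurable]: "f \<in> borel_measurable borel" for f :: "real^'n \<Rightarrow> real"
  proof -
    have "\<forall>j. \<exists>V. pconst j V \<and> V \<in> borel_measurable borel \<and>
        pint p (\<lambda>x. f x - V x) \<le> ennreal (2 powr real d) * omod p f (real d / 2^j)"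
      unfolding d_def using Jackson[OF f] by blast
    then obtain V where V: "\<And>j. pconst j (V j)" "\<And>j. V j \<in> borel_measurable borel"
      "\<And>j. pint p (\<lambda>x. f x - V j x) \<le> ennreal (2 powr real d) * omod p f (real d / 2^j)"
      by metis
    define x where "x j = ennreal (2 powr (\<sigma> * real j)) * pint p (\<lambda>x. f x - V j x)" for j
    have 1: "x (i + d) powe r \<le> ennreal C1 * (ennreal (2 powr (\<sigma> * real i)) * omod p f (1 / 2^i)) powe r" for i
    proof -
      have "real d / 2^(i + d) \<le> 1 / 2^i" using dd by (simp add: power_add field_simps)
      then have "x (i + d) \<le> ennreal (2 powr (\<sigma> * real (i + d))) * (ennreal (2 powr real d) * omod p f (1 / 2^i))"
        unfolding x_def by (intro mult_left_mono order_trans[OF V(3)] omod_mono) auto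
      also have "\<dots> = ennreal (2 powr real d * 2 powr (\<sigma> * real d)) * (ennreal (2 powr (\<sigma> * real i)) * omod p f (1 / 2^i))"
        by (simp add: ring_distribs powr_add ennreal_mult mult_ac)
      finally show ?thesis
        using powe_mono[of _ _ r] r by (force simp: powe_mult C1_def)
    qed
    have 2: "x j powe r \<le> ennreal ((2 powr (\<sigma> * real d) * (2 powr real d * 2)) powr r) * pint p f powe r" if "j < d" for j
    proof -
      have "x j \<le> ennreal (2 powr (\<sigma> * real d)) * (ennreal (2 powr real d) * (2 * pint p f))"
        unfolding x_def using that \<sigma>
        by (intro mult_mono order_trans[OF V(3)] mult_left_mono omod_le p ennreal_leI powr_mono) auto
      also have "\<dots> = ennreal (2 powr (\<sigma> * real d) * (2 powr real d * 2)) * pint p f"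
        by (simp add: ennreal_mult mult_ac)
      finally show ?thesis
        using powe_mono[of _ _ r] r by (force simp: powe_mult)
    qed
    have "apx p \<sigma> r f V = (\<Sum>i. x (i + d) powe r) + (\<Sum>j<d. x j powe r)"
      unfolding apx_def x_def[symmetric] by (rule ennreal_suminf_split)
    also have "\<dots> \<le> (\<Sum>i. ennreal C1 * (ennreal (2 powr (\<sigma> * real i)) * omod p f (1 / 2^i)) powe r)
       + (\<Sum>j<d. ennreal ((2 powr (\<sigma> * real d) * (2 powr real d * 2)) powr r) * pint p f powe r)"
      by (intro add_mono ennreal_suminf_le sum_mono 1 2) auto
    also have "\<dots> = ennreal C1 * bes p \<sigma> r f + ennreal C2 * pint p f powe r"
      by (simp add: bes_def C2_def ennreal_mult mult.assoc ennreal_of_nat_eq_real_of_nat)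
    also have "\<dots> \<le> ennreal (C1 + C2) * bes p \<sigma> r f + ennreal (C1 + C2) * pint p f powe r"
      using C0 by (intro add_mono mult_right_mono ennreal_leI) auto
    also have "\<dots> = ennreal (C1 + C2) * rho p \<sigma> r f"
      by (simp add: rho_def distrib_left add.commute)
    finally show ?thesis using V by (auto simp: step_seq_def)
  qed
  then show ?thesis using C0 by (intro exI[of _ "C1 + C2"]) auto
qed

lemma rho_cong: "(\<And>x. x \<in> hcube \<Longrightarrow> f x = g x) \<Longrightarrow> rho p \<sigma> r f = rho p \<sigma> r g"
  using pint_cong[of f g p] omod_cong[of f g p] by (simp add: rho_def bes_def)

lemma rho_add:
  assumes p: "0 < p" "p \<le> 1" and r: "0 < r" and [measurable]: "f \<in> borel_measurable borel" "g \<in> borel_measurable borel"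
  shows "rho p \<sigma> r (\<lambda>x. f x + g x) \<le> ennreal (2 powr r) * (rho p \<sigma> r f + rho p \<sigma> r g)"
proof -
  have "bes p \<sigma> r (\<lambda>x. f x + g x) \<le> (\<Sum>m. ennreal (2 powr r) *
      ((ennreal (2 powr (\<sigma> * real m)) * omod p f (1 / 2^m)) powe r + (ennreal (2 powr (\<sigma> * real m)) * omod p g (1 / 2^m)) powe r))"
    unfolding bes_def
  proof (rule ennreal_suminf_le)
    fix m
    show "(ennreal (2 powr (\<sigma> * real m)) * omod p (\<lambda>x. f x + g x) (1 / 2^m)) powe r \<le> ennreal (2 powr r) *
      ((ennreal (2 powr (\<sigma> * real m)) * omod p f (1 / 2^m)) powe r + (ennreal (2 powr (\<sigma> * real m)) * omod p g (1 / 2^m)) powe r)"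
      by (rule order_trans[OF powe_mono powe_add_le2])
         (use r in \<open>auto simp flip: distrib_left intro!: mult_left_mono omod_add p\<close>)
  qed
  also have "\<dots> = ennreal (2 powr r) * (bes p \<sigma> r f + bes p \<sigma> r g)"
    by (simp add: bes_def ennreal_suminf_add)
  finally have 1: "bes p \<sigma> r (\<lambda>x. f x + g x) \<le> ennreal (2 powr r) * (bes p \<sigma> r f + bes p \<sigma> r g)" .
  have "pint p (\<lambda>x. f x + g x) powe r \<le> ennreal (2 powr r) * (pint p f powe r + pint p g powe r)"
    by (rule order_trans[OF powe_mono powe_add_le2]) (use r in \<open>auto intro!: pint_add p\<close>)
  then have "rho p \<sigma> r (\<lambda>x. f x + g x) \<le> ennreal (2 powr r) * (pint p f powe r + pint p g powe r)
      + ennreal (2 powr r) * (bes p \<sigma> r f + bes p \<sigma> r g)"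
    unfolding rho_def by (intro add_mono 1)
  then show ?thesis by (simp add: rho_def distrib_left ac_simps)
qed

lemma rho_uminus: "rho p \<sigma> r (\<lambda>x. - f x) = rho p \<sigma> r f"
  by (simp add: rho_def bes_def pint_uminus omod_uminus)

lemma rho_diff:
  assumes p: "0 < p" "p \<le> 1" and r: "0 < r" and "f \<in> borel_measurable borel" "g \<in> borel_measurable borel"
  shows "rho p \<sigma> r (\<lambda>x. f x - g x) \<le> ennreal (2 powr r) * (rho p \<sigma> r f + rho p \<sigma> r g)"
  using rho_add[OF assms(1-4), of "\<lambda>x. - g x"] assms(5) by (simp add: rho_uminus)

lemma rho_zero [simp]: "rho p \<sigma> r (\<lambda>x. 0) = 0"
  by (simp add: rho_def bes_def)

lemma rho_le_apx:
  assumes p: "0 < p" "p \<le> 1" and \<sigma>: "\<sigma> < 1" and r: "0 < r"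
  shows "\<exists>C\<ge>0. \<forall>f V. step_seq V \<longrightarrow> f \<in> borel_measurable borel \<longrightarrow>
    rho p \<sigma> r (f :: real^'n \<Rightarrow> real) \<le> pint p f powe r + ennreal C * apx p \<sigma> r f V"
  using synthesis[OF assms] unfolding rho_def by (meson add_left_mono)

text \<open>Below level k the approximant 0 is used, at the cost of one geometric head. Thus a
  sequence of approximants has to be constructed only from level k on.\<close>

lemma apx_truncated:
  fixes f :: "real^'n \<Rightarrow> real"
  assumes "0 < \<sigma>" "0 < r"
  shows "apx p \<sigma> r f (\<lambda>j. if j < k then (\<lambda>x. 0) else V j)
    \<le> ennreal (2 / (1 - 2 powr - (\<sigma> * r))) * (ennreal (2 powr (\<sigma> * real k)) * pint p f) powe r
      + (\<Sum>j. (ennreal (2 powr (\<sigma> * real (j + k))) * pint p (\<lambda>x. f x - V (j + k) x)) powe r)"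
proof -
  have "apx p \<sigma> r f (\<lambda>j. if j < k then (\<lambda>x. 0) else V j)
     = (\<Sum>j. (ennreal (2 powr (\<sigma> * real (j + k))) * pint p (\<lambda>x. f x - V (j + k) x)) powe r)
       + (\<Sum>j<k. (ennreal (2 powr (\<sigma> * real j)) * pint p f) powe r)"
    unfolding apx_def by (subst ennreal_suminf_split[of _ k]) simp
  also have "\<dots> \<le> (\<Sum>j. (ennreal (2 powr (\<sigma> * real (j + k))) * pint p (\<lambda>x. f x - V (j + k) x)) powe r)
     + ennreal (2 / (1 - 2 powr - (\<sigma> * r))) * (ennreal (2 powr (\<sigma> * real k)) * pint p f) powe r"
    by (intro add_left_mono geometric_head_le assms)
  finally show ?thesis by (simp add: add.commute)
qed

lemma pint_powe_le_weighted:
  assumes "0 < \<sigma>" "0 < r"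
  shows "pint p f powe r \<le> (ennreal (2 powr (\<sigma> * real k)) * pint p f) powe r"
proof (rule powe_mono)
  have "1 * pint p f \<le> ennreal (2 powr (\<sigma> * real k)) * pint p f"
    using assms by (intro mult_right_mono) (auto simp: ge_one_powr_ge_zero simp flip: ennreal_1)
  then show "pint p f \<le> ennreal (2 powr (\<sigma> * real k)) * pint p f" by simp
qed (use assms in auto)

text \<open>With approximants 0 below level k and g itself from there on, all errors from level k
  vanish and only the head in \<open>apx_truncated\<close> is left.\<close>

lemma rho_pconst:
  assumes p: "0 < p" "p \<le> 1" and \<sigma>: "0 < \<sigma>" "\<sigma> < 1" and r: "0 < r"
  shows "\<exists>C\<ge>0. \<forall>k g. pconst k g \<longrightarrow> g \<in> borel_measurable borel \<longrightarrow>
    rho p \<sigma> r (g :: real^'n \<Rightarrow> real) \<le> ennreal C * (ennreal (2 powr (\<sigma> * real k)) * pint p g) powe r"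
proof -
  obtain C where C: "C \<ge> 0" "\<And>f V. step_seq V \<Longrightarrow> f \<in> borel_measurable borel \<Longrightarrow>
    rho p \<sigma> r (f :: real^'n \<Rightarrow> real) \<le> pint p f powe r + ennreal C * apx p \<sigma> r f V"
    using rho_le_apx[OF p \<sigma>(2) r] by metis
  define G where "G = 2 / (1 - 2 powr - (\<sigma> * r))"
  have "2 powr - (\<sigma> * r) < 1" using \<sigma> r by (simp add: powr_less_one)
  then have G0: "0 \<le> G" by (simp add: G_def)
  have "rho p \<sigma> r g \<le> ennreal (1 + C * G) * (ennreal (2 powr (\<sigma> * real k)) * pint p g) powe r"
    if g: "pconst k g" "g \<in> borel_measurable borel" for k and g :: "real^'n \<Rightarrow> real"
  proof -
    define V where "V j = (if j < k then (\<lambda>x. 0) else g)" for j :: nat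
    have V: "step_seq V" using g pconst_mono[OF g(1)] by (simp add: step_seq_def V_def)
    define X where "X = (ennreal (2 powr (\<sigma> * real k)) * pint p g) powe r"
    have "apx p \<sigma> r g V \<le> ennreal G * X"
      unfolding V_def X_def G_def by (rule order_trans[OF apx_truncated[OF \<sigma>(1) r]]) simp
    then have "rho p \<sigma> r g \<le> X + ennreal C * (ennreal G * X)"
      using pint_powe_le_weighted[OF \<sigma>(1) r, of p g k] unfolding X_def
      by (intro order_trans[OF C(2)[OF V g(2)]] add_mono mult_left_mono) auto
    also have "\<dots> = ennreal (1 + C * G) * X"
      using C(1) G0 by (simp add: distrib_right ennreal_mult mult.assoc)
    finally show ?thesis by (simp add: X_def)
  qed
  then show ?thesis using C(1) G0 by (intro exI[of _ "1 + C * G"]) auto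
qed

lemma step_approximation_converges:
  fixes f :: "real^'n \<Rightarrow> real"
  assumes p: "0 < p" "p \<le> 1" and \<sigma>: "0 < \<sigma>" "\<sigma> < 1" and r: "0 < r"
    and V: "step_seq V" and [measurable]: "f \<in> borel_measurable borel" and fin: "apx p \<sigma> r f V < top"
  shows "(\<lambda>k. rho p \<sigma> r (\<lambda>x. f x - V k x)) \<longlonglongrightarrow> 0"
proof -
  note [measurable] = step_seqD(2)[OF V]
  obtain C where C: "C \<ge> 0" "\<And>f V. step_seq V \<Longrightarrow> f \<in> borel_measurable borel \<Longrightarrow>
    rho p \<sigma> r (f :: real^'n \<Rightarrow> real) \<le> pint p f powe r + ennreal C * apx p \<sigma> r f V"
    using rho_le_apx[OF p \<sigma>(2) r] by metis
  define G where "G = 2 / (1 - 2 powr - (\<sigma> * r))"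
  define x where "x j = (ennreal (2 powr (\<sigma> * real j)) * pint p (\<lambda>x. f x - V j x)) powe r" for j
  have le: "rho p \<sigma> r (\<lambda>x. f x - V k x) \<le> x k + ennreal C * (ennreal G * x k + (\<Sum>j. x (j + k)))" for k
  proof -
    \<comment> \<open>f - V k is approximated by 0 below level k and by V j - V k afterwards. The
      later errors are those of f, so only the k-th term and the tail of a convergent series
      remain.\<close>
    define W where "W j = (if j < k then (\<lambda>x. 0) else (\<lambda>x. V j x - V k x))" for j :: nat
    have W: "step_seq W"
      unfolding step_seq_def W_def
    proof (intro allI conjI)
      fix j
      show "pconst j (if j < k then (\<lambda>x. 0) else (\<lambda>x. V j x - V k x))"
        using pconst_diff[OF step_seqD(1)[OF V, of j] pconst_mono[OF step_seqD(1)[OF V, of k], of j]] by simp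
      show "(if j < k then (\<lambda>x. 0) else (\<lambda>x. V j x - V k x)) \<in> borel_measurable borel"
        by simp
    qed
    have "apx p \<sigma> r (\<lambda>x. f x - V k x) W \<le> ennreal G * x k + (\<Sum>j. x (j + k))"
    proof -
      have "(\<lambda>x. f x - V k x - (V (j + k) x - V k x)) = (\<lambda>x. f x - V (j + k) x)" for j
        by (simp add: fun_eq_iff)
      then show ?thesis
        using apx_truncated[OF \<sigma>(1) r, of p "\<lambda>x. f x - V k x" k "\<lambda>j x. V j x - V k x"]
        unfolding W_def G_def x_def by (simp only:)
    qed
    then show ?thesis
      using pint_powe_le_weighted[OF \<sigma>(1) r, of p "\<lambda>x. f x - V k x" k]
      by (intro order_trans[OF C(2)[OF W]] add_mono mult_left_mono) (auto simp: x_def)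
  qed
  have fin': "(\<Sum>j. x j) < top" using fin by (simp add: apx_def x_def)
  have "(\<lambda>k. x k + ennreal C * (ennreal G * x k + (\<Sum>j. x (j + k)))) \<longlonglongrightarrow> 0 + ennreal C * (ennreal G * 0 + 0)"
    using ennreal_suminf_terms_to_0[OF fin'] ennreal_suminf_tail[OF fin']
    by (intro tendsto_add ennreal_tendsto_cmult) auto
  then have "(\<lambda>k. x k + ennreal C * (ennreal G * x k + (\<Sum>j. x (j + k)))) \<longlonglongrightarrow> 0" by simp
  then show ?thesis
    by (rule ennreal_LIMSEQ_0_le) (rule le)
qed

text \<open>Approximants multiplied by the indicator are step functions of their own level only from
  level l on; below l the approximant 0 is taken, so the constant depends on l. This allows an
  expansion to be restricted to a cell.\<close>

lemma rho_indicator_cell: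
  fixes i :: "'n::finite \<Rightarrow> nat"
  assumes p: "0 < p" "p \<le> 1" and \<sigma>: "0 < \<sigma>" "\<sigma> < 1" and r: "0 < r"
  shows "\<exists>C\<ge>0. \<forall>f\<in>borel_measurable borel. rho p \<sigma> r (\<lambda>x. indicator (cell l i) x * f x) \<le> ennreal C * rho p \<sigma> r f"
proof -
  obtain C where C: "C \<ge> 0" "\<And>f V. step_seq V \<Longrightarrow> f \<in> borel_measurable borel \<Longrightarrow>
    rho p \<sigma> r (f :: real^'n \<Rightarrow> real) \<le> pint p f powe r + ennreal C * apx p \<sigma> r f V"
    using rho_le_apx[OF p \<sigma>(2) r] by metis
  obtain A where A: "A \<ge> 0" "\<And>f :: real^'n \<Rightarrow> real. f \<in> borel_measurable borel \<Longrightarrow> \<exists>V. step_seq V \<and> apx p \<sigma> r f V \<le> ennreal A * rho p \<sigma> r f"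
    using analysis[OF p \<sigma>(1) r] by metis
  define G where "G = 2 / (1 - 2 powr - (\<sigma> * r))"
  have "2 powr - (\<sigma> * r) < 1" using \<sigma> r by (simp add: powr_less_one)
  then have G0: "0 \<le> G" by (simp add: G_def)
  define L where "L = (2 powr (\<sigma> * real l)) powr r"
  have L0: "0 \<le> L" by (simp add: L_def)
  have "rho p \<sigma> r (\<lambda>x. indicator (cell l i) x * f x) \<le> ennreal (1 + C * (G * L + A)) * rho p \<sigma> r f"
    if f [measurable]: "f \<in> borel_measurable borel" for f :: "real^'n \<Rightarrow> real"
  proof -
    obtain V where V: "step_seq V" "apx p \<sigma> r f V \<le> ennreal A * rho p \<sigma> r f" using A(2)[OF f] by blast
    note [measurable] = step_seqD(2)[OF V(1)]
    define g where "g x = indicator (cell l i) x * f x" for x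
    have [measurable]: "g \<in> borel_measurable borel" unfolding g_def by measurable
    define W where "W j = (if j < l then (\<lambda>x. 0) else (\<lambda>x. indicator (cell l i) x * V j x))" for j
    have W: "step_seq W"
      unfolding step_seq_def W_def
    proof (intro allI conjI)
      fix j
      show "pconst j (if j < l then \<lambda>x. 0 else (\<lambda>x. indicator (cell l i) x * V j x))"
        using pconst_comp2[of j "indicator (cell l i)" "V j" "(*)"] pconst_indicator_cell[of l j i, where 'b = real] step_seqD(1)[OF V(1), of j]
        by (simp add: not_less)
      show "(if j < l then \<lambda>x. 0 else (\<lambda>x. indicator (cell l i) x * V j x)) \<in> borel_measurable borel"
        by simp
    qed
    have gf: "pint p g \<le> pint p f"
      using p by (intro pint_mono) (auto simp: g_def indicator_def)
    have rf: "pint p f powe r \<le> rho p \<sigma> r f" by (simp add: rho_def)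
    have "apx p \<sigma> r g W \<le> ennreal G * (ennreal (2 powr (\<sigma> * real l)) * pint p g) powe r
      + (\<Sum>j. (ennreal (2 powr (\<sigma> * real (j + l))) * pint p (\<lambda>x. g x - indicator (cell l i) x * V (j + l) x)) powe r)"
      unfolding W_def G_def by (rule apx_truncated[OF \<sigma>(1) r])
    also have "\<dots> \<le> ennreal G * (ennreal (2 powr (\<sigma> * real l)) * pint p f) powe r
      + (\<Sum>j. (ennreal (2 powr (\<sigma> * real (j + l))) * pint p (\<lambda>x. f x - V (j + l) x)) powe r)"
      using p r by (intro add_mono mult_left_mono powe_mono ennreal_suminf_le gf pint_mono)
         (auto simp: g_def indicator_def)
    also have "\<dots> \<le> ennreal G * (ennreal (2 powr (\<sigma> * real l)) * pint p f) powe r + apx p \<sigma> r f V"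
      unfolding apx_def
      by (intro add_left_mono ennreal_suminf_shift_le[of "\<lambda>j. (ennreal (2 powr (\<sigma> * real j)) * pint p (\<lambda>x. f x - V j x)) powe r"])
    also have "\<dots> \<le> ennreal (G * L) * rho p \<sigma> r f + ennreal A * rho p \<sigma> r f"
    proof (intro add_mono V)
      have "ennreal G * (ennreal (2 powr (\<sigma> * real l)) * pint p f) powe r = ennreal (G * L) * pint p f powe r"
        using G0 by (simp add: powe_mult L_def ennreal_mult mult.assoc)
      also have "\<dots> \<le> ennreal (G * L) * rho p \<sigma> r f" by (intro mult_left_mono rf) auto
      finally show "ennreal G * (ennreal (2 powr (\<sigma> * real l)) * pint p f) powe r \<le> ennreal (G * L) * rho p \<sigma> r f" .
    qed
    also have "\<dots> = ennreal (G * L + A) * rho p \<sigma> r f"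
      using G0 A(1) L0 by (simp add: distrib_right)
    finally have "rho p \<sigma> r g \<le> rho p \<sigma> r f + ennreal C * (ennreal (G * L + A) * rho p \<sigma> r f)"
      using r by (intro order_trans[OF C(2)[OF W]] add_mono mult_left_mono order_trans[OF powe_mono[OF gf] rf]) auto
    also have "\<dots> = ennreal (1 + C * (G * L + A)) * rho p \<sigma> r f"
      using C(1) G0 A(1) L0 by (simp add: distrib_right ennreal_mult mult.assoc)
    finally show ?thesis unfolding g_def[abs_def] .
  qed
  then show ?thesis using C(1) G0 A(1) L0 by (intro exI[of _ "1 + C * (G * L + A)"]) auto
qed

section \<open>Embedding into the integrable functions and convergence of averages\<close>

text \<open>Subadditivity of the p-th power, applied to the values on the cells. The cell volume
  2^(-j d) enters to the power p on the left and to the power 1 on the right; the quotient has the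
  exponent d (1 - p), which is the origin of \<delta>.\<close>

lemma pint1_pconst:
  fixes g :: "real^'n \<Rightarrow> real"
  assumes p: "0 < p" "p \<le> 1" and g: "pconst j g" "g \<in> borel_measurable borel"
  shows "pint 1 g powe p \<le> ennreal (2 powr (cdim TYPE('n) * (1 - p) * real j)) * pint p g"
proof -
  have "pint 1 g powe p = (\<Sum>i\<in>Idx j. ennreal \<bar>g (corner j i)\<bar>) powe p * ennreal (2 powr (- real j * cdim TYPE('n) * p))"
    unfolding pint_pconst[OF g] powe_mult by (simp add: powr_powr del: sum_ennreal)
  also have "\<dots> \<le> (\<Sum>i\<in>Idx j. ennreal (\<bar>g (corner j i)\<bar> powr p)) * ennreal (2 powr (- real j * cdim TYPE('n) * p))"
    using powe_sum_le[of "Idx j" p "\<lambda>i. ennreal \<bar>g (corner j i)\<bar>"] p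
    by (intro mult_right_mono) (auto simp del: sum_ennreal)
  also have "ennreal (2 powr (- real j * cdim TYPE('n) * p))
      = ennreal (2 powr (cdim TYPE('n) * (1 - p) * real j)) * ennreal (2 powr (- real j * cdim TYPE('n)))"
    by (simp add: algebra_simps flip: ennreal_mult powr_add)
  finally show ?thesis unfolding pint_pconst[OF g] by (simp only: mult_ac)
qed

lemma pint1_pconst':
  fixes g :: "real^'n \<Rightarrow> real"
  assumes p: "0 < p" "p \<le> 1" and g: "pconst j g" "g \<in> borel_measurable borel"
  shows "pint 1 g \<le> (ennreal (2 powr (cdim TYPE('n) * (1 - p) * real j)) * pint p g) powe (1 / p)"
  using powe_mono[OF pint1_pconst[OF assms], of "1/p"] p by simp

text \<open>The sum over j of the p-th powers of the errors has a finite integral, so it converges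
  almost everywhere and its terms tend to 0, without passing to a subsequence.\<close>

lemma step_seq_tendsto:
  fixes f :: "real^'n \<Rightarrow> real"
  assumes p: "0 < p" and V: "step_seq V" and [measurable]: "f \<in> borel_measurable borel"
    and fin: "(\<Sum>j. pint p (\<lambda>x. f x - V j x)) < top"
  shows "AE x in lborel. x \<in> hcube \<longrightarrow> (\<lambda>j. V j x) \<longlonglongrightarrow> f x"
proof -
  note [measurable] = step_seqD(2)[OF V]
  have "(\<integral>\<^sup>+x. (\<Sum>j. ennreal (\<bar>f x - V j x\<bar> powr p) * indicator hcube x) \<partial>lborel) = (\<Sum>j. pint p (\<lambda>x. f x - V j x))"
    unfolding pint_def by (rule nn_integral_suminf) auto
  with fin have "(\<integral>\<^sup>+x. (\<Sum>j. ennreal (\<bar>f x - V j x\<bar> powr p) * indicator hcube x) \<partial>lborel) \<noteq> \<infinity>" by auto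
  then have "AE x in lborel. (\<Sum>j. ennreal (\<bar>f x - V j x\<bar> powr p) * indicator hcube x) \<noteq> \<infinity>"
    by (intro nn_integral_noteq_infinite) auto
  then show ?thesis
  proof eventually_elim
    case (elim x)
    show ?case
    proof
      assume "x \<in> hcube"
      with elim have "(\<Sum>j. ennreal \<bar>f x - V j x\<bar> powe p) < top" by (simp add: less_top)
      from powe_LIMSEQ_0[OF ennreal_suminf_terms_to_0[OF this], of "1/p"] p
      have "(\<lambda>j. ennreal \<bar>f x - V j x\<bar>) \<longlonglongrightarrow> 0" by (simp add: powr_powr)
      then have "(\<lambda>j. \<bar>f x - V j x\<bar>) \<longlonglongrightarrow> 0" by (subst (asm) ennreal_tendsto_0_iff) auto
      then have "(\<lambda>j. f x - V j x) \<longlonglongrightarrow> 0" by (rule tendsto_rabs_zero_cancel)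
      then have "(\<lambda>j. f x - (f x - V j x)) \<longlonglongrightarrow> f x - 0" by (intro tendsto_intros)
      then show "(\<lambda>j. V j x) \<longlonglongrightarrow> f x" by simp
    qed
  qed
qed

lemma telescoping_limit_le:
  fixes v :: "nat \<Rightarrow> real"
  assumes "v \<longlonglongrightarrow> a"
  shows "ennreal \<bar>a - v k\<bar> \<le> (\<Sum>j. ennreal \<bar>v (Suc (j + k)) - v (j + k)\<bar>)"
proof -
  have "ennreal \<bar>v (n + k) - v k\<bar> \<le> (\<Sum>j. ennreal \<bar>v (Suc (j + k)) - v (j + k)\<bar>)" for n
  proof -
    have "v (n + k) - v k = (\<Sum>j<n. v (Suc (j + k)) - v (j + k))"
      by (induction n) auto
    then have "\<bar>v (n + k) - v k\<bar> \<le> (\<Sum>j<n. \<bar>v (Suc (j + k)) - v (j + k)\<bar>)" by simp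
    then have "ennreal \<bar>v (n + k) - v k\<bar> \<le> (\<Sum>j<n. ennreal \<bar>v (Suc (j + k)) - v (j + k)\<bar>)"
      by (simp add: ennreal_leI)
    also have "\<dots> \<le> (\<Sum>j. ennreal \<bar>v (Suc (j + k)) - v (j + k)\<bar>)" by (rule sum_le_suminf) auto
    finally show ?thesis .
  qed
  moreover have "(\<lambda>n. ennreal \<bar>v (n + k) - v k\<bar>) \<longlonglongrightarrow> ennreal \<bar>a - v k\<bar>"
    using LIMSEQ_ignore_initial_segment[OF assms, of k] by (intro tendsto_intros)
  ultimately show ?thesis by (intro LIMSEQ_le_const2[of "\<lambda>n. ennreal \<bar>v (n + k) - v k\<bar>"]) blast+
qed

text \<open>Integrability of f is not yet known, so the L_1 distance to V k is bounded through the
  almost everywhere limit of the telescoping increments.\<close>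

lemma step_seq_integral_le:
  fixes f :: "real^'n \<Rightarrow> real"
  assumes p: "0 < p" and V: "step_seq V" and [measurable]: "f \<in> borel_measurable borel" "A \<in> sets borel"
    and fin: "(\<Sum>j. pint p (\<lambda>x. f x - V j x)) < top" and A: "A \<subseteq> hcube"
  shows "(\<integral>\<^sup>+x\<in>A. ennreal \<bar>f x - V k x\<bar> \<partial>lborel)
    \<le> (\<Sum>j. \<integral>\<^sup>+x\<in>A. ennreal \<bar>V (Suc (j + k)) x - V (j + k) x\<bar> \<partial>lborel)"
proof -
  note [measurable] = step_seqD(2)[OF V]
  have "(\<integral>\<^sup>+x\<in>A. ennreal \<bar>f x - V k x\<bar> \<partial>lborel)
      \<le> (\<integral>\<^sup>+x. (\<Sum>j. ennreal \<bar>V (Suc (j + k)) x - V (j + k) x\<bar> * indicator A x) \<partial>lborel)"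
    using step_seq_tendsto[OF p V assms(3) fin]
  proof (intro nn_integral_mono_AE, eventually_elim)
    case (elim x)
    then show ?case
      using telescoping_limit_le[of "\<lambda>j. V j x" "f x" k] A by (cases "x \<in> A") auto
  qed
  also have "\<dots> = (\<Sum>j. \<integral>\<^sup>+x\<in>A. ennreal \<bar>V (Suc (j + k)) x - V (j + k) x\<bar> \<partial>lborel)"
    by (rule nn_integral_suminf) auto
  finally show ?thesis .
qed

lemma apx_summable:
  assumes "0 < \<sigma>" "0 < r" "apx p \<sigma> r f V < top"
  shows "(\<Sum>j. pint p (\<lambda>x. f x - V j x)) < top"
proof -
  obtain C where C: "\<And>z :: nat \<Rightarrow> ennreal.
    (\<Sum>j. ennreal (2 powr (- \<sigma> * real j)) * z j) \<le> ennreal C * (\<Sum>j. z j powe r) powe (1 / r)"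
    using weighted_sum_le[of r \<sigma>] assms by auto
  have "pint p (\<lambda>x. f x - V j x) = ennreal (2 powr (- \<sigma> * real j)) * (ennreal (2 powr (\<sigma> * real j)) * pint p (\<lambda>x. f x - V j x))" for j
    by (simp add: mult.assoc[symmetric] flip: ennreal_mult powr_add)
  then have "(\<Sum>j. pint p (\<lambda>x. f x - V j x)) \<le> ennreal C * apx p \<sigma> r f V powe (1 / r)"
    unfolding apx_def using C[of "\<lambda>j. ennreal (2 powr (\<sigma> * real j)) * pint p (\<lambda>x. f x - V j x)"] by simp
  also have "\<dots> < top" using assms by (simp add: ennreal_mult_less_top)
  finally show ?thesis .
qed

text \<open>An increment is a difference of two consecutive errors, and since \<sigma> > 0 the
  weight of level j is at most that of the next level.\<close>

lemma apx_differences: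
  assumes p: "0 < p" "p \<le> 1" and \<sigma>: "0 < \<sigma>" and r: "0 < r"
    and V: "step_seq V" and [measurable]: "f \<in> borel_measurable borel"
  shows "(\<Sum>j. (ennreal (2 powr (\<sigma> * real j)) * pint p (\<lambda>x. V (Suc j) x - V j x)) powe r)
    \<le> ennreal (2 powr r * 2) * apx p \<sigma> r f V"
proof -
  note [measurable] = step_seqD(2)[OF V]
  define X where "X j = ennreal (2 powr (\<sigma> * real j)) * pint p (\<lambda>x. f x - V j x)" for j
  have "(ennreal (2 powr (\<sigma> * real j)) * pint p (\<lambda>x. V (Suc j) x - V j x)) powe r
      \<le> ennreal (2 powr r) * (X j powe r + X (Suc j) powe r)" for j
  proof -
    have "ennreal (2 powr (\<sigma> * real j)) * pint p (\<lambda>x. V (Suc j) x - V j x)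
        \<le> ennreal (2 powr (\<sigma> * real j)) * (pint p (\<lambda>x. f x - V (Suc j) x) + pint p (\<lambda>x. f x - V j x))"
      by (intro mult_left_mono pint_diff_triangle p) auto
    also have "\<dots> = ennreal (2 powr (\<sigma> * real j)) * pint p (\<lambda>x. f x - V (Suc j) x) + X j"
      by (simp add: X_def distrib_left)
    also have "\<dots> \<le> X (Suc j) + X j"
      unfolding X_def using \<sigma>
      by (intro add_mono mult_right_mono ennreal_leI powr_mono mult_left_mono order_refl) auto
    finally have "(ennreal (2 powr (\<sigma> * real j)) * pint p (\<lambda>x. V (Suc j) x - V j x)) powe r \<le> (X (Suc j) + X j) powe r"
      using r by (intro powe_mono) auto
    also have "\<dots> \<le> ennreal (2 powr r) * (X (Suc j) powe r + X j powe r)" by (rule powe_add_le2[OF r])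
    finally show ?thesis by (simp add: add.commute)
  qed
  then have "(\<Sum>j. (ennreal (2 powr (\<sigma> * real j)) * pint p (\<lambda>x. V (Suc j) x - V j x)) powe r)
      \<le> ennreal (2 powr r) * ((\<Sum>j. X j powe r) + (\<Sum>j. X (Suc j) powe r))"
    unfolding ennreal_suminf_add[symmetric] ennreal_suminf_cmult[symmetric] by (rule ennreal_suminf_le)
  also have "\<dots> \<le> ennreal (2 powr r) * ((\<Sum>j. X j powe r) + (\<Sum>j. X j powe r))"
    using ennreal_suminf_shift_le[of "\<lambda>j. X j powe r" 1] by (intro mult_left_mono add_left_mono) auto
  also have "\<dots> = ennreal (2 powr r * 2) * apx p \<sigma> r f V"
    by (simp add: apx_def X_def ennreal_mult mult.assoc mult_2[symmetric])
  finally show ?thesis .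
qed

lemma apx_term_le:
  assumes "0 < r"
  shows "ennreal (2 powr (\<sigma> * real j)) * pint p (\<lambda>x. f x - V j x) \<le> apx p \<sigma> r f V powe (1 / r)"
  using powe_mono[OF ennreal_term_le_suminf[of "\<lambda>j. (ennreal (2 powr (\<sigma> * real j)) * pint p (\<lambda>x. f x - V j x)) powe r" j], of "1 / r"] assms
  by (simp add: apx_def)

text \<open>The increments of the approximants have L_1 norm at most (2^(\<delta> (j + 1))
  \<open>pint\<close>)^(1/p). This leaves the weights 2^(-(\<sigma> - \<delta>) j / p) and the
  summation exponent p r = q. On the critical line the condition is therefore q \<le> 1, weaker than
  the condition q \<le> p for convergence of averages.\<close>

lemma L1_embedding:
  assumes p: "0 < p" "p \<le> 1" and \<sigma>: "0 < \<sigma>" and r: "0 < r"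
    and crit: "cdim TYPE('n) * (1 - p) < \<sigma> \<or> (\<sigma> = cdim TYPE('n) * (1 - p) \<and> p * r \<le> 1)"
  shows "\<exists>C\<ge>0. \<forall>f\<in>borel_measurable borel. rho p \<sigma> r (f :: real^'n \<Rightarrow> real) < top \<longrightarrow>
    pint 1 f \<le> ennreal C * rho p \<sigma> r f powe (1 / (p * r))"
proof -
  define \<delta> where "\<delta> = cdim TYPE('n) * (1 - p)"
  obtain A where A: "A \<ge> 0" "\<And>f :: real^'n \<Rightarrow> real. f \<in> borel_measurable borel \<Longrightarrow> \<exists>V. step_seq V \<and> apx p \<sigma> r f V \<le> ennreal A * rho p \<sigma> r f"
    using analysis[OF p \<sigma> r] by metis
  have "0 < (\<sigma> - \<delta>) / p \<or> ((\<sigma> - \<delta>) / p = 0 \<and> p * r \<le> 1)" using crit p by (auto simp: \<delta>_def)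
  then obtain C where C: "C \<ge> 0" "\<And>z :: nat \<Rightarrow> ennreal.
    (\<Sum>j. ennreal (2 powr (- ((\<sigma> - \<delta>) / p) * real j)) * z j) \<le> ennreal C * (\<Sum>j. z j powe (p * r)) powe (1 / (p * r))"
    using weighted_sum_le[of "p * r" "(\<sigma> - \<delta>) / p"] p r by auto
  define B where "B = (2 powr r * 2) * A"
  define K where "K = (1 + A powr (1 / r)) powr (1 / p) + 2 powr (\<delta> / p) * C * B powr (1 / (p * r))"
  have B0: "0 \<le> B" using A(1) by (simp add: B_def)
  have K0: "0 \<le> K" using A(1) C(1) by (simp add: K_def)
  have "pint 1 f \<le> ennreal K * rho p \<sigma> r f powe (1 / (p * r))"
    if f [measurable]: "f \<in> borel_measurable borel" and fin: "rho p \<sigma> r f < top" for f :: "real^'n \<Rightarrow> real"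
  proof -
    obtain V where V: "step_seq V" "apx p \<sigma> r f V \<le> ennreal A * rho p \<sigma> r f" using A(2)[OF f] by blast
    note [measurable] = step_seqD(2)[OF V(1)]
    define R where "R = rho p \<sigma> r f"
    have afin: "apx p \<sigma> r f V < top"
      using V(2) fin by (metis (no_types) ennreal_mult_less_top ennreal_less_top le_less_trans)
    define z where "z j = ennreal (2 powr (\<sigma> * real j)) * pint p (\<lambda>x. V (Suc j) x - V j x)" for j
    have z: "(\<Sum>j. z j powe r) \<le> ennreal B * R"
    proof -
      have "(\<Sum>j. z j powe r) \<le> ennreal (2 powr r * 2) * apx p \<sigma> r f V"
        unfolding z_def by (rule apx_differences[OF p \<sigma> r V(1) f])
      also have "\<dots> \<le> ennreal (2 powr r * 2) * (ennreal A * R)"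
        using V(2) by (intro mult_left_mono) (auto simp: R_def)
      also have "\<dots> = ennreal B * R" using A(1) by (simp add: B_def ennreal_mult mult.assoc)
      finally show ?thesis .
    qed
    have 1: "pint 1 (V 0) \<le> ennreal ((1 + A powr (1 / r)) powr (1 / p)) * R powe (1 / (p * r))"
    proof -
      define c where "c = 1 + A powr (1 / r)"
      have c0: "0 \<le> c" by (simp add: c_def)
      have "pint p f \<le> R powe (1 / r)"
        using powe_mono[of "pint p f powe r" R "1 / r"] r by (simp add: R_def rho_def)
      moreover have "pint p (\<lambda>x. f x - V 0 x) \<le> (ennreal A * R) powe (1 / r)"
        using apx_term_le[OF r, of \<sigma> 0 p f V] powe_mono[OF V(2), of "1 / r"] r by (simp add: R_def)
      moreover have "pint p (V 0) \<le> pint p f + pint p (\<lambda>x. f x - V 0 x)"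
        using pint_diff[OF p, of f "\<lambda>x. f x - V 0 x"] by simp
      ultimately have "pint p (V 0) \<le> R powe (1 / r) + (ennreal A * R) powe (1 / r)"
        by (meson add_mono order_trans)
      also have "\<dots> = ennreal c * R powe (1 / r)"
        using A(1) by (simp add: powe_mult c_def distrib_right)
      finally have "pint p (V 0) powe (1 / p) \<le> (ennreal c * R powe (1 / r)) powe (1 / p)"
        using p by (intro powe_mono) auto
      then have "pint p (V 0) powe (1 / p) \<le> ennreal (c powr (1 / p)) * R powe (1 / (p * r))"
        using c0 by (simp add: powe_mult mult.commute)
      moreover have "pint 1 (V 0) \<le> pint p (V 0) powe (1 / p)"
        using pint1_pconst'[OF p step_seqD[OF V(1), of 0]] by simp
      ultimately show ?thesis unfolding c_def by (rule order_trans[rotated])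
    qed
    have 2: "pint 1 (\<lambda>x. f x - V 0 x) \<le> ennreal (2 powr (\<delta> / p) * C * B powr (1 / (p * r))) * R powe (1 / (p * r))"
    proof -
      have "pint 1 (\<lambda>x. f x - V 0 x) \<le> (\<Sum>j. pint 1 (\<lambda>x. V (Suc j) x - V j x))"
        unfolding pint_def
        using step_seq_integral_le[OF p(1) V(1) f _ apx_summable[OF \<sigma> r afin], of hcube 0] by simp
      also have "\<dots> \<le> (\<Sum>j. ennreal (2 powr (\<delta> / p)) * (ennreal (2 powr (- ((\<sigma> - \<delta>) / p) * real j)) * z j powe (1 / p)))"
      proof (rule ennreal_suminf_le)
        fix j
        have "pint 1 (\<lambda>x. V (Suc j) x - V j x) \<le> (ennreal (2 powr (\<delta> * real (Suc j))) * pint p (\<lambda>x. V (Suc j) x - V j x)) powe (1 / p)"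
          unfolding \<delta>_def
          by (intro pint1_pconst' p pconst_diff step_seqD(1)[OF V(1)] pconst_mono[OF step_seqD(1)[OF V(1), of j]]) auto
        also have "ennreal (2 powr (\<delta> * real (Suc j))) * pint p (\<lambda>x. V (Suc j) x - V j x)
            = ennreal (2 powr \<delta>) * (ennreal (2 powr (- (\<sigma> - \<delta>) * real j)) * z j)"
          unfolding z_def mult.assoc[symmetric]
          by (simp add: algebra_simps flip: ennreal_mult powr_add)
        also have "\<dots> powe (1 / p) = ennreal (2 powr (\<delta> / p)) * (ennreal (2 powr (- ((\<sigma> - \<delta>) / p) * real j)) * z j powe (1 / p))"
          by (simp add: powe_mult powr_powr minus_divide_left)
        finally show "pint 1 (\<lambda>x. V (Suc j) x - V j x) \<le> \<dots>" .
      qed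
      also have "\<dots> \<le> ennreal (2 powr (\<delta> / p)) * (ennreal C * (\<Sum>j. (z j powe (1 / p)) powe (p * r)) powe (1 / (p * r)))"
        unfolding ennreal_suminf_cmult by (intro mult_left_mono C) auto
      also have "(\<Sum>j. (z j powe (1 / p)) powe (p * r)) = (\<Sum>j. z j powe r)" using p by simp
      also have "(\<Sum>j. z j powe r) powe (1 / (p * r)) \<le> (ennreal B * R) powe (1 / (p * r))"
        using p r by (intro powe_mono z) auto
      also have "ennreal (2 powr (\<delta> / p)) * (ennreal C * (ennreal B * R) powe (1 / (p * r)))
          = ennreal (2 powr (\<delta> / p) * C * B powr (1 / (p * r))) * R powe (1 / (p * r))"
        using B0 C(1) by (simp add: powe_mult ennreal_mult mult.assoc)
      finally show ?thesis by (simp add: mult_left_mono)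
    qed
    have "pint 1 f \<le> pint 1 (V 0) + pint 1 (\<lambda>x. f x - V 0 x)"
      using pint_add[of 1 "V 0" "\<lambda>x. f x - V 0 x"] by simp
    also have "\<dots> \<le> ennreal K * R powe (1 / (p * r))"
      using add_mono[OF 1 2] C(1) unfolding K_def by (simp add: distrib_right)
    finally show ?thesis by (simp add: R_def)
  qed
  then show ?thesis using K0 by (intro exI[of _ K]) auto
qed

section \<open>Cell averages and their convergence\<close>

definition avg :: "nat \<Rightarrow> (real^'n \<Rightarrow> real) \<Rightarrow> real^'n \<Rightarrow> real" where
  "avg k f x = (if x \<in> hcube then
    2 powr (real k * cdim TYPE('n)) * (\<integral>y. indicator (cell k (idx k x)) y * f y \<partial>lborel) else 0)"

lemma avg_borel [measurable]: "avg k (f :: real^'n::finite \<Rightarrow> real) \<in> borel_measurable borel"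
  unfolding avg_def[abs_def]
  by (rule borel_idx_fun[where v = "\<lambda>i. 2 powr (real k * cdim TYPE('n)) * (\<integral>y. indicator (cell k i) y * f y \<partial>lborel)"])

lemma avg_pconst: "pconst k (avg k f)"
  by (simp add: pconst_def avg_def)

lemma avg_corner:
  "i \<in> Idx k \<Longrightarrow> avg k f (corner k i :: real^'n::finite) = 2 powr (real k * cdim TYPE('n)) * (\<integral>y. indicator (cell k i) y * f y \<partial>lborel)"
  by (simp add: avg_def corner_in_hcube idx_corner)

lemma integrable_indicator_pint1:
  fixes f :: "real^'n \<Rightarrow> real"
  assumes [measurable]: "f \<in> borel_measurable borel" "A \<in> sets borel" and "pint 1 f < top" "A \<subseteq> hcube"
  shows "integrable lborel (\<lambda>x. indicator A x * f x)"
proof (rule integrableI_bounded)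
  have "(\<integral>\<^sup>+x. ennreal (norm (indicator A x * f x)) \<partial>lborel) \<le> pint 1 f"
    unfolding pint_def using assms(4)
    by (intro nn_integral_mono) (auto simp: indicator_def)
  then show "(\<integral>\<^sup>+x. ennreal (norm (indicator A x * f x)) \<partial>lborel) < \<infinity>" using assms(3) by (auto intro: le_less_trans)
qed simp

lemma avg_diff:
  fixes f g :: "real^'n \<Rightarrow> real"
  assumes "f \<in> borel_measurable borel" "g \<in> borel_measurable borel" "pint 1 f < top" "pint 1 g < top"
  shows "avg k (\<lambda>x. f x - g x) x = avg k f x - avg k g x"
  using integrable_indicator_pint1[OF assms(1) _ assms(3) cell_subset] integrable_indicator_pint1[OF assms(2) _ assms(4) cell_subset]
  by (simp add: avg_def right_diff_distrib)

lemma avg_id: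
  fixes g :: "real^'n \<Rightarrow> real"
  assumes "pconst k g" "x \<in> hcube"
  shows "avg k g x = g x"
proof -
  have "(\<integral>y. indicator (cell k (idx k x)) y * g y \<partial>lborel) = (\<integral>y. indicator (cell k (idx k x)) y * g x \<partial>lborel)"
    using assms by (intro Bochner_Integration.integral_cong refl) (auto simp: indicator_def cell_def intro: pconstD)
  also have "\<dots> = measure lborel (cell k (idx k x)) * g x" by simp
  also have "measure lborel (cell k (idx k x)) = 2 powr (- real k * cdim TYPE('n))"
    using emeasure_cell[OF idx_in_Idx[OF assms(2)], of k] by (simp add: measure_def)
  finally show ?thesis using assms(2) by (simp add: avg_def mult.assoc[symmetric] flip: powr_add)
qed

lemma pint1_pconst_finite:
  fixes g :: "real^'n \<Rightarrow> real"
  assumes "pconst k g" "g \<in> borel_measurable borel"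
  shows "pint p g < top"
  unfolding pint_pconst[OF assms] by (auto intro!: ennreal_mult_less_top[THEN iffD2] simp: less_top)

text \<open>The p-th power of a mean carries the normalisation 2^(k d p), the cell volume
  contributes 2^(-k d), and together they give 2^(-\<delta> k).\<close>

lemma pint_avg_le:
  fixes h :: "real^'n \<Rightarrow> real"
  assumes p: "0 < p" and [measurable]: "h \<in> borel_measurable borel" and fin: "pint 1 h < top"
  shows "pint p (avg k h) \<le> ennreal (2 powr (- (cdim TYPE('n) * (1 - p)) * real k)) *
    (\<Sum>i\<in>Idx k. (\<integral>\<^sup>+x\<in>cell k i. ennreal \<bar>h x\<bar> \<partial>lborel) powe p)"
proof -
  have le: "ennreal (\<bar>avg k h (corner k i)\<bar> powr p)
      \<le> ennreal (2 powr (real k * cdim TYPE('n) * p)) * (\<integral>\<^sup>+x\<in>cell k i. ennreal \<bar>h x\<bar> \<partial>lborel) powe p" if "i \<in> Idx k" for i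
  proof -
    have int: "integrable lborel (\<lambda>x. indicator (cell k i) x * h x)"
      by (rule integrable_indicator_pint1) (use fin cell_subset in auto)
    have "ennreal \<bar>\<integral>y. indicator (cell k i) y * h y \<partial>lborel\<bar> \<le> (\<integral>\<^sup>+x. ennreal (norm (indicator (cell k i) x * h x)) \<partial>lborel)"
      using integral_norm_bound_ennreal[OF int] by simp
    also have "\<dots> = (\<integral>\<^sup>+x\<in>cell k i. ennreal \<bar>h x\<bar> \<partial>lborel)"
      by (intro nn_integral_cong) (auto simp: indicator_def)
    finally have "ennreal \<bar>\<integral>y. indicator (cell k i) y * h y \<partial>lborel\<bar> powe p \<le> (\<integral>\<^sup>+x\<in>cell k i. ennreal \<bar>h x\<bar> \<partial>lborel) powe p"
      using p by (intro powe_mono) auto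
    then show ?thesis
      using that by (simp add: avg_corner abs_mult powr_mult powr_powr ennreal_mult mult_left_mono)
  qed
  have "pint p (avg k h) = (\<Sum>i\<in>Idx k. ennreal (\<bar>avg k h (corner k i)\<bar> powr p)) * ennreal (2 powr (- real k * cdim TYPE('n)))"
    by (rule pint_pconst[OF avg_pconst]) simp
  also have "\<dots> \<le> (\<Sum>i\<in>Idx k. ennreal (2 powr (real k * cdim TYPE('n) * p)) * (\<integral>\<^sup>+x\<in>cell k i. ennreal \<bar>h x\<bar> \<partial>lborel) powe p)
      * ennreal (2 powr (- real k * cdim TYPE('n)))"
    by (intro mult_right_mono sum_mono le) auto
  also have "\<dots> = (ennreal (2 powr (real k * cdim TYPE('n) * p)) * ennreal (2 powr (- real k * cdim TYPE('n)))) *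
      (\<Sum>i\<in>Idx k. (\<integral>\<^sup>+x\<in>cell k i. ennreal \<bar>h x\<bar> \<partial>lborel) powe p)"
    by (simp only: sum_distrib_left[symmetric] mult_ac)
  also have "ennreal (2 powr (real k * cdim TYPE('n) * p)) * ennreal (2 powr (- real k * cdim TYPE('n)))
      = ennreal (2 powr (- (cdim TYPE('n) * (1 - p)) * real k))"
    by (simp add: algebra_simps flip: ennreal_mult powr_add)
  finally show ?thesis .
qed

text \<open>Cutting g to a cell of the coarser level k leaves a step function of level j, so
  \<open>pint1_pconst\<close> holds on each such cell; the right-hand sides add up to the integral
  over the cube.\<close>

lemma cells_powe_le:
  fixes g :: "real^'n \<Rightarrow> real"
  assumes p: "0 < p" "p \<le> 1" and g: "pconst j g" and [measurable]: "g \<in> borel_measurable borel" and kj: "k \<le> j"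
  shows "(\<Sum>i\<in>Idx k. (\<integral>\<^sup>+x\<in>cell k i. ennreal \<bar>g x\<bar> \<partial>lborel) powe p)
    \<le> ennreal (2 powr (cdim TYPE('n) * (1 - p) * real j)) * pint p g"
proof -
  have "(\<integral>\<^sup>+x\<in>cell k i. ennreal \<bar>g x\<bar> \<partial>lborel) powe p
      \<le> ennreal (2 powr (cdim TYPE('n) * (1 - p) * real j)) * (\<integral>\<^sup>+x\<in>cell k i. ennreal (\<bar>g x\<bar> powr p) \<partial>lborel)" for i
  proof -
    have "pint 1 (\<lambda>x. indicator (cell k i) x * g x) powe p
        \<le> ennreal (2 powr (cdim TYPE('n) * (1 - p) * real j)) * pint p (\<lambda>x. indicator (cell k i) x * g x)"
      by (rule pint1_pconst[OF p]) (auto intro: pconst_comp2[where h = "(*)"] pconst_indicator_cell[OF kj] g)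
    moreover have "pint p' (\<lambda>x. indicator (cell k i) x * g x) = (\<integral>\<^sup>+x\<in>cell k i. ennreal (\<bar>g x\<bar> powr p') \<partial>lborel)" if "0 < p'" for p'
      unfolding pint_def using cell_subset[of k i] that by (intro nn_integral_cong) (auto simp: indicator_def)
    ultimately show ?thesis using p by simp
  qed
  then have "(\<Sum>i\<in>Idx k. (\<integral>\<^sup>+x\<in>cell k i. ennreal \<bar>g x\<bar> \<partial>lborel) powe p)
      \<le> (\<Sum>i\<in>Idx k. ennreal (2 powr (cdim TYPE('n) * (1 - p) * real j)) * (\<integral>\<^sup>+x\<in>cell k i. ennreal (\<bar>g x\<bar> powr p) \<partial>lborel))"
    by (intro sum_mono)
  also have "\<dots> = ennreal (2 powr (cdim TYPE('n) * (1 - p) * real j)) * pint p g"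
    unfolding pint_def by (subst nn_integral_hcube_cells[of _ k]) (auto simp: sum_distrib_left)
  finally show ?thesis .
qed

text \<open>Since averaging fixes V k, the error is the average of f - V k, which telescopes. The
  gain 2^(-\<delta> k) of averaging cancels against the loss 2^(\<delta> (j + k + 1)) of passing to
  L_1. Subadditivity is used on each cell before the cells are summed.\<close>

lemma avg_error_le:
  fixes f :: "real^'n \<Rightarrow> real"
  assumes p: "0 < p" "p \<le> 1" and V: "step_seq V" and [measurable]: "f \<in> borel_measurable borel"
    and fin: "(\<Sum>j. pint p (\<lambda>x. f x - V j x)) < top" and f1: "pint 1 f < top"
  shows "pint p (\<lambda>x. avg k f x - V k x)
    \<le> (\<Sum>j. ennreal (2 powr (cdim TYPE('n) * (1 - p) * real (Suc j))) * pint p (\<lambda>x. V (Suc (j + k)) x - V (j + k) x))"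
proof -
  note [measurable] = step_seqD(2)[OF V]
  define \<delta> where "\<delta> = cdim TYPE('n) * (1 - p)"
  define v where "v j x = V (Suc (j + k)) x - V (j + k) x" for j x
  have [measurable]: "v j \<in> borel_measurable borel" for j unfolding v_def by measurable
  have pv: "pconst (Suc (j + k)) (v j)" for j
    unfolding v_def by (intro pconst_diff step_seqD(1)[OF V] pconst_mono[OF step_seqD(1)[OF V, of "j + k"]]) simp
  have V1: "pint 1 (V k) < top" by (rule pint1_pconst_finite[OF step_seqD[OF V]])
  have fV1: "pint 1 (\<lambda>x. f x - V k x) < top"
    using pint_diff[of 1 f "V k"] f1 V1 by (auto intro: le_less_trans)
  have "pint p (\<lambda>x. avg k f x - V k x) = pint p (avg k (\<lambda>x. f x - V k x))"
    using f1 V1 by (intro pint_cong) (simp add: avg_diff avg_id step_seqD(1)[OF V])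
  also have "\<dots> \<le> ennreal (2 powr (- \<delta> * real k)) * (\<Sum>i\<in>Idx k. (\<integral>\<^sup>+x\<in>cell k i. ennreal \<bar>f x - V k x\<bar> \<partial>lborel) powe p)"
    unfolding \<delta>_def by (rule pint_avg_le) (use p fV1 in auto)
  also have "\<dots> \<le> ennreal (2 powr (- \<delta> * real k)) * (\<Sum>i\<in>Idx k. \<Sum>j. (\<integral>\<^sup>+x\<in>cell k i. ennreal \<bar>v j x\<bar> \<partial>lborel) powe p)"
  proof (intro mult_left_mono sum_mono)
    fix i
    have "(\<integral>\<^sup>+x\<in>cell k i. ennreal \<bar>f x - V k x\<bar> \<partial>lborel) powe p \<le> (\<Sum>j. \<integral>\<^sup>+x\<in>cell k i. ennreal \<bar>v j x\<bar> \<partial>lborel) powe p"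
      unfolding v_def using p cell_subset[of k i] by (intro powe_mono step_seq_integral_le[OF p(1) V _ _ fin]) auto
    also have "\<dots> \<le> (\<Sum>j. (\<integral>\<^sup>+x\<in>cell k i. ennreal \<bar>v j x\<bar> \<partial>lborel) powe p)"
      by (rule powe_suminf_le[OF p])
    finally show "(\<integral>\<^sup>+x\<in>cell k i. ennreal \<bar>f x - V k x\<bar> \<partial>lborel) powe p \<le> \<dots>" .
  qed auto
  also have "(\<Sum>i\<in>Idx k. \<Sum>j. (\<integral>\<^sup>+x\<in>cell k i. ennreal \<bar>v j x\<bar> \<partial>lborel) powe p)
      = (\<Sum>j. \<Sum>i\<in>Idx k. (\<integral>\<^sup>+x\<in>cell k i. ennreal \<bar>v j x\<bar> \<partial>lborel) powe p)"
    by (rule suminf_sum[symmetric]) simp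
  also have "\<dots> \<le> (\<Sum>j. ennreal (2 powr (\<delta> * real (Suc (j + k)))) * pint p (v j))"
    unfolding \<delta>_def by (intro ennreal_suminf_le cells_powe_le p pv) auto
  also have "ennreal (2 powr (- \<delta> * real k)) * \<dots> = (\<Sum>j. ennreal (2 powr (\<delta> * real (Suc j))) * pint p (v j))"
    unfolding ennreal_suminf_cmult[symmetric] mult.assoc[symmetric]
    by (simp add: algebra_simps flip: ennreal_mult powr_add)
  finally show ?thesis unfolding v_def[abs_def] \<delta>_def by (simp add: mult_left_mono)
qed

lemma ennreal_cmult_tendsto_0:
  fixes X :: "nat \<Rightarrow> ennreal"
  assumes "X \<longlonglongrightarrow> 0"
  shows "(\<lambda>k. ennreal c * X k) \<longlonglongrightarrow> 0"
  using ennreal_tendsto_cmult[OF _ assms, of "ennreal c"] by simp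

lemma ennreal_add_tendsto_0:
  fixes X Y :: "nat \<Rightarrow> ennreal"
  assumes "X \<longlonglongrightarrow> 0" "Y \<longlonglongrightarrow> 0"
  shows "(\<lambda>k. X k + Y k) \<longlonglongrightarrow> 0"
  using tendsto_add[OF assms] by simp

text \<open>Weighted by 2^(\<sigma> k), the distance of the averages from V k becomes a sum of
  2^(-(\<sigma> - \<delta>) j) z (j + k), bounded through the tail of a convergent series; at
  \<sigma> = \<delta> this takes r \<le> 1. The second conclusion is what the passage to incomplete
  levels requires.\<close>

lemma avg_converges:
  fixes f :: "real^'n \<Rightarrow> real"
  assumes p: "0 < p" "p \<le> 1" and \<sigma>: "0 < \<sigma>" "\<sigma> < 1" and r: "0 < r"
    and crit: "cdim TYPE('n) * (1 - p) < \<sigma> \<or> (\<sigma> = cdim TYPE('n) * (1 - p) \<and> r \<le> 1)"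
    and f [measurable]: "f \<in> borel_measurable borel" and fin: "rho p \<sigma> r f < top"
  shows "(\<lambda>k. rho p \<sigma> r (\<lambda>x. f x - avg k f x)) \<longlonglongrightarrow> 0"
    and "(\<lambda>k. ennreal (2 powr (\<sigma> * real k)) * pint p (\<lambda>x. avg (Suc k) f x - avg k f x)) \<longlonglongrightarrow> 0"
proof -
  define \<delta> where "\<delta> = cdim TYPE('n) * (1 - p)"
  obtain A V where V: "step_seq V" "apx p \<sigma> r f V \<le> ennreal A * rho p \<sigma> r f"
    using analysis[OF p \<sigma>(1) r] f by metis
  note [measurable] = step_seqD(2)[OF V(1)]
  have afin: "apx p \<sigma> r f V < top"
    using V(2) fin by (metis (no_types) ennreal_mult_less_top ennreal_less_top le_less_trans)
  obtain E where E: "\<And>f :: real^'n \<Rightarrow> real. f\<in>borel_measurable borel \<Longrightarrow> rho p \<sigma> r f < top \<Longrightarrow>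
    pint 1 f \<le> ennreal E * rho p \<sigma> r f powe (1 / (p * r))"
    using L1_embedding[OF p \<sigma>(1) r, where 'n = 'n] crit p r mult_le_one[of p r] by auto
  have f1: "pint 1 f < top"
    using E[OF f fin] fin by (auto intro!: le_less_trans[OF E] simp: ennreal_mult_less_top)
  obtain C where C: "\<And>z :: nat \<Rightarrow> ennreal.
    (\<Sum>j. ennreal (2 powr (- (\<sigma> - \<delta>) * real j)) * z j) \<le> ennreal C * (\<Sum>j. z j powe r) powe (1 / r)"
    using weighted_sum_le[of r "\<sigma> - \<delta>"] r crit unfolding \<delta>_def by auto
  define z where "z j = ennreal (2 powr (\<sigma> * real j)) * pint p (\<lambda>x. V (Suc j) x - V j x)" for j
  have zfin: "(\<Sum>j. z j powe r) < top"
    using apx_differences[OF p \<sigma>(1) r V(1) f] afin unfolding z_def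
    by (auto intro: le_less_trans simp: ennreal_mult_less_top)
  define e where "e k = ennreal (2 powr (\<sigma> * real k)) * pint p (\<lambda>x. avg k f x - V k x)" for k
  have e_le: "e k \<le> ennreal (2 powr \<delta>) * (ennreal C * (\<Sum>j. z (j + k) powe r) powe (1 / r))" for k
  proof -
    have "e k \<le> ennreal (2 powr (\<sigma> * real k)) *
        (\<Sum>j. ennreal (2 powr (\<delta> * real (Suc j))) * pint p (\<lambda>x. V (Suc (j + k)) x - V (j + k) x))"
      unfolding e_def \<delta>_def
      by (intro mult_left_mono avg_error_le p V(1) f f1 apx_summable[OF \<sigma>(1) r afin]) auto
    also have "\<dots> = ennreal (2 powr \<delta>) * (\<Sum>j. ennreal (2 powr (- (\<sigma> - \<delta>) * real j)) * z (j + k))"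
      unfolding z_def ennreal_suminf_cmult[symmetric] mult.assoc[symmetric]
      by (simp add: algebra_simps flip: ennreal_mult powr_add)
    also have "\<dots> \<le> ennreal (2 powr \<delta>) * (ennreal C * (\<Sum>j. z (j + k) powe r) powe (1 / r))"
      by (intro mult_left_mono C) auto
    finally show ?thesis .
  qed
  have e0: "e \<longlonglongrightarrow> 0"
    by (rule ennreal_LIMSEQ_0_le[OF _ e_le])
       (use r in \<open>auto intro!: ennreal_cmult_tendsto_0 powe_LIMSEQ_0 ennreal_suminf_tail[OF zfin]\<close>)
  obtain K where K: "\<And>k g. pconst k g \<Longrightarrow> g \<in> borel_measurable borel \<Longrightarrow>
    rho p \<sigma> r (g :: real^'n \<Rightarrow> real) \<le> ennreal K * (ennreal (2 powr (\<sigma> * real k)) * pint p g) powe r"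
    using rho_pconst[OF p \<sigma> r] by metis
  have "(\<lambda>k. rho p \<sigma> r (\<lambda>x. avg k f x - V k x)) \<longlonglongrightarrow> 0"
  proof (rule ennreal_LIMSEQ_0_le)
    show "rho p \<sigma> r (\<lambda>x. avg k f x - V k x) \<le> ennreal K * e k powe r" for k
      unfolding e_def by (intro K pconst_diff avg_pconst step_seqD(1)[OF V(1)]) auto
    show "(\<lambda>k. ennreal K * e k powe r) \<longlonglongrightarrow> 0"
      by (intro ennreal_cmult_tendsto_0 powe_LIMSEQ_0 e0 r)
  qed
  moreover have "(\<lambda>k. rho p \<sigma> r (\<lambda>x. f x - V k x)) \<longlonglongrightarrow> 0"
    by (rule step_approximation_converges[OF p \<sigma> r V(1) f afin])
  ultimately have "(\<lambda>k. ennreal (2 powr r) * (rho p \<sigma> r (\<lambda>x. f x - V k x) + rho p \<sigma> r (\<lambda>x. avg k f x - V k x))) \<longlonglongrightarrow> 0"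
    by (intro ennreal_cmult_tendsto_0 ennreal_add_tendsto_0)
  then show "(\<lambda>k. rho p \<sigma> r (\<lambda>x. f x - avg k f x)) \<longlonglongrightarrow> 0"
  proof (rule ennreal_LIMSEQ_0_le)
    show "rho p \<sigma> r (\<lambda>x. f x - avg k f x)
      \<le> ennreal (2 powr r) * (rho p \<sigma> r (\<lambda>x. f x - V k x) + rho p \<sigma> r (\<lambda>x. avg k f x - V k x))" for k
      using rho_diff[OF p r, of "\<lambda>x. f x - V k x" "\<lambda>x. avg k f x - V k x" \<sigma>] by simp
  qed
  have z0: "z \<longlonglongrightarrow> 0"
    using powe_LIMSEQ_0[OF ennreal_suminf_terms_to_0[OF zfin], of "1/r"] r by simp
  show "(\<lambda>k. ennreal (2 powr (\<sigma> * real k)) * pint p (\<lambda>x. avg (Suc k) f x - avg k f x)) \<longlonglongrightarrow> 0"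
  proof (rule ennreal_LIMSEQ_0_le)
    fix k
    let ?w = "ennreal (2 powr (\<sigma> * real k))"
    have "pint p (\<lambda>x. avg (Suc k) f x - avg k f x)
        \<le> pint p (\<lambda>x. avg (Suc k) f x - V (Suc k) x) + (pint p (\<lambda>x. V (Suc k) x - V k x) + pint p (\<lambda>x. avg k f x - V k x))"
      using pint_add[OF p, of "\<lambda>x. avg (Suc k) f x - V (Suc k) x" "\<lambda>x. (V (Suc k) x - V k x) - (avg k f x - V k x)"]
        pint_diff[OF p, of "\<lambda>x. V (Suc k) x - V k x" "\<lambda>x. avg k f x - V k x"]
      by (auto intro: order_trans add_left_mono)
    then have "?w * pint p (\<lambda>x. avg (Suc k) f x - avg k f x)
      \<le> ?w * pint p (\<lambda>x. avg (Suc k) f x - V (Suc k) x) + (z k + e k)"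
      unfolding z_def e_def distrib_left[symmetric] by (intro mult_left_mono) auto
    also have "?w * pint p (\<lambda>x. avg (Suc k) f x - V (Suc k) x) \<le> e (Suc k)"
      unfolding e_def using \<sigma> by (intro mult_right_mono ennreal_leI powr_mono) auto
    finally show "?w * pint p (\<lambda>x. avg (Suc k) f x - avg k f x) \<le> e (Suc k) + (z k + e k)"
      by (simp add: add_right_mono)
  next
    show "(\<lambda>k. e (Suc k) + (z k + e k)) \<longlonglongrightarrow> 0"
      by (intro ennreal_add_tendsto_0 z0 e0 LIMSEQ_Suc[OF e0])
  qed
qed

text \<open>A modulus is a supremum over shifts and \<open>bes\<close> a sum over levels, so a
  single shift at a single level bounds \<open>rho\<close> from below. It detects jumps of partial
  sums and of averages.\<close>

lemma rho_lower_bound: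
  fixes g :: "real^'n \<Rightarrow> real"
  assumes r: "0 < r" and p: "0 < p" and [measurable]: "g \<in> borel_measurable borel" "A \<in> sets borel"
    and y: "norm y \<le> 1 / 2^k" and A: "\<And>x. x \<in> A \<Longrightarrow> x \<in> hcube \<and> x + y \<in> hcube \<and> u \<le> \<bar>g (x + y) - g x\<bar>"
    and u: "0 \<le> u"
  shows "(ennreal (2 powr (\<sigma> * real k)) * (ennreal (u powr p) * emeasure lborel A)) powe r \<le> rho p \<sigma> r g"
proof -
  have "ennreal (u powr p) * emeasure lborel A = (\<integral>\<^sup>+x\<in>A. ennreal (u powr p) \<partial>lborel)"
    by (simp add: nn_integral_cmult_indicator)
  also have "\<dots> \<le> dint p g y"
    unfolding dint_def using A u p
    by (intro nn_integral_mono) (auto simp: indicator_def intro!: ennreal_leI powr_mono2)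
  also have "\<dots> \<le> omod p g (1 / 2^k)" by (rule dint_le_omod[OF y])
  finally have "(ennreal (2 powr (\<sigma> * real k)) * (ennreal (u powr p) * emeasure lborel A)) powe r
      \<le> (ennreal (2 powr (\<sigma> * real k)) * omod p g (1 / 2^k)) powe r"
    using r by (intro powe_mono mult_left_mono) auto
  also have "\<dots> \<le> bes p \<sigma> r g"
    unfolding bes_def by (rule ennreal_term_le_suminf)
  also have "\<dots> \<le> rho p \<sigma> r g" by (simp add: rho_def)
  finally show ?thesis .
qed

section \<open>Smoothness beyond the threshold \<sigma> = 1\<close>

lemma hcube_midpoint: "x \<in> hcube \<Longrightarrow> x + y \<in> hcube \<Longrightarrow> x + (1/2) *\<^sub>R y \<in> hcube"
  by (auto simp: hcube_iff) (smt (verit, best) field_sum_of_halves)+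

text \<open>The cube is convex, so x + y/2 lies in it and the difference splits into two of half the
  length. For p-th powers the factor is 2, so m doublings cost 2^m, which is the weight 2^(\<sigma>
  m) at \<sigma> = 1.\<close>

lemma omod_double:
  fixes f :: "real^'n \<Rightarrow> real"
  assumes p: "0 < p" "p \<le> 1" and [measurable]: "f \<in> borel_measurable borel"
  shows "omod p f (2 * t) \<le> 2 * omod p f t"
  unfolding omod_def[of p f "2 * t"]
proof (rule SUP_least)
  fix y :: "real^'n" assume "y \<in> {y. norm y \<le> 2 * t}"
  then have y: "norm ((1/2) *\<^sub>R y) \<le> t" by simp
  define h where "h = (1/2) *\<^sub>R y"
  have yh: "x + y = (x + h) + h" for x by (simp add: h_def add.assoc flip: scaleR_left_distrib)
  define D where "D x = ennreal (\<bar>f (x + h) - f x\<bar> powr p) * (indicator hcube x * indicator hcube (x + h))" for x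
  have [measurable]: "D \<in> borel_measurable borel" unfolding D_def by measurable
  have "dint p f y \<le> (\<integral>\<^sup>+x. D (x + h) + D x \<partial>lborel)"
    unfolding dint_def
  proof (rule nn_integral_mono)
    fix x
    show "ennreal (\<bar>f (x + y) - f x\<bar> powr p) * (indicator hcube x * indicator hcube (x + y)) \<le> D (x + h) + D x"
    proof (cases "x \<in> hcube \<and> x + y \<in> hcube")
      case True
      then have "x + h \<in> hcube" using hcube_midpoint[of x y] by (simp add: h_def)
      with True show ?thesis
        using abs_powr_add_le[OF p, of "f (x + y) - f (x + h)" "f (x + h) - f x"] by (simp add: D_def yh)
    qed auto
  qed
  also have "\<dots> = dint p f h + dint p f h"
  proof -
    have "(\<integral>\<^sup>+x. D x \<partial>lborel) = dint p f h" unfolding D_def dint_def ..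
    then show ?thesis by (subst nn_integral_add) (simp_all add: nn_integral_translate)
  qed
  also have "\<dots> \<le> 2 * omod p f t"
    unfolding mult_2 by (intro add_mono dint_le_omod) (use y in \<open>auto simp: h_def\<close>)
  finally show "dint p f y \<le> 2 * omod p f t" .
qed

lemma omod_power_le:
  assumes p: "0 < p" "p \<le> 1" and "f \<in> borel_measurable borel"
  shows "omod p f (2^m * t) \<le> 2^m * omod p f t"
proof (induction m)
  case (Suc m)
  have "omod p f (2^Suc m * t) \<le> 2 * omod p f (2^m * t)"
    using omod_double[OF assms, of "2^m * t"] by (simp add: mult.assoc)
  also have "\<dots> \<le> 2 * (2^m * omod p f t)" by (intro mult_left_mono Suc) auto
  finally show ?case by (simp add: mult.assoc)
qed simp

text \<open>Descending from radius 1 to 2^(-m) costs at most 2^m \<le> 2^(\<sigma> m), and the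
  moduli with these weights tend to 0 because their series converges. So the modulus vanishes at
  radius 1.\<close>

lemma constant_of_large_smoothness:
  fixes f :: "real^'n \<Rightarrow> real"
  assumes p: "0 < p" "p \<le> 1" and \<sigma>: "1 \<le> \<sigma>" and r: "0 < r"
    and f [measurable]: "f \<in> borel_measurable borel" and fin: "rho p \<sigma> r f < top"
  shows "\<exists>c. AE x in lborel. x \<in> hcube \<longrightarrow> f x = c"
proof -
  have bfin: "bes p \<sigma> r f < top" using fin by (auto simp: rho_def)
  have "(\<lambda>m. (ennreal (2 powr (\<sigma> * real m)) * omod p f (1 / 2^m)) powe r) \<longlonglongrightarrow> 0"
    using bfin unfolding bes_def by (rule ennreal_suminf_terms_to_0)
  from powe_LIMSEQ_0[OF this, of "1 / r"] r
  have lim: "(\<lambda>m. ennreal (2 powr (\<sigma> * real m)) * omod p f (1 / 2^m)) \<longlonglongrightarrow> 0" by simp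
  have "omod p f 1 \<le> ennreal (2 powr (\<sigma> * real m)) * omod p f (1 / 2^m)" for m
  proof -
    have "omod p f 1 \<le> 2^m * omod p f (1 / 2^m)" using omod_power_le[OF p f, of m "1 / 2^m"] by simp
    also have "(2::ennreal)^m = ennreal (2 powr real m)" by (simp add: powr_realpow ennreal_power[symmetric])
    also have "ennreal (2 powr real m) * omod p f (1 / 2^m) \<le> ennreal (2 powr (\<sigma> * real m)) * omod p f (1 / 2^m)"
      using \<sigma> mult_right_mono[OF \<sigma>, of "real m"] by (intro mult_right_mono ennreal_leI powr_mono) auto
    finally show ?thesis .
  qed
  then have "omod p f 1 \<le> 0" using LIMSEQ_le_const[OF lim] by blast
  then have o1: "omod p f 1 = 0" by simp
  \<comment> \<open>Jackson at level 0 needs radius d, which is reached from radius 1 by d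
    doublings.\<close>
  have "real CARD('n) \<le> 2 ^ CARD('n)"
    by (metis less_imp_le of_nat_le_iff of_nat_less_two_power of_nat_power of_nat_numeral)
  then have "omod p f (cdim TYPE('n) / 2^0) \<le> omod p f (2 ^ CARD('n) * 1)" by (intro omod_mono) simp
  also have "\<dots> \<le> 2 ^ CARD('n) * omod p f 1" by (rule omod_power_le[OF p f])
  finally have "omod p f (cdim TYPE('n) / 2^0) = 0" using o1 by simp
  then obtain V where V: "pconst 0 V" "V \<in> borel_measurable borel" "pint p (\<lambda>x. f x - V x) = 0"
    using Jackson[OF f, of 0 p] by (auto simp: o1)
  note [measurable] = V(2)
  have "AE x in lborel. ennreal (\<bar>f x - V x\<bar> powr p) * indicator hcube x = 0"
    using V(3) unfolding pint_def by (subst (asm) nn_integral_0_iff_AE) auto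
  then have "AE x in lborel. x \<in> hcube \<longrightarrow> f x = V 0"
  proof eventually_elim
    case (elim x)
    show ?case
    proof
      assume x: "x \<in> hcube"
      moreover have "0 \<in> (hcube :: (real^'n) set)" by (simp add: hcube_iff)
      ultimately have "V x = V 0" using pconstD[OF V(1), of x 0] by (simp add: idx_0)
      then show "f x = V 0" using elim x by (simp add: indicator_def)
    qed
  qed
  then show ?thesis by blast
qed

section \<open>Sums of spikes at the critical smoothness\<close>

text \<open>In the critical case \<open>\<sigma> = d (1 - p)\<close> a summand with coefficient \<open>1\<close> has modular comparable
  to \<open>1\<close>, on every level.\<close>

definition spikes :: "(nat \<Rightarrow> real) \<Rightarrow> (nat \<Rightarrow> 'n \<Rightarrow> nat) \<Rightarrow> real^'n::finite \<Rightarrow> real" where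
  "spikes \<beta> i x = enn2real (\<Sum>m. ennreal (\<beta> m * 2 powr (real m * cdim TYPE('n))) * indicator (cell m (i m)) x)"

definition spikes_upto :: "(nat \<Rightarrow> real) \<Rightarrow> (nat \<Rightarrow> 'n \<Rightarrow> nat) \<Rightarrow> nat \<Rightarrow> real^'n::finite \<Rightarrow> real" where
  "spikes_upto \<beta> i k x = (\<Sum>m<k. \<beta> m * 2 powr (real m * cdim TYPE('n)) * indicator (cell m (i m)) x)"

lemma spikes_borel [measurable]: "spikes \<beta> i \<in> borel_measurable borel"
  unfolding spikes_def[abs_def] by measurable

lemma spikes_upto_borel [measurable]: "spikes_upto \<beta> i k \<in> borel_measurable borel"
  unfolding spikes_upto_def[abs_def] by measurable

lemma spikes_upto_pconst: "pconst k (spikes_upto \<beta> i (Suc k))"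
  unfolding spikes_upto_def[abs_def]
proof (rule pconst_sum)
  fix m assume "m \<in> {..<Suc k}"
  then have "pconst k (indicator (cell m (i m)) :: real^'a \<Rightarrow> real)" by (intro pconst_indicator_cell) auto
  then show "pconst k (\<lambda>x. \<beta> m * 2 powr (real m * cdim TYPE('a)) * indicator (cell m (i m)) x)"
    by (rule pconst_comp)
qed

text \<open>Where the tail is infinite the bound is trivial, so the value 0 that
  \<open>enn2real\<close> assigns to a divergent sum requires no exceptional set.\<close>

lemma spikes_diff_le:
  fixes i :: "nat \<Rightarrow> 'n::finite \<Rightarrow> nat"
  assumes \<beta>: "\<And>m. 0 \<le> \<beta> m"
  shows "ennreal \<bar>spikes \<beta> i x - spikes_upto \<beta> i k x\<bar>
    \<le> (\<Sum>l. ennreal (\<beta> (l + k) * 2 powr (real (l + k) * cdim TYPE('n))) * indicator (cell (l + k) (i (l + k))) x)"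
proof -
  define t where "t m = ennreal (\<beta> m * 2 powr (real m * cdim TYPE('n))) * indicator (cell m (i m)) x" for m
  define T where "T = (\<Sum>l. t (l + k))"
  have t: "t m = ennreal (\<beta> m * 2 powr (real m * cdim TYPE('n)) * indicator (cell m (i m)) x)" for m
    by (simp add: t_def indicator_def)
  have V: "(\<Sum>m<k. t m) = ennreal (spikes_upto \<beta> i k x)"
    unfolding spikes_upto_def t using \<beta> by (intro sum_ennreal) (auto simp: indicator_def)
  have V0: "0 \<le> spikes_upto \<beta> i k x" unfolding spikes_upto_def using \<beta> by (auto intro!: sum_nonneg)
  have S: "(\<Sum>m. t m) = T + ennreal (spikes_upto \<beta> i k x)"
    unfolding T_def V[symmetric] by (rule ennreal_suminf_split)
  have "ennreal \<bar>spikes \<beta> i x - spikes_upto \<beta> i k x\<bar> \<le> T"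
  proof (cases T)
    case (real \<tau>)
    then have "spikes \<beta> i x = \<tau> + spikes_upto \<beta> i k x"
      unfolding spikes_def t_def[symmetric] S using V0 by (simp flip: ennreal_plus)
    then show ?thesis using real by simp
  qed simp
  then show ?thesis by (simp add: T_def t_def)
qed

text \<open>A spike of weight \<beta> has height \<beta> 2^(m d) on volume 2^(-m d), hence p-th
  power integral \<beta>^p 2^(-\<delta> m). With the finite sums as approximants the weighted errors
  are dominated by a convolution with 2^(-\<delta> |m - j|), and \<open>geometric_Hardy\<close>
  applies. Subadditivity gives this for every choice of the cells.\<close>

lemma rho_spikes:
  assumes p: "0 < p" "p < 1" and r: "0 < r" and \<delta>: "\<delta> = cdim TYPE('n::finite) * (1 - p)" "\<delta> < 1"
  shows "\<exists>C\<ge>0. \<forall>\<beta> i. (\<forall>m. 0 \<le> \<beta> m) \<longrightarrow> (\<forall>m. i m \<in> Idx m) \<longrightarrow>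
    rho p \<delta> r (spikes \<beta> i :: real^'n \<Rightarrow> real) \<le> ennreal C * (\<Sum>m. ennreal (\<beta> m powr (p * r)))"
proof -
  have p': "p \<le> 1" using p by simp
  have d0: "0 < \<delta>" using p \<delta> by simp
  obtain C where C: "C \<ge> 0" "\<And>f V. step_seq V \<Longrightarrow> f \<in> borel_measurable borel \<Longrightarrow>
    rho p \<delta> r (f :: real^'n \<Rightarrow> real) \<le> pint p f powe r + ennreal C * apx p \<delta> r f V"
    using rho_le_apx[OF p(1) p' \<delta>(2) r] by metis
  obtain H where H: "H \<ge> 0" "\<And>x :: nat \<Rightarrow> ennreal. (\<Sum>m. (\<Sum>j. ennreal (2 powr (- \<delta> * \<bar>real m - real j\<bar>)) * x j) powe r)
      \<le> ennreal H * (\<Sum>j. x j powe r)"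
    using geometric_Hardy[OF d0 r] by auto
  have "rho p \<delta> r (spikes \<beta> i) \<le> ennreal (H + C * H) * (\<Sum>m. ennreal (\<beta> m powr (p * r)))"
    if \<beta>: "\<And>m. 0 \<le> \<beta> m" and i: "\<And>m. i m \<in> Idx m" for \<beta> and i :: "nat \<Rightarrow> 'n \<Rightarrow> nat"
  proof -
    define f where "f = (spikes \<beta> i :: real^'n \<Rightarrow> real)"
    define b where "b m = ennreal (\<beta> m powr p)" for m
    define B where "B = (\<Sum>m. ennreal (\<beta> m powr (p * r)))"
    have bB: "(\<Sum>m. b m powe r) = B" by (simp add: b_def B_def powr_powr)
    define row where "row m = (\<Sum>j. ennreal (2 powr (- \<delta> * \<bar>real m - real j\<bar>)) * b j)" for m :: nat
    have row: "(\<Sum>m. row m powe r) \<le> ennreal H * B" unfolding row_def bB[symmetric] by (rule H)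
    have pint_le: "pint p (\<lambda>x. f x - spikes_upto \<beta> i k x) \<le> (\<Sum>l. ennreal (2 powr (- \<delta> * real (l + k))) * b (l + k))" for k
    proof -
      define s where "s l x = ennreal (\<beta> (l + k) * 2 powr (real (l + k) * cdim TYPE('n))) * indicator (cell (l + k) (i (l + k))) x" for l x
      have [measurable]: "s l \<in> borel_measurable borel" for l unfolding s_def by measurable
      have "pint p (\<lambda>x. f x - spikes_upto \<beta> i k x) \<le> (\<integral>\<^sup>+x. (\<Sum>l. s l x powe p) \<partial>lborel)"
        unfolding pint_def
      proof (rule nn_integral_mono)
        fix x
        have "ennreal (\<bar>f x - spikes_upto \<beta> i k x\<bar> powr p) = ennreal \<bar>f x - spikes_upto \<beta> i k x\<bar> powe p" by simp
        also have "\<dots> \<le> (\<Sum>l. s l x) powe p"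
          unfolding f_def s_def using p by (intro powe_mono spikes_diff_le \<beta>) auto
        also have "\<dots> \<le> (\<Sum>l. s l x powe p)" by (rule powe_suminf_le) (use p in auto)
        finally show "ennreal (\<bar>f x - spikes_upto \<beta> i k x\<bar> powr p) * indicator hcube x \<le> (\<Sum>l. s l x powe p)"
          by (auto simp: indicator_def)
      qed
      also have "\<dots> = (\<Sum>l. \<integral>\<^sup>+x. s l x powe p \<partial>lborel)" by (rule nn_integral_suminf) measurable
      also have "\<dots> = (\<Sum>l. ennreal (2 powr (- \<delta> * real (l + k))) * b (l + k))"
      proof (rule arg_cong[where f = suminf], rule ext)
        fix l
        have ind: "indicator A x powe p = (indicator A x :: ennreal)" for A and x :: "real^'n" by (auto simp: indicator_def)
        have "(\<integral>\<^sup>+x. s l x powe p \<partial>lborel) = ennreal ((\<beta> (l + k) * 2 powr (real (l + k) * cdim TYPE('n))) powr p) * emeasure lborel (cell (l + k) (i (l + k)))"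
          using \<beta> by (simp add: s_def powe_mult ind nn_integral_cmult_indicator)
        also have "\<dots> = ennreal (2 powr (- \<delta> * real (l + k))) * b (l + k)"
          unfolding emeasure_cell[OF i] using \<beta>
          by (simp add: b_def \<delta>(1) powr_mult powr_powr algebra_simps flip: ennreal_mult powr_add)
        finally show "(\<integral>\<^sup>+x. s l x powe p \<partial>lborel) = ennreal (2 powr (- \<delta> * real (l + k))) * b (l + k)" .
      qed
      finally show ?thesis .
    qed
    \<comment> \<open>\<open>Suc j\<close> includes the spike of level j, which is still a step
      function of that level.\<close>
    define V where "V j = (spikes_upto \<beta> i (Suc j) :: real^'n \<Rightarrow> real)" for j
    have V: "step_seq V" by (simp add: step_seq_def V_def spikes_upto_pconst)
    have "ennreal (2 powr (\<delta> * real j)) * pint p (\<lambda>x. f x - V j x) \<le> row j" for j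
    proof -
      have "ennreal (2 powr (\<delta> * real j)) * pint p (\<lambda>x. f x - V j x)
          \<le> ennreal (2 powr (\<delta> * real j)) * (\<Sum>l. ennreal (2 powr (- \<delta> * real (l + Suc j))) * b (l + Suc j))"
        unfolding V_def by (intro mult_left_mono pint_le) auto
      also have "\<dots> = (\<Sum>l. ennreal (2 powr (- \<delta> * \<bar>real j - real (l + Suc j)\<bar>)) * b (l + Suc j))"
        unfolding ennreal_suminf_cmult[symmetric] mult.assoc[symmetric]
        by (simp add: algebra_simps flip: ennreal_mult powr_add)
      also have "\<dots> \<le> row j"
        unfolding row_def by (rule ennreal_suminf_shift_le[of "\<lambda>l. ennreal (2 powr (- \<delta> * \<bar>real j - real l\<bar>)) * b l"])
      finally show ?thesis .
    qed
    then have "apx p \<delta> r f V \<le> (\<Sum>m. row m powe r)"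
      unfolding apx_def using r by (intro ennreal_suminf_le powe_mono) auto
    then have 1: "apx p \<delta> r f V \<le> ennreal H * B" using row by simp
    have "pint p f \<le> row 0"
      using pint_le[of 0] by (simp add: spikes_upto_def row_def)
    then have "pint p f powe r \<le> row 0 powe r" using r by (intro powe_mono) auto
    also have "\<dots> \<le> (\<Sum>m. row m powe r)" by (rule ennreal_term_le_suminf)
    finally have 2: "pint p f powe r \<le> ennreal H * B" using row by simp
    have fb: "f \<in> borel_measurable borel" by (simp add: f_def)
    have "rho p \<delta> r f \<le> ennreal H * B + ennreal C * (ennreal H * B)"
      by (intro order_trans[OF C(2)[OF V fb]] add_mono mult_left_mono 1 2) auto
    also have "\<dots> = ennreal (H + C * H) * B"
      using C(1) H(1) by (simp add: distrib_right ennreal_mult mult.assoc)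
    finally show ?thesis by (simp add: f_def B_def)
  qed
  then show ?thesis using C(1) H(1) by (intro exI[of _ "H + C * H"]) auto
qed

section \<open>The Haar system\<close>

lemma pconst_bounded:
  fixes g :: "real^'n \<Rightarrow> real"
  assumes "pconst k g"
  shows "\<exists>B\<ge>0. \<forall>x\<in>hcube. \<bar>g x\<bar> \<le> B"
proof -
  define B where "B = (\<Sum>i\<in>Idx k. \<bar>g (corner k i)\<bar>)"
  have "\<bar>g x\<bar> \<le> B" if x: "x \<in> hcube" for x
  proof -
    have "\<bar>g x\<bar> = \<bar>g (corner k (idx k x))\<bar>" using pconst_corner[OF assms x] by simp
    also have "\<dots> \<le> B" unfolding B_def by (rule member_le_sum) (auto simp: idx_in_Idx[OF x])
    finally show ?thesis .
  qed
  then show ?thesis by (intro exI[of _ B]) (auto simp: B_def sum_nonneg)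
qed

text \<open>The inner product over the half-open cube for \<open>lborel\<close>;
  \<open>haar_coeff_eq\<close> reduces Haar coefficients to it.\<close>

definition hint :: "(real^'n \<Rightarrow> real) \<Rightarrow> (real^'n \<Rightarrow> real) \<Rightarrow> real" where
  "hint f h = (\<integral>x. indicator hcube x * (f x * h x) \<partial>lborel)"

lemma integral_hcube_pconst:
  fixes F :: "real^'n \<Rightarrow> real"
  assumes "pconst m F"
  shows "(\<integral>x. indicator hcube x * F x \<partial>lborel) = (\<Sum>i\<in>Idx m. F (corner m i)) * 2 powr (- real m * cdim TYPE('n))"
proof -
  have "indicator hcube x * F x = (\<Sum>i\<in>Idx m. F (corner m i) * indicator (cell m i) x)" for x
  proof (cases "x \<in> hcube")
    case True
    have "(\<Sum>i\<in>Idx m. F (corner m i) * indicator (cell m i) x) = (\<Sum>i\<in>Idx m. if i = idx m x then F (corner m i) else 0)"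
      using True by (intro sum.cong) (auto simp: cell_def)
    also have "\<dots> = F (corner m (idx m x))" using idx_in_Idx[OF True] by simp
    finally show ?thesis using True pconst_corner[OF assms True] by simp
  qed (auto simp: cell_def)
  then have "(\<integral>x. indicator hcube x * F x \<partial>lborel) = (\<integral>x. (\<Sum>i\<in>Idx m. F (corner m i) * indicator (cell m i) x) \<partial>lborel)"
    by (intro Bochner_Integration.integral_cong) auto
  also have "\<dots> = (\<Sum>i\<in>Idx m. F (corner m i) * measure lborel (cell m i))"
    by (subst Bochner_Integration.integral_sum)
       (auto simp: emeasure_cell intro!: integrable_mult_right integrable_real_indicator)
  also have "\<dots> = (\<Sum>i\<in>Idx m. F (corner m i) * 2 powr (- real m * cdim TYPE('n)))"
    by (intro sum.cong refl) (simp add: measure_def emeasure_cell)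
  finally show ?thesis by (simp add: sum_distrib_right)
qed

lemma hint_integrable:
  fixes f :: "real^'n \<Rightarrow> real"
  assumes [measurable]: "f \<in> borel_measurable borel" "h \<in> borel_measurable borel"
    and f: "pint 1 f < top" and h: "\<And>x. x \<in> hcube \<Longrightarrow> \<bar>h x\<bar> \<le> B"
  shows "integrable lborel (\<lambda>x. indicator hcube x * (f x * h x))"
    and "ennreal \<bar>hint f h\<bar> \<le> ennreal B * pint 1 f"
proof -
  have le: "(\<integral>\<^sup>+x. ennreal (norm (indicator hcube x * (f x * h x))) \<partial>lborel) \<le> ennreal B * pint 1 f"
  proof -
    have "(\<integral>\<^sup>+x. ennreal (norm (indicator hcube x * (f x * h x))) \<partial>lborel)
        \<le> (\<integral>\<^sup>+x. ennreal B * (ennreal (\<bar>f x\<bar> powr 1) * indicator hcube x) \<partial>lborel)"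
    proof (rule nn_integral_mono)
      fix x
      show "ennreal (norm (indicator hcube x * (f x * h x))) \<le> ennreal B * (ennreal (\<bar>f x\<bar> powr 1) * indicator hcube x)"
      proof (cases "x \<in> hcube")
        case True
        then have "\<bar>f x\<bar> * \<bar>h x\<bar> \<le> B * \<bar>f x\<bar>"
          using mult_left_mono[OF h[OF True], of "\<bar>f x\<bar>"] by (simp add: mult.commute)
        moreover have "0 \<le> B" using h[OF True] by linarith
        ultimately show ?thesis using True by (simp add: abs_mult ennreal_leI flip: ennreal_mult)
      qed simp
    qed
    also have "\<dots> = ennreal B * pint 1 f" unfolding pint_def by (rule nn_integral_cmult) simp
    finally show ?thesis .
  qed
  show int: "integrable lborel (\<lambda>x. indicator hcube x * (f x * h x))"
  proof (rule integrableI_bounded)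
    have "ennreal B * pint 1 f < top" using f by (simp add: ennreal_mult_less_top)
    then show "(\<integral>\<^sup>+x. ennreal (norm (indicator hcube x * (f x * h x))) \<partial>lborel) < \<infinity>" using le by (auto intro: le_less_trans)
  qed simp
  show "ennreal \<bar>hint f h\<bar> \<le> ennreal B * pint 1 f"
    using integral_norm_bound_ennreal[OF int] le by (simp add: hint_def)
qed

lemma hint_sum_left:
  fixes g :: "'b \<Rightarrow> real^'n \<Rightarrow> real"
  assumes "finite A" and "\<And>a. a \<in> A \<Longrightarrow> g a \<in> borel_measurable borel" "\<And>a. a \<in> A \<Longrightarrow> pint 1 (g a) < top"
    and h: "pconst k h" "h \<in> borel_measurable borel"
  shows "hint (\<lambda>x. \<Sum>a\<in>A. c a * g a x) h = (\<Sum>a\<in>A. c a * hint (g a) h)"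
proof -
  obtain B where B: "\<And>x. x \<in> hcube \<Longrightarrow> \<bar>h x\<bar> \<le> B" using pconst_bounded[OF h(1)] by blast
  have "hint (\<lambda>x. \<Sum>a\<in>A. c a * g a x) h = (\<integral>x. (\<Sum>a\<in>A. c a * (indicator hcube x * (g a x * h x))) \<partial>lborel)"
    unfolding hint_def by (simp add: sum_distrib_left sum_distrib_right mult_ac)
  also have "\<dots> = (\<Sum>a\<in>A. c a * hint (g a) h)"
    unfolding hint_def using hint_integrable(1)[OF assms(2) h(2) assms(3) B]
    by (subst Bochner_Integration.integral_sum) auto
  finally show ?thesis .
qed

lemma hint_diff_left:
  fixes f g :: "real^'n \<Rightarrow> real"
  assumes "f \<in> borel_measurable borel" "g \<in> borel_measurable borel" "pint 1 f < top" "pint 1 g < top"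
    and h: "pconst k h" "h \<in> borel_measurable borel"
  shows "hint (\<lambda>x. f x - g x) h = hint f h - hint g h"
proof -
  obtain B where B: "\<And>x. x \<in> hcube \<Longrightarrow> \<bar>h x\<bar> \<le> B" using pconst_bounded[OF h(1)] by blast
  show ?thesis
    unfolding hint_def left_diff_distrib right_diff_distrib
    using hint_integrable(1)[OF assms(1) h(2) assms(3) B] hint_integrable(1)[OF assms(2) h(2) assms(4) B]
    by (intro Bochner_Integration.integral_diff) auto
qed

section \<open>Explicit form of the Haar functions\<close>

text \<open>The functions \<open>haar_fun k i S\<close>, for the cells of level \<open>k\<close>, are the Haar functions of level \<open>k + 1\<close>.\<close>

definition hsign :: "nat \<Rightarrow> 'n set \<Rightarrow> real^'n \<Rightarrow> real" where
  "hsign k S x = (\<Prod>j\<in>S. (-1) ^ idx (Suc k) x j)"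

definition haar_fun :: "nat \<Rightarrow> ('n \<Rightarrow> nat) \<Rightarrow> 'n set \<Rightarrow> real^'n::finite \<Rightarrow> real" where
  "haar_fun k i S x = 2 powr (real k * cdim TYPE('n) / 2) * indicator (cell k i) x * hsign k S x"

lemma dyadic_Suc_iff:
  assumes "0 \<le> t"
  shows "t \<in> dyadic k (Suc n) \<longleftrightarrow> nat \<lfloor>2^k * t\<rfloor> = n"
  using assms by (subst nat_floor_less_iff) (auto simp: dyadic_def field_simps)

lemma dyadic_subset:
  assumes "n < 2^k" "t \<in> dyadic k (Suc n)"
  shows "0 \<le> t \<and> t < 1"
proof -
  have "real (n + 1) \<le> real (2^k)" using assms(1) by (intro of_nat_mono) simp
  then have "real n + 1 \<le> 2^k" by simp
  moreover have "real n \<le> t * 2^k" "t * 2^k < real n + 1" using assms(2) by (auto simp: dyadic_def field_simps)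
  moreover have "0 \<le> real n" by simp
  ultimately have "0 \<le> t * 2^k" "t * 2^k < 1 * 2^k" by linarith+
  then show ?thesis
    using mult_less_cancel_right_pos[of "2^k" t 1] mult_le_cancel_right_pos[of "2^k" 0 t] by simp
qed

lemma haar_box_value:
  assumes "n < 2^k"
  shows "haar_box (Suc k) (Suc n) t = 2 powr (real k / 2) * (if 0 \<le> t \<and> t < 1 \<and> nat \<lfloor>2^k * t\<rfloor> = n then 1 else 0)"
  using dyadic_Suc_iff[of t k n] dyadic_subset[OF assms, of t]
  by (auto simp: haar_box_def indicator_def)

text \<open>Counted from zero, the halves of interval n are 2 n and 2 n + 1, so the sign of the wave
  is the parity of the index on the finer level. This is where \<open>hsign\<close> comes
  from.\<close>

lemma haar_wave_value:
  assumes "n < 2^k"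
  shows "haar_wave (Suc k) (Suc n) t = 2 powr (real k / 2) *
    (if 0 \<le> t \<and> t < 1 \<and> nat \<lfloor>2^k * t\<rfloor> = n then (-1) ^ nat \<lfloor>2^Suc k * t\<rfloor> else 0)"
proof -
  have 1: "2 * Suc n - 1 = Suc (2 * n)" "2 * Suc n = Suc (2 * n + 1)" by auto
  have lt: "2 * n < 2^Suc k" "2 * n + 1 < 2^Suc k" using assms by auto
  show ?thesis
  proof (cases "0 \<le> t \<and> t < 1")
    case True
    \<comment> \<open>\<open>idx_div\<close> speaks of vectors; a constant vector and an arbitrary
      coordinate transfer it to a single real.\<close>
    have "nat \<lfloor>2^k * t\<rfloor> = nat \<lfloor>2^Suc k * t\<rfloor> div 2"
      using idx_div[of k "\<chi> j. t" undefined 1] by (simp add: idx_def)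
    then have "nat \<lfloor>2^k * t\<rfloor> = n \<longleftrightarrow> nat \<lfloor>2^Suc k * t\<rfloor> = 2 * n \<or> nat \<lfloor>2^Suc k * t\<rfloor> = 2 * n + 1"
      by linarith
    then show ?thesis
      unfolding haar_wave_def 1 using True dyadic_Suc_iff[of t "Suc k" "2 * n"] dyadic_Suc_iff[of t "Suc k" "2 * n + 1"]
      by (auto simp: indicator_def simp del: power_Suc)
  next
    case False
    then show ?thesis unfolding haar_wave_def 1
      using dyadic_subset[OF lt(1), of t] dyadic_subset[OF lt(2), of t] by (auto simp: indicator_def simp del: power_Suc)
  qed
qed

lemma haar_fun_eq:
  assumes i: "i \<in> Idx k"
  shows "(\<Prod>j\<in>UNIV. if j \<in> S then haar_wave (Suc k) (Suc (i j)) (x $ j) else haar_box (Suc k) (Suc (i j)) (x $ j)) = haar_fun k i S (x :: real^'n)"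
proof -
  have i': "i j < 2^k" for j using i by (simp add: Idx_def)
  define B where "B j \<longleftrightarrow> 0 \<le> x $ j \<and> x $ j < 1 \<and> idx k x j = i j" for j
  have "(\<Prod>j\<in>UNIV. if j \<in> S then haar_wave (Suc k) (Suc (i j)) (x $ j) else haar_box (Suc k) (Suc (i j)) (x $ j))
     = (\<Prod>j\<in>UNIV. 2 powr (real k / 2) * (if B j then 1 else 0) * (if j \<in> S then (-1) ^ idx (Suc k) x j else 1))"
    by (intro prod.cong) (auto simp: haar_wave_value[OF i'] haar_box_value[OF i'] B_def idx_def)
  also have "\<dots> = (\<Prod>j\<in>(UNIV::'n set). 2 powr (real k / 2)) * (\<Prod>j\<in>UNIV. if B j then 1 else 0) * (\<Prod>j\<in>UNIV. if j \<in> S then (-1) ^ idx (Suc k) x j else 1)"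
    by (simp only: prod.distrib)
  also have "(\<Prod>j\<in>(UNIV::'n set). 2 powr (real k / 2)) = (2::real) powr (real k * cdim TYPE('n) / 2)"
    by (simp add: powr_realpow[symmetric] powr_powr)
  also have "(\<Prod>j\<in>UNIV. if B j then 1 else 0) = (indicator (cell k i) x :: real)"
  proof (cases "\<forall>j. B j")
    case True
    then have "x \<in> cell k i" by (auto simp: B_def cell_def hcube_iff)
    with True show ?thesis by simp
  next
    case False
    then have "x \<notin> cell k i" by (auto simp: B_def cell_def hcube_iff)
    with False show ?thesis by (auto intro: prod_zero)
  qed
  also have "(\<Prod>j\<in>UNIV. if j \<in> S then (-1) ^ idx (Suc k) x j else 1) = hsign k S x"
    unfolding hsign_def by (simp add: prod.inter_restrict[symmetric])
  finally show ?thesis by (simp add: haar_fun_def)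
qed

lemma haar_level_0: "haar_level 0 = {indicator unit_cube}"
  by (simp add: haar_level_def)

lemma haar_level_Suc:
  "haar_level (Suc k) = (\<lambda>(i, S). haar_fun k i S) ` (Idx k \<times> (UNIV - {{}}) :: (('n::finite \<Rightarrow> nat) \<times> 'n set) set)"
proof (rule set_eqI, rule iffI)
  fix h :: "real^'n \<Rightarrow> real" assume "h \<in> haar_level (Suc k)"
  then obtain i S where i: "\<forall>j. i j \<in> {1..2^k}" and S: "S \<noteq> {}"
    and h: "h = (\<lambda>x. \<Prod>j\<in>UNIV. if j \<in> S then haar_wave (Suc k) (i j) (x $ j) else haar_box (Suc k) (i j) (x $ j))"
    by (auto simp: haar_level_def haar_block_def)
  define i' where "i' j = i j - 1" for j
  have i': "i' \<in> Idx k"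
    unfolding Idx_def i'_def
  proof (intro CollectI allI)
    fix j show "i j - 1 < 2^k" using i[rule_format, of j] by auto
  qed
  have ij: "i j = Suc (i' j)" for j using i[rule_format, of j] by (auto simp: i'_def)
  have "h = haar_fun k i' S" unfolding h ij haar_fun_eq[OF i'] by (rule refl)
  with i' S show "h \<in> (\<lambda>(i, S). haar_fun k i S) ` (Idx k \<times> (UNIV - {{}}))" by auto
next
  fix h :: "real^'n \<Rightarrow> real" assume "h \<in> (\<lambda>(i, S). haar_fun k i S) ` (Idx k \<times> (UNIV - {{}}))"
  then obtain i S where i: "i \<in> Idx k" and S: "S \<noteq> {}" and h: "h = haar_fun k i S" by auto
  have h': "h = (\<lambda>x. \<Prod>j\<in>UNIV. if j \<in> S then haar_wave (Suc k) (Suc (i j)) (x $ j) else haar_box (Suc k) (Suc (i j)) (x $ j))"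
    unfolding h by (rule ext) (rule haar_fun_eq[OF i, symmetric])
  have "\<forall>j. Suc (i j) \<in> {1..2^k}" using i by (auto simp: Idx_def Suc_le_eq)
  with S h' show "h \<in> haar_level (Suc k)"
    unfolding haar_level_def haar_block_def by auto
qed

lemma hsign_pconst: "pconst (Suc k) (hsign k S)"
  unfolding hsign_def by (rule pconst_idx)

lemma haar_fun_pconst: "pconst (Suc k) (haar_fun k i S)"
  unfolding haar_fun_def[abs_def]
  by (rule pconst_comp2[where h = "\<lambda>a b. 2 powr (real k * cdim TYPE('a) / 2) * a * b"]) (rule pconst_indicator_cell hsign_pconst; simp)+

lemma haar_fun_borel [measurable]: "(haar_fun k i S :: real^'a::finite \<Rightarrow> real) \<in> borel_measurable borel"
proof -
  define v :: "('a \<Rightarrow> nat) \<Rightarrow> real" where "v i' = 2 powr (real k * cdim TYPE('a) / 2) *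
      (if (\<lambda>j. i' j div 2) = i then 1 else 0) * (\<Prod>j\<in>S. (-1) ^ i' j)" for i'
  have eq: "(haar_fun k i S :: real^'a \<Rightarrow> real) = (\<lambda>x. if x \<in> hcube then v (idx (Suc k) x) else 0)"
  proof
    fix x :: "real^'a"
    have "idx k x = (\<lambda>j. idx (Suc k) x j div 2)"
    proof
      fix j show "idx k x j = idx (Suc k) x j div 2" using idx_div[of k x j 1] by simp
    qed
    then show "haar_fun k i S x = (if x \<in> hcube then v (idx (Suc k) x) else 0)"
      by (simp add: haar_fun_def hsign_def indicator_def cell_def v_def)
  qed
  show ?thesis unfolding eq by (rule borel_idx_fun)
qed

lemma indicator_unit_cube_hcube: "x \<in> hcube \<Longrightarrow> indicator unit_cube x = (1::real)"
  by (auto simp: unit_cube_def hcube_iff mem_box_cart indicator_def intro: less_imp_le)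

lemma indicator_unit_cube_pconst: "pconst k (indicator unit_cube :: real^'n \<Rightarrow> real)"
  by (simp add: pconst_def indicator_unit_cube_hcube)

lemma indicator_unit_cube_borel [measurable]: "(indicator unit_cube :: real^'n \<Rightarrow> real) \<in> borel_measurable borel"
  by (simp add: unit_cube_def)

lemma haar_level_pconst:
  assumes "h \<in> haar_level k"
  shows "pconst k h"
  using assms by (cases k) (auto simp: haar_level_0 haar_level_Suc haar_fun_pconst indicator_unit_cube_pconst)

lemma haar_level_borel: "h \<in> haar_level k \<Longrightarrow> h \<in> borel_measurable borel"
  by (cases k) (auto simp: haar_level_0 haar_level_Suc)

lemma finite_haar_level [simp]: "finite (haar_level k :: (real^'n \<Rightarrow> real) set)"
  by (cases k) (auto simp: haar_level_0 haar_level_Suc)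

lemma haar_level_nonempty: "(haar_level k :: (real^'n \<Rightarrow> real) set) \<noteq> {}"
proof (cases k)
  case (Suc l)
  have "(\<lambda>_. 0) \<in> (Idx l :: ('n \<Rightarrow> nat) set)" by (simp add: Idx_def)
  then show ?thesis by (auto simp: Suc haar_level_Suc intro!: exI[of _ UNIV])
qed (simp add: haar_level_0)

text \<open>The integral is a sum over the 2^d children of the cell, with indices 2 i j or 2 i j +
  1. It factorises over the coordinates, and a coordinate in S contributes 1 - 1 = 0.\<close>

lemma integral_cell_hsign:
  fixes i :: "'n::finite \<Rightarrow> nat"
  assumes i: "i \<in> Idx k" and S: "S \<noteq> {}"
  shows "(\<integral>x. indicator hcube x * (indicator (cell k i) x * hsign k S x) \<partial>lborel) = 0"
proof -
  have "pconst (Suc k) (\<lambda>x. indicator (cell k i) x * hsign k S x)"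
    by (rule pconst_comp2[where h = "(*)"]) (rule pconst_indicator_cell hsign_pconst; simp)+
  from integral_hcube_pconst[OF this]
  have "(\<integral>x. indicator hcube x * (indicator (cell k i) x * hsign k S x) \<partial>lborel)
      = (\<Sum>i'\<in>Idx (Suc k). indicator (cell k i) (corner (Suc k) i') * hsign k S (corner (Suc k) i')) * 2 powr (- real (Suc k) * cdim TYPE('n))" .
  also have "(\<Sum>i'\<in>Idx (Suc k). indicator (cell k i) (corner (Suc k) i') * hsign k S (corner (Suc k) i'))
     = (\<Sum>i'\<in>Idx (Suc k). if (\<lambda>j. i' j div 2) = i then (\<Prod>j\<in>S. (-1) ^ i' j) else 0)"
  proof (rule sum.cong)
    fix i' :: "'n \<Rightarrow> nat" assume i': "i' \<in> Idx (Suc k)"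
    have "idx k (corner (Suc k) i') j = i' j div 2" for j
      using idx_div[of k "corner (Suc k) i'" j 1] idx_corner[OF i'] by simp
    then show "indicator (cell k i) (corner (Suc k) i') * hsign k S (corner (Suc k) i') = (if (\<lambda>j. i' j div 2) = i then (\<Prod>j\<in>S. (-1) ^ i' j) else 0)"
      using corner_in_hcube[OF i'] by (auto simp: hsign_def idx_corner[OF i'] cell_def indicator_def fun_eq_iff)
  qed simp
  also have "\<dots> = (\<Sum>i'\<in>PiE UNIV (\<lambda>j. {2 * i j, 2 * i j + 1}). \<Prod>j\<in>UNIV. if j \<in> S then (-1) ^ i' j else 1)"
  proof (rule sum.mono_neutral_cong_right)
    show "PiE UNIV (\<lambda>j. {2 * i j, 2 * i j + 1}) \<subseteq> Idx (Suc k)"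
    proof
      fix i' assume "i' \<in> PiE UNIV (\<lambda>j. {2 * i j, 2 * i j + 1})"
      then have "i' j \<in> {2 * i j, 2 * i j + 1}" for j by (rule PiE_mem) simp
      then have "i' j \<le> 2 * i j + 1" for j by (metis insertE le_add1 order_refl singletonD)
      moreover have "2 * i j + 1 < 2^Suc k" for j
      proof -
        have "i j < 2^k" using i by (simp add: Idx_def)
        then show ?thesis by simp
      qed
      ultimately have "i' j < 2^Suc k" for j by (meson le_less_trans)
      then show "i' \<in> Idx (Suc k)" unfolding Idx_def by blast
    qed
    show "\<forall>i'\<in>Idx (Suc k) - PiE UNIV (\<lambda>j. {2 * i j, 2 * i j + 1}). (if (\<lambda>j. i' j div 2) = i then (\<Prod>j\<in>S. (-1) ^ i' j) else 0) = (0::real)"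
    proof
      fix i' assume i': "i' \<in> Idx (Suc k) - PiE UNIV (\<lambda>j. {2 * i j, 2 * i j + 1})"
      have "(\<lambda>j. i' j div 2) \<noteq> i"
      proof
        assume "(\<lambda>j. i' j div 2) = i"
        then have "i' j div 2 = i j" for j by (simp add: fun_eq_iff)
        then have "i' j = 2 * i j \<or> i' j = 2 * i j + 1" for j by (metis div_mult_mod_eq mod2_eq_if mult.commute add_0_right)
        then have "i' \<in> PiE UNIV (\<lambda>j. {2 * i j, 2 * i j + 1})" by (auto simp: PiE_def)
        with i' show False by simp
      qed
      then show "(if (\<lambda>j. i' j div 2) = i then (\<Prod>j\<in>S. (-1) ^ i' j) else 0) = (0::real)" by simp
    qed
    fix i' assume "i' \<in> PiE UNIV (\<lambda>j. {2 * i j, 2 * i j + 1})"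
    then have "i' j \<in> {2 * i j, 2 * i j + 1}" for j by (rule PiE_mem) simp
    then have "i' j = 2 * i j \<or> i' j = 2 * i j + 1" for j by blast
    then have "i' j div 2 = i j" for j
      proof -
      from \<open>\<And>j. i' j = 2 * i j \<or> i' j = 2 * i j + 1\<close>[of j] show ?thesis by presburger
    qed
    then have "(\<lambda>j. i' j div 2) = i" by auto
    then show "(if (\<lambda>j. i' j div 2) = i then (\<Prod>j\<in>S. (-1) ^ i' j) else 0) = (\<Prod>j\<in>UNIV. if j \<in> S then (-1) ^ i' j else (1::real))"
      by (simp add: prod.inter_restrict[symmetric])
  qed simp
  also have "\<dots> = (\<Prod>j\<in>UNIV. \<Sum>v\<in>{2 * i j, 2 * i j + 1}. if j \<in> S then (-1) ^ v else 1)"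
    by (rule prod_sum_PiE[symmetric]) auto
  also have "\<dots> = 0"
    using S by (intro prod_zero) auto
  finally show ?thesis by simp
qed

section \<open>Orthonormality of the Haar functions\<close>

lemma hsign_mult: "hsign k S x * hsign k T x = hsign k (S - T \<union> (T - S)) (x :: real^'n)"
proof -
  have *: "hsign k S x = (\<Prod>j\<in>UNIV. if j \<in> S then (-1) ^ idx (Suc k) x j else 1)" for S
    unfolding hsign_def by (simp add: prod.inter_restrict[symmetric])
  show ?thesis unfolding * prod.distrib[symmetric]
    by (intro prod.cong) (auto simp flip: power_mult_distrib)
qed

lemma hsign_empty [simp]: "hsign k {} x = 1"
  by (simp add: hsign_def)

lemma abs_hsign [simp]: "\<bar>hsign k S x\<bar> = 1"
  by (simp add: hsign_def abs_prod)

lemma integral_haar_fun: "i \<in> Idx k \<Longrightarrow> S \<noteq> {} \<Longrightarrow> (\<integral>x. indicator hcube x * haar_fun k i S x \<partial>lborel) = 0"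
  using integral_cell_hsign[of i k S]
  by (simp add: haar_fun_def mult.assoc mult.left_commute[of _ "2 powr _"])

text \<open>Different cells are disjoint. On one cell the product of two sign patterns is the
  pattern of their symmetric difference, which integrates to 0 unless it is empty.\<close>

lemma hint_haar_fun_same_level:
  fixes i i' :: "'n::finite \<Rightarrow> nat"
  assumes i: "i \<in> Idx k"
  shows "hint (haar_fun k i S) (haar_fun k i' T) = (if i = i' \<and> S = T then 1 else 0)"
proof (cases "i = i'")
  case True
  have pp: "2 powr (real k * cdim TYPE('n) / 2) * 2 powr (real k * cdim TYPE('n) / 2) = (2::real) powr (real k * cdim TYPE('n))"
    by (simp flip: powr_add)
  have "haar_fun k i S x * haar_fun k i T x = 2 powr (real k * cdim TYPE('n)) * (indicator (cell k i) x * hsign k (S - T \<union> (T - S)) x)" for x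
    unfolding hsign_mult[symmetric] pp[symmetric] by (simp add: haar_fun_def indicator_def)
  then have eq: "hint (haar_fun k i S) (haar_fun k i T) = 2 powr (real k * cdim TYPE('n)) * (\<integral>x. indicator hcube x * (indicator (cell k i) x * hsign k (S - T \<union> (T - S)) x) \<partial>lborel)"
    unfolding hint_def by (simp add: mult.left_commute[of _ "2 powr _"])
  show ?thesis
  proof (cases "S = T")
    case False
    then have "S - T \<union> (T - S) \<noteq> {}" by auto
    with False True show ?thesis using eq integral_cell_hsign[OF i] by auto
  next
    case S: True
    have "(\<integral>x. indicator hcube x * indicator (cell k i) x \<partial>lborel) = (\<integral>x. indicator (cell k i) x \<partial>lborel :: real)"
      using cell_subset[of k i] by (intro Bochner_Integration.integral_cong) (auto simp: indicator_def)
    also have "\<dots> = 2 powr (- real k * cdim TYPE('n))" using i by (simp add: measure_def emeasure_cell)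
    finally show ?thesis using True S eq by (simp flip: powr_add)
  qed
next
  case False
  then have "haar_fun k i S x * haar_fun k i' T x = 0" for x
    by (auto simp: haar_fun_def indicator_def cell_def)
  then have "hint (haar_fun k i S) (haar_fun k i' T) = 0"
    unfolding hint_def by (simp only: mult_zero_right integral_zero)
  then show ?thesis using False by simp
qed

text \<open>A step function of level \<open>k\<close> is constant on the support of a Haar function of a higher level.\<close>

lemma hint_step_haar_fun:
  fixes g :: "real^'n \<Rightarrow> real"
  assumes g: "pconst k g" and k: "k \<le> l" and i: "i \<in> Idx l" and S: "S \<noteq> {}"
  shows "hint g (haar_fun l i S) = 0"
proof -
  have "indicator hcube x * (g x * haar_fun l i S x) = g (corner l i) * (indicator hcube x * haar_fun l i S x)" for x
    using pconst_cell[OF pconst_mono[OF g k], of x i] by (cases "x \<in> cell l i") (auto simp: haar_fun_def)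
  then have "hint g (haar_fun l i S) = g (corner l i) * (\<integral>x. indicator hcube x * haar_fun l i S x \<partial>lborel)"
    unfolding hint_def by (simp only: integral_mult_right_zero)
  then show ?thesis using integral_haar_fun[OF i S] by simp
qed

lemma hint_commute: "hint f g = hint g f"
  by (simp add: hint_def mult.commute)

lemma hint_step_haar_level:
  fixes g :: "real^'n \<Rightarrow> real"
  assumes "pconst k g" "k < l" "h \<in> haar_level l"
  shows "hint g h = 0"
proof (cases l)
  case (Suc m)
  with assms hint_step_haar_fun[OF assms(1), of m] show ?thesis by (auto simp: haar_level_Suc)
qed (use assms in auto)

lemma hint_haar_levels:
  assumes "h \<in> haar_level k" "h' \<in> haar_level l" "k \<noteq> l"
  shows "hint h h' = 0"
  using assms hint_step_haar_level[OF haar_level_pconst, of h k l h'] hint_step_haar_level[OF haar_level_pconst, of h' l k h]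
    hint_commute[of h h'] by (cases "k < l") auto

lemma hint_unit_cube: "hint (indicator unit_cube) (indicator unit_cube :: real^'n \<Rightarrow> real) = 1"
proof -
  have "hint (indicator unit_cube) (indicator unit_cube :: real^'n \<Rightarrow> real) = (\<integral>x. indicator (hcube :: (real^'n) set) x \<partial>lborel)"
    unfolding hint_def by (intro Bochner_Integration.integral_cong) (auto simp: indicator_unit_cube_hcube indicator_def[of hcube])
  then show ?thesis by (simp add: measure_def)
qed

lemma hint_haar_self:
  assumes "h \<in> haar_level k"
  shows "hint h h = 1"
  using assms by (cases k) (auto simp: haar_level_0 haar_level_Suc hint_unit_cube hint_haar_fun_same_level)

lemma haar_levels_disjoint: "h \<in> haar_level k \<Longrightarrow> h \<in> haar_level l \<Longrightarrow> k = l"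
  using hint_haar_levels[of h k h l] hint_haar_self[of h k] by auto

text \<open>Injectivity comes from orthonormality: equal functions have inner product 1, functions
  with different parameters 0.\<close>

lemma inj_haar_fun: "inj_on (\<lambda>(i, S). haar_fun k i S) (Idx k \<times> UNIV :: (('n::finite \<Rightarrow> nat) \<times> 'n set) set)"
proof (rule inj_onI, clarsimp)
  fix i i' :: "'n \<Rightarrow> nat" and S S' :: "'n set"
  assume "i \<in> Idx k" "i' \<in> Idx k" "haar_fun k i S = haar_fun k i' S'"
  then show "i = i' \<and> S = S'"
    using hint_haar_fun_same_level[of i k S i' S'] hint_haar_fun_same_level[of i k S i S] by (auto split: if_splits)
qed

lemma haar_orthonormal:
  assumes "h \<in> haar_system" "h' \<in> haar_system"
  shows "hint h h' = (if h = h' then 1 else 0)"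
proof (cases "h = h'")
  case True
  then show ?thesis using assms hint_haar_self by (auto simp: haar_system_def)
next
  case False
  obtain k l where kl: "h \<in> haar_level k" "h' \<in> haar_level l" using assms by (auto simp: haar_system_def)
  show ?thesis
  proof (cases "k = l")
    case True
    show ?thesis
    proof (cases k)
      case 0
      then show ?thesis using kl True False by (auto simp: haar_level_0)
    next
      case (Suc m)
      then show ?thesis using kl True False by (auto simp: haar_level_Suc hint_haar_fun_same_level split: if_splits)
    qed
  qed (use hint_haar_levels[OF kl] False in auto)
qed

section \<open>Reproducing kernels of the Haar levels\<close>

lemma sum_haar_level_Suc:
  "(\<Sum>h\<in>haar_level (Suc k). F h) = (\<Sum>i\<in>Idx k. \<Sum>S\<in>UNIV - {{}}. F (haar_fun k i S :: real^'n::finite \<Rightarrow> real))"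
proof -
  have "inj_on (\<lambda>(i, S). haar_fun k i S) (Idx k \<times> (UNIV - {{}}) :: (('n \<Rightarrow> nat) \<times> 'n set) set)"
    by (rule inj_on_subset[OF inj_haar_fun]) auto
  then show ?thesis
    unfolding haar_level_Suc by (subst sum.reindex) (auto simp: sum.cartesian_product case_prod_unfold)
qed

text \<open>This is the difference of the reproducing kernels of two consecutive levels. For x and y
  in a common cell the sum over nonempty S is the product of all 1 + a j minus the empty term; the
  product is 2^d if they share the finer cell, and 0 otherwise because a j = -1 in a coordinate
  where the finer indices differ.\<close>

lemma haar_kernel_level:
  fixes x y :: "real^'n"
  assumes x: "x \<in> hcube" and y: "y \<in> hcube"
  shows "(\<Sum>h\<in>haar_level (Suc k). h x * h y) =
    2 powr (real (Suc k) * cdim TYPE('n)) * (if idx (Suc k) x = idx (Suc k) y then 1 else 0)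
    - 2 powr (real k * cdim TYPE('n)) * (if idx k x = idx k y then 1 else 0)"
proof -
  define P where "P = (2::real) powr (real k * cdim TYPE('n))"
  have pp: "2 powr (real k * cdim TYPE('n) / 2) * 2 powr (real k * cdim TYPE('n) / 2) = P"
    by (simp add: P_def flip: powr_add)
  define a where "a j = (-1 :: real) ^ idx (Suc k) x j * (-1) ^ idx (Suc k) y j" for j
  have hh: "haar_fun k i S x * haar_fun k i S y = (if i = idx k x then (if idx k x = idx k y then P * (\<Prod>j\<in>S. a j) else 0) else 0)" for i S
    using x y unfolding pp[symmetric]
    by (auto simp: haar_fun_def hsign_def a_def cell_def prod.distrib)
  have "(\<Sum>h\<in>haar_level (Suc k). h x * h y) = (\<Sum>i\<in>Idx k. \<Sum>S\<in>UNIV - {{}}. haar_fun k i S x * haar_fun k i S y)"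
    by (rule sum_haar_level_Suc)
  also have "\<dots> = (\<Sum>S\<in>UNIV - {{}}. \<Sum>i\<in>Idx k. haar_fun k i S x * haar_fun k i S y)"
    by (rule sum.swap)
  also have "\<dots> = (\<Sum>S\<in>UNIV - {{}}. if idx k x = idx k y then P * (\<Prod>j\<in>S. a j) else 0)"
    unfolding hh using idx_in_Idx[OF x, of k] by simp
  also have "\<dots> = (if idx k x = idx k y then P * (\<Sum>S\<in>UNIV - {{}}. \<Prod>j\<in>S. a j) else 0)"
    by (simp add: sum_distrib_left)
  also have "(\<Sum>S\<in>UNIV - {{}}. \<Prod>j\<in>S. a j) = (\<Sum>S\<in>Pow UNIV. \<Prod>j\<in>S. a j) - 1"
    by (simp add: sum_diff1)
  also have "(\<Sum>S\<in>Pow UNIV. \<Prod>j\<in>S. a j) = (\<Prod>j\<in>UNIV. a j + 1)"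
    by (subst prod_add) auto
  finally have eq: "(\<Sum>h\<in>haar_level (Suc k). h x * h y) = (if idx k x = idx k y then P * ((\<Prod>j\<in>UNIV. a j + 1) - 1) else 0)" .
  have prod: "(\<Prod>j\<in>UNIV. a j + 1) = (if idx (Suc k) x = idx (Suc k) y then 2 powr cdim TYPE('n) else 0)" if e: "idx k x = idx k y"
  proof (cases "idx (Suc k) x = idx (Suc k) y")
    case True
    then have "a j = 1" for j by (simp add: a_def flip: power_mult_distrib)
    with True show ?thesis by (simp add: powr_realpow)
  next
    case False
    then obtain j where j: "idx (Suc k) x j \<noteq> idx (Suc k) y j" by (auto simp: fun_eq_iff)
    have "idx (Suc k) x j div 2 = idx (Suc k) y j div 2"
      using e idx_div[of k x j 1] idx_div[of k y j 1] by simp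
    with j have "even (idx (Suc k) x j) \<noteq> even (idx (Suc k) y j)" by (metis bit_eq_rec)
    then have "a j + 1 = 0" by (auto simp: a_def)
    with False show ?thesis by (auto intro!: prod_zero)
  qed
  have "idx (Suc k) x = idx (Suc k) y \<Longrightarrow> idx k x = idx k y" using idx_eq_mono[of k "Suc k" x y] by simp
  then show ?thesis
    unfolding eq using prod by (auto simp: P_def algebra_simps powr_add)
qed

definition haar_upto :: "nat \<Rightarrow> (real^'n \<Rightarrow> real) set" where
  "haar_upto k = (\<Union>l\<le>k. haar_level l)"

lemma finite_haar_upto [simp]: "finite (haar_upto k :: (real^'n \<Rightarrow> real) set)"
  by (simp add: haar_upto_def)

lemma haar_upto_0: "haar_upto 0 = {indicator unit_cube}"
  by (simp add: haar_upto_def haar_level_0)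

lemma haar_upto_Suc: "haar_upto (Suc k) = haar_upto k \<union> haar_level (Suc k)"
  by (auto simp: haar_upto_def atMost_Suc)

lemma haar_upto_disjoint: "haar_upto k \<inter> haar_level (Suc k) = {}"
  by (auto simp: haar_upto_def dest: haar_levels_disjoint)

lemma haar_upto_subset: "haar_upto k \<subseteq> haar_system"
  by (auto simp: haar_upto_def haar_system_def)

lemma haar_upto_pconst: "h \<in> haar_upto k \<Longrightarrow> pconst k h"
  by (auto simp: haar_upto_def intro: pconst_mono[OF haar_level_pconst])

lemma haar_system_borel: "h \<in> haar_system \<Longrightarrow> h \<in> borel_measurable borel"
  by (auto simp: haar_system_def haar_level_borel)

lemma haar_system_pconst: "h \<in> haar_system \<Longrightarrow> \<exists>k. pconst k h"
  by (auto simp: haar_system_def dest: haar_level_pconst)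

lemma haar_kernel:
  fixes x y :: "real^'n"
  assumes x: "x \<in> hcube" and y: "y \<in> hcube"
  shows "(\<Sum>h\<in>haar_upto k. h x * h y) = 2 powr (real k * cdim TYPE('n)) * (if idx k x = idx k y then 1 else 0)"
proof (induction k)
  case 0
  then show ?case using x y by (simp add: haar_upto_0 indicator_unit_cube_hcube idx_0)
next
  case (Suc k)
  have "(\<Sum>h\<in>haar_upto (Suc k). h x * h y) = (\<Sum>h\<in>haar_upto k. h x * h y) + (\<Sum>h\<in>haar_level (Suc k). h x * h y)"
    unfolding haar_upto_Suc by (rule sum.union_disjoint) (auto simp: haar_upto_disjoint)
  then show ?case unfolding Suc haar_kernel_level[OF assms] by simp
qed

lemma haar_sum_eq_avg:
  fixes f :: "real^'n \<Rightarrow> real"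
  assumes f: "f \<in> borel_measurable borel" "pint 1 f < top" and x: "x \<in> hcube"
  shows "(\<Sum>h\<in>haar_upto k. hint f h * h x) = avg k f x"
proof -
  have int: "integrable lborel (\<lambda>y. indicator hcube y * (f y * h y))" if h: "h \<in> haar_upto k" for h
  proof -
    obtain B where B: "\<And>x. x \<in> hcube \<Longrightarrow> \<bar>h x\<bar> \<le> B" using pconst_bounded[OF haar_upto_pconst[OF h]] by blast
    have "h \<in> borel_measurable borel" using h haar_upto_subset by (intro haar_system_borel) auto
    from hint_integrable(1)[OF f(1) this f(2) B] show ?thesis .
  qed
  have "(\<Sum>h\<in>haar_upto k. hint f h * h x) = (\<integral>y. (\<Sum>h\<in>haar_upto k. (indicator hcube y * (f y * h y)) * h x) \<partial>lborel)"
    unfolding hint_def using int by (subst Bochner_Integration.integral_sum) auto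
  also have "\<dots> = (\<integral>y. 2 powr (real k * cdim TYPE('n)) * (indicator (cell k (idx k x)) y * f y) \<partial>lborel)"
  proof (rule Bochner_Integration.integral_cong[OF refl])
    fix y
    show "(\<Sum>h\<in>haar_upto k. (indicator hcube y * (f y * h y)) * h x) = 2 powr (real k * cdim TYPE('n)) * (indicator (cell k (idx k x)) y * f y)"
    proof (cases "y \<in> hcube")
      case True
      have "(\<Sum>h\<in>haar_upto k. (indicator hcube y * (f y * h y)) * h x) = f y * (\<Sum>h\<in>haar_upto k. h x * h y)"
        using True by (simp add: sum_distrib_left mult_ac)
      then show ?thesis unfolding haar_kernel[OF x True] using True by (simp add: indicator_def cell_def)
    qed (auto simp: cell_def)
  qed
  finally show ?thesis using x by (simp add: avg_def)
qed

lemma haar_expansion_pconst: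
  fixes g :: "real^'n \<Rightarrow> real"
  assumes g: "pconst k g" "g \<in> borel_measurable borel" and x: "x \<in> hcube"
  shows "(\<Sum>h\<in>haar_upto k. hint g h * h x) = g x"
  using haar_sum_eq_avg[OF g(2) pint1_pconst_finite[OF g] x, of k] avg_id[OF g(1) x] by simp

lemma pconst_cmult: "pconst k f \<Longrightarrow> pconst k (\<lambda>x. c * f x :: real)"
  by (rule pconst_comp[where g = "\<lambda>u. c * u"])

text \<open>Only the cell containing x contributes, and 2^d bounds the number of patterns S.\<close>

lemma haar_kernel_abs:
  fixes x y :: "real^'n"
  assumes x: "x \<in> hcube" and y: "y \<in> hcube"
  shows "(\<Sum>h\<in>haar_level (Suc k). \<bar>h x\<bar> * \<bar>h y\<bar>)
    \<le> 2 powr cdim TYPE('n) * (2 powr (real k * cdim TYPE('n)) * indicator (cell k (idx k x)) y)"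
proof -
  define P where "P = (2::real) powr (real k * cdim TYPE('n)) * indicator (cell k (idx k x)) y"
  have pp: "2 powr (real k * cdim TYPE('n) / 2) * 2 powr (real k * cdim TYPE('n) / 2) = (2::real) powr (real k * cdim TYPE('n))"
    by (simp flip: powr_add)
  have P0: "0 \<le> P" by (simp add: P_def)
  have hh: "\<bar>haar_fun k i S x\<bar> * \<bar>haar_fun k i S y\<bar> = (if i = idx k x then P else 0)" for i S
    using x y unfolding P_def pp[symmetric]
    by (auto simp: haar_fun_def abs_mult cell_def indicator_def)
  have "(\<Sum>h\<in>haar_level (Suc k). \<bar>h x\<bar> * \<bar>h y\<bar>) = (\<Sum>i\<in>Idx k. \<Sum>S\<in>UNIV - {{}}. \<bar>haar_fun k i S x\<bar> * \<bar>haar_fun k i S y\<bar>)"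
    by (rule sum_haar_level_Suc)
  also have "\<dots> = (\<Sum>S\<in>(UNIV - {{}} :: 'n set set). \<Sum>i\<in>Idx k. if i = idx k x then P else 0)"
    unfolding hh by (rule sum.swap)
  also have "\<dots> = (\<Sum>S\<in>(UNIV - {{}} :: 'n set set). P)"
    using idx_in_Idx[OF x, of k] by simp
  also have "\<dots> \<le> (\<Sum>S\<in>(UNIV :: 'n set set). P)"
    using P0 by (intro sum_mono2) auto
  also have "\<dots> = 2 powr cdim TYPE('n) * P"
  proof -
    have "card (UNIV :: 'n set set) = 2 ^ CARD('n)" by (metis Pow_UNIV card_Pow finite)
    then show ?thesis by (simp add: powr_realpow)
  qed
  finally show ?thesis by (simp add: P_def)
qed

text \<open>This makes the order within a level harmless. The coefficients are inner products with
  the full block D, so any partial block is dominated pointwise by 2^d times the cell average of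
  |D|. Averaging one level up costs only 2^\<delta> in \<open>pint\<close>, since D is a step
  function of the next level; the constant is independent of k.\<close>

lemma haar_block_bound:
  assumes p: "0 < p" "p \<le> 1"
  shows "\<exists>C\<ge>0. \<forall>k B c. B \<subseteq> haar_level (Suc k) \<longrightarrow>
    pint p (\<lambda>x::real^'n. \<Sum>h\<in>B. c h * h x) \<le> ennreal C * pint p (\<lambda>x. \<Sum>h\<in>haar_level (Suc k). c h * h x)"
proof -
  define \<delta> where "\<delta> = cdim TYPE('n) * (1 - p)"
  define A where "A = (2::real) powr cdim TYPE('n)"
  have A0: "0 \<le> A" by (simp add: A_def)
  have "pint p (\<lambda>x. \<Sum>h\<in>B. c h * h x) \<le> ennreal (A powr p * 2 powr \<delta>) * pint p (\<lambda>x. \<Sum>h\<in>haar_level (Suc k). c h * h x)"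
    if B: "B \<subseteq> haar_level (Suc k)" for k and B :: "(real^'n \<Rightarrow> real) set" and c
  proof -
    define D where "D x = (\<Sum>h\<in>haar_level (Suc k). c h * h x)" for x :: "real^'n"
    note [measurable] = haar_level_borel
    have Db [measurable]: "D \<in> borel_measurable borel" unfolding D_def by measurable
    have Dp: "pconst (Suc k) D"
      unfolding D_def by (intro pconst_sum pconst_cmult haar_level_pconst)
    have D1: "pint 1 D < top" by (rule pint1_pconst_finite[OF Dp Db])
    have absD: "pint 1 (\<lambda>x. \<bar>D x\<bar>) = pint 1 D" by (simp add: pint_def)
    have c: "c h = hint D h" if h: "h \<in> haar_level (Suc k)" for h
    proof -
      have "hint D h = (\<Sum>g\<in>haar_level (Suc k). c g * hint g h)"
        unfolding D_def
        by (rule hint_sum_left[OF _ _ _ haar_level_pconst[OF h] haar_level_borel[OF h]])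
           (auto simp: haar_level_borel intro: pint1_pconst_finite[OF haar_level_pconst])
      also have "\<dots> = (\<Sum>g\<in>haar_level (Suc k). if g = h then c h else 0)"
      proof (rule sum.cong)
        fix g :: "real^'n \<Rightarrow> real" assume "g \<in> haar_level (Suc k)"
        then show "c g * hint g h = (if g = h then c h else 0)"
          using haar_orthonormal[of g h] h unfolding haar_system_def by fastforce
      qed simp
      also have "\<dots> = c h" using h by simp
      finally show ?thesis ..
    qed
    have "\<bar>\<Sum>h\<in>B. c h * h x\<bar> \<le> \<bar>A * avg k (\<lambda>x. \<bar>D x\<bar>) x\<bar>" if x: "x \<in> hcube" for x
    proof -
      have int: "integrable lborel (\<lambda>y. indicator hcube y * (\<bar>D y\<bar> * \<bar>h y\<bar>))" if h: "h \<in> haar_level (Suc k)" for h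
      proof -
        obtain b where b: "\<And>x. x \<in> hcube \<Longrightarrow> \<bar>h x\<bar> \<le> b" using pconst_bounded[OF haar_level_pconst[OF h]] by blast
        have [measurable]: "h \<in> borel_measurable borel" by (rule haar_level_borel[OF h])
        show ?thesis by (rule hint_integrable(1)[where B = b]) (use D1 absD b in auto)
      qed
      have cx: "\<bar>c h\<bar> \<le> (\<integral>y. indicator hcube y * (\<bar>D y\<bar> * \<bar>h y\<bar>) \<partial>lborel)" if h: "h \<in> haar_level (Suc k)" for h
      proof -
        have "\<bar>c h\<bar> \<le> (\<integral>y. norm (indicator hcube y * (D y * h y)) \<partial>lborel)"
          unfolding c[OF h] hint_def using integral_norm_bound[of lborel "\<lambda>y. indicator hcube y * (D y * h y)"] by simp
        also have "\<dots> = (\<integral>y. indicator hcube y * (\<bar>D y\<bar> * \<bar>h y\<bar>) \<partial>lborel)"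
          by (intro Bochner_Integration.integral_cong) (auto simp: abs_mult)
        finally show ?thesis .
      qed
      have "\<bar>\<Sum>h\<in>B. c h * h x\<bar> \<le> (\<Sum>h\<in>B. \<bar>c h\<bar> * \<bar>h x\<bar>)"
        using sum_abs[of "\<lambda>h. c h * h x" B] by (simp add: abs_mult)
      also have "\<dots> \<le> (\<Sum>h\<in>haar_level (Suc k). \<bar>c h\<bar> * \<bar>h x\<bar>)"
        using B by (intro sum_mono2) auto
      also have "\<dots> \<le> (\<Sum>h\<in>haar_level (Suc k). (\<integral>y. indicator hcube y * (\<bar>D y\<bar> * \<bar>h y\<bar>) \<partial>lborel) * \<bar>h x\<bar>)"
        by (intro sum_mono mult_right_mono cx) auto
      also have "\<dots> = (\<integral>y. (\<Sum>h\<in>haar_level (Suc k). indicator hcube y * (\<bar>D y\<bar> * \<bar>h y\<bar>) * \<bar>h x\<bar>) \<partial>lborel)"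
        using int by (subst Bochner_Integration.integral_sum) auto
      also have "\<dots> \<le> (\<integral>y. A * (2 powr (real k * cdim TYPE('n)) * (indicator (cell k (idx k x)) y * \<bar>D y\<bar>)) \<partial>lborel)"
      proof (rule integral_mono)
        show "integrable lborel (\<lambda>y. \<Sum>h\<in>haar_level (Suc k). indicator hcube y * (\<bar>D y\<bar> * \<bar>h y\<bar>) * \<bar>h x\<bar>)"
          using int by (intro Bochner_Integration.integrable_sum integrable_mult_left) auto
        show "integrable lborel (\<lambda>y. A * (2 powr (real k * cdim TYPE('n)) * (indicator (cell k (idx k x)) y * \<bar>D y\<bar>)))"
          by (intro integrable_mult_right integrable_indicator_pint1) (use D1 absD cell_subset in auto)
        fix y
        show "(\<Sum>h\<in>haar_level (Suc k). indicator hcube y * (\<bar>D y\<bar> * \<bar>h y\<bar>) * \<bar>h x\<bar>)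
          \<le> A * (2 powr (real k * cdim TYPE('n)) * (indicator (cell k (idx k x)) y * \<bar>D y\<bar>))"
        proof (cases "y \<in> hcube")
          case True
          have "(\<Sum>h\<in>haar_level (Suc k). indicator hcube y * (\<bar>D y\<bar> * \<bar>h y\<bar>) * \<bar>h x\<bar>)
              = \<bar>D y\<bar> * (\<Sum>h\<in>haar_level (Suc k). \<bar>h x\<bar> * \<bar>h y\<bar>)"
            using True by (simp add: sum_distrib_left mult_ac)
          also have "\<dots> \<le> \<bar>D y\<bar> * (A * (2 powr (real k * cdim TYPE('n)) * indicator (cell k (idx k x)) y))"
            unfolding A_def by (intro mult_left_mono haar_kernel_abs x True) auto
          finally show ?thesis by (simp add: mult_ac)
        qed (use A0 in auto)
      qed
      also have "\<dots> = A * avg k (\<lambda>x. \<bar>D x\<bar>) x" using x by (simp add: avg_def)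
      finally show ?thesis by simp
    qed
    then have "pint p (\<lambda>x. \<Sum>h\<in>B. c h * h x) \<le> pint p (\<lambda>x. A * avg k (\<lambda>x. \<bar>D x\<bar>) x)"
      using p by (intro pint_mono)
    also have "\<dots> = ennreal (A powr p) * pint p (avg k (\<lambda>x. \<bar>D x\<bar>))"
      using A0 by (simp add: pint_cmult)
    also have "pint p (avg k (\<lambda>x. \<bar>D x\<bar>)) \<le> ennreal (2 powr (- \<delta> * real k)) *
        (\<Sum>i\<in>Idx k. (\<integral>\<^sup>+x\<in>cell k i. ennreal \<bar>\<bar>D x\<bar>\<bar> \<partial>lborel) powe p)"
      unfolding \<delta>_def by (rule pint_avg_le) (use p D1 absD in auto)
    also have "\<dots> \<le> ennreal (2 powr (- \<delta> * real k)) * (ennreal (2 powr (\<delta> * real (Suc k))) * pint p D)"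
      using cells_powe_le[OF p Dp Db, of k] unfolding \<delta>_def by (intro mult_left_mono) auto
    also have "\<dots> = ennreal (2 powr \<delta>) * pint p D"
      unfolding mult.assoc[symmetric] by (simp add: algebra_simps flip: ennreal_mult powr_add)
    also have "ennreal (A powr p) * (ennreal (2 powr \<delta>) * pint p D) = ennreal (A powr p * 2 powr \<delta>) * pint p D"
      by (simp add: ennreal_mult mult.assoc)
    finally show ?thesis by (simp add: D_def[abs_def] mult_left_mono)
  qed
  then show ?thesis by (intro exI[of _ "A powr p * 2 powr \<delta>"]) auto
qed

subsection \<open>Natural enumerations\<close>

text \<open>Also the index at which every natural enumeration starts level k + 1. The type argument
  carries the dimension.\<close>

definition haar_count :: "'n::finite itself \<Rightarrow> nat \<Rightarrow> nat" where
  "haar_count _ k = card (haar_upto k :: (real^'n \<Rightarrow> real) set)"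

lemma haar_count_0: "haar_count TYPE('n::finite) 0 = 1"
  by (simp add: haar_count_def haar_upto_0)

lemma haar_count_less_Suc: "haar_count TYPE('n::finite) k < haar_count TYPE('n) (Suc k)"
proof -
  have "haar_count TYPE('n) (Suc k) = haar_count TYPE('n) k + card (haar_level (Suc k) :: (real^'n \<Rightarrow> real) set)"
    unfolding haar_count_def haar_upto_Suc by (rule card_Un_disjoint) (auto simp: haar_upto_disjoint)
  moreover have "card (haar_level (Suc k) :: (real^'n \<Rightarrow> real) set) > 0"
    by (simp add: card_gt_0_iff haar_level_nonempty)
  ultimately show ?thesis by simp
qed

lemma haar_count_strict_mono: "strict_mono (haar_count TYPE('n::finite))"
  by (simp add: strict_mono_Suc_iff haar_count_less_Suc)

lemma haar_count_ge: "k < haar_count TYPE('n::finite) k"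
proof (induction k)
  case (Suc k)
  then show ?case using haar_count_less_Suc[where 'n = 'n, of k] by linarith
qed (simp add: haar_count_0)

lemma haar_count_between:
  assumes "haar_count TYPE('n::finite) K \<le> M"
  obtains k where "K \<le> k" "haar_count TYPE('n) k \<le> M" "M < haar_count TYPE('n) (Suc k)"
proof -
  define j where "j = (LEAST j. M < haar_count TYPE('n) j)"
  have ex: "\<exists>j. M < haar_count TYPE('n) j" using haar_count_ge by blast
  have j: "M < haar_count TYPE('n) j" unfolding j_def by (rule LeastI_ex[OF ex])
  have Kj: "K < j" using j assms strict_mono_less[OF haar_count_strict_mono[where 'n = 'n], of K j] by linarith
  then obtain k where k: "j = Suc k" by (cases j) auto
  have "haar_count TYPE('n) k \<le> M"
    using not_less_Least[of k "\<lambda>j. M < haar_count TYPE('n) j"] k unfolding j_def[symmetric] by simp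
  then show ?thesis using that[of k] Kj j k by simp
qed

text \<open>\<open>natural_enumeration\<close> compares consecutive levels only; the intermediate
  levels are nonempty, so the comparison can be chained.\<close>

lemma natural_enumeration_less:
  assumes e: "natural_enumeration (e :: nat \<Rightarrow> real^'n \<Rightarrow> real)"
  shows "e m \<in> haar_level k \<Longrightarrow> e n \<in> haar_level (Suc (k + l)) \<Longrightarrow> m < n"
proof (induction l arbitrary: n)
  case 0
  then show ?case using e unfolding natural_enumeration_def by auto
next
  case (Suc l)
  obtain h where h: "h \<in> (haar_level (Suc (k + l)) :: (real^'n \<Rightarrow> real) set)" using haar_level_nonempty by blast
  then have "h \<in> range e" using e unfolding natural_enumeration_def bij_betw_def haar_system_def by blast
  then obtain n' where n': "h = e n'" by blast
  have "m < n'" using Suc.IH[of n'] Suc.prems(1) h n' by simp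
  moreover have "n' < n"
    using e h n' Suc.prems(2) unfolding natural_enumeration_def by auto
  ultimately show ?case by simp
qed

lemma finite_downward_closed_nat:
  assumes "finite (A :: nat set)" "\<And>m n. n \<in> A \<Longrightarrow> m < n \<Longrightarrow> m \<in> A"
  shows "A = {..<card A}"
proof (cases "A = {}")
  case False
  have "A = {..<Suc (Max A)}"
  proof (intro equalityI subsetI)
    fix x assume "x \<in> {..<Suc (Max A)}"
    then have "x < Max A \<or> x = Max A" by auto
    then show "x \<in> A" using assms(2)[OF Max_in[OF assms(1) False], of x] Max_in[OF assms(1) False] by auto
  qed (use assms(1) in \<open>auto simp: less_Suc_eq_le\<close>)
  then show ?thesis by (metis card_lessThan)
qed simp

text \<open>The indices of functions up to level k form a finite downward closed set, hence an
  initial segment, whose length is the number of these functions.\<close>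

lemma natural_enumeration_image:
  assumes e: "natural_enumeration (e :: nat \<Rightarrow> real^'n \<Rightarrow> real)"
  shows "e ` {..<haar_count TYPE('n) k} = haar_upto k"
    and "inj e" and "e m \<in> haar_system"
proof -
  show inj: "inj e" and "e m \<in> haar_system" using e by (auto simp: natural_enumeration_def bij_betw_def)
  have ran: "range e = haar_system" using e by (auto simp: natural_enumeration_def bij_betw_def)
  define A where "A = {m. e m \<in> haar_upto k}"
  have eA: "e ` A = haar_upto k"   proof (intro equalityI subsetI)
    fix h :: "real^'n \<Rightarrow> real" assume h: "h \<in> haar_upto k"
    then have "h \<in> range e" unfolding ran using haar_upto_subset by blast
    then obtain m where "h = e m" by blast
    with h show "h \<in> e ` A" by (simp add: A_def)
  qed (auto simp: A_def)
  have injA: "inj_on e A" using inj by (rule inj_on_subset) simp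
  have fin: "finite A" using finite_imageD[of e A] eA injA by simp
  have cA: "card A = haar_count TYPE('n) k" using card_image[OF injA] eA by (simp add: haar_count_def)
  have "A = {..<card A}"
  proof (rule finite_downward_closed_nat[OF fin])
    fix m n assume n: "n \<in> A" and mn: "m < n"
    obtain l where l: "l \<le> k" "e n \<in> haar_level l" using n by (auto simp: A_def haar_upto_def)
    obtain l' where l': "e m \<in> haar_level l'" using ran by (auto simp: haar_system_def)
    show "m \<in> A"
    proof (rule ccontr)
      assume "m \<notin> A"
      then have "k < l'" using l' by (auto simp: A_def haar_upto_def not_le)
      then have "n < m" using natural_enumeration_less[OF e l(2), of m "l' - l - 1"] l l' by simp
      with mn show False by simp
    qed
  qed
  then show "e ` {..<haar_count TYPE('n) k} = haar_upto k" using eA cA by simp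
qed

lemma sum_natural_enumeration:
  assumes e: "natural_enumeration (e :: nat \<Rightarrow> real^'n \<Rightarrow> real)"
  shows "(\<Sum>m<haar_count TYPE('n) k. F (e m)) = (\<Sum>h\<in>haar_upto k. F h)"
  unfolding natural_enumeration_image(1)[OF e, of k, symmetric]
  by (subst sum.reindex) (auto intro: inj_on_subset[OF natural_enumeration_image(2)[OF e]])

lemma natural_enumeration_0:
  assumes e: "natural_enumeration (e :: nat \<Rightarrow> real^'n \<Rightarrow> real)"
  shows "e 0 = indicator unit_cube"
proof -
  have "e ` {..<Suc 0} = {indicator unit_cube}"
    using natural_enumeration_image(1)[OF e, of 0] by (simp add: haar_count_0 haar_upto_0)
  then show ?thesis by (metis image_eqI lessI lessThan_iff singletonD)
qed

lemma natural_enumeration_borel: "natural_enumeration e \<Longrightarrow> e m \<in> borel_measurable borel"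
  using natural_enumeration_image(3) haar_system_borel by blast

lemma natural_enumeration_pconst:
  assumes e: "natural_enumeration (e :: nat \<Rightarrow> real^'n \<Rightarrow> real)" and m: "m < haar_count TYPE('n) k"
  shows "pconst k (e m)"
  using natural_enumeration_image(1)[OF e, of k] m by (intro haar_upto_pconst) blast

lemma natural_partial_sum_pconst:
  assumes e: "natural_enumeration (e :: nat \<Rightarrow> real^'n \<Rightarrow> real)" and M: "M \<le> haar_count TYPE('n) k"
  shows "pconst k (\<lambda>x. \<Sum>m<M. c m * e m x)"
  by (intro pconst_sum pconst_cmult natural_enumeration_pconst[OF e]) (use M in auto)

lemma natural_partial_sum_borel:
  assumes e: "natural_enumeration (e :: nat \<Rightarrow> real^'n \<Rightarrow> real)"
  shows "(\<lambda>x. \<Sum>m<M. c m * e m x) \<in> borel_measurable borel"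
  using natural_enumeration_borel[OF e] by measurable

text \<open>A partial sum between two complete levels adds a subset of the next level.
  \<open>inv e\<close> moves the coefficients from indices to functions, the form in which
  \<open>haar_block_bound\<close> is stated.\<close>

lemma natural_block:
  assumes e: "natural_enumeration (e :: nat \<Rightarrow> real^'n \<Rightarrow> real)"
    and M: "haar_count TYPE('n) k \<le> M" "M \<le> haar_count TYPE('n) (Suc k)"
  shows "\<exists>B\<subseteq>haar_level (Suc k). \<forall>c x. (\<Sum>m<M. c m * e m x) - (\<Sum>m<haar_count TYPE('n) k. c m * e m x) = (\<Sum>h\<in>B. c (inv e h) * h x)"
    and "(\<Sum>m<haar_count TYPE('n) (Suc k). c m * e m x) - (\<Sum>m<haar_count TYPE('n) k. c m * e m x) = (\<Sum>h\<in>haar_level (Suc k). c (inv e h) * h x)"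
proof -
  define N where "N = haar_count TYPE('n)"
  note inj = natural_enumeration_image(2)[OF e]
  have diff: "(\<Sum>m<M. c m * e m x) - (\<Sum>m<N k. c m * e m x) = (\<Sum>h\<in>e ` {N k..<M}. c (inv e h) * h x)"
    if "N k \<le> M" for M c x
  proof -
    have "{..<M} = {..<N k} \<union> {N k..<M}" using that by auto
    then have "(\<Sum>m<M. c m * e m x) = (\<Sum>m<N k. c m * e m x) + (\<Sum>m\<in>{N k..<M}. c m * e m x)"
      by (metis (no_types, lifting) sum.union_disjoint[of "{..<N k}" "{N k..<M}" "\<lambda>m. c m * e m x"] finite_lessThan finite_atLeastLessThan ivl_disj_int_one(2))
    moreover have "(\<Sum>h\<in>e ` {N k..<M}. c (inv e h) * h x) = (\<Sum>m\<in>{N k..<M}. c m * e m x)"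
      by (subst sum.reindex) (auto simp: inv_f_f[OF inj] intro: inj_on_subset[OF inj])
    ultimately show ?thesis by simp
  qed
  have lev: "e ` {N k..<N (Suc k)} = haar_level (Suc k)"
  proof -
    have "e ` {N k..<N (Suc k)} = e ` {..<N (Suc k)} - e ` {..<N k}"
      unfolding image_set_diff[OF inj, symmetric] by (rule arg_cong[where f = "image e"]) auto
    also have "\<dots> = haar_upto (Suc k) - haar_upto k"
      using natural_enumeration_image(1)[OF e] by (simp add: N_def)
    also have "\<dots> = haar_level (Suc k)"
      using haar_upto_disjoint[of k, where 'a = 'n] by (auto simp: haar_upto_Suc)
    finally show ?thesis .
  qed
  have "e ` {N k..<M} \<subseteq> haar_level (Suc k)" unfolding lev[symmetric] using M by (auto simp: N_def)
  then show "\<exists>B\<subseteq>haar_level (Suc k). \<forall>c x. (\<Sum>m<M. c m * e m x) - (\<Sum>m<haar_count TYPE('n) k. c m * e m x) = (\<Sum>h\<in>B. c (inv e h) * h x)"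
    using diff[of M] M(1) unfolding N_def by blast
  show "(\<Sum>m<haar_count TYPE('n) (Suc k). c m * e m x) - (\<Sum>m<haar_count TYPE('n) k. c m * e m x) = (\<Sum>h\<in>haar_level (Suc k). c (inv e h) * h x)"
    using diff[of "N (Suc k)" c x] haar_count_less_Suc[where 'n = 'n, of k] unfolding lev unfolding N_def
    by (meson less_imp_le)
qed

text \<open>A partial sum stopped inside a level differs from the last complete one by part of a
  block, which \<open>haar_block_bound\<close> and \<open>rho_pconst\<close> control by the whole
  increment. The coefficients c are arbitrary, so that the expansion of a point mass is covered
  too.\<close>

lemma natural_series_converges:
  fixes e :: "nat \<Rightarrow> real^'n \<Rightarrow> real"
  assumes e: "natural_enumeration e" and p: "0 < p" "p \<le> 1" and \<sigma>: "0 < \<sigma>" "\<sigma> < 1" and r: "0 < r"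
    and f [measurable]: "f \<in> borel_measurable borel"
    and L: "\<And>k. L k = (\<lambda>x. \<Sum>m<haar_count TYPE('n) k. c m * e m x)"
    and lim: "(\<lambda>k. rho p \<sigma> r (\<lambda>x. f x - L k x)) \<longlonglongrightarrow> 0"
    and inc: "(\<lambda>k. ennreal (2 powr (\<sigma> * real k)) * pint p (\<lambda>x. L (Suc k) x - L k x)) \<longlonglongrightarrow> 0"
  shows "(\<lambda>M. rho p \<sigma> r (\<lambda>x. f x - (\<Sum>m<M. c m * e m x))) \<longlonglongrightarrow> 0"
proof -
  note [measurable] = natural_partial_sum_borel[OF e]
  define S where "S M x = (\<Sum>m<M. c m * e m x)" for M x
  have [measurable]: "S M \<in> borel_measurable borel" for M unfolding S_def by measurable
  have LS: "L k = S (haar_count TYPE('n) k)" for k unfolding L S_def[abs_def] ..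
  obtain C where C: "C \<ge> 0" "\<And>k B c. B \<subseteq> haar_level (Suc k) \<Longrightarrow>
    pint p (\<lambda>x::real^'n. \<Sum>h\<in>B. c h * h x) \<le> ennreal C * pint p (\<lambda>x. \<Sum>h\<in>haar_level (Suc k). c h * h x)"
    using haar_block_bound[OF p] by blast
  obtain K where K: "K \<ge> 0" "\<And>k g. pconst k g \<Longrightarrow> g \<in> borel_measurable borel \<Longrightarrow>
    rho p \<sigma> r (g :: real^'n \<Rightarrow> real) \<le> ennreal K * (ennreal (2 powr (\<sigma> * real k)) * pint p g) powe r"
    using rho_pconst[OF p \<sigma> r] by metis
  define U where "U k = ennreal (2 powr r) * (rho p \<sigma> r (\<lambda>x. f x - L k x) +
    ennreal K * (ennreal (2 powr \<sigma> * C) * (ennreal (2 powr (\<sigma> * real k)) * pint p (\<lambda>x. L (Suc k) x - L k x))) powe r)" for k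
  have U0: "U \<longlonglongrightarrow> 0"
    unfolding U_def
    by (rule ennreal_cmult_tendsto_0, rule ennreal_add_tendsto_0[OF lim], rule ennreal_cmult_tendsto_0,
        rule powe_LIMSEQ_0[OF ennreal_cmult_tendsto_0[OF inc] r])
  have le: "rho p \<sigma> r (\<lambda>x. f x - S M x) \<le> U k"
    if M: "haar_count TYPE('n) k \<le> M" "M < haar_count TYPE('n) (Suc k)" for M k
  proof -
    have M': "M \<le> haar_count TYPE('n) (Suc k)" using M by simp
    obtain B where B: "B \<subseteq> haar_level (Suc k)" and
      B': "\<forall>c x. (\<Sum>m<M. c m * e m x) - (\<Sum>m<haar_count TYPE('n) k. c m * e m x) = (\<Sum>h\<in>B. c (inv e h) * h x)"
      using natural_block(1)[OF e M(1) M'] by blast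
    have 1: "S M x - L k x = (\<Sum>h\<in>B. c (inv e h) * h x)" for x
      using B'[rule_format, of c x] by (simp only: LS S_def)
    have 2: "L (Suc k) x - L k x = (\<Sum>h\<in>haar_level (Suc k). c (inv e h) * h x)" for x
      using natural_block(2)[OF e M(1) M', of c x] by (simp only: LS S_def)
    have "pint p (\<lambda>x. S M x - L k x) \<le> ennreal C * pint p (\<lambda>x. L (Suc k) x - L k x)"
      unfolding 1 2 by (rule C(2)[OF B])
    then have "ennreal (2 powr (\<sigma> * real (Suc k))) * pint p (\<lambda>x. S M x - L k x)
        \<le> ennreal (2 powr (\<sigma> * real (Suc k))) * (ennreal C * pint p (\<lambda>x. L (Suc k) x - L k x))"
      by (intro mult_left_mono) auto
    also have "\<dots> = ennreal (2 powr \<sigma> * C) * (ennreal (2 powr (\<sigma> * real k)) * pint p (\<lambda>x. L (Suc k) x - L k x))"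
      using C(1) by (simp add: ring_distribs powr_add ennreal_mult mult_ac)
    finally have le: "ennreal (2 powr (\<sigma> * real (Suc k))) * pint p (\<lambda>x. S M x - L k x)
      \<le> ennreal (2 powr \<sigma> * C) * (ennreal (2 powr (\<sigma> * real k)) * pint p (\<lambda>x. L (Suc k) x - L k x))" .
    have pc: "pconst (Suc k) (\<lambda>x. S M x - L k x)"
      unfolding LS S_def by (intro pconst_diff natural_partial_sum_pconst[OF e] M')
         (use M haar_count_less_Suc[where 'n = 'n, of k] in simp)
    have "rho p \<sigma> r (\<lambda>x. S M x - L k x) \<le> ennreal K * (ennreal (2 powr (\<sigma> * real (Suc k))) * pint p (\<lambda>x. S M x - L k x)) powe r"
      by (rule K(2)[OF pc]) (simp add: LS)
    also have "\<dots> \<le> ennreal K * (ennreal (2 powr \<sigma> * C) * (ennreal (2 powr (\<sigma> * real k)) * pint p (\<lambda>x. L (Suc k) x - L k x))) powe r"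
      using r by (intro mult_left_mono powe_mono le) auto
    finally have 2: "rho p \<sigma> r (\<lambda>x. S M x - L k x) \<le> \<dots>" .
    have "rho p \<sigma> r (\<lambda>x. f x - S M x) \<le> ennreal (2 powr r) * (rho p \<sigma> r (\<lambda>x. f x - L k x) + rho p \<sigma> r (\<lambda>x. S M x - L k x))"
      using rho_diff[OF p r, of "\<lambda>x. f x - L k x" "\<lambda>x. S M x - L k x" \<sigma>] by (simp add: LS)
    also have "\<dots> \<le> U k" unfolding U_def by (intro mult_left_mono add_left_mono 2) auto
    finally show ?thesis .
  qed
  have "(\<lambda>M. rho p \<sigma> r (\<lambda>x. f x - S M x)) \<longlonglongrightarrow> 0"
  proof (rule order_tendstoI)
    fix a :: ennreal assume "0 < a"
    from order_tendstoD(2)[OF U0 this] obtain K where K: "\<And>k. K \<le> k \<Longrightarrow> U k < a"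
      unfolding eventually_sequentially by blast
    show "eventually (\<lambda>M. rho p \<sigma> r (\<lambda>x. f x - S M x) < a) sequentially"
      unfolding eventually_sequentially
    proof (intro exI allI impI)
      fix M assume "haar_count TYPE('n) K \<le> M"
      then obtain k where "K \<le> k" "haar_count TYPE('n) k \<le> M" "M < haar_count TYPE('n) (Suc k)"
        by (rule haar_count_between)
      then show "rho p \<sigma> r (\<lambda>x. f x - S M x) < a" using le[of k M] K[of k] by (meson le_less_trans)
    qed
  qed auto
  then show ?thesis by (simp add: S_def)
qed

text \<open>Pairing with the bounded function \<open>e n\<close> is continuous in L_1, and by
  orthonormality it gives c n for every partial sum with M > n.\<close>

lemma natural_coefficients_unique:
  fixes e :: "nat \<Rightarrow> real^'n \<Rightarrow> real"
  assumes e: "natural_enumeration e" and f: "f \<in> borel_measurable borel" "pint 1 f < top"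
    and lim: "(\<lambda>M. pint 1 (\<lambda>x. f x - (\<Sum>m<M. c m * e m x))) \<longlonglongrightarrow> 0"
  shows "c n = hint f (e n)"
proof -
  note eb = natural_enumeration_borel[OF e]
  have ep: "\<exists>k. pconst k (e m)" for m using natural_enumeration_image(3)[OF e] haar_system_pconst by blast
  have e1: "pint 1 (e m) < top" for m using ep[of m] pint1_pconst_finite[OF _ eb] by blast
  obtain k where k: "pconst k (e n)" using ep by blast
  obtain B where B: "\<And>x. x \<in> hcube \<Longrightarrow> \<bar>e n x\<bar> \<le> B" using pconst_bounded[OF k] by blast
  have "ennreal \<bar>hint f (e n) - c n\<bar> \<le> ennreal B * pint 1 (\<lambda>x. f x - (\<Sum>m<M. c m * e m x))" if M: "n < M" for M
  proof -
    define S where "S x = (\<Sum>m<M. c m * e m x)" for x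
    have Sb: "S \<in> borel_measurable borel" unfolding S_def by (rule natural_partial_sum_borel[OF e])
    have "pconst M S" unfolding S_def
      by (rule natural_partial_sum_pconst[OF e]) (simp add: haar_count_ge less_imp_le)
    then have S1: "pint 1 S < top" by (rule pint1_pconst_finite[OF _ Sb])
    have "hint S (e n) = (\<Sum>m<M. c m * hint (e m) (e n))"
      unfolding S_def by (rule hint_sum_left[OF _ _ _ k]) (auto simp: eb e1)
    also have "\<dots> = (\<Sum>m<M. if m = n then c n else 0)"
      using natural_enumeration_image(2,3)[OF e] by (intro sum.cong) (auto simp: haar_orthonormal inj_eq)
    also have "\<dots> = c n" using M by simp
    finally have "hint (\<lambda>x. f x - S x) (e n) = hint f (e n) - c n"
      using hint_diff_left[OF f(1) Sb f(2) S1 k eb] by simp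
    moreover have "pint 1 (\<lambda>x. f x - S x) < top"
      using pint_diff[of 1 f S] f S1 Sb by (auto intro: le_less_trans)
    ultimately show ?thesis
      using hint_integrable(2)[of "\<lambda>x. f x - S x" "e n" B] f Sb eb B by (simp add: S_def)
  qed
  then have "ennreal \<bar>hint f (e n) - c n\<bar> \<le> 0"
    by (intro LIMSEQ_le_const[OF ennreal_cmult_tendsto_0[OF lim, of B]]) (auto intro!: exI[of _ "Suc n"])
  then show ?thesis by simp
qed

section \<open>Comparison with the Besov quasi-norm\<close>

text \<open>Elements of the Besov space are only Lebesgue measurable on the cube and arbitrary
  outside; this relation ties them to Borel representatives, for which the previous estimates
  hold.\<close>

definition cube_eq :: "(real^'n \<Rightarrow> real) \<Rightarrow> (real^'n \<Rightarrow> real) \<Rightarrow> bool" where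
  "cube_eq f g \<longleftrightarrow> (AE x in lborel. x \<in> hcube \<longrightarrow> f x = g x)"

lemma unit_cube_lebesgue [simp]: "unit_cube \<in> sets lebesgue"
  by (simp add: unit_cube_def)

lemma hcube_subset_unit_cube: "hcube \<subseteq> unit_cube"
  by (auto simp: hcube_iff unit_cube_def mem_box_cart) (meson less_imp_le)

lemma AE_unit_cube: "AE x in lborel. x \<in> unit_cube \<longleftrightarrow> x \<in> (hcube :: (real^'n) set)"
proof -
  have em: "emeasure lborel (unit_cube :: (real^'n) set) = 1"
  proof -
    have "emeasure lborel (cbox 0 1 :: (real^'n) set) = ennreal (\<Prod>v\<in>Basis. (1 - 0 :: real^'n) \<bullet> v)"
      by (rule emeasure_lborel_cbox) (auto simp: Basis_vec_def inner_axis)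
    also have "(\<Prod>v\<in>Basis. (1 - 0 :: real^'n) \<bullet> v) = 1"
      by (intro prod.neutral) (auto simp: Basis_vec_def inner_axis)
    finally show ?thesis by (simp add: unit_cube_def)
  qed
  have [measurable]: "unit_cube \<in> sets (borel :: (real^'n) measure)" by (simp add: unit_cube_def)
  have "emeasure lborel (unit_cube - hcube :: (real^'n) set) = emeasure lborel (unit_cube :: (real^'n) set) - emeasure lborel (hcube :: (real^'n) set)"
    by (rule emeasure_Diff) (auto simp: hcube_subset_unit_cube)
  then have "unit_cube - hcube \<in> null_sets (lborel :: (real^'n) measure)" by (auto simp: em)
  from AE_not_in[OF this] show ?thesis
    by eventually_elim (use hcube_subset_unit_cube in blast)
qed

lemma AE_translate:
  fixes y :: "real^'n"
  assumes "AE x in lborel. P x"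
  shows "AE x in lborel. P (x + y)"
proof -
  obtain N where N: "{x \<in> space lborel. \<not> P x} \<subseteq> N" "emeasure lborel N = 0" and Nm [measurable]: "N \<in> sets lborel"
    using AE_E[OF assms] by blast
  have [measurable]: "{x. x + y \<in> N} \<in> sets lborel"
  proof -
    have "(\<lambda>x. x + y) -` N \<inter> space borel \<in> sets borel"
      by (rule measurable_sets[of _ borel borel]) (use Nm in auto)
    then show ?thesis by (simp add: vimage_def)
  qed
  have "emeasure lborel {x. x + y \<in> N} = (\<integral>\<^sup>+x. indicator N (x + y) \<partial>lborel)"
  proof -
    have "(\<lambda>x. indicator N (x + y)) = (indicator {x. x + y \<in> N} :: _ \<Rightarrow> ennreal)" by (auto simp: indicator_def)
    then show ?thesis by simp
  qed
  also have "\<dots> = (\<integral>\<^sup>+x. indicator N x \<partial>lborel)"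
    by (rule nn_integral_translate) (use Nm in auto)
  also have "\<dots> = 0" by (subst nn_integral_indicator[OF Nm]) (rule N(2))
  finally have "{x. x + y \<in> N} \<in> null_sets lborel" by auto
  from AE_not_in[OF this] show ?thesis
    by eventually_elim (use N(1) in auto)
qed

lemma nn_integral_lebesgue_on:
  assumes "A \<in> sets lebesgue"
  shows "nn_integral (lebesgue_on A) F = (\<integral>\<^sup>+x. F x * indicator A x \<partial>lborel)"
  using assms by (simp add: nn_integral_restrict_space nn_integral_completion)

lemma AE_lebesgue_on:
  assumes "A \<in> sets lebesgue"
  shows "(AE x in lebesgue_on A. P x) \<longleftrightarrow> (AE x in lborel. x \<in> A \<longrightarrow> P x)"
  using assms by (simp add: AE_restrict_space_iff AE_completion_iff)

lemma AE_unit_cube_iff: "(AE x in lebesgue_on unit_cube. P x) \<longleftrightarrow> (AE x in lborel. x \<in> (hcube :: (real^'n) set) \<longrightarrow> P x)"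
  unfolding AE_lebesgue_on[OF unit_cube_lebesgue]
proof
  assume "AE x in lborel. x \<in> unit_cube \<longrightarrow> P x"
  then show "AE x in lborel. x \<in> hcube \<longrightarrow> P x"
    by eventually_elim (use hcube_subset_unit_cube in auto)
next
  assume "AE x in lborel. x \<in> (hcube :: (real^'n) set) \<longrightarrow> P x"
  with AE_unit_cube show "AE x in lborel. x \<in> unit_cube \<longrightarrow> P x"
    by eventually_elim auto
qed

lemma Lnorm_unit_cube:
  assumes "cube_eq f g"
  shows "Lnorm (lebesgue_on unit_cube) p (\<lambda>x. ennreal \<bar>f x\<bar>) = pint p g powe (1 / p)"
proof -
  have "(\<integral>\<^sup>+x. ennreal \<bar>f x\<bar> powe p * indicator unit_cube x \<partial>lborel) = pint p g"
    unfolding pint_def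
  proof (rule nn_integral_cong_AE)
    show "AE x in lborel. ennreal \<bar>f x\<bar> powe p * indicator unit_cube x = ennreal (\<bar>g x\<bar> powr p) * indicator hcube x"
      using assms AE_unit_cube unfolding cube_eq_def by eventually_elim (auto simp: indicator_def)
  qed
  then show ?thesis by (simp add: Lnorm_def nn_integral_lebesgue_on)
qed

lemma translated_cube_lebesgue: "{z \<in> unit_cube. z + y \<in> unit_cube} \<in> sets lebesgue"
proof -
  have "{z \<in> unit_cube. z + y \<in> unit_cube} = cbox 0 1 \<inter> cbox (0 - y) (1 - y)"
  proof -
    have *: "- b \<le> a \<longleftrightarrow> 0 \<le> a + b" "a \<le> 1 - b \<longleftrightarrow> a + b \<le> 1" for a b :: real by auto
    show ?thesis by (auto simp: unit_cube_def mem_box_cart *)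
  qed
  then show ?thesis by simp
qed

lemma Lnorm_difference:
  fixes f g :: "real^'n \<Rightarrow> real"
  assumes "cube_eq f g"
  shows "Lnorm (lebesgue_on {z \<in> unit_cube. z + y \<in> unit_cube}) p (\<lambda>z. ennreal \<bar>f (z + y) - f z\<bar>) = dint p g y powe (1 / p)"
proof -
  have "(\<integral>\<^sup>+z. ennreal \<bar>f (z + y) - f z\<bar> powe p * indicator {z \<in> unit_cube. z + y \<in> unit_cube} z \<partial>lborel) = dint p g y"
    unfolding dint_def
  proof (rule nn_integral_cong_AE)
    show "AE z in lborel. ennreal \<bar>f (z + y) - f z\<bar> powe p * indicator {z \<in> unit_cube. z + y \<in> unit_cube} z
       = ennreal (\<bar>g (z + y) - g z\<bar> powr p) * (indicator hcube z * indicator hcube (z + y))"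
      using assms[unfolded cube_eq_def] AE_unit_cube AE_translate[OF assms[unfolded cube_eq_def], of y] AE_translate[OF AE_unit_cube, of y]
      by eventually_elim (auto simp: indicator_def)
  qed
  then show ?thesis by (simp add: Lnorm_def nn_integral_lebesgue_on translated_cube_lebesgue)
qed

lemma modulus_powe:
  fixes f g :: "real^'n \<Rightarrow> real"
  assumes "cube_eq f g" and p: "0 < p"
  shows "modulus p f t powe p = omod p g t"
proof (rule antisym)
  have "modulus p f t \<le> omod p g t powe (1 / p)"
    unfolding modulus_def Lnorm_difference[OF assms(1)]
    by (rule SUP_least) (use p in \<open>auto intro!: powe_mono dint_le_omod\<close>)
  from powe_mono[OF this, of p] p show "modulus p f t powe p \<le> omod p g t" by simp
  show "omod p g t \<le> modulus p f t powe p"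
    unfolding omod_def
  proof (rule SUP_least)
    fix y :: "real^'n" assume y: "y \<in> {y. norm y \<le> t}"
    show "dint p g y \<le> modulus p f t powe p"
    proof (cases "y = 0")
      case False
      then have "dint p g y powe (1 / p) \<le> modulus p f t"
        unfolding modulus_def Lnorm_difference[OF assms(1)] using y by (intro SUP_upper) auto
      from powe_mono[OF this, of p] p show ?thesis by simp
    qed (simp add: dint_def)
  qed
qed

section \<open>Discretisation of the integral over t\<close>

lemma dyadic_scale:
  fixes t :: real
  assumes "0 < t" "t \<le> 1"
  obtains m where "1 / 2^Suc m < t" "t \<le> 1 / 2^m"
proof -
  define n where "n = (LEAST n. 1 / 2^n < t)"
  have ex: "\<exists>n. 1 / 2^n < t"
    using real_arch_pow_inv[OF assms(1), of "1/2"] by (auto simp: power_one_over)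
  have n: "1 / 2^n < t" unfolding n_def by (rule LeastI_ex[OF ex])
  then obtain m where m: "n = Suc m" using assms(2) by (cases n) auto
  have "\<not> 1 / 2^m < t" using not_less_Least[of m "\<lambda>n. 1 / 2^n < t"] m unfolding n_def[symmetric] by simp
  then show ?thesis using that n m by simp
qed

lemma dyadic_scale_unique:
  fixes t :: real
  assumes "1 / 2^Suc m < t" "t \<le> 1 / 2^m" "1 / 2^Suc n < t" "t \<le> 1 / 2^n"
  shows "m = n"
proof -
  have *: "\<not> m < n" if "1 / 2^Suc m < t" "t \<le> 1 / 2^n" for m n
  proof
    assume "m < n"
    then have "(2::real)^Suc m \<le> 2^n" by (intro power_increasing) auto
    then have "1 / 2^n \<le> (1::real) / 2^Suc m" by (intro divide_left_mono) auto
    with that show False by simp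
  qed
  show ?thesis using *[OF assms(1,4)] *[OF assms(3,2)] by simp
qed

lemma mult_swap1: "(A :: ennreal) * B = C * D \<Longrightarrow> A * w * B = C * (D * w)"
proof -
  assume *: "A * B = C * D"
  have "A * w * B = A * B * w" by (simp only: mult_ac)
  then show "A * w * B = C * (D * w)" by (simp only: * mult.assoc)
qed

lemma mult_swap2: "(A :: ennreal) * (B * C) = D \<Longrightarrow> D * w = A * (B * w * C)"
proof -
  assume *: "A * (B * C) = D"
  have "A * (B * w * C) = A * (B * C) * w" by (simp only: mult_ac)
  then show "D * w = A * (B * w * C)" by (simp only: *)
qed

text \<open>On the interval from 2^(-m-1) to 2^(-m) both factors are compared with endpoint values:
  t powr (- a - 1) decreases, w increases, and the length supplies 2^(-m-1). From below, w t only
  dominates w at the left endpoint, so the term w 1 is missing from the second sum and has to be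
  estimated elsewhere.\<close>

lemma time_integral_bounds:
  fixes w :: "real \<Rightarrow> ennreal"
  assumes a: "0 < a" and w: "\<And>t u. t \<le> u \<Longrightarrow> w t \<le> w u"
  defines "J \<equiv> (\<integral>\<^sup>+t\<in>{0..1}. ennreal (t powr (- a - 1)) * w t \<partial>lborel)"
  shows "J \<le> ennreal (2 powr a) * (\<Sum>m. ennreal (2 powr (a * real m)) * w (1 / 2^m))"
    and "(\<Sum>m. ennreal (2 powr (a * real (Suc m))) * w (1 / 2^Suc m)) \<le> ennreal (2 powr (a + 1)) * J"
proof -
  define I where "I m = {1 / 2^Suc m<..1 / 2^m :: real}" for m :: nat
  have emI: "emeasure lborel (I m) = ennreal (2 powr (- real (Suc m)))" for m
  proof -
    have "(1::real) / 2^m - 1 / 2^Suc m = 2 powr (- real (Suc m))"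
    proof -
      have "(2::real) powr (- real (Suc m)) = 1 / 2^Suc m"
        unfolding powr_minus by (subst powr_realpow) (simp_all add: inverse_eq_divide)
      then show ?thesis by (simp only:) (simp add: field_simps)
    qed
    then show ?thesis unfolding I_def by (subst emeasure_lborel_Ioc) (auto simp: field_simps)
  qed
  have [measurable]: "I m \<in> sets borel" for m by (simp add: I_def)
  have val: "(\<Sum>k. b k * indicator (I k) t) = b m" if "t \<in> I m" for b :: "nat \<Rightarrow> ennreal" and m t
  proof -
    have "t \<notin> I k" if "k \<noteq> m" for k
      using that \<open>t \<in> I m\<close> dyadic_scale_unique[of m t k] unfolding I_def greaterThanAtMost_iff by blast
    then have "(\<Sum>k. b k * indicator (I k) t) = (\<Sum>k\<in>{m}. b k * indicator (I k) t)"
      by (intro suminf_finite) auto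
    then show ?thesis using that by simp
  qed
  have int: "(\<integral>\<^sup>+t. (\<Sum>k. b k * indicator (I k) t) \<partial>lborel) = (\<Sum>k. b k * ennreal (2 powr (- real (Suc k))))" for b :: "nat \<Rightarrow> ennreal"
  proof -
    have "(\<integral>\<^sup>+t. (\<Sum>k. b k * indicator (I k) t) \<partial>lborel) = (\<Sum>k. \<integral>\<^sup>+t. b k * indicator (I k) t \<partial>lborel)"
      by (rule nn_integral_suminf) measurable
    also have "\<dots> = (\<Sum>k. b k * ennreal (2 powr (- real (Suc k))))"
      unfolding emI[symmetric] by (intro arg_cong[where f = suminf] ext nn_integral_cmult_indicator) simp
    finally show ?thesis .
  qed
  have p2: "1 / 2^m = (2::real) powr (- real m)" for m
    by (simp add: powr_minus powr_realpow inverse_eq_divide)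
  have "J \<le> (\<integral>\<^sup>+t. (\<Sum>k. (ennreal (2 powr (real (Suc k) * (a + 1))) * w (1 / 2^k)) * indicator (I k) t) \<partial>lborel)"
    unfolding J_def
  proof (rule nn_integral_mono)
    fix t :: real
    show "ennreal (t powr (- a - 1)) * w t * indicator {0..1} t \<le> (\<Sum>k. (ennreal (2 powr (real (Suc k) * (a + 1))) * w (1 / 2^k)) * indicator (I k) t)"
    proof (cases "0 < t \<and> t \<le> 1")
      case True
      then obtain m where m: "1 / 2^Suc m < t" "t \<le> 1 / 2^m" using dyadic_scale by blast
      then have tI: "t \<in> I m" by (simp add: I_def)
      have "t powr (- a - 1) \<le> (1 / 2^Suc m) powr (- a - 1)"
        using m a True by (intro powr_mono2') auto
      also have "\<dots> = 2 powr (real (Suc m) * (a + 1))"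
        unfolding p2 powr_powr by (simp add: algebra_simps)
      finally have "ennreal (t powr (- a - 1)) * w t \<le> ennreal (2 powr (real (Suc m) * (a + 1))) * w (1 / 2^m)"
        using w m by (intro mult_mono ennreal_leI) auto
      then show ?thesis unfolding val[OF tI] using True by simp
    next
      case False
      \<comment> \<open>At t = 0 the weight is 0 because \<open>0 powr x = 0\<close>.\<close>
      then have "t = 0 \<or> t \<notin> {0..1}" by auto
      then show ?thesis by auto
    qed
  qed
  also have "\<dots> = (\<Sum>k. ennreal (2 powr a) * (ennreal (2 powr (a * real k)) * w (1 / 2^k)))"
    unfolding int
  proof (rule arg_cong[where f = suminf], rule ext)
    fix k
    have "ennreal (2 powr (real (Suc k) * (a + 1))) * ennreal (2 powr (- real (Suc k))) = ennreal (2 powr a) * ennreal (2 powr (a * real k))"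
      by (simp add: algebra_simps flip: ennreal_mult powr_add)
    then show "ennreal (2 powr (real (Suc k) * (a + 1))) * w (1 / 2^k) * ennreal (2 powr (- real (Suc k)))
        = ennreal (2 powr a) * (ennreal (2 powr (a * real k)) * w (1 / 2^k))"
      by (rule mult_swap1)
  qed
  finally show "J \<le> ennreal (2 powr a) * (\<Sum>m. ennreal (2 powr (a * real m)) * w (1 / 2^m))" by simp
  have "(\<integral>\<^sup>+t. (\<Sum>k. (ennreal (2 powr (real k * (a + 1))) * w (1 / 2^Suc k)) * indicator (I k) t) \<partial>lborel) \<le> J"
    unfolding J_def
  proof (rule nn_integral_mono)
    fix t :: real
    show "(\<Sum>k. (ennreal (2 powr (real k * (a + 1))) * w (1 / 2^Suc k)) * indicator (I k) t) \<le> ennreal (t powr (- a - 1)) * w t * indicator {0..1} t"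
    proof (cases "\<exists>m. t \<in> I m")
      case True
      then obtain m where tI: "t \<in> I m" by blast
      then have m: "1 / 2^Suc m < t" "t \<le> 1 / 2^m" by (auto simp: I_def)
      have t0: "0 < t" using m(1) less_trans[of 0 "1 / 2^Suc m" t] by simp
      have t1: "t \<le> 1" using m(2) by (rule order_trans) simp
      have "2 powr (real m * (a + 1)) = (1 / 2^m) powr (- a - 1)"
        unfolding p2 powr_powr by (simp add: algebra_simps)
      also have "\<dots> \<le> t powr (- a - 1)" using m a t0 by (intro powr_mono2') auto
      finally have "ennreal (2 powr (real m * (a + 1))) * w (1 / 2^Suc m) \<le> ennreal (t powr (- a - 1)) * w t"
        using w m by (intro mult_mono ennreal_leI) auto
      then show ?thesis unfolding val[OF tI] using t0 t1 by simp
    qed simp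
  qed
  then have le: "(\<Sum>k. (ennreal (2 powr (real k * (a + 1))) * w (1 / 2^Suc k)) * ennreal (2 powr (- real (Suc k)))) \<le> J"
    unfolding int .
  have "(\<Sum>m. ennreal (2 powr (a * real (Suc m))) * w (1 / 2^Suc m))
     = (\<Sum>k. ennreal (2 powr (a + 1)) * ((ennreal (2 powr (real k * (a + 1))) * w (1 / 2^Suc k)) * ennreal (2 powr (- real (Suc k)))))"
  proof (rule arg_cong[where f = suminf], rule ext)
    fix k
    have "ennreal (2 powr (a + 1)) * (ennreal (2 powr (real k * (a + 1))) * ennreal (2 powr (- real (Suc k)))) = ennreal (2 powr (a * real (Suc k)))"
      by (simp add: algebra_simps flip: ennreal_mult powr_add)
    then show "ennreal (2 powr (a * real (Suc k))) * w (1 / 2^Suc k)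
        = ennreal (2 powr (a + 1)) * ((ennreal (2 powr (real k * (a + 1))) * w (1 / 2^Suc k)) * ennreal (2 powr (- real (Suc k))))"
      by (rule mult_swap2)
  qed
  also have "\<dots> \<le> ennreal (2 powr (a + 1)) * J" unfolding ennreal_suminf_cmult by (intro mult_left_mono le) auto
  finally show "(\<Sum>m. ennreal (2 powr (a * real (Suc m))) * w (1 / 2^Suc m)) \<le> ennreal (2 powr (a + 1)) * J" .
qed

lemma besov_norm_eq:
  fixes f g :: "real^'n \<Rightarrow> real"
  assumes "cube_eq f g" and p: "0 < p" and q: "0 < q"
  shows "besov_norm p q s f = pint p g powe (1 / p) +
    (\<integral>\<^sup>+t\<in>{0..1}. ennreal (t powr (- (s * q) - 1)) * omod p g t powe (q / p) \<partial>lborel) powe (1 / q)"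
proof -
  have "(ennreal (t powr (- s - 1 / q)) * modulus p f t) powe q = ennreal (t powr (- (s * q) - 1)) * omod p g t powe (q / p)" for t
  proof -
    have "(- s - 1 / q) * q = - (s * q) - 1" using q by (simp add: field_simps)
    then have "(t powr (- s - 1 / q)) powr q = t powr (- (s * q) - 1)" by (simp add: powr_powr)
    then show ?thesis
      using p by (simp add: powe_mult modulus_powe[OF assms(1) p, symmetric])
  qed
  then show ?thesis
    unfolding besov_norm_def Lnorm_unit_cube[OF assms(1)] Lnorm_def[of "lebesgue_on {0..1}"]
    by (simp add: nn_integral_lebesgue_on)
qed

lemma bes_expand:
  "bes p (s * p) (q / p) g = (\<Sum>m. ennreal (2 powr (s * q * real m)) * omod p g (1 / 2^m) powe (q / p))" if "0 < p"
  using that unfolding bes_def by (simp add: powe_mult powr_powr mult_ac)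

lemma besov_norm_le_rho:
  assumes p: "0 < p" and q: "0 < q" and s: "0 < s"
  shows "\<exists>C\<ge>0. \<forall>f g. cube_eq f g \<longrightarrow> besov_norm p q s (f :: real^'n \<Rightarrow> real) \<le> ennreal C * rho p (s * p) (q / p) g powe (1 / q)"
proof -
  define A where "A = (2 powr (s * q)) powr (1 / q)"
  have A0: "0 \<le> A" by (simp add: A_def)
  have "besov_norm p q s f \<le> ennreal (1 + A) * rho p (s * p) (q / p) g powe (1 / q)" if "cube_eq f g" for f g :: "real^'n \<Rightarrow> real"
  proof -
    define R where "R = rho p (s * p) (q / p) g"
    have "(\<integral>\<^sup>+t\<in>{0..1}. ennreal (t powr (- (s * q) - 1)) * omod p g t powe (q / p) \<partial>lborel)
        \<le> ennreal (2 powr (s * q)) * bes p (s * p) (q / p) g"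
      unfolding bes_expand[OF p] using p q s
      by (intro time_integral_bounds(1) powe_mono omod_mono) auto
    also have "\<dots> \<le> ennreal (2 powr (s * q)) * R" by (intro mult_left_mono) (auto simp: R_def rho_def)
    finally have "(\<integral>\<^sup>+t\<in>{0..1}. ennreal (t powr (- (s * q) - 1)) * omod p g t powe (q / p) \<partial>lborel) powe (1 / q)
        \<le> (ennreal (2 powr (s * q)) * R) powe (1 / q)"
      using q by (intro powe_mono) auto
    also have "\<dots> = ennreal A * R powe (1 / q)" by (simp add: powe_mult A_def)
    finally have 1: "(\<integral>\<^sup>+t\<in>{0..1}. ennreal (t powr (- (s * q) - 1)) * omod p g t powe (q / p) \<partial>lborel) powe (1 / q)
        \<le> ennreal A * R powe (1 / q)" .
    have "pint p g powe (q / p) \<le> R" by (simp add: R_def rho_def)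
    from powe_mono[OF this, of "1 / q"] q have 2: "pint p g powe (1 / p) \<le> R powe (1 / q)" by simp
    have "besov_norm p q s f \<le> R powe (1 / q) + ennreal A * R powe (1 / q)"
      unfolding besov_norm_eq[OF that p q] by (intro add_mono 1 2)
    also have "\<dots> = ennreal (1 + A) * R powe (1 / q)" using A0 by (simp add: distrib_right)
    finally show ?thesis by (simp add: R_def)
  qed
  then show ?thesis using A0 by (intro exI[of _ "1 + A"]) auto
qed

text \<open>The integral controls every scale except t = 1, see \<open>time_integral_bounds\<close>;
  the missing term is bounded by \<open>omod_le\<close> and absorbed by the L_p part.\<close>

lemma rho_le_besov_norm:
  assumes p: "0 < p" "p \<le> 1" and q: "0 < q" and s: "0 < s"
  shows "\<exists>C\<ge>0. \<forall>f g. cube_eq f g \<longrightarrow> g \<in> borel_measurable borel \<longrightarrow>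
    rho p (s * p) (q / p) (g :: real^'n \<Rightarrow> real) \<le> ennreal C * besov_norm p q s f powe q"
proof -
  define A where "A = (2::real) powr (s * q + 1)"
  define B where "B = (2::real) powr (q / p)"
  have AB: "0 \<le> A" "0 \<le> B" by (auto simp: A_def B_def)
  have "rho p (s * p) (q / p) g \<le> ennreal (1 + A + B) * besov_norm p q s f powe q"
    if fg: "cube_eq f g" and g: "g \<in> borel_measurable borel" for f g :: "real^'n \<Rightarrow> real"
  proof -
    define J where "J = (\<integral>\<^sup>+t\<in>{0..1}. ennreal (t powr (- (s * q) - 1)) * omod p g t powe (q / p) \<partial>lborel)"
    define N where "N = besov_norm p q s f"
    have N: "N = pint p g powe (1 / p) + J powe (1 / q)" unfolding N_def J_def by (rule besov_norm_eq[OF fg p(1) q])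
    have "J powe (1 / q) \<le> N" by (simp add: N)
    from powe_mono[OF this, of q] q have J: "J \<le> N powe q" by simp
    have "pint p g powe (1 / p) \<le> N" by (simp add: N)
    from powe_mono[OF this, of q] q have P: "pint p g powe (q / p) \<le> N powe q" by simp
    have "omod p g 1 powe (q / p) \<le> (2 * pint p g) powe (q / p)"
      using p q by (intro powe_mono omod_le g) auto
    also have "\<dots> = ennreal B * pint p g powe (q / p)"
      using powe_ennreal[of 2 "q / p"] by (simp add: powe_mult B_def)
    also have "\<dots> \<le> ennreal B * N powe q" by (intro mult_left_mono P) auto
    finally have o1: "omod p g 1 powe (q / p) \<le> ennreal B * N powe q" .
    have "(\<Sum>m. ennreal (2 powr (s * q * real (Suc m))) * omod p g (1 / 2^Suc m) powe (q / p)) \<le> ennreal A * J"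
      unfolding A_def J_def using p q s by (intro time_integral_bounds(2) powe_mono omod_mono) auto
    also have "\<dots> \<le> ennreal A * N powe q" by (intro mult_left_mono J) auto
    finally have 1: "(\<Sum>m. ennreal (2 powr (s * q * real (Suc m))) * omod p g (1 / 2^Suc m) powe (q / p)) \<le> ennreal A * N powe q" .
    have "bes p (s * p) (q / p) g = (\<Sum>m. ennreal (2 powr (s * q * real (m + 1))) * omod p g (1 / 2^(m + 1)) powe (q / p)) + omod p g 1 powe (q / p)"
      unfolding bes_expand[OF p(1)] by (subst ennreal_suminf_split[of _ 1]) simp
    also have "\<dots> \<le> ennreal A * N powe q + ennreal B * N powe q"
      using 1 o1 by (intro add_mono) (auto simp del: power_Suc)
    finally have "rho p (s * p) (q / p) g \<le> N powe q + (ennreal A * N powe q + ennreal B * N powe q)"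
      unfolding rho_def by (intro add_mono P)
    also have "\<dots> = ennreal (1 + A + B) * N powe q"
      using AB by (simp add: distrib_right add.assoc)
    finally show ?thesis by (simp add: N_def)
  qed
  then show ?thesis using AB by (intro exI[of _ "1 + A + B"]) auto
qed

section \<open>Borel representatives of elements of the Besov space\<close>

lemma cube_eq_refl [simp]: "cube_eq f f"
  by (simp add: cube_eq_def)

lemma cube_eq_cong: "(\<And>x. x \<in> hcube \<Longrightarrow> f x = g x) \<Longrightarrow> cube_eq f g"
  by (simp add: cube_eq_def)

lemma cube_eq_diff: "cube_eq f g \<Longrightarrow> cube_eq (\<lambda>x. f x - h x) (\<lambda>x. g x - h x)"
  unfolding cube_eq_def by (elim eventually_mono) auto

lemma cube_eq_borel_ex:
  fixes f :: "real^'n \<Rightarrow> real"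
  assumes "f \<in> borel_measurable (lebesgue_on unit_cube)"
  shows "\<exists>g\<in>borel_measurable borel. cube_eq f g"
proof -
  have "(\<lambda>x. if x \<in> unit_cube then f x else 0) \<in> borel_measurable lebesgue"
    using assms by (subst borel_measurable_if) auto
  then obtain g where g: "g \<in> borel_measurable lborel" "AE x in lborel. (if x \<in> unit_cube then f x else 0) = g x"
    using completion_ex_borel_measurable_real by blast
  from g(2) have "cube_eq f g"
    unfolding cube_eq_def by eventually_elim (use hcube_subset_unit_cube in auto)
  with g(1) show ?thesis by auto
qed

lemma borel_imp_lebesgue_on: "g \<in> borel_measurable borel \<Longrightarrow> g \<in> borel_measurable (lebesgue_on A)"
  by (rule measurable_restrict_space1) (auto intro: measurable_completion)

lemma besov_space_iff:
  assumes p: "0 < p" "p \<le> 1" and q: "0 < q" and s: "0 < s" and g: "g \<in> borel_measurable borel"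
  shows "(g :: real^'n \<Rightarrow> real) \<in> besov_space p q s \<longleftrightarrow> rho p (s * p) (q / p) g < top"
proof -
  obtain C where C: "\<And>f g :: real^'n \<Rightarrow> real. cube_eq f g \<Longrightarrow> besov_norm p q s f \<le> ennreal C * rho p (s * p) (q / p) g powe (1 / q)"
    using besov_norm_le_rho[OF p(1) q s] by metis
  obtain D where D: "\<And>f g :: real^'n \<Rightarrow> real. cube_eq f g \<Longrightarrow> g \<in> borel_measurable borel \<Longrightarrow>
      rho p (s * p) (q / p) g \<le> ennreal D * besov_norm p q s f powe q"
    using rho_le_besov_norm[OF p q s] by metis
  have "besov_norm p q s g < top" if "rho p (s * p) (q / p) g < top"
    by (rule le_less_trans[OF C[OF cube_eq_refl]]) (use that in \<open>simp add: ennreal_mult_less_top\<close>)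
  moreover have "rho p (s * p) (q / p) g < top" if "besov_norm p q s g < top"
    by (rule le_less_trans[OF D[OF cube_eq_refl g]]) (use that in \<open>simp add: ennreal_mult_less_top\<close>)
  ultimately show ?thesis
    using borel_imp_lebesgue_on[OF g] by (auto simp: besov_space_def)
qed

lemma besov_space_representative:
  assumes p: "0 < p" "p \<le> 1" and q: "0 < q" and s: "0 < s" and f: "f \<in> besov_space p q s"
  obtains g :: "real^'n \<Rightarrow> real" where "g \<in> borel_measurable borel" "cube_eq f g" "rho p (s * p) (q / p) g < top"
proof -
  obtain D where D: "\<And>f g :: real^'n \<Rightarrow> real. cube_eq f g \<Longrightarrow> g \<in> borel_measurable borel \<Longrightarrow>
      rho p (s * p) (q / p) g \<le> ennreal D * besov_norm p q s f powe q"
    using rho_le_besov_norm[OF p q s] by metis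
  obtain g where g: "g \<in> borel_measurable borel" "cube_eq f g"
    using cube_eq_borel_ex[of f] f by (auto simp: besov_space_def)
  moreover have "rho p (s * p) (q / p) g < top"
    by (rule le_less_trans[OF D[OF g(2,1)]]) (use f in \<open>auto simp: besov_space_def ennreal_mult_less_top\<close>)
  ultimately show ?thesis using that by blast
qed

lemma besov_norm_tendsto_0_iff:
  fixes f g :: "nat \<Rightarrow> real^'n \<Rightarrow> real"
  assumes p: "0 < p" "p \<le> 1" and q: "0 < q" and s: "0 < s"
    and fg: "\<And>k. cube_eq (f k) (g k)" "\<And>k. g k \<in> borel_measurable borel"
  shows "(\<lambda>k. besov_norm p q s (f k)) \<longlonglongrightarrow> 0 \<longleftrightarrow> (\<lambda>k. rho p (s * p) (q / p) (g k)) \<longlonglongrightarrow> 0"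
proof
  obtain D where D: "\<And>f g :: real^'n \<Rightarrow> real. cube_eq f g \<Longrightarrow> g \<in> borel_measurable borel \<Longrightarrow>
      rho p (s * p) (q / p) g \<le> ennreal D * besov_norm p q s f powe q"
    using rho_le_besov_norm[OF p q s] by metis
  assume "(\<lambda>k. besov_norm p q s (f k)) \<longlonglongrightarrow> 0"
  from ennreal_cmult_tendsto_0[OF powe_LIMSEQ_0[OF this q], of D]
  show "(\<lambda>k. rho p (s * p) (q / p) (g k)) \<longlonglongrightarrow> 0"
    by (rule ennreal_LIMSEQ_0_le) (rule D[OF fg])
next
  obtain C where C: "\<And>f g :: real^'n \<Rightarrow> real. cube_eq f g \<Longrightarrow> besov_norm p q s f \<le> ennreal C * rho p (s * p) (q / p) g powe (1 / q)"
    using besov_norm_le_rho[OF p(1) q s] by metis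
  assume "(\<lambda>k. rho p (s * p) (q / p) (g k)) \<longlonglongrightarrow> 0"
  from ennreal_cmult_tendsto_0[OF powe_LIMSEQ_0[OF this, of "1 / q"], of C] q
  have "(\<lambda>k. ennreal C * rho p (s * p) (q / p) (g k) powe (1 / q)) \<longlonglongrightarrow> 0" by simp
  then show "(\<lambda>k. besov_norm p q s (f k)) \<longlonglongrightarrow> 0"
    by (rule ennreal_LIMSEQ_0_le) (rule C[OF fg(1)])
qed

lemma haar_coeff_eq:
  fixes f g :: "real^'n \<Rightarrow> real"
  assumes fg: "cube_eq f g" and f: "f \<in> borel_measurable (lebesgue_on unit_cube)"
    and [measurable]: "g \<in> borel_measurable borel" "h \<in> borel_measurable borel"
  shows "haar_coeff h f = hint g h"
proof -
  have [measurable]: "unit_cube \<in> sets (borel :: (real^'n) measure)" by (simp add: unit_cube_def)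
  have gh: "(\<lambda>x. indicator unit_cube x *\<^sub>R (g x * h x)) \<in> borel_measurable lborel" by simp
  have "AE x in lebesgue_on unit_cube. f x * h x = g x * h x"
    using fg unfolding AE_unit_cube_iff cube_eq_def by (elim eventually_mono) auto
    have "haar_coeff h f = (\<integral>x. g x * h x \<partial>lebesgue_on unit_cube)"
      unfolding haar_coeff_def
    proof (rule integral_cong_AE)
      show "(\<lambda>x. f x * h x) \<in> borel_measurable (lebesgue_on unit_cube)"
        by (rule borel_measurable_times[OF f]) (rule borel_imp_lebesgue_on, simp)
      show "(\<lambda>x. g x * h x) \<in> borel_measurable (lebesgue_on unit_cube)"
        by (rule borel_imp_lebesgue_on) simp
    qed fact
    also have "\<dots> = (\<integral>x. indicator unit_cube x *\<^sub>R (g x * h x) \<partial>lborel)"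
      by (subst integral_restrict_space) (simp, rule integral_completion[OF gh])
    also have "\<dots> = hint g h"
      unfolding hint_def
    proof (rule integral_cong_AE)
      show "AE x in lborel. indicator unit_cube x *\<^sub>R (g x * h x) = indicator hcube x * (g x * h x)"
        using AE_unit_cube by eventually_elim (auto simp: indicator_def)
    qed simp_all
    finally show ?thesis .
qed

section \<open>The Haar system in Besov spaces\<close>

lemma step_rho_finite:
  fixes g :: "real^'n \<Rightarrow> real"
  assumes p: "0 < p" "p \<le> 1" and \<sigma>: "0 < \<sigma>" "\<sigma> < 1" and r: "0 < r"
    and g: "pconst k g" "g \<in> borel_measurable borel"
  shows "rho p \<sigma> r g < top"
proof -
  obtain C where "\<And>k g. pconst k g \<Longrightarrow> g \<in> borel_measurable borel \<Longrightarrow>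
    rho p \<sigma> r (g :: real^'n \<Rightarrow> real) \<le> ennreal C * (ennreal (2 powr (\<sigma> * real k)) * pint p g) powe r"
    using rho_pconst[OF p \<sigma> r] by metis
  from this[OF g] show ?thesis
    by (rule le_less_trans) (simp add: ennreal_mult_less_top pint1_pconst_finite[OF g])
qed

lemma step_in_besov_space:
  fixes g :: "real^'n \<Rightarrow> real"
  assumes p: "0 < p" "p \<le> 1" and q: "0 < q" and s: "0 < s" "s * p < 1"
    and g: "pconst k g" "g \<in> borel_measurable borel"
  shows "g \<in> besov_space p q s"
  using step_rho_finite[OF p, of "s * p" "q / p" k g] assms by (simp add: besov_space_iff)

lemma natural_partial_sum_eq_avg:
  fixes e :: "nat \<Rightarrow> real^'n \<Rightarrow> real"
  assumes e: "natural_enumeration e" and g: "g \<in> borel_measurable borel" "pint 1 g < top" and x: "x \<in> hcube"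
  shows "(\<Sum>m<haar_count TYPE('n) k. hint g (e m) * e m x) = avg k g x"
  using sum_natural_enumeration[OF e, of "\<lambda>h. hint g h * h x" k] haar_sum_eq_avg[OF g x, of k] by simp

text \<open>Convergence in \<open>rho\<close> implies convergence in L_1, where coefficients are
  determined. On the critical line p r \<le> 1 means q \<le> 1, so uniqueness persists for p < q
  \<le> 1.\<close>

lemma natural_expansion_unique:
  fixes e :: "nat \<Rightarrow> real^'n \<Rightarrow> real"
  assumes e: "natural_enumeration e" and p: "0 < p" "p \<le> 1" and \<sigma>: "0 < \<sigma>" "\<sigma> < 1" and r: "0 < r"
    and crit: "cdim TYPE('n) * (1 - p) < \<sigma> \<or> (\<sigma> = cdim TYPE('n) * (1 - p) \<and> p * r \<le> 1)"
    and g: "g \<in> borel_measurable borel" and fin: "rho p \<sigma> r g < top"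
    and lim: "(\<lambda>M. rho p \<sigma> r (\<lambda>x. g x - (\<Sum>m<M. c m * e m x))) \<longlonglongrightarrow> 0"
  shows "pint 1 g < top" and "c n = hint g (e n)"
proof -
  obtain C where C: "\<And>f :: real^'n \<Rightarrow> real. f\<in>borel_measurable borel \<Longrightarrow> rho p \<sigma> r f < top \<Longrightarrow>
    pint 1 f \<le> ennreal C * rho p \<sigma> r f powe (1 / (p * r))"
    using L1_embedding[OF p \<sigma>(1) r crit] by auto
  show g1: "pint 1 g < top"
    by (rule le_less_trans[OF C[OF g fin]]) (use fin in \<open>simp add: ennreal_mult_less_top\<close>)
  have le: "pint 1 (\<lambda>x. g x - (\<Sum>m<M. c m * e m x)) \<le> ennreal C * rho p \<sigma> r (\<lambda>x. g x - (\<Sum>m<M. c m * e m x)) powe (1 / (p * r))" for M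
  proof (rule C)
    have Sb: "(\<lambda>x. \<Sum>m<M. c m * e m x) \<in> borel_measurable borel" by (rule natural_partial_sum_borel[OF e])
    then show "(\<lambda>x. g x - (\<Sum>m<M. c m * e m x)) \<in> borel_measurable borel" using g by simp
    have "pconst M (\<lambda>x. \<Sum>m<M. c m * e m x)"
      by (rule natural_partial_sum_pconst[OF e]) (simp add: haar_count_ge less_imp_le)
    from step_rho_finite[OF p \<sigma> r this Sb] fin
    show "rho p \<sigma> r (\<lambda>x. g x - (\<Sum>m<M. c m * e m x)) < top"
      by (intro le_less_trans[OF rho_diff[OF p r g Sb]]) (simp add: ennreal_mult_less_top)
  qed
  have "(\<lambda>M. ennreal C * rho p \<sigma> r (\<lambda>x. g x - (\<Sum>m<M. c m * e m x)) powe (1 / (p * r))) \<longlonglongrightarrow> 0"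
    by (intro ennreal_cmult_tendsto_0 powe_LIMSEQ_0 lim) (use p r in simp)
  from this le have "(\<lambda>M. pint 1 (\<lambda>x. g x - (\<Sum>m<M. c m * e m x))) \<longlonglongrightarrow> 0"
    by (rule ennreal_LIMSEQ_0_le)
  then show "c n = hint g (e n)" by (rule natural_coefficients_unique[OF e g g1])
qed

lemma besov_norm_partial_sums:
  fixes e :: "nat \<Rightarrow> real^'n \<Rightarrow> real"
  assumes e: "natural_enumeration e" and p: "0 < p" "p \<le> 1" and q: "0 < q" and s: "0 < s"
    and fg: "cube_eq f g" and g: "g \<in> borel_measurable borel"
  shows "(\<lambda>M. besov_norm p q s (\<lambda>x. f x - (\<Sum>m<M. c m * e m x))) \<longlonglongrightarrow> 0 \<longleftrightarrow>
    (\<lambda>M. rho p (s * p) (q / p) (\<lambda>x. g x - (\<Sum>m<M. c m * e m x))) \<longlonglongrightarrow> 0"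
proof (rule besov_norm_tendsto_0_iff[OF p q s])
  fix M
  show "cube_eq (\<lambda>x. f x - (\<Sum>m<M. c m * e m x)) (\<lambda>x. g x - (\<Sum>m<M. c m * e m x))"
    by (rule cube_eq_diff[OF fg])
  show "(\<lambda>x. g x - (\<Sum>m<M. c m * e m x)) \<in> borel_measurable borel"
    using natural_partial_sum_borel[OF e] g by simp
qed

lemma haar_schauder_basis:
  fixes e :: "nat \<Rightarrow> real^'n \<Rightarrow> real"
  assumes p: "0 < p" "p \<le> 1" and q: "0 < q" and s: "0 < s" "s * p < 1"
    and crit: "cdim TYPE('n) * (1 - p) < s * p \<or> (s * p = cdim TYPE('n) * (1 - p) \<and> q / p \<le> 1)"
    and e: "natural_enumeration e"
  shows "schauder_basis (besov_space p q s) (besov_norm p q s) e"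
proof -
  have \<sigma>: "0 < s * p" "s * p < 1" and r: "0 < q / p" using p q s by auto
  \<comment> \<open>Uniqueness asks for q \<le> 1 on the critical line, which follows from q \<le> p
    \<le> 1.\<close>
  have crit': "cdim TYPE('n) * (1 - p) < s * p \<or> (s * p = cdim TYPE('n) * (1 - p) \<and> p * (q / p) \<le> 1)"
    using crit mult_le_one[of p "q / p"] p q by auto
  have mem: "e m \<in> besov_space p q s" for m
    using natural_enumeration_image(3)[OF e, of m] haar_system_pconst[of "e m"]
      step_in_besov_space[OF p q s _ natural_enumeration_borel[OF e]] by blast
  have "\<exists>!c. (\<lambda>M. besov_norm p q s (\<lambda>x. f x - (\<Sum>m<M. c m * e m x))) \<longlonglongrightarrow> 0" if f: "f \<in> besov_space p q s" for f
  proof -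
    obtain g where g: "g \<in> borel_measurable borel" "cube_eq f g" "rho p (s * p) (q / p) g < top"
      using besov_space_representative[OF p q s(1) f] by blast
    note conv = besov_norm_partial_sums[OF e p q s(1) g(2,1)]
    note uniq = natural_expansion_unique[OF e p \<sigma> r crit' g(1,3)]
    have g1: "pint 1 g < top"
    proof -
      obtain C where C: "\<And>f :: real^'n \<Rightarrow> real. f\<in>borel_measurable borel \<Longrightarrow> rho p (s * p) (q / p) f < top \<Longrightarrow>
        pint 1 f \<le> ennreal C * rho p (s * p) (q / p) f powe (1 / (p * (q / p)))"
        using L1_embedding[OF p \<sigma>(1) r crit'] by auto
      show ?thesis by (rule le_less_trans[OF C[OF g(1,3)]]) (use g(3) in \<open>simp add: ennreal_mult_less_top\<close>)
    qed
    define L where "L k = (\<lambda>x. \<Sum>m<haar_count TYPE('n) k. hint g (e m) * e m x)" for k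
    have L: "L k x = avg k g x" if "x \<in> hcube" for k x
      unfolding L_def by (rule natural_partial_sum_eq_avg[OF e g(1) g1 that])
    note A = avg_converges[OF p \<sigma> r crit g(1,3)]
    have "(\<lambda>M. rho p (s * p) (q / p) (\<lambda>x. g x - (\<Sum>m<M. hint g (e m) * e m x))) \<longlonglongrightarrow> 0"
    proof (rule natural_series_converges[OF e p \<sigma> r g(1) L_def])
      have "rho p (s * p) (q / p) (\<lambda>x. g x - L k x) = rho p (s * p) (q / p) (\<lambda>x. g x - avg k g x)" for k
        by (rule rho_cong) (simp add: L)
      then show "(\<lambda>k. rho p (s * p) (q / p) (\<lambda>x. g x - L k x)) \<longlonglongrightarrow> 0" using A(1) by simp
      have "pint p (\<lambda>x. L (Suc k) x - L k x) = pint p (\<lambda>x. avg (Suc k) g x - avg k g x)" for k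
        by (rule pint_cong) (simp add: L)
      then show "(\<lambda>k. ennreal (2 powr (s * p * real k)) * pint p (\<lambda>x. L (Suc k) x - L k x)) \<longlonglongrightarrow> 0" using A(2) by simp
    qed
    then have "(\<lambda>M. besov_norm p q s (\<lambda>x. f x - (\<Sum>m<M. hint g (e m) * e m x))) \<longlonglongrightarrow> 0"
      using conv by simp
    moreover have "c = (\<lambda>m. hint g (e m))" if "(\<lambda>M. besov_norm p q s (\<lambda>x. f x - (\<Sum>m<M. c m * e m x))) \<longlonglongrightarrow> 0" for c
      using uniq(2)[of c] that conv by auto
    ultimately show ?thesis by (intro ex1I[of _ "\<lambda>m. hint g (e m)"])
  qed
  with mem show ?thesis by (auto simp: schauder_basis_def)
qed

section \<open>Below the critical line: the expansion of a point mass\<close>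

lemma corner_cell_pint:
  fixes i :: "'n::finite \<Rightarrow> nat"
  assumes i: "i \<in> Idx k" and p: "0 < p"
  shows "pint p (\<lambda>x. c * indicator (cell k i) x) = ennreal (\<bar>c\<bar> powr p * 2 powr (- real k * cdim TYPE('n)))"
proof -
  have "pint p (indicator (cell k i)) = (\<integral>\<^sup>+x. indicator (cell k i) x \<partial>lborel)"
    unfolding pint_def using cell_subset[of k i] p by (intro nn_integral_cong) (auto simp: indicator_def)
  also have "\<dots> = ennreal (2 powr (- real k * cdim TYPE('n)))" using emeasure_cell[OF i] by simp
  finally show ?thesis by (simp add: pint_cmult ennreal_mult)
qed

lemma powr_neg_tendsto_0:
  assumes "a < 0"
  shows "(\<lambda>k. ennreal (2 powr (a * real k))) \<longlonglongrightarrow> 0"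
proof -
  have "(\<lambda>k. (2 powr a) ^ k) \<longlonglongrightarrow> 0"
    using assms by (intro LIMSEQ_realpow_zero) (auto simp: powr_less_one)
  moreover have "(2 powr a) ^ k = 2 powr (a * real k)" for k
    by (simp add: powr_powr flip: powr_realpow)
  ultimately have "(\<lambda>k. 2 powr (a * real k)) \<longlonglongrightarrow> 0" by simp
  then have "(\<lambda>k. ennreal (2 powr (a * real k))) \<longlonglongrightarrow> ennreal 0" by (intro tendsto_ennrealI)
  then show ?thesis by simp
qed

text \<open>The coefficients \<open>e m 0\<close> are those of the point mass at the origin.\<close>

lemma point_mass_expansion_converges:
  fixes e :: "nat \<Rightarrow> real^'n \<Rightarrow> real"
  assumes e: "natural_enumeration e" and p: "0 < p" "p \<le> 1" and \<sigma>: "0 < \<sigma>" "\<sigma> < 1" and r: "0 < r"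
    and small: "\<sigma> < cdim TYPE('n) * (1 - p)"
  shows "(\<lambda>M. rho p \<sigma> r (\<lambda>x. 0 - (\<Sum>m<M. e m 0 * e m x))) \<longlonglongrightarrow> 0"
proof -
  define \<delta> where "\<delta> = cdim TYPE('n) * (1 - p)"
  have neg: "\<sigma> - \<delta> < 0" using small by (simp add: \<delta>_def)
  define Z where "Z = (\<lambda>_ :: 'n. 0 :: nat)"
  have Z: "Z \<in> Idx k" for k by (simp add: Z_def Idx_def)
  have 0: "(0 :: real^'n) \<in> hcube" by (simp add: hcube_iff)
  have i0: "idx k (0 :: real^'n) = Z" for k by (simp add: idx_def Z_def fun_eq_iff)
  define G where "G k x = 2 powr (real k * cdim TYPE('n)) * indicator (cell k Z) x" for k and x :: "real^'n"
  define L where "L k = (\<lambda>x. \<Sum>m<haar_count TYPE('n) k. e m 0 * e m x)" for k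
  have LG: "L k x = G k x" if x: "x \<in> hcube" for k x
  proof -
    have "L k x = (\<Sum>h\<in>haar_upto k. h 0 * h x)"
      unfolding L_def by (rule sum_natural_enumeration[OF e])
    also have "\<dots> = G k x" unfolding haar_kernel[OF 0 x] using x by (auto simp: G_def cell_def i0)
    finally show ?thesis .
  qed
  have pG: "pconst k (G k)" for k
    unfolding G_def by (intro pconst_cmult pconst_indicator_cell) simp
  have [measurable]: "G k \<in> borel_measurable borel" for k unfolding G_def by measurable
  have iG: "pint p (G k) = ennreal (2 powr (- \<delta> * real k))" for k
    unfolding G_def corner_cell_pint[OF Z p(1)] by (simp add: \<delta>_def powr_powr algebra_simps flip: powr_add)
  have w: "ennreal (2 powr (\<sigma> * real k)) * pint p (G k) = ennreal (2 powr ((\<sigma> - \<delta>) * real k))" for k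
    unfolding iG by (simp add: algebra_simps flip: ennreal_mult powr_add)
  obtain K where K: "\<And>k g. pconst k g \<Longrightarrow> g \<in> borel_measurable borel \<Longrightarrow>
    rho p \<sigma> r (g :: real^'n \<Rightarrow> real) \<le> ennreal K * (ennreal (2 powr (\<sigma> * real k)) * pint p g) powe r"
    using rho_pconst[OF p \<sigma> r] by metis
  show ?thesis
  proof (rule natural_series_converges[OF e p \<sigma> r _ L_def])
    show "(\<lambda>k. rho p \<sigma> r (\<lambda>x. 0 - L k x)) \<longlonglongrightarrow> 0"
    proof (rule ennreal_LIMSEQ_0_le)
      fix k
      have "rho p \<sigma> r (\<lambda>x. 0 - L k x) = rho p \<sigma> r (\<lambda>x. - G k x)" by (rule rho_cong) (simp add: LG)
      also have "\<dots> = rho p \<sigma> r (G k)" by (rule rho_uminus)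
      also have "\<dots> \<le> ennreal K * ennreal (2 powr ((\<sigma> - \<delta>) * real k)) powe r"
        using K[OF pG, of k] unfolding w by simp
      finally show "rho p \<sigma> r (\<lambda>x. 0 - L k x) \<le> \<dots>" .
    qed (intro ennreal_cmult_tendsto_0 powe_LIMSEQ_0 powr_neg_tendsto_0 neg r)
    show "(\<lambda>k. ennreal (2 powr (\<sigma> * real k)) * pint p (\<lambda>x. L (Suc k) x - L k x)) \<longlonglongrightarrow> 0"
    proof (rule ennreal_LIMSEQ_0_le)
      fix k
      have "pint p (\<lambda>x. L (Suc k) x - L k x) = pint p (\<lambda>x. G (Suc k) x - G k x)" by (rule pint_cong) (simp add: LG)
      also have "\<dots> \<le> pint p (G (Suc k)) + pint p (G k)" by (rule pint_diff[OF p]) simp_all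
      also have "pint p (G (Suc k)) \<le> pint p (G k)"
        unfolding iG using small \<sigma> by (intro ennreal_leI powr_mono) (auto simp: \<delta>_def mult_left_mono intro!: mult_nonneg_nonneg)
      finally have "ennreal (2 powr (\<sigma> * real k)) * pint p (\<lambda>x. L (Suc k) x - L k x)
          \<le> ennreal (2 powr (\<sigma> * real k)) * (pint p (G k) + pint p (G k))"
        by (intro mult_left_mono) (auto simp: add_right_mono)
      also have "\<dots> = ennreal 2 * ennreal (2 powr ((\<sigma> - \<delta>) * real k))"
        unfolding distrib_left w by (simp add: mult_2)
      finally show "ennreal (2 powr (\<sigma> * real k)) * pint p (\<lambda>x. L (Suc k) x - L k x) \<le> \<dots>" .
    qed (intro ennreal_cmult_tendsto_0 powr_neg_tendsto_0 neg)
  qed simp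
qed

lemma schauder_basis_unique:
  assumes sb: "schauder_basis X N e" and f: "f \<in> X"
    and c: "(\<lambda>M. N (\<lambda>x. f x - (\<Sum>m<M. c m * e m x))) \<longlonglongrightarrow> 0"
    and c': "(\<lambda>M. N (\<lambda>x. f x - (\<Sum>m<M. c' m * e m x))) \<longlonglongrightarrow> 0"
  shows "c = c'"
proof -
  define P where "P c \<longleftrightarrow> (\<lambda>M. N (\<lambda>x. f x - (\<Sum>m<M. c m * e m x))) \<longlonglongrightarrow> 0" for c :: "nat \<Rightarrow> real"
  have "\<forall>f\<in>X. \<exists>!c. (\<lambda>M. N (\<lambda>x. f x - (\<Sum>m<M. c m * e m x))) \<longlonglongrightarrow> 0"
    using sb by (simp add: schauder_basis_def)
  from bspec[OF this f] have "\<exists>!c. P c" unfolding P_def .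
  moreover have "P c" "P c'" unfolding P_def by (rule c c')+
  ultimately show ?thesis by blast
qed

lemma schauder_basis_expansion:
  assumes sb: "schauder_basis X N e" and f: "f \<in> X"
  obtains c where "(\<lambda>M. N (\<lambda>x. f x - (\<Sum>m<M. c m * e m x))) \<longlonglongrightarrow> 0"
proof -
  have "\<forall>f\<in>X. \<exists>!c. (\<lambda>M. N (\<lambda>x. f x - (\<Sum>m<M. c m * e m x))) \<longlonglongrightarrow> 0"
    using sb by (simp add: schauder_basis_def)
  from ex1_implies_ex[OF bspec[OF this f]] that show ?thesis by (elim exE)
qed

text \<open>Zero has two expansions, the trivial one and that of the point mass at the origin. They
  differ at index 0, since \<open>e 0\<close> is the indicator of the cube and has the value 1 at
  the origin.\<close>

lemma not_schauder_basis_small_smoothness: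
  fixes e :: "nat \<Rightarrow> real^'n \<Rightarrow> real"
  assumes p: "0 < p" "p \<le> 1" and q: "0 < q" and s: "0 < s" "s * p < 1"
    and small: "s * p < cdim TYPE('n) * (1 - p)" and e: "natural_enumeration e"
  shows "\<not> schauder_basis (besov_space p q s) (besov_norm p q s) e"
proof
  assume sb: "schauder_basis (besov_space p q s) (besov_norm p q s) e"
  have \<sigma>: "0 < s * p" and r: "0 < q / p" using p q s by auto
  have z: "(\<lambda>x :: real^'n. 0) \<in> besov_space p q s"
    by (rule step_in_besov_space[OF p q s pconst_const]) simp
  note conv = besov_norm_partial_sums[OF e p q s(1) cube_eq_refl, of "\<lambda>x. 0"]
  have 1: "(\<lambda>M. besov_norm p q s (\<lambda>x. 0 - (\<Sum>m<M. e m 0 * e m x))) \<longlonglongrightarrow> 0"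
    using conv point_mass_expansion_converges[OF e p \<sigma> s(2) r small] by simp
  have 2: "(\<lambda>M. besov_norm p q s (\<lambda>x. 0 - (\<Sum>m<M. 0 * e m x))) \<longlonglongrightarrow> 0"
    using conv[of "\<lambda>_. 0"] by simp
  have "(\<lambda>m. e m 0) = (\<lambda>m. 0)" by (rule schauder_basis_unique[OF sb z 1 2])
  then have "e 0 0 = 0" by (rule fun_cong)
  then show False by (simp add: natural_enumeration_0[OF e] unit_cube_def mem_box_cart)
qed

subsection \<open>Bounded functionals\<close>

lemma besov_norm_add_step_finite:
  fixes f V :: "real^'n \<Rightarrow> real"
  assumes p: "0 < p" "p \<le> 1" and q: "0 < q" and s: "0 < s" "s * p < 1"
    and f: "f \<in> besov_space p q s" and V: "pconst k V" "V \<in> borel_measurable borel"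
  shows "(\<lambda>x. f x - V x) \<in> besov_space p q s"
proof -
  obtain g where g: "g \<in> borel_measurable borel" "cube_eq f g" "rho p (s * p) (q / p) g < top"
    using besov_space_representative[OF p q s(1) f] by blast
  obtain C where C: "\<And>f g :: real^'n \<Rightarrow> real. cube_eq f g \<Longrightarrow> besov_norm p q s f \<le> ennreal C * rho p (s * p) (q / p) g powe (1 / q)"
    using besov_norm_le_rho[OF p(1) q s(1)] by metis
  have "rho p (s * p) (q / p) (\<lambda>x. g x - V x) < top"
    using step_rho_finite[OF p, of "s * p" "q / p" k V] g(3) V p q s
    by (intro le_less_trans[OF rho_diff[OF p _ g(1) V(2)]]) (auto simp: ennreal_mult_less_top)
  then have "besov_norm p q s (\<lambda>x. f x - V x) < top"
    by (intro le_less_trans[OF C[OF cube_eq_diff[OF g(2)]]]) (simp add: ennreal_mult_less_top)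
  then show ?thesis using f borel_imp_lebesgue_on[OF V(2)] by (auto simp: besov_space_def)
qed

lemma bounded_functionalE:
  assumes "bounded_functional X N \<phi>"
  obtains C where "C \<ge> 0" "\<And>f. f \<in> X \<Longrightarrow> ennreal \<bar>\<phi> f\<bar> \<le> ennreal C * N f"
    "\<And>f g. f \<in> X \<Longrightarrow> g \<in> X \<Longrightarrow> \<phi> (\<lambda>x. f x + g x) = \<phi> f + \<phi> g" "\<And>f a. f \<in> X \<Longrightarrow> \<phi> (\<lambda>x. a * f x) = a * \<phi> f"
proof -
  obtain C where C: "\<And>f. f \<in> X \<Longrightarrow> ennreal \<bar>\<phi> f\<bar> \<le> ennreal C * N f"
    using assms unfolding bounded_functional_def by blast
  have "ennreal C * N f \<le> ennreal \<bar>C\<bar> * N f" for f by (intro mult_right_mono ennreal_leI) auto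
  then have "ennreal \<bar>\<phi> f\<bar> \<le> ennreal \<bar>C\<bar> * N f" if "f \<in> X" for f using C[OF that] by (rule order_trans[rotated])
  then show ?thesis using assms that[of "\<bar>C\<bar>"] by (auto simp: bounded_functional_def)
qed

text \<open>A cell indicator of level m has quasi-norm of order 2^((\<sigma> - d) m / p). Writing V
  as a combination of 2^(d m) of them bounds the functional at V by a constant times 2^((\<sigma> -
  \<delta>) m / p), which tends to 0 as the cells are refined.\<close>

lemma functional_vanishes_on_steps:
  fixes V :: "real^'n \<Rightarrow> real"
  assumes p: "0 < p" "p \<le> 1" and q: "0 < q" and s: "0 < s" "s * p < 1"
    and small: "s * p < cdim TYPE('n) * (1 - p)"
    and \<phi>: "bounded_functional (besov_space p q s) (besov_norm p q s) \<phi>"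
    and V: "pconst k V" "V \<in> borel_measurable borel"
  shows "\<phi> V = 0"
proof -
  define \<sigma> where "\<sigma> = s * p"
  define d where "d = cdim TYPE('n)"
  have \<sigma>: "0 < \<sigma>" "\<sigma> < 1" and r: "0 < q / p" using p q s by (auto simp: \<sigma>_def)
  let ?X = "besov_space p q s :: (real^'n \<Rightarrow> real) set"
  obtain C where C: "C \<ge> 0" "\<And>f. f \<in> ?X \<Longrightarrow> ennreal \<bar>\<phi> f\<bar> \<le> ennreal C * besov_norm p q s f"
    "\<And>f g. f \<in> ?X \<Longrightarrow> g \<in> ?X \<Longrightarrow> \<phi> (\<lambda>x. f x + g x) = \<phi> f + \<phi> g" "\<And>f a. f \<in> ?X \<Longrightarrow> \<phi> (\<lambda>x. a * f x) = a * \<phi> f"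
    by (rule bounded_functionalE[OF \<phi>], rule that; assumption)
  obtain A where A: "A \<ge> 0" "\<And>f g :: real^'n \<Rightarrow> real. cube_eq f g \<Longrightarrow> besov_norm p q s f \<le> ennreal A * rho p \<sigma> (q / p) g powe (1 / q)"
    using besov_norm_le_rho[OF p(1) q s(1)] unfolding \<sigma>_def by metis
  obtain K where K: "K \<ge> 0" "\<And>k g. pconst k g \<Longrightarrow> g \<in> borel_measurable borel \<Longrightarrow>
    rho p \<sigma> (q / p) (g :: real^'n \<Rightarrow> real) \<le> ennreal K * (ennreal (2 powr (\<sigma> * real k)) * pint p g) powe (q / p)"
    using rho_pconst[OF p \<sigma> r] by metis
  obtain B where B: "B \<ge> 0" "\<And>x. x \<in> hcube \<Longrightarrow> \<bar>V x\<bar> \<le> B" using pconst_bounded[OF V(1)] by blast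
  define D where "D = C * (A * K powr (1 / q))"
  have cellX: "indicator (cell m i) \<in> ?X" for m i
    by (rule step_in_besov_space[OF p q s pconst_indicator_cell]) auto
  have cell_le: "\<bar>\<phi> (indicator (cell m i))\<bar> \<le> D * 2 powr ((\<sigma> - d) / p * real m)" if i: "i \<in> Idx m" for m i
  proof -
    have "pint p (indicator (cell m i)) = ennreal (2 powr (- real m * d))"
      using corner_cell_pint[OF i p(1), of 1] by (simp add: d_def)
    then have "rho p \<sigma> (q / p) (indicator (cell m i)) \<le> ennreal K * (ennreal (2 powr (\<sigma> * real m)) * ennreal (2 powr (- real m * d))) powe (q / p)"
      using K(2)[OF pconst_indicator_cell, of m m i] by simp
    also have "\<dots> = ennreal K * ennreal (2 powr ((\<sigma> - d) * real m)) powe (q / p)"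
      by (simp add: algebra_simps flip: ennreal_mult powr_add)
    finally have "rho p \<sigma> (q / p) (indicator (cell m i)) powe (1 / q) \<le> (ennreal K * ennreal (2 powr ((\<sigma> - d) * real m)) powe (q / p)) powe (1 / q)"
      using q by (intro powe_mono) auto
    also have "\<dots> = ennreal (K powr (1 / q) * 2 powr ((\<sigma> - d) / p * real m))"
      using K(1) q by (simp add: powe_mult powr_powr ennreal_mult)
    finally have 1: "rho p \<sigma> (q / p) (indicator (cell m i)) powe (1 / q) \<le> \<dots>" .
    have "ennreal \<bar>\<phi> (indicator (cell m i))\<bar> \<le> ennreal C * (ennreal A * rho p \<sigma> (q / p) (indicator (cell m i)) powe (1 / q))"
      by (rule order_trans[OF C(2)[OF cellX]], rule mult_left_mono[OF A(2)[OF cube_eq_refl]]) simp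
    also have "\<dots> \<le> ennreal C * (ennreal A * ennreal (K powr (1 / q) * 2 powr ((\<sigma> - d) / p * real m)))"
      by (intro mult_left_mono 1) auto
    also have "\<dots> = ennreal (D * 2 powr ((\<sigma> - d) / p * real m))"
      using C(1) A(1) by (simp add: D_def ennreal_mult mult.assoc)
    finally show ?thesis
      using C(1) A(1) by (subst (asm) ennreal_le_iff) (auto simp: D_def)
  qed
  have sumX: "(\<lambda>x. \<Sum>i\<in>F. v i * indicator (cell m i) x) \<in> ?X" for m and v :: "('n \<Rightarrow> nat) \<Rightarrow> real" and F
  proof (rule step_in_besov_space[OF p q s])
    show "pconst m (\<lambda>x. \<Sum>i\<in>F. v i * indicator (cell m i) x)"
      by (intro pconst_sum pconst_cmult pconst_indicator_cell order_refl)
  qed measurable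
  have phi_sum: "\<phi> (\<lambda>x. \<Sum>i\<in>F. v i * indicator (cell m i) x) = (\<Sum>i\<in>F. v i * \<phi> (indicator (cell m i)))"
    if "finite F" for F and v :: "('n \<Rightarrow> nat) \<Rightarrow> real" and m
    using that
  proof induction
    case empty
    then show ?case using C(4)[OF sumX[of v m "{}"], of 0] by simp
  next
    case (insert j F)
    have vX: "(\<lambda>x. v j * indicator (cell m j) x) \<in> ?X" using sumX[of v m "{j}"] by (simp only: sum.insert[OF finite.emptyI] empty_iff not_False_eq_True sum.empty add_0_right)
    have "\<phi> (\<lambda>x. \<Sum>i\<in>insert j F. v i * indicator (cell m i) x) = \<phi> (\<lambda>x. v j * indicator (cell m j) x + (\<Sum>i\<in>F. v i * indicator (cell m i) x))"
      by (simp only: sum.insert[OF insert.hyps])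
    also have "\<dots> = v j * \<phi> (indicator (cell m j)) + (\<Sum>i\<in>F. v i * \<phi> (indicator (cell m i)))"
      by (simp only: C(3)[OF vX sumX[of v m F]] C(4)[OF cellX] insert.IH)
    finally show ?case by (simp only: sum.insert[OF insert.hyps])
  qed
  have le: "\<bar>\<phi> V\<bar> \<le> B * D * 2 powr ((\<sigma> - d * (1 - p)) / p * real m)" if m: "k \<le> m" for m
  proof -
    define W where "W x = (\<Sum>i\<in>Idx m. V (corner m i) * indicator (cell m i) x)" for x
    have WX: "W \<in> ?X" unfolding W_def by (rule sumX)
    have VX: "V \<in> ?X" by (rule step_in_besov_space[OF p q s V])
    have eq: "V x = W x" if "x \<in> hcube" for x
    proof -
      have "W x = (\<Sum>i\<in>Idx m. if i = idx m x then V (corner m i) else 0)"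
        unfolding W_def using that by (intro sum.cong) (auto simp: cell_def)
      also have "\<dots> = V (corner m (idx m x))" using idx_in_Idx[OF that, of m] by simp
      finally show ?thesis using pconst_corner[OF pconst_mono[OF V(1) m] that] by simp
    qed
    have mWX: "(\<lambda>x. (-1) * W x) \<in> ?X"
      using sumX[of "\<lambda>i. (-1) * V (corner m i)" m "Idx m"] unfolding W_def sum_distrib_left by (simp add: mult.assoc)
    have dX: "(\<lambda>x. V x + (-1) * W x) \<in> ?X"
    proof (rule step_in_besov_space[OF p q s])
      have "pconst m W" unfolding W_def by (intro pconst_sum pconst_cmult pconst_indicator_cell order_refl)
      then show "pconst m (\<lambda>x. V x + (-1) * W x)"
        by (intro pconst_comp2[OF pconst_mono[OF V(1) m], where h = "\<lambda>a b. a + (-1) * b"])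
      have [measurable]: "V \<in> borel_measurable borel" by (rule V)
      show "(\<lambda>x. V x + (-1) * W x) \<in> borel_measurable borel" unfolding W_def by measurable
    qed
    \<comment> \<open>V and W agree on the cube only. Their difference has quasi-norm 0, so
      boundedness makes \<phi> vanish on it.\<close>
    have "besov_norm p q s (\<lambda>x. V x + (-1) * W x) \<le> ennreal A * rho p \<sigma> (q / p) (\<lambda>x :: real^'n. 0) powe (1 / q)"
      by (rule A(2)) (simp add: cube_eq_cong eq)
    then have "\<phi> (\<lambda>x. V x + (-1) * W x) = 0" using C(2)[OF dX] by simp
    then have "\<phi> V = \<phi> W" using C(3)[OF VX mWX] C(4)[OF WX, of "-1"] by simp
    also have "\<phi> W = (\<Sum>i\<in>Idx m. V (corner m i) * \<phi> (indicator (cell m i)))"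
      unfolding W_def by (rule phi_sum) simp
    finally have "\<bar>\<phi> V\<bar> \<le> (\<Sum>i\<in>Idx m. \<bar>V (corner m i)\<bar> * \<bar>\<phi> (indicator (cell m i))\<bar>)"
      using sum_abs[of "\<lambda>i. V (corner m i) * \<phi> (indicator (cell m i))" "Idx m"] by (simp add: abs_mult)
    also have "\<dots> \<le> (\<Sum>i\<in>(Idx m :: ('n \<Rightarrow> nat) set). B * (D * 2 powr ((\<sigma> - d) / p * real m)))"
      using B corner_in_hcube cell_le by (intro sum_mono mult_mono) auto
    also have "\<dots> = 2 powr (d * real m) * (B * (D * 2 powr ((\<sigma> - d) / p * real m)))"
      by (simp add: card_Idx d_def mult.commute[of "real m"] flip: powr_realpow)
    also have "\<dots> = B * D * (2 powr (d * real m) * 2 powr ((\<sigma> - d) / p * real m))" by simp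
    also have "2 powr (d * real m) * 2 powr ((\<sigma> - d) / p * real m) = 2 powr ((\<sigma> - d * (1 - p)) / p * real m)"
      using p by (simp add: field_simps flip: powr_add)
    finally show ?thesis .
  qed
  have neg: "(\<sigma> - d * (1 - p)) / p < 0" using small p by (simp add: \<sigma>_def d_def field_simps)
  have BD: "0 \<le> B * D" using B C(1) A(1) by (simp add: D_def)
  have "(\<lambda>m. ennreal (B * D) * ennreal (2 powr ((\<sigma> - d * (1 - p)) / p * real m))) \<longlonglongrightarrow> 0"
    by (intro ennreal_cmult_tendsto_0 powr_neg_tendsto_0 neg)
  then have "ennreal \<bar>\<phi> V\<bar> \<le> 0"
  proof (rule LIMSEQ_le_const)
    show "\<exists>N. \<forall>m\<ge>N. ennreal \<bar>\<phi> V\<bar> \<le> ennreal (B * D) * ennreal (2 powr ((\<sigma> - d * (1 - p)) / p * real m))"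
      using le BD by (intro exI[of _ k]) (auto simp: ennreal_leI simp flip: ennreal_mult)
  qed
  then show ?thesis by simp
qed

text \<open>Step functions are dense for \<sigma> < 1 by \<open>analysis\<close> and
  \<open>step_approximation_converges\<close>, and the functional vanishes on them.\<close>

lemma trivial_dual:
  fixes f :: "real^'n \<Rightarrow> real"
  assumes p: "0 < p" "p \<le> 1" and q: "0 < q" and s: "0 < s" "s * p < 1"
    and small: "s * p < cdim TYPE('n) * (1 - p)"
    and \<phi>: "bounded_functional (besov_space p q s) (besov_norm p q s) \<phi>" and f: "f \<in> besov_space p q s"
  shows "\<phi> f = 0"
proof -
  have \<sigma>: "0 < s * p" and r: "0 < q / p" using p q s by auto
  let ?X = "besov_space p q s :: (real^'n \<Rightarrow> real) set"
  obtain C where C: "C \<ge> 0" "\<And>f. f \<in> ?X \<Longrightarrow> ennreal \<bar>\<phi> f\<bar> \<le> ennreal C * besov_norm p q s f"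
    "\<And>f g. f \<in> ?X \<Longrightarrow> g \<in> ?X \<Longrightarrow> \<phi> (\<lambda>x. f x + g x) = \<phi> f + \<phi> g" "\<And>f a. f \<in> ?X \<Longrightarrow> \<phi> (\<lambda>x. a * f x) = a * \<phi> f"
    by (rule bounded_functionalE[OF \<phi>], rule that; assumption)
  obtain g where g: "g \<in> borel_measurable borel" "cube_eq f g" "rho p (s * p) (q / p) g < top"
    using besov_space_representative[OF p q s(1) f] by blast
  obtain A V where V: "step_seq V" "apx p (s * p) (q / p) g V \<le> ennreal A * rho p (s * p) (q / p) g"
    using analysis[OF p \<sigma> r] g(1) by metis
  have afin: "apx p (s * p) (q / p) g V < top"
    using V(2) g(3) by (metis (no_types) ennreal_mult_less_top ennreal_less_top le_less_trans)
  have "(\<lambda>k. rho p (s * p) (q / p) (\<lambda>x. g x - V k x)) \<longlonglongrightarrow> 0"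
    by (rule step_approximation_converges[OF p \<sigma> s(2) r V(1) g(1) afin])
  then have lim: "(\<lambda>k. besov_norm p q s (\<lambda>x. f x - V k x)) \<longlonglongrightarrow> 0"
    using besov_norm_tendsto_0_iff[OF p q s(1), of "\<lambda>k x. f x - V k x" "\<lambda>k x. g x - V k x"]
      cube_eq_diff[OF g(2)] g(1) step_seqD(2)[OF V(1)] by simp
  have "ennreal \<bar>\<phi> f\<bar> \<le> ennreal C * besov_norm p q s (\<lambda>x. f x - V k x)" for k
  proof -
    have dX: "(\<lambda>x. f x - V k x) \<in> ?X"
      by (rule besov_norm_add_step_finite[OF p q s f step_seqD[OF V(1)]])
    have "\<phi> (\<lambda>x. (f x - V k x) + V k x) = \<phi> (\<lambda>x. f x - V k x) + \<phi> (V k)"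
      by (rule C(3)[OF dX step_in_besov_space[OF p q s step_seqD[OF V(1)]]])
    also have "\<phi> (V k) = 0" by (rule functional_vanishes_on_steps[OF p q s small \<phi> step_seqD[OF V(1)]])
    finally have "\<phi> f = \<phi> (\<lambda>x. f x - V k x)" by simp
    then show ?thesis using C(2)[OF dX] by simp
  qed
  then have "ennreal \<bar>\<phi> f\<bar> \<le> 0"
    by (intro LIMSEQ_le_const[OF ennreal_cmult_tendsto_0[OF lim, of C]]) auto
  then show ?thesis by simp
qed

section \<open>Smoothness at or above 1/p\<close>

lemma besov_space_constant:
  fixes f :: "real^'n \<Rightarrow> real"
  assumes p: "0 < p" "p \<le> 1" and q: "0 < q" and s: "0 < s" "1 \<le> s * p" and f: "f \<in> besov_space p q s"
  shows "\<exists>c. AE x in lborel. x \<in> hcube \<longrightarrow> f x = c"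
proof -
  obtain g where g: "g \<in> borel_measurable borel" "cube_eq f g" "rho p (s * p) (q / p) g < top"
    using besov_space_representative[OF p q s(1) f] by blast
  have r: "0 < q / p" using p q by simp
  obtain c where c: "AE x in lborel. x \<in> hcube \<longrightarrow> g x = c"
    using constant_of_large_smoothness[OF p s(2) r g(1,3)] by blast
  have "AE x in lborel. x \<in> hcube \<longrightarrow> f x = c"
    using c g(2) unfolding cube_eq_def by eventually_elim auto
  then show ?thesis by blast
qed

text \<open>Basis elements belong to the space and would be constant almost everywhere; a Haar
  function of level 1 is orthogonal to constants but has inner product 1 with itself.\<close>

lemma not_schauder_basis_large_smoothness:
  fixes e :: "nat \<Rightarrow> real^'n \<Rightarrow> real"
  assumes p: "0 < p" "p \<le> 1" and q: "0 < q" and s: "0 < s" "1 \<le> s * p" and e: "natural_enumeration e"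
  shows "\<not> schauder_basis (besov_space p q s) (besov_norm p q s) e"
proof
  assume "schauder_basis (besov_space p q s) (besov_norm p q s) e"
  then have X: "e m \<in> besov_space p q s" for m by (auto simp: schauder_basis_def)
  obtain h where h: "h \<in> (haar_level (Suc 0) :: (real^'n \<Rightarrow> real) set)" using haar_level_nonempty by blast
  then have "h \<in> range e" using e unfolding natural_enumeration_def bij_betw_def haar_system_def by blast
  then obtain m where m: "h = e m" by blast
  obtain c where c: "AE x in lborel. x \<in> hcube \<longrightarrow> h x = c"
    using besov_space_constant[OF p q s X[of m]] m by blast
  have [measurable]: "h \<in> borel_measurable borel" by (rule haar_level_borel[OF h])
  have "hint h h = hint (\<lambda>x. c) h"
    unfolding hint_def
  proof (rule integral_cong_AE)
    show "AE x in lborel. indicator hcube x * (h x * h x) = indicator hcube x * (c * h x)"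
      using c by eventually_elim (auto simp: indicator_def)
  qed simp_all
  also have "\<dots> = 0" by (rule hint_step_haar_level[OF pconst_const[of 0] _ h]) simp
  finally show False using hint_haar_self[OF h] by simp
qed

subsection \<open>The critical smoothness with large \<open>q\<close>\<close>

lemma spikes_eq_upto:
  assumes "\<And>m. 0 \<le> \<beta> m" "\<And>m. k \<le> m \<Longrightarrow> \<beta> m = 0 \<or> x \<notin> cell m (i m)"
  shows "spikes \<beta> i x = spikes_upto \<beta> i k x"
proof -
  have z: "ennreal (\<beta> (l + k) * 2 powr (real (l + k) * cdim TYPE('a))) * indicator (cell (l + k) (i (l + k))) x = 0" for l
    using assms(2)[of "l + k"] by auto
  have "ennreal \<bar>spikes \<beta> i x - spikes_upto \<beta> i k x\<bar> \<le> 0"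
    using spikes_diff_le[of \<beta> i x k] assms(1) unfolding z by simp
  then show ?thesis by simp
qed

lemma hint_indicator_cell:
  fixes i :: "'n::finite \<Rightarrow> nat" and h :: "real^'n \<Rightarrow> real"
  assumes i: "i \<in> Idx m" and h: "\<And>x. x \<in> cell m i \<Longrightarrow> h x = v"
  shows "hint (indicator (cell m i)) h = v * 2 powr (- real m * cdim TYPE('n))"
proof -
  have "hint (indicator (cell m i)) h = (\<integral>x. v * indicator (cell m i) x \<partial>lborel)"
    unfolding hint_def using h cell_subset[of m i] by (intro Bochner_Integration.integral_cong) (auto simp: indicator_def)
  then show ?thesis using i by (simp add: measure_def emeasure_cell)
qed

text \<open>Elements of \<open>haar_span\<close> have prescribed values off the cube too, so a given
  step function can only be matched on \<open>hcube\<close>.\<close>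

lemma haar_span_step:
  fixes g :: "real^'n \<Rightarrow> real"
  assumes "pconst k g" "g \<in> borel_measurable borel"
  obtains G where "G \<in> haar_span" "pconst k G" "G \<in> borel_measurable borel" "\<And>x. x \<in> hcube \<Longrightarrow> G x = g x"
proof -
  define G where "G x = (\<Sum>h\<in>haar_upto k. hint g h * h x)" for x
  have "G \<in> haar_span"
    unfolding haar_span_def G_def using haar_upto_subset[of k, where 'a = 'n]
    by (intro CollectI exI[of _ "haar_upto k"] exI[of _ "hint g"]) auto
  moreover have "pconst k G" unfolding G_def by (intro pconst_sum pconst_cmult haar_upto_pconst)
  moreover have "G \<in> borel_measurable borel"
    unfolding G_def by (intro borel_measurable_sum borel_measurable_times borel_measurable_const haar_system_borel) (use haar_upto_subset in auto)
  moreover have "G x = g x" if "x \<in> hcube" for x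
    unfolding G_def by (rule haar_expansion_pconst[OF assms that])
  ultimately show ?thesis using that by blast
qed

text \<open>On some cell of level k the function h has a nonzero constant value v. K nested spikes
  of mass 1 in this cell have coefficient K v, while by \<open>rho_spikes\<close> the quasi-norm of
  their sum is of order at most K^(1/q); for q > 1 these rates are incompatible.\<close>

lemma haar_coeff_not_bounded:
  fixes h :: "real^'n \<Rightarrow> real"
  assumes p: "0 < p" "p < 1" and q: "1 < q" and s: "0 < s" "s * p = cdim TYPE('n) * (1 - p)" "s * p < 1"
    and h: "h \<in> haar_system"
    and \<phi>: "bounded_functional (besov_space p q s) (besov_norm p q s) \<phi>"
    and eq: "\<And>g. g \<in> haar_span \<Longrightarrow> \<phi> g = haar_coeff h g"
  shows False
proof -
  let ?X = "besov_space p q s :: (real^'n \<Rightarrow> real) set"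
  have p': "p \<le> 1" and q0: "0 < q" and r: "0 < q / p" using p q by auto
  obtain k where k: "pconst k h" using haar_system_pconst[OF h] by blast
  have hb: "h \<in> borel_measurable borel" by (rule haar_system_borel[OF h])
  have "\<exists>i0\<in>Idx k. h (corner k i0) \<noteq> 0"
  proof (rule ccontr)
    assume no: "\<not> ?thesis"
    have "indicator hcube x * (h x * h x) = 0" for x
    proof (cases "x \<in> hcube")
      case True
      then have "h x = 0" using no pconst_corner[OF k True] idx_in_Idx[OF True, of k] by auto
      then show ?thesis by simp
    qed simp
    then have "hint h h = 0" unfolding hint_def by (simp only: integral_zero)
    then show False using haar_orthonormal[OF h h] by simp
  qed
  then obtain i0 where i0: "i0 \<in> Idx k" "h (corner k i0) \<noteq> 0" by blast
  define v where "v = h (corner k i0)"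
  obtain C1 where C1: "C1 \<ge> 0" "\<And>f. f \<in> ?X \<Longrightarrow> ennreal \<bar>\<phi> f\<bar> \<le> ennreal C1 * besov_norm p q s f"
    by (rule bounded_functionalE[OF \<phi>], rule that; assumption)
  obtain A where A: "A \<ge> 0" "\<And>f g :: real^'n \<Rightarrow> real. cube_eq f g \<Longrightarrow> besov_norm p q s f \<le> ennreal A * rho p (s * p) (q / p) g powe (1 / q)"
    using besov_norm_le_rho[OF p(1) q0 s(1)] by metis
  obtain C where C: "C \<ge> 0" "\<And>\<beta> i. (\<forall>m. 0 \<le> \<beta> m) \<Longrightarrow> (\<forall>m. i m \<in> Idx m) \<Longrightarrow>
    rho p (s * p) (q / p) (spikes \<beta> i :: real^'n \<Rightarrow> real) \<le> ennreal C * (\<Sum>m. ennreal (\<beta> m powr (p * (q / p))))"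
    using rho_spikes[OF p r s(2,3)] by metis
  \<comment> \<open>The descendant of i0 at its lower corner. Below level k the index 0 is a
    placeholder, since the weights vanish there.\<close>
  define i where "i m = (\<lambda>l. if k \<le> m then i0 l * 2^(m - k) else 0)" for m
  have i: "i m \<in> Idx m" for m
    unfolding Idx_def
  proof (intro CollectI allI)
    fix l
    have "k \<le> m \<Longrightarrow> i0 l * 2^(m - k) < 2^k * 2^(m - k)" using i0(1) by (intro mult_strict_right_mono) (auto simp: Idx_def)
    then show "i m l < 2^m" by (auto simp: i_def simp flip: power_add)
  qed
  have sub: "x \<in> cell k i0" if "x \<in> cell m (i m)" "k \<le> m" for x m
  proof -
    have "idx k x l = i0 l" for l using that idx_div[of k x l "m - k"] by (simp add: cell_def i_def)
    then show ?thesis using that by (auto simp: cell_def)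
  qed
  have main: "real K * \<bar>v\<bar> \<le> C1 * (A * C powr (1 / q)) * real K powr (1 / q)" for K
  proof -
    define \<beta> where "\<beta> m = (if k \<le> m \<and> m < k + K then 1 else 0 :: real)" for m
    have \<beta>0: "0 \<le> \<beta> m" for m by (simp add: \<beta>_def)
    define g0 where "g0 = (spikes_upto \<beta> i (k + K) :: real^'n \<Rightarrow> real)"
    have sp: "spikes \<beta> i = g0"
      unfolding g0_def by (intro ext spikes_eq_upto \<beta>0) (auto simp: \<beta>_def)
    have "(\<Sum>m. ennreal (\<beta> m powr (p * (q / p)))) = (\<Sum>m\<in>{k..<k + K}. ennreal (\<beta> m powr (p * (q / p))))"
      by (rule suminf_finite) (auto simp: \<beta>_def)
    also have "\<dots> = (\<Sum>m\<in>{k..<k + K}. 1)" by (intro sum.cong) (auto simp: \<beta>_def)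
    also have "\<dots> = ennreal (real K)" by (simp add: ennreal_of_nat_eq_real_of_nat)
    finally have cnt: "(\<Sum>m. ennreal (\<beta> m powr (p * (q / p)))) = ennreal (real K)" .
    have rho: "rho p (s * p) (q / p) g0 \<le> ennreal C * ennreal (real K)"
      unfolding sp[symmetric] cnt[symmetric] by (rule C(2)) (intro allI \<beta>0 i)+
    have g0b: "g0 \<in> borel_measurable borel" by (simp add: g0_def)
    have g0p: "pconst (k + K) g0"
      using pconst_mono[OF spikes_upto_pconst[of "k + K - 1" \<beta> i], of "k + K"]
      by (cases "k + K") (auto simp: g0_def spikes_upto_def[abs_def])
    have "hint g0 h = (\<Sum>m<k + K. (\<beta> m * 2 powr (real m * cdim TYPE('n))) * hint (indicator (cell m (i m))) h)"
      unfolding g0_def spikes_upto_def[abs_def]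
      by (rule hint_sum_left[OF _ _ _ k hb]) (auto intro: pint1_pconst_finite[OF pconst_indicator_cell])
    also have "\<dots> = (\<Sum>m<k + K. if k \<le> m then v else 0)"
    proof (rule sum.cong)
      fix m assume m: "m \<in> {..<k + K}"
      show "(\<beta> m * 2 powr (real m * cdim TYPE('n))) * hint (indicator (cell m (i m))) h = (if k \<le> m then v else 0)"
      proof (cases "k \<le> m")
        case True
        have "hint (indicator (cell m (i m))) h = v * 2 powr (- real m * cdim TYPE('n))"
          by (rule hint_indicator_cell[OF i]) (use sub[OF _ True] pconst_cell[OF k] in \<open>auto simp: v_def\<close>)
        then show ?thesis using True m by (simp add: \<beta>_def mult.left_commute[of _ v] flip: powr_add)
      qed (simp add: \<beta>_def)
    qed simp
    also have "\<dots> = (\<Sum>m\<in>{k..<k + K}. v)"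
      by (rule sum.mono_neutral_cong_right) auto
    also have "\<dots> = real K * v" by simp
    finally have hg: "hint g0 h = real K * v" .
    obtain G where G: "G \<in> haar_span" "pconst (k + K) G" "G \<in> borel_measurable borel" "\<And>x. x \<in> hcube \<Longrightarrow> G x = g0 x"
      using haar_span_step[OF g0p g0b] by blast
    have ce: "cube_eq G g0" by (rule cube_eq_cong) (rule G(4))
    have GX: "G \<in> ?X" by (rule step_in_besov_space[OF p(1) p' q0 s(1,3) G(2,3)])
    have "\<phi> G = real K * v"
      unfolding eq[OF G(1)] using haar_coeff_eq[OF ce borel_imp_lebesgue_on[OF G(3)] g0b hb] hg by simp
    then have "ennreal \<bar>real K * v\<bar> \<le> ennreal C1 * besov_norm p q s G" using C1(2)[OF GX] by simp
    also have "\<dots> \<le> ennreal C1 * (ennreal A * (ennreal C * ennreal (real K)) powe (1 / q))"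
      by (rule mult_left_mono[OF order_trans[OF A(2)[OF ce] mult_left_mono[OF powe_mono[OF rho]]]]) (use q in auto)
    also have "\<dots> = ennreal (C1 * (A * C powr (1 / q)) * real K powr (1 / q))"
      using C1(1) A(1) C(1) by (simp add: powe_mult ennreal_mult mult.assoc)
    finally show ?thesis
      using C1(1) A(1) by (subst (asm) ennreal_le_iff) (auto simp: abs_mult)
  qed
  define D where "D = C1 * (A * C powr (1 / q)) / \<bar>v\<bar>"
  define \<theta> where "\<theta> = 1 - 1 / q"
  have \<theta>: "0 < \<theta>" using q by (simp add: \<theta>_def)
  have D0: "0 \<le> D" using C1(1) A(1) by (simp add: D_def)
  have v0: "0 < \<bar>v\<bar>" using i0 by (simp add: v_def)
  \<comment> \<open>K is chosen so that K^(1 - 1/q) exceeds D + 1, which contradicts K \<le> D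
    K^(1/q).\<close>
  obtain K :: nat where K: "(D + 1) powr (1 / \<theta>) < real K" using reals_Archimedean2 by blast
  have K0: "0 < real K" using K by (meson le_less_trans powr_ge_zero)
  have "D + 1 = ((D + 1) powr (1 / \<theta>)) powr \<theta>" using \<theta> D0 by (simp add: powr_powr)
  also have "\<dots> < real K powr \<theta>" using K \<theta> by (intro powr_less_mono2) auto
  finally have "(D + 1) * real K powr (1 / q) < real K powr \<theta> * real K powr (1 / q)"
    using K0 by (intro mult_strict_right_mono) auto
  also have "\<dots> = real K" using K0 by (simp add: \<theta>_def flip: powr_add)
  also have "\<dots> \<le> D * real K powr (1 / q)"
    using main[of K] v0 by (simp add: D_def field_simps)
  finally show False using powr_ge_zero[of "real K" "1 / q"] by (simp add: distrib_right)
qed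

lemma haar_fun_localized:
  assumes "l \<le> k" "i \<in> Idx k"
  shows "\<exists>b::real. \<forall>x. indicator (cell l i') x * haar_fun k i S x = b * haar_fun k i S x"
proof (intro exI allI)
  fix x
  show "indicator (cell l i') x * haar_fun k i S x = indicator (cell l i') (corner k i) * haar_fun k i S x"
  proof (cases "x \<in> cell k i")
    case True
    have "(indicator (cell l i') x :: real) = indicator (cell l i') (corner k i)"
      by (rule pconst_cell[OF pconst_indicator_cell[OF assms(1)] True])
    then show ?thesis by (simp only:)
  qed (simp add: haar_fun_def)
qed

text \<open>From level l + 1 on, the indicator of a cell of level l is constant on the support of
  each Haar function, so multiplication by it acts diagonally on these basis elements.\<close>

lemma natural_enumeration_localized:
  fixes e :: "nat \<Rightarrow> real^'n \<Rightarrow> real"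
  assumes e: "natural_enumeration e" and m: "haar_count TYPE('n) l \<le> m"
  shows "\<exists>b::real. \<forall>x. indicator (cell l i) x * e m x = b * e m x"
proof -
  have "e m \<notin> e ` {..<haar_count TYPE('n) l}"
    using m natural_enumeration_image(2)[OF e] by (auto dest: injD)
  then have "e m \<notin> haar_upto l" unfolding natural_enumeration_image(1)[OF e] .
  moreover obtain k where k: "e m \<in> haar_level k" using natural_enumeration_image(3)[OF e, of m] by (auto simp: haar_system_def)
  ultimately have "l < k" by (auto simp: haar_upto_def not_le[symmetric])
  then obtain k' where k': "k = Suc k'" "l \<le> k'" by (cases k) auto
  from k obtain i' S where "i' \<in> Idx k'" "e m = haar_fun k' i' S" unfolding k' haar_level_Suc by auto
  then show ?thesis using haar_fun_localized[OF k'(2)] by auto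
qed

text \<open>If a function is constant on a cell, uniqueness of the expansion forces the partial sums of that
  level to attain this constant there: otherwise restricting the series to the cell would produce a
  nontrivial expansion of zero.\<close>

lemma schauder_basis_local_value:
  fixes e :: "nat \<Rightarrow> real^'n \<Rightarrow> real"
  assumes e: "natural_enumeration e" and p: "0 < p" "p \<le> 1" and q: "0 < q" and s: "0 < s" "s * p < 1"
    and sb: "schauder_basis (besov_space p q s) (besov_norm p q s) e"
    and f: "f \<in> borel_measurable borel"
    and lim: "(\<lambda>M. rho p (s * p) (q / p) (\<lambda>x. f x - (\<Sum>m<M. c m * e m x))) \<longlonglongrightarrow> 0"
    and i: "i \<in> Idx l" and F: "\<And>x. x \<in> cell l i \<Longrightarrow> f x = F"
  shows "(\<Sum>m<haar_count TYPE('n) l. c m * e m (corner l i)) = F"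
proof -
  define N where "N = haar_count TYPE('n) l"
  define Q where "Q = (indicator (cell l i) :: real^'n \<Rightarrow> real)"
  have \<sigma>: "0 < s * p" and r: "0 < q / p" using p q s by auto
  define L where "L x = (\<Sum>m<N. c m * e m x)" for x
  define a where "a = L (corner l i)"
  have pL: "pconst l L" unfolding L_def N_def by (rule natural_partial_sum_pconst[OF e]) simp
  have "\<forall>m. \<exists>b::real. N \<le> m \<longrightarrow> (\<forall>x. Q x * e m x = b * e m x)"
    unfolding Q_def using natural_enumeration_localized[OF e, of l _ i] unfolding N_def by blast
  then obtain b where b: "\<And>m x. N \<le> m \<Longrightarrow> Q x * e m x = b m * e m x" by metis
  \<comment> \<open>The series is to represent Q times the sum of c minus Q f. Beyond N,
    multiplication by Q acts through b; on the cell the first N terms equal a and f equals F, so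
    they are replaced by the Haar expansion of (a - F) Q.\<close>
  define c' where "c' m = (if m < N then (a - F) * hint Q (e m) else b m * c m)" for m
  have Qp: "pconst l Q" unfolding Q_def by (rule pconst_indicator_cell) simp
  have Qb: "Q \<in> borel_measurable borel" unfolding Q_def by simp
  have sum: "0 - (\<Sum>m<M. c' m * e m x) = Q x * (f x - (\<Sum>m<M. c m * e m x))" if x: "x \<in> hcube" and M: "N \<le> M" for x M
  proof -
    have split: "(\<Sum>m<M. g m) = (\<Sum>m<N. g m) + (\<Sum>m\<in>{N..<M}. g m)" for g :: "nat \<Rightarrow> real"
    proof -
      have "{..<M} = {..<N} \<union> {N..<M}" using M by auto
      moreover have "sum g ({..<N} \<union> {N..<M}) = (\<Sum>m<N. g m) + (\<Sum>m\<in>{N..<M}. g m)"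
        by (rule sum.union_disjoint) auto
      ultimately show ?thesis by (simp only:)
    qed
    have "(\<Sum>m<N. c' m * e m x) = (\<Sum>m<N. (a - F) * (hint Q (e m) * e m x))"
      by (intro sum.cong) (auto simp: c'_def)
    also have "\<dots> = (a - F) * (\<Sum>h\<in>haar_upto l. hint Q h * h x)"
      unfolding N_def sum_distrib_left[symmetric]
      by (subst sum_natural_enumeration[OF e, of "\<lambda>h. hint Q h * h x" l, symmetric]) simp
    also have "(\<Sum>h\<in>haar_upto l. hint Q h * h x) = Q x" by (rule haar_expansion_pconst[OF Qp Qb x])
    finally have 1: "(\<Sum>m<N. c' m * e m x) = (a - F) * Q x" .
    have 2: "(\<Sum>m\<in>{N..<M}. c' m * e m x) = Q x * (\<Sum>m\<in>{N..<M}. c m * e m x)"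
      unfolding sum_distrib_left
    proof (rule sum.cong)
      fix m assume "m \<in> {N..<M}"
      then have m: "N \<le> m" by simp
      have "c' m * e m x = c m * (b m * e m x)" using m by (simp add: c'_def)
      also have "\<dots> = Q x * (c m * e m x)" unfolding b[OF m, symmetric] by simp
      finally show "c' m * e m x = Q x * (c m * e m x)" .
    qed simp
    have 3: "Q x * L x = Q x * a" "Q x * f x = Q x * F"
      using pconst_cell[OF pL, of x i] F[of x] by (auto simp: Q_def a_def indicator_def)
    show ?thesis unfolding split 1 2 right_diff_distrib distrib_left 3(2) 3(1)[unfolded L_def]
      by (simp add: algebra_simps)
  qed
  obtain K where K: "\<And>f :: real^'n \<Rightarrow> real. f\<in>borel_measurable borel \<Longrightarrow> rho p (s * p) (q / p) (\<lambda>x. Q x * f x) \<le> ennreal K * rho p (s * p) (q / p) f"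
    using rho_indicator_cell[OF p \<sigma> s(2) r, of l i] unfolding Q_def by blast
  have "(\<lambda>M. rho p (s * p) (q / p) (\<lambda>x. 0 - (\<Sum>m<M. c' m * e m x))) \<longlonglongrightarrow> 0"
  proof (rule LIMSEQ_offset[where k = N], rule ennreal_LIMSEQ_0_le)
    show "(\<lambda>M. ennreal K * rho p (s * p) (q / p) (\<lambda>x. f x - (\<Sum>m<M + N. c m * e m x))) \<longlonglongrightarrow> 0"
      by (rule ennreal_cmult_tendsto_0) (rule LIMSEQ_ignore_initial_segment[OF lim])
    fix M
    have "rho p (s * p) (q / p) (\<lambda>x. 0 - (\<Sum>m<M + N. c' m * e m x)) = rho p (s * p) (q / p) (\<lambda>x. Q x * (f x - (\<Sum>m<M + N. c m * e m x)))"
      by (rule rho_cong) (rule sum; simp)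
    also have "\<dots> \<le> ennreal K * rho p (s * p) (q / p) (\<lambda>x. f x - (\<Sum>m<M + N. c m * e m x))"
      by (rule K) (use natural_partial_sum_borel[OF e] f in simp)
    finally show "rho p (s * p) (q / p) (\<lambda>x. 0 - (\<Sum>m<M + N. c' m * e m x)) \<le> \<dots>" .
  qed
  note conv = besov_norm_partial_sums[OF e p q s(1) cube_eq_refl, of "\<lambda>x. 0"]
  have 1: "(\<lambda>M. besov_norm p q s (\<lambda>x. 0 - (\<Sum>m<M. c' m * e m x))) \<longlonglongrightarrow> 0"
    using conv[of c'] \<open>(\<lambda>M. rho p (s * p) (q / p) (\<lambda>x. 0 - (\<Sum>m<M. c' m * e m x))) \<longlonglongrightarrow> 0\<close> by simp
  have 2: "(\<lambda>M. besov_norm p q s (\<lambda>x. 0 - (\<Sum>m<M. 0 * e m x))) \<longlonglongrightarrow> 0"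
    using conv[of "\<lambda>_. 0"] by simp
  have z: "(\<lambda>x :: real^'n. 0) \<in> besov_space p q s"
    by (rule step_in_besov_space[OF p q s pconst_const]) simp
  have "c' = (\<lambda>m. 0)" by (rule schauder_basis_unique[OF sb z 1 2])
  then have "c' 0 = 0" by (rule fun_cong)
  moreover have "0 < N" using haar_count_ge[where 'n = 'n, of l] by (simp add: N_def)
  moreover have "hint Q (e 0) = 1 * 2 powr (- real l * cdim TYPE('n))"
    unfolding Q_def natural_enumeration_0[OF e]
    by (rule hint_indicator_cell[OF i]) (use cell_subset[of l i] indicator_unit_cube_hcube in auto)
  ultimately have "a = F" by (simp add: c'_def)
  then show ?thesis by (simp add: a_def L_def N_def)
qed

text \<open>Take nested spikes at the origin with harmonic weights. On the siblings of the origin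
  cell f is constant, so \<open>schauder_basis_local_value\<close> fixes the partial sums there,
  while increments have mean zero over the parent cell. Hence the mass of the partial sum on the
  origin cell drops by at least \<beta> k / 2 per level and becomes arbitrarily negative. The jump
  to a sibling then keeps the increments away from 0, although the series converges.\<close>

lemma not_schauder_basis_critical_large_q:
  fixes e :: "nat \<Rightarrow> real^'n \<Rightarrow> real"
  assumes p: "0 < p" "p < 1" and q: "1 < q" and s: "0 < s" "s * p = cdim TYPE('n) * (1 - p)" "s * p < 1"
    and e: "natural_enumeration e"
  shows "\<not> schauder_basis (besov_space p q s) (besov_norm p q s) e"
proof
  assume sb: "schauder_basis (besov_space p q s) (besov_norm p q s) e"
  define d where "d = cdim TYPE('n)"
  have d1: "1 \<le> d" by (simp add: d_def Suc_le_eq)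
  have p': "p \<le> 1" and q0: "0 < q" and r: "0 < q / p" and \<sigma>: "0 < s * p" using p q s by auto
  define Z where "Z = (\<lambda>_ :: 'n. 0 :: nat)"
  have Z: "Z \<in> Idx k" for k by (simp add: Z_def Idx_def)
  define \<beta> where "\<beta> m = 1 / real (Suc m)" for m
  have \<beta>0: "0 \<le> \<beta> m" for m by (simp add: \<beta>_def)
  define f where "f = (spikes \<beta> (\<lambda>_. Z) :: real^'n \<Rightarrow> real)"
  have fb: "f \<in> borel_measurable borel" by (simp add: f_def)
  obtain C where C: "C \<ge> 0" "\<And>\<beta> i. (\<forall>m. 0 \<le> \<beta> m) \<Longrightarrow> (\<forall>m. i m \<in> Idx m) \<Longrightarrow>
    rho p (s * p) (q / p) (spikes \<beta> i :: real^'n \<Rightarrow> real) \<le> ennreal C * (\<Sum>m. ennreal (\<beta> m powr (p * (q / p))))"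
    using rho_spikes[OF p r s(2,3)] by metis
  have "summable (\<lambda>m. \<beta> m powr q)"
  proof -
    have "summable (\<lambda>m. real m powr (- q))" using q by (subst summable_real_powr_iff) simp
    then have "summable (\<lambda>m. real (Suc m) powr (- q))" by (subst summable_Suc_iff)
    then show ?thesis by (simp add: \<beta>_def powr_divide powr_minus inverse_eq_divide)
  qed
  then have "(\<Sum>m. ennreal (\<beta> m powr q)) < top"
    by (simp add: ennreal_suminf_neq_top less_top[symmetric] top.not_eq_extremum[symmetric])
  then have ffin: "rho p (s * p) (q / p) f < top"
    unfolding f_def using p C(2)[of \<beta> "\<lambda>_. Z"] \<beta>0 Z
    by (auto intro!: le_less_trans[OF C(2)] simp: ennreal_mult_less_top)
  then have fX: "f \<in> besov_space p q s" using besov_space_iff[OF p(1) p' q0 s(1) fb] by simp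
  obtain c where c: "(\<lambda>M. besov_norm p q s (\<lambda>x. f x - (\<Sum>m<M. c m * e m x))) \<longlonglongrightarrow> 0"
    using schauder_basis_expansion[OF sb fX] by blast
  have lim: "(\<lambda>M. rho p (s * p) (q / p) (\<lambda>x. f x - (\<Sum>m<M. c m * e m x))) \<longlonglongrightarrow> 0"
    using besov_norm_partial_sums[OF e p(1) p' q0 s(1) cube_eq_refl fb] c by simp
  define N where "N = haar_count TYPE('n)"
  define L where "L k x = (\<Sum>m<N k. c m * e m x)" for k x
  have Lb: "L k \<in> borel_measurable borel" for k unfolding L_def by (rule natural_partial_sum_borel[OF e])
  have Lp: "pconst k (L k)" for k unfolding L_def N_def by (rule natural_partial_sum_pconst[OF e]) simp
  \<comment> \<open>The value of f on the shell between the origin cells of levels l - 1 and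
    l.\<close>
  define F where "F l = (\<Sum>m<l. \<beta> m * 2 powr (real m * d))" for l
  have cell_mono: "x \<in> cell l Z" if "x \<in> cell m Z" "l \<le> m" for x :: "real^'n" and l m
    using that idx_div[of l x _ "m - l"] by (auto simp: cell_def Z_def fun_eq_iff)
  have fF: "f x = F (Suc k)" if x: "x \<in> cell k Z" "x \<notin> cell (Suc k) Z" for x k
  proof -
    have "f x = spikes_upto \<beta> (\<lambda>_. Z) (Suc k) x"
      unfolding f_def by (rule spikes_eq_upto[OF \<beta>0]) (use x cell_mono in blast)
    also have "\<dots> = F (Suc k)"
      unfolding spikes_upto_def F_def d_def using cell_mono[OF x(1)] by (intro sum.cong) auto
    finally show ?thesis .
  qed
  \<comment> \<open>\<open>Idx 1\<close> consists of the 0-1 vectors, which at every level Suc k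
    index the children of the origin cell of level k.\<close>
  have sub: "x \<in> cell k Z \<and> x \<notin> cell (Suc k) Z" if "x \<in> cell (Suc k) i" "i \<in> Idx 1" "i \<noteq> Z" for x :: "real^'n" and k i
  proof -
    have "idx k x j = 0" for j using that idx_div[of k x j 1] by (simp add: cell_def Idx_def)
    then show ?thesis using that by (auto simp: cell_def Z_def)
  qed
  have Idx1: "i \<in> Idx (Suc k)" if "i \<in> Idx 1" for i :: "'n \<Rightarrow> nat" and k
  proof -
    have "(2::nat) ^ 1 \<le> 2 ^ Suc k" by (intro power_increasing) auto
    then show ?thesis using that unfolding Idx_def by (auto intro: less_le_trans)
  qed
  have LF: "L (Suc k) (corner (Suc k) i) = F (Suc k)" if i: "i \<in> Idx 1" "i \<noteq> Z" for i k
    unfolding L_def N_def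
    by (rule schauder_basis_local_value[OF e p(1) p' q0 s(1,3) sb fb lim Idx1[OF i(1)]]) (use fF sub i in blast)
  define a where "a k = L k (corner k Z)" for k
  \<comment> \<open>The mass of the partial sum of level k on the origin cell.\<close>
  define M where "M k = a k * 2 powr (- real k * d)" for k
  \<comment> \<open>Mass balance: passing to level Suc k preserves the integral over the origin cell
    of level k, and the 2^d - 1 siblings carry the value F (Suc k).\<close>
  have "M k = M (Suc k) + (2 powr d - 1) * (F (Suc k) * 2 powr (- real (Suc k) * d))" for k
  proof -
    define Q where "Q = (indicator (cell k Z) :: real^'n \<Rightarrow> real)"
    have Qp: "pconst k Q" unfolding Q_def by (rule pconst_indicator_cell) simp
    have Qb: "Q \<in> borel_measurable borel" by (simp add: Q_def)
    have diff: "L (Suc k) x - L k x = (\<Sum>h\<in>haar_level (Suc k). c (inv e h) * h x)" for x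
      using natural_block(2)[OF e order_refl less_imp_le[OF haar_count_less_Suc], of c x k]
      by (simp add: L_def N_def)
    have "hint (\<lambda>x. L (Suc k) x - L k x) Q = (\<Sum>h\<in>haar_level (Suc k). c (inv e h) * hint h Q)"
      unfolding diff by (rule hint_sum_left[OF _ _ _ Qp Qb])
        (auto simp: haar_level_borel intro: pint1_pconst_finite[OF haar_level_pconst])
    also have "\<dots> = 0"
      using hint_step_haar_level[OF Qp, of "Suc k"] by (intro sum.neutral) (auto simp: hint_commute[of _ Q])
    finally have eq: "hint (L (Suc k)) Q = hint (L k) Q"
      using hint_diff_left[OF Lb Lb pint1_pconst_finite[OF Lp Lb] pint1_pconst_finite[OF Lp Lb] Qp Qb, of "Suc k" k] by simp
    have "hint Q (L k) = M k"
      unfolding Q_def M_def d_def a_def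
      by (rule hint_indicator_cell[OF Z]) (rule pconst_cell[OF Lp])
    then have 1: "hint (L k) Q = M k" by (simp only: hint_commute[of "L k" Q])
    have "hint (L (Suc k)) Q = (\<Sum>i\<in>Idx (Suc k). L (Suc k) (corner (Suc k) i) * Q (corner (Suc k) i)) * 2 powr (- real (Suc k) * d)"
      unfolding hint_def d_def
      by (rule integral_hcube_pconst, rule pconst_comp2[OF Lp pconst_mono[OF Qp]]) simp
    also have "(\<Sum>i\<in>Idx (Suc k). L (Suc k) (corner (Suc k) i) * Q (corner (Suc k) i)) = (\<Sum>i\<in>Idx 1. L (Suc k) (corner (Suc k) i))"
    proof (rule sum.mono_neutral_cong_right)
      have idxc: "idx k (corner (Suc k) i) j = i j div 2" if "i \<in> Idx (Suc k)" for i j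
        using idx_div[of k "corner (Suc k) i" j 1] idx_corner[OF that] by simp
      show "\<forall>i\<in>Idx (Suc k) - Idx 1. L (Suc k) (corner (Suc k) i) * Q (corner (Suc k) i) = 0"
      proof
        fix i :: "'n \<Rightarrow> nat" assume i: "i \<in> Idx (Suc k) - Idx 1"
        then obtain j where "2 \<le> i j" by (auto simp: Idx_def not_less)
        then have "idx k (corner (Suc k) i) j \<noteq> 0" using idxc[of i j] i by simp
        then have "corner (Suc k) i \<notin> cell k Z" by (auto simp: cell_def Z_def)
        then show "L (Suc k) (corner (Suc k) i) * Q (corner (Suc k) i) = 0" by (simp add: Q_def)
      qed
      fix i :: "'n \<Rightarrow> nat" assume i: "i \<in> Idx 1"
      then have "idx k (corner (Suc k) i) j = 0" for j using idxc[OF Idx1[OF i], of j] by (simp add: Idx_def)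
      then have "corner (Suc k) i \<in> cell k Z" using corner_in_hcube[OF Idx1[OF i], of k] by (auto simp: cell_def Z_def)
      then show "L (Suc k) (corner (Suc k) i) * Q (corner (Suc k) i) = L (Suc k) (corner (Suc k) i)" by (simp add: Q_def)
    qed (auto simp: Idx1[simplified])
    also have "\<dots> = a (Suc k) + (\<Sum>i\<in>Idx 1 - {Z}. L (Suc k) (corner (Suc k) i))"
      using Z[of 1] unfolding a_def by (intro sum.remove) auto
    also have "(\<Sum>i\<in>Idx 1 - {Z}. L (Suc k) (corner (Suc k) i)) = (\<Sum>i\<in>(Idx 1 - {Z} :: ('n \<Rightarrow> nat) set). F (Suc k))"
      by (rule sum.cong[OF refl]) (use LF in blast)
    also have "\<dots> = (2 powr d - 1) * F (Suc k)"
      using Z[of 1] by (simp add: card_Diff_singleton card_Idx d_def powr_realpow of_nat_diff)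
    finally show ?thesis using eq 1 by (simp add: M_def algebra_simps)
  qed
  then have M_Suc: "M (Suc k) \<le> M k - \<beta> k / 2" for k
  proof -
    assume rec: "\<And>k. M k = M (Suc k) + (2 powr d - 1) * (F (Suc k) * 2 powr (- real (Suc k) * d))"
    have F_ge: "\<beta> k * 2 powr (real k * d) \<le> F (Suc k)"
      unfolding F_def using \<beta>0 by (auto intro!: sum_nonneg)
    have "(2::real) powr 1 \<le> 2 powr d" using d1 by (intro powr_mono) auto
    then have d2: "(2::real) \<le> 2 powr d" by simp
    have "\<beta> k * 2 powr (- d) = (\<beta> k * 2 powr (real k * d)) * 2 powr (- real (Suc k) * d)"
      by (simp add: algebra_simps flip: powr_add)
    also have "\<dots> \<le> F (Suc k) * 2 powr (- real (Suc k) * d)" by (intro mult_right_mono F_ge) auto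
    finally have "(2 powr d - 1) * (\<beta> k * 2 powr (- d)) \<le> (2 powr d - 1) * (F (Suc k) * 2 powr (- real (Suc k) * d))"
      using d2 by (intro mult_left_mono) auto
    moreover have "(2 powr d - 1) * (\<beta> k * 2 powr (- d)) = \<beta> k * (1 - 2 powr (- d))"
      by (simp add: algebra_simps flip: powr_add)
    moreover have "2 powr (- d) \<le> (1/2 :: real)" using d2 by (simp add: powr_minus field_simps)
    then have "\<beta> k * (1/2) \<le> \<beta> k * (1 - 2 powr (- d))" using \<beta>0 by (intro mult_left_mono) auto
    ultimately show ?thesis using rec[of k] by simp
  qed
  have M_le: "M k \<le> M 0 - (\<Sum>m<k. \<beta> m) / 2" for k
  proof (induction k)
    case (Suc k)
    then show ?case using M_Suc[of k] by (simp add: add_divide_distrib)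
  qed simp
  have M_dec: "M l \<le> M k" if "k \<le> l" for k l
    using that
  proof (induction l rule: dec_induct)
    case (step l)
    then show ?case using M_Suc[of l] \<beta>0[of l] by linarith
  qed simp
  \<comment> \<open>Otherwise the decrements, and with them the harmonic series, would be
    summable.\<close>
  have "\<exists>k0. M k0 \<le> -1"
  proof (rule ccontr)
    assume no: "\<not> ?thesis"
    have "(\<Sum>m<k. \<beta> m) \<le> 2 * (M 0 + 1)" for k
      using M_le[of k] no by (smt (verit) field_sum_of_halves)
    then have "summable \<beta>" using \<beta>0 by (intro summableI_nonneg_bounded) auto
    then have "summable (\<lambda>m. inverse (real (Suc m)))" by (simp add: \<beta>_def[abs_def] inverse_eq_divide)
    then have "summable (\<lambda>m. inverse (real m))" by (subst (asm) summable_Suc_iff)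
    then show False using not_summable_harmonic[where 'a = real] by simp
  qed
  then obtain k0 where k0: "M k0 \<le> -1" by blast
  \<comment> \<open>A shift by one cell in one coordinate takes the origin cell to a sibling. L k is
    the same on both; L (Suc k) is at most -u on the first and nonnegative on the second, where u is
    the height of a spike of unit mass, whose contribution is exactly 1.\<close>
  have big: "1 \<le> rho p (s * p) (q / p) (\<lambda>x. L (Suc k) x - L k x)" if k: "k0 \<le> k" for k
  proof -
    fix j0 :: 'n
    define y where "y = axis j0 (1 / 2^Suc k :: real)"
    define U where "U = Z(j0 := 1)"
    have U: "U \<in> Idx 1" "U \<noteq> Z" by (auto simp: U_def Z_def Idx_def fun_eq_iff)
    define u where "u = 2 powr (real (Suc k) * d)"
    have aM: "a (Suc k) \<le> - u"
    proof -
      have "M (Suc k) \<le> -1" using M_dec[of k0 "Suc k"] k k0 by linarith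
      then have "M (Suc k) * u \<le> -1 * u" by (intro mult_right_mono) (auto simp: u_def)
      moreover have "2 powr (- real (Suc k) * d) * u = 1"
        unfolding u_def powr_add[symmetric] by (simp add: algebra_simps)
      then have "M (Suc k) * u = a (Suc k)" by (simp add: M_def mult.assoc)
      ultimately show ?thesis by simp
    qed
    have F0: "0 \<le> F (Suc k)" unfolding F_def by (rule sum_nonneg) (simp add: \<beta>0)
    have mem: "x \<in> hcube \<and> x + y \<in> hcube \<and> u \<le> \<bar>(L (Suc k) (x + y) - L k (x + y)) - (L (Suc k) x - L k x)\<bar>"
      if x: "x \<in> cell (Suc k) Z" for x
    proof -
      have "x + y \<in> cell (Suc k) U"
        unfolding cell_iff[OF Idx1[OF U(1)]]
      proof
        fix j
        have "real (Z j) / 2^Suc k \<le> x $ j \<and> x $ j < (real (Z j) + 1) / 2^Suc k" using x unfolding cell_iff[OF Z] by blast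
        then have xj: "0 \<le> x $ j" "x $ j < 1 / 2^Suc k" by (auto simp: Z_def)
        have yj: "y $ j = (if j = j0 then 1 / 2^Suc k else 0)" by (simp add: y_def axis_def)
        define w where "w = (1 :: real) / 2^Suc k"
        have w: "c / 2^Suc k = c * w" for c by (simp add: w_def)
        show "real (U j) / 2^Suc k \<le> (x + y) $ j \<and> (x + y) $ j < (real (U j) + 1) / 2^Suc k"
          using xj yj unfolding w by (auto simp: U_def Z_def distrib_right)
      qed
      moreover from this have xk: "x + y \<in> cell k Z" using sub U by blast
      moreover have "x \<in> cell k Z" using cell_mono[OF x, of k] by simp
      ultimately have "L (Suc k) (x + y) = F (Suc k)" "L k (x + y) = L k x" "L (Suc k) x = a (Suc k)"
        using pconst_cell[OF Lp, of "x + y" "Suc k" U] LF[OF U] pconst_cell[OF Lp, of "x + y" k Z] pconst_cell[OF Lp, of x k Z]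
          pconst_cell[OF Lp x] by (auto simp: a_def)
      moreover have "u \<le> F (Suc k) - a (Suc k)" using aM F0 by linarith
      ultimately show ?thesis using x xk cell_subset by auto
    qed
    have "(ennreal (2 powr (s * p * real (Suc k))) * (ennreal (u powr p) * emeasure lborel (cell (Suc k) Z :: (real^'n) set))) powe (q / p)
        \<le> rho p (s * p) (q / p) (\<lambda>x. L (Suc k) x - L k x)"
    proof (rule rho_lower_bound[OF r p(1), where y = y])
      show "norm y \<le> 1 / 2^Suc k"       unfolding y_def norm_eq_sqrt_inner inner_axis_axis by (simp add: power2_eq_square[symmetric])
      show "(\<lambda>x. L (Suc k) x - L k x) \<in> borel_measurable borel" using Lb by simp
      show "0 \<le> u" by (simp add: u_def)
    qed (use mem in auto)
    moreover have "ennreal (2 powr (s * p * real (Suc k))) * (ennreal (u powr p) * emeasure lborel (cell (Suc k) Z :: (real^'n) set)) = 1"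
      unfolding emeasure_cell[OF Z] s(2) u_def
      by (simp add: d_def powr_powr algebra_simps flip: ennreal_mult powr_add)
    ultimately show ?thesis by simp
  qed
  have "(\<lambda>k. rho p (s * p) (q / p) (\<lambda>x. L (Suc k) x - L k x)) \<longlonglongrightarrow> 0"
  proof (rule ennreal_LIMSEQ_0_le)
    define E where "E k = rho p (s * p) (q / p) (\<lambda>x. f x - L k x)" for k
    have N_sub: "strict_mono N" unfolding N_def by (rule haar_count_strict_mono)
    have E0: "E \<longlonglongrightarrow> 0"
      using LIMSEQ_subseq_LIMSEQ[OF lim N_sub] by (simp add: E_def[abs_def] L_def comp_def)
    show "(\<lambda>k. ennreal (2 powr (q / p)) * (E k + E (Suc k))) \<longlonglongrightarrow> 0"
      by (rule ennreal_cmult_tendsto_0, rule ennreal_add_tendsto_0[OF E0 LIMSEQ_Suc[OF E0]])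
    show "rho p (s * p) (q / p) (\<lambda>x. L (Suc k) x - L k x) \<le> ennreal (2 powr (q / p)) * (E k + E (Suc k))" for k
      unfolding E_def using rho_diff[OF p(1) p' r, of "\<lambda>x. f x - L k x" "\<lambda>x. f x - L (Suc k) x" "s * p"] fb Lb by simp
  qed
  from order_tendstoD(2)[OF this, of 1] have "eventually (\<lambda>k. rho p (s * p) (q / p) (\<lambda>x. L (Suc k) x - L k x) < 1) sequentially" by simp
  then obtain k1 where "\<And>k. k1 \<le> k \<Longrightarrow> rho p (s * p) (q / p) (\<lambda>x. L (Suc k) x - L k x) < 1"
    unfolding eventually_sequentially by blast
  from this[of "max k0 k1"] big[of "max k0 k1"] show False by simp
qed

subsection \<open>The critical smoothness with \<open>p < q \<le> 1\<close>\<close>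

lemma cell_shift_axis:
  fixes x :: "real^'n"
  assumes i: "i \<in> Idx k" "i(j0 := Suc (i j0)) \<in> Idx k" and x: "x \<in> cell k i"
  shows "x + axis j0 (1 / 2^k) \<in> cell k (i(j0 := Suc (i j0)))"
  unfolding cell_iff[OF i(2)]
proof
  fix j
  define w where "w = (1 :: real) / 2^k"
  have w: "c / 2^k = c * w" for c by (simp add: w_def)
  have "real (i j) / 2^k \<le> x $ j \<and> x $ j < (real (i j) + 1) / 2^k" using x unfolding cell_iff[OF i(1)] by blast
  moreover have "axis j0 (1 / 2^k) $ j = (if j = j0 then 1 / 2^k else 0 :: real)" by (simp add: axis_def)
  ultimately show "real ((i(j0 := Suc (i j0))) j) / 2^k \<le> (x + axis j0 (1 / 2^k)) $ j \<and>
      (x + axis j0 (1 / 2^k)) $ j < (real ((i(j0 := Suc (i j0))) j) + 1) / 2^k"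
    unfolding w by (auto simp: distrib_right)
qed

lemma norm_axis: "norm (axis j (a :: real)) = \<bar>a\<bar>"
  unfolding norm_eq_sqrt_inner inner_axis_axis by (simp add: power2_eq_square[symmetric])

text \<open>Block \<open>j\<close> consists of \<open>n j\<close> spikes, one on each of the levels \<open>4 n j + 1, \<dots>, 5 n j\<close>, placed in
  pairwise non-adjacent cells of level \<open>4 n j\<close>. Averaging at level \<open>4 n j\<close> moves all of them to one
  level, where the \<open>\<ell>\<^sub>p\<close>-sum of the masses replaces the smaller \<open>\<ell>\<^sub>q\<close>-sum.\<close>

definition in_block :: "(nat \<Rightarrow> nat) \<Rightarrow> nat \<Rightarrow> nat \<Rightarrow> bool" where
  "in_block n j m \<longleftrightarrow> 4 * n j < m \<and> m \<le> 5 * n j"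

definition block_weight :: "(nat \<Rightarrow> nat) \<Rightarrow> (nat \<Rightarrow> real) \<Rightarrow> nat \<Rightarrow> real" where
  "block_weight n a m = (if \<exists>j. in_block n j m then a (THE j. in_block n j m) else 0)"

text \<open>At level 4 n j + t this is the lower corner descendant of the cell with index 2 t along
  j0 at level 4 n j, which leaves the odd neighbours empty. Outside all blocks 0 is a
  placeholder.\<close>

definition block_position :: "(nat \<Rightarrow> nat) \<Rightarrow> 'n \<Rightarrow> nat \<Rightarrow> 'n \<Rightarrow> nat" where
  "block_position n j0 m = (\<lambda>l. if l = j0 \<and> (\<exists>j. in_block n j m)
     then (let t = m - 4 * n (THE j. in_block n j m) in 2 * t * 2^t) else 0)"

text \<open>Doubling keeps the level ranges of the blocks disjoint and separates their scales by
  more than the positions 2 t within a block, see \<open>n_less_power\<close>.\<close>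

locale spike_blocks =
  fixes n :: "nat \<Rightarrow> nat"
  assumes n_pos: "0 < n j" and n_double: "2 * n j \<le> n (Suc j)"
begin

lemma n_less: "j < j' \<Longrightarrow> 2 * n j \<le> n j'"
proof (induction j' rule: less_induct)
  case (less j')
  then obtain i where i: "j' = Suc i" by (cases j') auto
  then show ?case
    using less.IH[of i] less.prems n_double[of i] n_double[of j] by (cases "j = i") auto
qed

lemma in_block_unique: "in_block n j m \<Longrightarrow> in_block n j' m \<Longrightarrow> j = j'"
  using n_less[of j j'] n_less[of j' j] n_pos[of j] n_pos[of j'] by (cases j j' rule: linorder_cases) (auto simp: in_block_def)

lemma in_block_the: "in_block n j m \<Longrightarrow> (THE j. in_block n j m) = j"
  using in_block_unique by blast

lemma block_weight_eq: "in_block n j m \<Longrightarrow> block_weight n a m = a j"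
  using in_block_the by (auto simp: block_weight_def)

lemma block_position_eq:
  "in_block n j m \<Longrightarrow> block_position n j0 m = (\<lambda>l. if l = j0 then 2 * (m - 4 * n j) * 2^(m - 4 * n j) else 0)"
  using in_block_the by (auto simp: block_position_def Let_def fun_eq_iff)

lemma n_less_power: "2 * n j + 2 \<le> 2 ^ (2 * n j)"
proof -
  have *: "2 * Suc m + 2 \<le> 2 ^ (2 * Suc m)" for m by (induction m) auto
  show ?thesis using *[of "n j - 1"] n_pos[of j] by simp
qed

lemma block_position_Idx: "block_position n j0 m \<in> Idx m"
  unfolding Idx_def
proof (intro CollectI allI)
  fix l
  show "block_position n j0 m l < 2^m"
  proof (cases "\<exists>j. in_block n j m")
    case True
    then obtain j where j: "in_block n j m" by blast
    define t where "t = m - 4 * n j"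
    have t: "t \<le> n j" "m = 4 * n j + t" using j by (auto simp: in_block_def t_def)
    have "2 * t < 2 ^ (2 * n j)" using t n_less_power[of j] by linarith
    also have "\<dots> \<le> 2 ^ (4 * n j)" by (intro power_increasing) auto
    finally have "2 * t * 2^t < 2^(4 * n j) * 2^t" by (intro mult_strict_right_mono) auto
    then show ?thesis using j t by (simp add: block_position_eq power_add)
  qed (simp add: block_position_def)
qed

text \<open>Along j0, spikes of a block with smaller j start beyond the given interval, because 2 t'
  \<ge> 1 on their coarser scale; spikes of a block with larger j end before it, because t \<ge> 1.
  Within the same block the even positions decide.\<close>

lemma blocks_separated:
  fixes x :: "real^'n"
  assumes t: "1 \<le> t" "t \<le> n j" and x: "real (2 * t) / 2^(4 * n j) \<le> x $ j0" "x $ j0 < real (2 * t + 2) / 2^(4 * n j)"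
    and j': "in_block n j' m" and xm: "x \<in> cell m (block_position n j0 m)"
  shows "m = 4 * n j + t"
proof -
  define t' where "t' = m - 4 * n j'"
  have t': "1 \<le> t'" "t' \<le> n j'" "m = 4 * n j' + t'" using j' by (auto simp: in_block_def t'_def)
  have lo: "real (2 * t') / 2^(4 * n j') \<le> x $ j0" and hi: "x $ j0 < real (2 * t' + 1) / 2^(4 * n j')"
  proof -
    have *: "real (2 * t' * 2^t') / 2^m \<le> x $ j0 \<and> x $ j0 < (real (2 * t' * 2^t') + 1) / 2^m"
      using xm[unfolded cell_iff[OF block_position_Idx], rule_format, of j0]
      unfolding block_position_eq[OF j'] t'_def[symmetric] by simp
    have e: "real (2 * t' * 2^t') / 2^m = real (2 * t') / 2^(4 * n j')"
      unfolding t'(3) by (simp add: power_add)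
    then show "real (2 * t') / 2^(4 * n j') \<le> x $ j0" using * by simp
    have "(1::real) / 2^m \<le> 1 / 2^(4 * n j')" unfolding t'(3) by (intro divide_left_mono power_increasing) auto
    then show "x $ j0 < real (2 * t' + 1) / 2^(4 * n j')" using * e by (simp add: add_divide_distrib)
  qed
  have "j' = j"
  proof (cases j' j rule: linorder_cases)
    case less
    have "4 * n j' + 2 * n j \<le> 4 * n j" using n_less[OF less] by simp
    then have "(2::real) ^ (4 * n j') * 2 ^ (2 * n j) \<le> 2 ^ (4 * n j)"
      unfolding power_add[symmetric] by (intro power_increasing) auto
    moreover have "real (2 * t + 2) \<le> 2 ^ (2 * n j)"
    proof -
      have "2 * t + 2 \<le> 2 ^ (2 * n j)" using t n_less_power[of j] by linarith
      then have "real (2 * t + 2) \<le> real (2 ^ (2 * n j))" by (rule of_nat_mono)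
      then show ?thesis by simp
    qed
    ultimately have "(2::real) ^ (4 * n j') * real (2 * t + 2) \<le> 2 ^ (4 * n j)"
      by (meson mult_left_mono order_trans zero_le_numeral zero_le_power)
    then have "real (2 * t + 2) / 2^(4 * n j) \<le> 1 / 2^(4 * n j')"
      by (simp add: field_simps)
    also have "\<dots> \<le> real (2 * t') / 2^(4 * n j')" using t'(1) by (intro divide_right_mono) auto
    finally show ?thesis using lo x(2) by linarith
  next
    case greater
    have "4 * n j + 2 * n j' \<le> 4 * n j'" using n_less[OF greater] by simp
    then have "(2::real) ^ (4 * n j) * 2 ^ (2 * n j') \<le> 2 ^ (4 * n j')"
      unfolding power_add[symmetric] by (intro power_increasing) auto
    moreover have "real (2 * t' + 1) \<le> 2 ^ (2 * n j')"
    proof -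
      have "2 * t' + 1 \<le> 2 ^ (2 * n j')" using t' n_less_power[of j'] by linarith
      then have "real (2 * t' + 1) \<le> real (2 ^ (2 * n j'))" by (rule of_nat_mono)
      then show ?thesis by simp
    qed
    ultimately have "(2::real) ^ (4 * n j) * real (2 * t' + 1) \<le> 2 ^ (4 * n j')"
      by (meson mult_left_mono order_trans zero_le_numeral zero_le_power)
    then have "real (2 * t' + 1) / 2^(4 * n j') \<le> 1 / 2^(4 * n j)"
      by (simp add: field_simps)
    also have "\<dots> \<le> real (2 * t) / 2^(4 * n j)" using t(1) by (intro divide_right_mono) auto
    finally show ?thesis using hi x(1) by linarith
  qed simp
  moreover have "t' = t"
  proof -
    have "real (2 * t') / 2^(4 * n j) < real (2 * t + 2) / 2^(4 * n j)" using lo x(2) \<open>j' = j\<close> by simp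
    then have "real (2 * t') < real (2 * t + 2)" by (simp add: divide_less_cancel)
    moreover have "real (2 * t) / 2^(4 * n j) < real (2 * t' + 1) / 2^(4 * n j)" using hi x(1) \<open>j' = j\<close> by simp
    then have "real (2 * t) < real (2 * t' + 1)" by (simp add: divide_less_cancel)
    ultimately show ?thesis by linarith
  qed
  ultimately show ?thesis using t' by simp
qed

lemma spikes_block_value:
  fixes x :: "real^'n"
  assumes a: "\<And>j. 0 \<le> a j" and t: "1 \<le> t" "t \<le> n j"
    and x: "real (2 * t) / 2^(4 * n j) \<le> x $ j0" "x $ j0 < real (2 * t + 2) / 2^(4 * n j)"
  shows "spikes (block_weight n a) (block_position n j0) x =
    a j * 2 powr (real (4 * n j + t) * cdim TYPE('n)) * indicator (cell (4 * n j + t) (block_position n j0 (4 * n j + t))) x"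
proof -
  define m where "m = 4 * n j + t"
  have jm: "in_block n j m" using t by (auto simp: in_block_def m_def)
  have b0: "0 \<le> block_weight n a l" for l using a by (simp add: block_weight_def)
  have van: "block_weight n a l = 0 \<or> x \<notin> cell l (block_position n j0 l)" if "l \<noteq> m" for l
    using blocks_separated[OF t x, of _ l] that by (auto simp: block_weight_def m_def)
  have "spikes (block_weight n a) (block_position n j0) x = spikes_upto (block_weight n a) (block_position n j0) (Suc m) x"
    by (rule spikes_eq_upto[OF b0]) (rule van, simp)
  also have "\<dots> = (\<Sum>l<Suc m. if l = m then a j * 2 powr (real m * cdim TYPE('n)) * indicator (cell m (block_position n j0 m)) x else 0)"
    unfolding spikes_upto_def
  proof (rule sum.cong[OF refl])
    fix l
    show "block_weight n a l * 2 powr (real l * cdim TYPE('n)) * indicator (cell l (block_position n j0 l)) x =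
        (if l = m then a j * 2 powr (real m * cdim TYPE('n)) * indicator (cell m (block_position n j0 m)) x else 0)"
      using van[of l] block_weight_eq[OF jm, of a] by auto
  qed
  also have "\<dots> = a j * 2 powr (real m * cdim TYPE('n)) * indicator (cell m (block_position n j0 m)) x" by simp
  finally show ?thesis by (simp only: m_def)
qed

lemma block_weight_sum_le:
  assumes a: "\<And>j. 0 \<le> a j"
  shows "(\<Sum>m. ennreal (block_weight n a m powr q)) \<le> (\<Sum>j. ennreal (real (n j) * a j powr q))"
proof -
  have "(\<Sum>m. ennreal (block_weight n a m powr q)) \<le> (\<Sum>m. \<Sum>j. if in_block n j m then ennreal (a j powr q) else 0)"
  proof (rule ennreal_suminf_le)
    fix m
    show "ennreal (block_weight n a m powr q) \<le> (\<Sum>j. if in_block n j m then ennreal (a j powr q) else 0)"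
    proof (cases "\<exists>j. in_block n j m")
      case True
      then obtain j where "in_block n j m" by blast
      then show ?thesis
        using ennreal_term_le_suminf[of "\<lambda>j. if in_block n j m then ennreal (a j powr q) else 0" j] by (simp add: block_weight_eq)
    qed (simp add: block_weight_def)
  qed
  also have "\<dots> = (\<Sum>j. \<Sum>m. if in_block n j m then ennreal (a j powr q) else 0)"
    by (rule ennreal_suminf_swap)
  also have "\<dots> = (\<Sum>j. ennreal (real (n j) * a j powr q))"
  proof (rule arg_cong[where f = suminf], rule ext)
    fix j
    have "(\<Sum>m. if in_block n j m then ennreal (a j powr q) else 0) = (\<Sum>m\<in>{4 * n j<..5 * n j}. if in_block n j m then ennreal (a j powr q) else 0)"
      by (rule suminf_finite) (auto simp: in_block_def)
    also have "\<dots> = (\<Sum>m\<in>{4 * n j<..5 * n j}. ennreal (a j powr q))"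
      by (intro sum.cong) (auto simp: in_block_def)
    finally show "(\<Sum>m. if in_block n j m then ennreal (a j powr q) else 0) = ennreal (real (n j) * a j powr q)"
      by (simp add: ennreal_mult ennreal_of_nat_eq_real_of_nat)
  qed
  finally show ?thesis .
qed

text \<open>At level 4 n j each spike of block j averages to 2^(4 n j d) a j on its ancestor cell
  \<open>U t\<close>, and the right neighbour \<open>R t\<close> averages to 0. Shifting by one cell
  produces this jump on n j cells; at \<sigma> = \<delta> all powers of 2 cancel.\<close>

lemma avg_spikes_lower_bound:
  fixes j0 :: "'n::finite"
  assumes a: "\<And>j. 0 \<le> a j" and p: "0 < p" and r: "0 < r"
    and \<sigma>: "\<sigma> = cdim TYPE('n) * (1 - p)"
  shows "ennreal (real (n j) * a j powr p) powe r
    \<le> rho p \<sigma> r (avg (4 * n j) (spikes (block_weight n a) (block_position n j0) :: real^'n \<Rightarrow> real))"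
proof -
  define \<kappa> where "\<kappa> = 4 * n j"
  define d where "d = cdim TYPE('n)"
  define f where "f = (spikes (block_weight n a) (block_position n j0) :: real^'n \<Rightarrow> real)"
  define U where "U t = (\<lambda>l. if l = j0 then 2 * t else 0 :: nat)" for t
  define R where "R t = (U t)(j0 := Suc (U t j0))" for t
  have small: "2 * t + 1 < 2^\<kappa>" if "t \<le> n j" for t
  proof -
    have "2 * t + 1 < 2 ^ (2 * n j)" using that n_less_power[of j] by linarith
    also have "\<dots> \<le> 2 ^ \<kappa>" unfolding \<kappa>_def by (intro power_increasing) auto
    finally show ?thesis .
  qed
  have UI: "U t \<in> Idx \<kappa>" and RI: "R t \<in> Idx \<kappa>" if "t \<le> n j" for t
    using small[OF that] by (auto simp: U_def R_def Idx_def)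
  have xU: "real (2 * t) / 2^\<kappa> \<le> x $ j0" "x $ j0 < real (2 * t + 2) / 2^\<kappa>" if "t \<le> n j" "x \<in> cell \<kappa> (U t) \<or> x \<in> cell \<kappa> (R t)" for t x
  proof -
    have "real (2 * t) / 2^\<kappa> \<le> x $ j0 \<and> x $ j0 < real (2 * t + 2) / 2^\<kappa>"
      using that(2)
    proof
      assume "x \<in> cell \<kappa> (U t)"
      then have "real (2 * t) / 2^\<kappa> \<le> x $ j0 \<and> x $ j0 < (real (2 * t) + 1) / 2^\<kappa>"
        unfolding cell_iff[OF UI[OF that(1)]] by (elim allE[of _ j0]) (simp add: U_def)
      moreover have "(real (2 * t) + 1) / 2^\<kappa> \<le> real (2 * t + 2) / 2^\<kappa>" by (intro divide_right_mono) auto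
      ultimately show ?thesis by linarith
    next
      assume "x \<in> cell \<kappa> (R t)"
      then have "(real (2 * t) + 1) / 2^\<kappa> \<le> x $ j0 \<and> x $ j0 < (real (2 * t) + 2) / 2^\<kappa>"
        unfolding cell_iff[OF RI[OF that(1)]] by (elim allE[of _ j0]) (simp add: R_def U_def add_ac)
      moreover have "real (2 * t) / 2^\<kappa> \<le> (real (2 * t) + 1) / 2^\<kappa>" by (intro divide_right_mono) auto
      moreover have "real (2 * t) + 2 = real (2 * t + 2)" by simp
      ultimately show ?thesis by (smt (verit))
    qed
    then show "real (2 * t) / 2^\<kappa> \<le> x $ j0" "x $ j0 < real (2 * t + 2) / 2^\<kappa>" by auto
  qed
  have f_val: "f x = a j * 2 powr (real (\<kappa> + t) * d) * indicator (cell (\<kappa> + t) (block_position n j0 (\<kappa> + t))) x"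
    if "1 \<le> t" "t \<le> n j" "x \<in> cell \<kappa> (U t) \<or> x \<in> cell \<kappa> (R t)" for t x
    unfolding f_def d_def \<kappa>_def
    by (rule spikes_block_value[where a = a, OF a that(1,2)]) (use xU[OF that(2,3)] in \<open>simp_all add: \<kappa>_def\<close>)
  have sub: "x \<in> cell \<kappa> (U t)" if "1 \<le> t" "t \<le> n j" "x \<in> cell (\<kappa> + t) (block_position n j0 (\<kappa> + t))" for t x
  proof -
    have blk: "in_block n j (\<kappa> + t)" using that by (auto simp: in_block_def \<kappa>_def)
    have "idx \<kappa> x l = U t l" for l
      using idx_div[of \<kappa> x l t] that(3) unfolding cell_def block_position_eq[OF blk] by (auto simp: U_def \<kappa>_def)
    then show ?thesis using that(3) by (auto simp: cell_def)
  qed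
  have avgU: "avg \<kappa> f x = 2 powr (real \<kappa> * d) * a j" if t: "1 \<le> t" "t \<le> n j" and x: "x \<in> cell \<kappa> (U t)" for t x
  proof -
    let ?m = "\<kappa> + t"
    have "(\<integral>y. indicator (cell \<kappa> (U t)) y * f y \<partial>lborel) = (\<integral>y. (a j * 2 powr (real ?m * d)) * indicator (cell ?m (block_position n j0 ?m)) y \<partial>lborel)"
    proof (rule Bochner_Integration.integral_cong[OF refl])
      fix y
      show "indicator (cell \<kappa> (U t)) y * f y = (a j * 2 powr (real ?m * d)) * indicator (cell ?m (block_position n j0 ?m)) y"
      proof (cases "y \<in> cell \<kappa> (U t)")
        case True
        then show ?thesis using f_val[OF t disjI1[OF True]] by simp
      next
        case False
        then have "y \<notin> cell ?m (block_position n j0 ?m)" using sub[OF t, of y] by blast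
        with False show ?thesis by simp
      qed
    qed
    also have "\<dots> = (a j * 2 powr (real ?m * d)) * 2 powr (- real ?m * d)"
      by (simp add: measure_def emeasure_cell[OF block_position_Idx] d_def)
    also have "\<dots> = a j" by (simp add: mult.assoc algebra_simps flip: powr_add)
    finally show ?thesis using pconst_cell[OF avg_pconst x] avg_corner[OF UI[OF t(2)], of f] by (simp add: d_def)
  qed
  have avgR: "avg \<kappa> f x = 0" if t: "1 \<le> t" "t \<le> n j" and x: "x \<in> cell \<kappa> (R t)" for t x
  proof -
    have "U t \<noteq> R t" by (auto simp: R_def dest: fun_cong[of _ _ j0])
    then have "cell \<kappa> (R t) \<inter> cell \<kappa> (U t) = {}" by (auto simp: cell_def)
    then have "f y = 0" if y: "y \<in> cell \<kappa> (R t)" for y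
    proof -
      have "y \<notin> cell (\<kappa> + t) (block_position n j0 (\<kappa> + t))"
        using sub[OF t, of y] y \<open>cell \<kappa> (R t) \<inter> cell \<kappa> (U t) = {}\<close> by blast
      then show ?thesis unfolding f_val[OF t disjI2[OF y]] indicator_def by (simp only: if_False of_bool_eq mult_zero_right simp_thms)
    qed
    then have "(\<lambda>y. indicator (cell \<kappa> (R t)) y * f y) = (\<lambda>y. 0)" by (auto simp: indicator_def)
    then show ?thesis using pconst_cell[OF avg_pconst x] avg_corner[OF RI[OF t(2)], of f] by simp
  qed
  define A where "A = (\<Union>t\<in>{1..n j}. cell \<kappa> (U t) :: (real^'n) set)"
  have emA: "emeasure lborel A = ennreal (real (n j) * 2 powr (- real \<kappa> * d))"
  proof -
    have "disjoint_family_on (\<lambda>t. cell \<kappa> (U t) :: (real^'n) set) {1..n j}"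
    proof (unfold disjoint_family_on_def, intro ballI impI)
      fix t t' :: nat assume "t \<noteq> t'"
      then have "U t \<noteq> U t'" by (auto simp: U_def dest: fun_cong[of _ _ j0])
      then show "(cell \<kappa> (U t) :: (real^'n) set) \<inter> cell \<kappa> (U t') = {}" by (auto simp: cell_def)
    qed
    then have "emeasure lborel A = (\<Sum>t\<in>{1..n j}. emeasure lborel (cell \<kappa> (U t) :: (real^'n) set))"
      unfolding A_def by (intro sum_emeasure[symmetric]) auto
    also have "\<dots> = (\<Sum>t\<in>{1..n j}. ennreal (2 powr (- real \<kappa> * d)))"
      by (intro sum.cong) (auto simp: emeasure_cell[OF UI] d_def)
    finally show ?thesis by (simp add: ennreal_mult ennreal_of_nat_eq_real_of_nat)
  qed
  define u where "u = 2 powr (real \<kappa> * d) * a j"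
  have "(ennreal (2 powr (\<sigma> * real \<kappa>)) * (ennreal (u powr p) * emeasure lborel A)) powe r \<le> rho p \<sigma> r (avg \<kappa> f)"
  proof (rule rho_lower_bound[OF r p, where y = "axis j0 (1 / 2^\<kappa>)"])
    show "A \<in> sets borel" unfolding A_def by auto
    show "norm (axis j0 (1 / 2^\<kappa>) :: real^'n) \<le> 1 / 2^\<kappa>" by (simp add: norm_axis)
    show "0 \<le> u" using a by (simp add: u_def)
    fix x assume "x \<in> A"
    then obtain t where t: "1 \<le> t" "t \<le> n j" and x: "x \<in> cell \<kappa> (U t)" by (auto simp: A_def)
    have y: "x + axis j0 (1 / 2^\<kappa>) \<in> cell \<kappa> (R t)"
      unfolding R_def by (rule cell_shift_axis[OF UI[OF t(2)] _ x]) (use RI[OF t(2)] in \<open>simp add: R_def\<close>)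
    show "x \<in> hcube \<and> x + axis j0 (1 / 2^\<kappa>) \<in> hcube \<and> u \<le> \<bar>avg \<kappa> f (x + axis j0 (1 / 2^\<kappa>)) - avg \<kappa> f x\<bar>"
      using x y cell_subset avgU[OF t x] avgR[OF t y] a[of j] by (auto simp: u_def)
  qed simp
  moreover have "ennreal (2 powr (\<sigma> * real \<kappa>)) * (ennreal (u powr p) * emeasure lborel A) = ennreal (real (n j) * a j powr p)"
  proof -
    have "2 powr (\<sigma> * real \<kappa>) * (u powr p * (real (n j) * 2 powr (- real \<kappa> * d)))
       = (2 powr (\<sigma> * real \<kappa>) * 2 powr (real \<kappa> * d * p) * 2 powr (- real \<kappa> * d)) * (real (n j) * a j powr p)"
      using a by (simp add: u_def powr_mult powr_powr)
    also have "2 powr (\<sigma> * real \<kappa>) * 2 powr (real \<kappa> * d * p) * 2 powr (- real \<kappa> * d) = 1"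
      by (simp add: \<sigma> d_def algebra_simps flip: powr_add)
    finally show ?thesis unfolding emA by (simp flip: ennreal_mult)
  qed
  ultimately show ?thesis by (simp add: f_def \<kappa>_def)
qed

end

text \<open>With n j = 2^(c j) and a j = 2^(-(c + 1) j / q), the sum of n j (a j)^q is geometric
  with ratio 1/2, which bounds \<open>rho\<close> of f, while n j (a j)^p = 2^((c - (c + 1) p / q)
  j) is unbounded for large c since p < q.\<close>

lemma critical_unbounded_averages:
  assumes p: "0 < p" "p < 1" and q: "p < q" "q \<le> 1"
    and \<sigma>: "\<sigma> = cdim TYPE('n::finite) * (1 - p)" "\<sigma> < 1"
  obtains f :: "real^'n \<Rightarrow> real" where "f \<in> borel_measurable borel" "rho p \<sigma> (q / p) f < top"
    "\<And>B K. \<exists>k\<ge>K. ennreal B \<le> rho p \<sigma> (q / p) (avg k f)"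
proof -
  fix j0 :: 'n
  have q0: "0 < q" and r: "0 < q / p" using p q by auto
  define \<gamma> where "\<gamma> = 1 - p / q"
  have \<gamma>: "0 < \<gamma>" using p q by (simp add: \<gamma>_def)
  \<comment> \<open>This makes the exponent c - (c + 1) p / q at least 1.\<close>
  obtain c :: nat where c: "(1 + p / q) / \<gamma> < real c" using reals_Archimedean2 by blast
  have c1: "0 < c"
  proof (rule ccontr)
    assume "\<not> 0 < c"
    moreover have "0 < (1 + p / q) / \<gamma>" using \<gamma> p q0 by (intro divide_pos_pos add_pos_pos) auto
    ultimately show False using c by simp
  qed
  have c2: "1 \<le> real c - (real c + 1) * (p / q)"
    using c \<gamma> by (simp add: \<gamma>_def pos_divide_less_eq algebra_simps)
  define n :: "nat \<Rightarrow> nat" where "n j = 2^(c * j)" for j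
  define a where "a j = 2 powr (- ((real c + 1) * real j / q))" for j
  have a0: "0 \<le> a j" for j by (simp add: a_def)
  interpret spike_blocks n
  proof
    show "0 < n j" for j by (simp add: n_def)
    have "(2::nat) ^ 1 \<le> 2 ^ c" using c1 by (intro power_increasing) auto
    then show "2 * n j \<le> n (Suc j)" for j by (simp add: n_def power_add)
  qed
  define f where "f = (spikes (block_weight n a) (block_position n j0) :: real^'n \<Rightarrow> real)"
  obtain C where C: "C \<ge> 0" "\<And>\<beta> i. (\<forall>m. 0 \<le> \<beta> m) \<Longrightarrow> (\<forall>m. i m \<in> Idx m) \<Longrightarrow>
    rho p \<sigma> (q / p) (spikes \<beta> i :: real^'n \<Rightarrow> real) \<le> ennreal C * (\<Sum>m. ennreal (\<beta> m powr (p * (q / p))))"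
    using rho_spikes[OF p r \<sigma>] by metis
  have nn: "real (n j) = 2 powr (real c * real j)" for j by (simp add: n_def flip: powr_realpow)
  have "(\<Sum>m. ennreal (block_weight n a m powr q)) \<le> (\<Sum>j. ennreal (real (n j) * a j powr q))"
    by (rule block_weight_sum_le) (rule a0)
  also have "\<dots> = (\<Sum>j. ennreal (2 powr (- 1 * real j)))"
  proof (rule arg_cong[where f = suminf], rule ext)
    fix j
    have "a j powr q = 2 powr (- ((real c + 1) * real j))" using q0 by (simp add: a_def powr_powr)
    then show "ennreal (real (n j) * a j powr q) = ennreal (2 powr (- 1 * real j))"
      unfolding nn by (simp add: algebra_simps flip: powr_add)
  qed
  also have "\<dots> < top" unfolding geometric_ennreal[OF zero_less_one] by simp
  finally have "(\<Sum>m. ennreal (block_weight n a m powr (p * (q / p)))) < top" using p by simp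
  then have fin: "rho p \<sigma> (q / p) f < top"
    unfolding f_def
    by (intro le_less_trans[OF C(2)]) (auto simp: ennreal_mult_less_top block_position_Idx block_weight_def a0)
  have "\<exists>k\<ge>K. ennreal B \<le> rho p \<sigma> (q / p) (avg k f)" for B :: real and K
  proof -
    obtain j1 :: nat where j1: "\<bar>B\<bar> powr (p / q) < real j1" using reals_Archimedean2 by blast
    define j where "j = max K j1"
    have jlt: "real j \<le> 2 powr real j"
      using of_nat_less_two_power[of j, where 'a = real] by (simp add: powr_realpow)
    have "\<bar>B\<bar> powr (p / q) \<le> real j" using j1 by (simp add: j_def)
    also have "\<dots> \<le> 2 powr real j" by (rule jlt)
    also have "\<dots> \<le> 2 powr ((real c - (real c + 1) * (p / q)) * real j)"
      using mult_right_mono[OF c2, of "real j"] by (intro powr_mono) auto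
    also have "\<dots> = real (n j) * a j powr p"
      unfolding nn a_def by (simp add: powr_powr algebra_simps add_divide_distrib flip: powr_add)
    finally have "(\<bar>B\<bar> powr (p / q)) powr (q / p) \<le> (real (n j) * a j powr p) powr (q / p)"
      using r by (intro powr_mono2) auto
    then have "\<bar>B\<bar> \<le> (real (n j) * a j powr p) powr (q / p)" using p q0 by (simp add: powr_powr)
    then have "ennreal B \<le> ennreal (real (n j) * a j powr p) powe (q / p)"
      by (simp add: ennreal_leI)
    also have "\<dots> \<le> rho p \<sigma> (q / p) (avg (4 * n j) f)"
      unfolding f_def by (rule avg_spikes_lower_bound[OF a0 p(1) r \<sigma>(1)])
    finally have "ennreal B \<le> rho p \<sigma> (q / p) (avg (4 * n j) f)" .
    moreover have "K \<le> 4 * n j"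
    proof -
      have "K \<le> j" by (simp add: j_def)
      also have "j \<le> c * j" using c1 by simp
      also have "\<dots> \<le> n j" unfolding n_def by (rule less_imp_le) (rule less_exp)
      finally show ?thesis by simp
    qed
    ultimately show ?thesis by blast
  qed
  with fin that[of f] show ?thesis by (simp add: f_def)
qed

text \<open>Partial sums over complete levels are the averages of the previous lemma. The failure of
  the basis needs no boundedness principle: q \<le> 1 forces the coefficients of an expansion of f
  to be its Haar coefficients, and convergence would bound the averages of this one f.\<close>

lemma partial_sums_not_uniformly_bounded:
  fixes e :: "nat \<Rightarrow> real^'n \<Rightarrow> real"
  assumes p: "0 < p" "p < 1" and q: "p < q" "q \<le> 1"
    and s: "0 < s" "s * p = cdim TYPE('n) * (1 - p)" "s * p < 1" and e: "natural_enumeration e"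
  shows "\<not> uniformly_bounded (besov_space p q s) (besov_norm p q s) (haar_partial_sum e)"
    and "\<not> schauder_basis (besov_space p q s) (besov_norm p q s) e"
proof -
  have p': "p \<le> 1" and q0: "0 < q" and r: "0 < q / p" and \<sigma>: "0 < s * p" using p q s by auto
  have crit: "cdim TYPE('n) * (1 - p) < s * p \<or> (s * p = cdim TYPE('n) * (1 - p) \<and> p * (q / p) \<le> 1)"
    using p q s by simp
  obtain f :: "real^'n \<Rightarrow> real" where f: "f \<in> borel_measurable borel" "rho p (s * p) (q / p) f < top"
    and unb: "\<And>B K. \<exists>k\<ge>K. ennreal B \<le> rho p (s * p) (q / p) (avg k f)"
    using critical_unbounded_averages[OF p q s(2,3)] by metis
  have fX: "f \<in> besov_space p q s" using besov_space_iff[OF p(1) p' q0 s(1) f(1)] f(2) by simp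
  obtain E where E: "\<And>f :: real^'n \<Rightarrow> real. f\<in>borel_measurable borel \<Longrightarrow> rho p (s * p) (q / p) f < top \<Longrightarrow>
    pint 1 f \<le> ennreal E * rho p (s * p) (q / p) f powe (1 / (p * (q / p)))"
    using L1_embedding[OF p(1) p' \<sigma> r crit] by auto
  have f1: "pint 1 f < top" by (rule le_less_trans[OF E[OF f]]) (use f(2) in \<open>simp add: ennreal_mult_less_top\<close>)
  have no_bound: False if "b < top" "\<And>k. K \<le> k \<Longrightarrow> rho p (s * p) (q / p) (avg k f) \<le> b" for b K
  proof -
    obtain k where "K \<le> k" "ennreal (enn2real b + 1) \<le> rho p (s * p) (q / p) (avg k f)"
      using unb[of K "enn2real b + 1"] by blast
    then have "ennreal (enn2real b + 1) \<le> b" using that(2) order_trans by blast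
    also have "b = ennreal (enn2real b)" using that(1) by simp
    finally show False by (subst (asm) ennreal_le_iff) auto
  qed
  show "\<not> uniformly_bounded (besov_space p q s) (besov_norm p q s) (haar_partial_sum e)"
  proof
    assume "uniformly_bounded (besov_space p q s) (besov_norm p q s) (haar_partial_sum e)"
    then obtain C where C: "\<And>M. besov_norm p q s (haar_partial_sum e M f) \<le> ennreal C * besov_norm p q s f"
      using fX unfolding uniformly_bounded_def by blast
    obtain D where D: "\<And>f g :: real^'n \<Rightarrow> real. cube_eq f g \<Longrightarrow> g \<in> borel_measurable borel \<Longrightarrow>
      rho p (s * p) (q / p) g \<le> ennreal D * besov_norm p q s f powe q"
      using rho_le_besov_norm[OF p(1) p' q0 s(1)] by metis
    have "rho p (s * p) (q / p) (avg k f) \<le> ennreal D * (ennreal C * besov_norm p q s f) powe q" for k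
    proof -
      have "haar_partial_sum e (haar_count TYPE('n) k) f x = avg k f x" if x: "x \<in> hcube" for x
        using natural_partial_sum_eq_avg[OF e f(1) f1 x, of k]
        by (simp add: haar_partial_sum_def haar_coeff_eq[OF cube_eq_refl borel_imp_lebesgue_on[OF f(1)] f(1) natural_enumeration_borel[OF e]])
      then have "cube_eq (haar_partial_sum e (haar_count TYPE('n) k) f) (avg k f)" by (rule cube_eq_cong)
      from D[OF this avg_borel]
      have "rho p (s * p) (q / p) (avg k f) \<le> ennreal D * besov_norm p q s (haar_partial_sum e (haar_count TYPE('n) k) f) powe q" .
      also have "\<dots> \<le> ennreal D * (ennreal C * besov_norm p q s f) powe q"
        using q0 by (intro mult_left_mono powe_mono C) auto
      finally show ?thesis .
    qed
    moreover have "ennreal D * (ennreal C * besov_norm p q s f) powe q < top"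
      using fX by (simp add: besov_space_def ennreal_mult_less_top)
    ultimately show False using no_bound by blast
  qed
  show "\<not> schauder_basis (besov_space p q s) (besov_norm p q s) e"
  proof
    assume sb: "schauder_basis (besov_space p q s) (besov_norm p q s) e"
    obtain c where c: "(\<lambda>M. besov_norm p q s (\<lambda>x. f x - (\<Sum>m<M. c m * e m x))) \<longlonglongrightarrow> 0"
      using schauder_basis_expansion[OF sb fX] by blast
    have lim: "(\<lambda>M. rho p (s * p) (q / p) (\<lambda>x. f x - (\<Sum>m<M. c m * e m x))) \<longlonglongrightarrow> 0"
      using besov_norm_partial_sums[OF e p(1) p' q0 s(1) cube_eq_refl f(1)] c by simp
    have cm: "c = (\<lambda>m. hint f (e m))"
      using natural_expansion_unique(2)[OF e p(1) p' \<sigma> s(3) r crit f lim] by (rule ext)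
    have "(\<lambda>k. rho p (s * p) (q / p) (\<lambda>x. f x - (\<Sum>m<haar_count TYPE('n) k. c m * e m x))) \<longlonglongrightarrow> 0"
      using LIMSEQ_subseq_LIMSEQ[OF lim haar_count_strict_mono[where 'n = 'n]] by (simp add: comp_def)
    moreover have "rho p (s * p) (q / p) (\<lambda>x. f x - (\<Sum>m<haar_count TYPE('n) k. c m * e m x)) = rho p (s * p) (q / p) (\<lambda>x. f x - avg k f x)" for k
      unfolding cm by (rule rho_cong) (simp only: natural_partial_sum_eq_avg[OF e f(1) f1])
    ultimately have "(\<lambda>k. rho p (s * p) (q / p) (\<lambda>x. f x - avg k f x)) \<longlonglongrightarrow> 0" by simp
    from order_tendstoD(2)[OF this, of 1] obtain K where K: "\<And>k. K \<le> k \<Longrightarrow> rho p (s * p) (q / p) (\<lambda>x. f x - avg k f x) < 1"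
      unfolding eventually_sequentially by auto
    define b where "b = ennreal (2 powr (q / p)) * (rho p (s * p) (q / p) f + 1)"
    have "rho p (s * p) (q / p) (avg k f) \<le> b" if "K \<le> k" for k
    proof -
      have "rho p (s * p) (q / p) (avg k f) \<le> ennreal (2 powr (q / p)) * (rho p (s * p) (q / p) f + rho p (s * p) (q / p) (\<lambda>x. f x - avg k f x))"
        using rho_diff[OF p(1) p' r f(1), of "\<lambda>x. f x - avg k f x" "s * p"] f(1) by simp
      also have "\<dots> \<le> b" unfolding b_def using K[OF that] by (intro mult_left_mono add_left_mono) auto
      finally show ?thesis .
    qed
    moreover have "b < top" using f(2) by (simp add: b_def ennreal_mult_less_top)
    ultimately show False using no_bound by blast
  qed
qed

theorem theorem1:
  fixes d p q s :: real
  assumes d: "d = real CARD('n::finite)"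
    and p: "0 < p" "p \<le> 1" and q: "0 < q" and s: "0 < s"
  shows
    "((d * (1 / p - 1) < s \<and> s < 1 / p \<and> (d - 1) / d < p \<and> p \<le> 1) \<or>
      (s = d * (1 / p - 1) \<and> (d - 1) / d < p \<and> p < 1 \<and> q \<le> p) \<longrightarrow>
       (\<forall>e :: nat \<Rightarrow> real^'n \<Rightarrow> real. natural_enumeration e \<longrightarrow>
          schauder_basis (besov_space p q s) (besov_norm p q s) e)) \<and>
     (\<not> ((d * (1 / p - 1) < s \<and> s < 1 / p \<and> (d - 1) / d < p \<and> p \<le> 1) \<or>
         (s = d * (1 / p - 1) \<and> (d - 1) / d < p \<and> p < 1 \<and> q \<le> p)) \<longrightarrow>
       (\<forall>e :: nat \<Rightarrow> real^'n \<Rightarrow> real. natural_enumeration e \<longrightarrow>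
          \<not> schauder_basis (besov_space p q s) (besov_norm p q s) e)) \<and>
     (s < min (d * (1 / p - 1)) (1 / p) \<longrightarrow>
       (\<forall>\<phi> :: (real^'n \<Rightarrow> real) \<Rightarrow> real.
          bounded_functional (besov_space p q s) (besov_norm p q s) \<phi> \<longrightarrow>
          (\<forall>f \<in> besov_space p q s. \<phi> f = 0))) \<and>
     (1 / p \<le> s \<longrightarrow>
       (\<forall>f :: real^'n \<Rightarrow> real. f \<in> besov_space p q s \<longrightarrow>
          (\<exists>c. AE x in lebesgue_on unit_cube. f x = c))) \<and>
     (s = d * (1 / p - 1) \<and> (d - 1) / d < p \<and> p < 1 \<and> 1 < q \<longrightarrow>
       (\<forall>h \<in> haar_system :: (real^'n \<Rightarrow> real) set.
          \<not> (\<exists>\<phi>. bounded_functional (besov_space p q s) (besov_norm p q s) \<phi> \<and>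
                (\<forall>g \<in> haar_span. \<phi> g = haar_coeff h g)))) \<and>
     (s = d * (1 / p - 1) \<and> (d - 1) / d < p \<and> p < 1 \<and> p < q \<and> q \<le> 1 \<longrightarrow>
       (\<forall>e :: nat \<Rightarrow> real^'n \<Rightarrow> real. natural_enumeration e \<longrightarrow>
          \<not> uniformly_bounded (besov_space p q s) (besov_norm p q s) (haar_partial_sum e)))"
proof -
  have d0: "0 < d" by (simp add: d)
  \<comment> \<open>Multiplication by p passes to \<sigma> and \<delta>; the condition p > (d - 1) /
    d becomes \<delta> < 1.\<close>
  have eqs: "d * (1 / p - 1) < s \<longleftrightarrow> cdim TYPE('n) * (1 - p) < s * p"
    "s < d * (1 / p - 1) \<longleftrightarrow> s * p < cdim TYPE('n) * (1 - p)"
    "s = d * (1 / p - 1) \<longleftrightarrow> s * p = cdim TYPE('n) * (1 - p)"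
    "s < 1 / p \<longleftrightarrow> s * p < 1" "1 / p \<le> s \<longleftrightarrow> 1 \<le> s * p" "q \<le> p \<longleftrightarrow> q / p \<le> 1"
    "(d - 1) / d < p \<longleftrightarrow> cdim TYPE('n) * (1 - p) < 1"
    using p d0 unfolding d[symmetric] by (auto simp: field_simps)
  have 1: "schauder_basis (besov_space p q s) (besov_norm p q s) e"
    if "(d * (1 / p - 1) < s \<and> s < 1 / p \<and> (d - 1) / d < p \<and> p \<le> 1) \<or>
      (s = d * (1 / p - 1) \<and> (d - 1) / d < p \<and> p < 1 \<and> q \<le> p)" and e: "natural_enumeration e" for e :: "nat \<Rightarrow> real^'n \<Rightarrow> real"
    using that(1) unfolding eqs by (intro haar_schauder_basis[OF p q s _ _ e]) auto
  have 2: "\<not> schauder_basis (besov_space p q s) (besov_norm p q s) e"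
    if no: "\<not> ((d * (1 / p - 1) < s \<and> s < 1 / p \<and> (d - 1) / d < p \<and> p \<le> 1) \<or>
         (s = d * (1 / p - 1) \<and> (d - 1) / d < p \<and> p < 1 \<and> q \<le> p))" and e: "natural_enumeration e" for e :: "nat \<Rightarrow> real^'n \<Rightarrow> real"
  proof (cases "1 \<le> s * p")
    case True
    then show ?thesis by (rule not_schauder_basis_large_smoothness[OF p q s _ e])
  next
    case False
    then have sp: "s * p < 1" by simp
    show ?thesis
    proof (cases "s * p < cdim TYPE('n) * (1 - p)")
      case True
      then show ?thesis by (rule not_schauder_basis_small_smoothness[OF p q s sp _ e])
    next
      case nl: False
      \<comment> \<open>If s p exceeded \<delta>, then s p < 1 would give \<delta> < 1 and all
        conditions of the first positive case.\<close>
      then have eq: "s * p = cdim TYPE('n) * (1 - p)" using no sp p unfolding eqs by linarith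
      moreover have "0 < s * p" using s p by simp
      ultimately have p1: "p < 1" using p by (cases "p = 1") auto
      have "p < q" using no sp eq p1 p unfolding eqs(1-5,7) by auto
      show ?thesis
      proof (cases "q \<le> 1")
        case True
        then show ?thesis by (rule partial_sums_not_uniformly_bounded(2)[OF p(1) p1 \<open>p < q\<close> _ s eq sp e])
      next
        case False
        then show ?thesis by (intro not_schauder_basis_critical_large_q[OF p(1) p1 _ s eq sp e]) simp
      qed
    qed
  qed
  have 3: "\<phi> f = 0" if "s < min (d * (1 / p - 1)) (1 / p)"
    "bounded_functional (besov_space p q s) (besov_norm p q s) \<phi>" "f \<in> besov_space p q s"
    for \<phi> and f :: "real^'n \<Rightarrow> real"
    using that(1) unfolding min_less_iff_conj eqs by (intro trivial_dual[OF p q s _ _ that(2,3)]) auto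
  have 4: "\<exists>c. AE x in lebesgue_on unit_cube. f x = c" if "1 / p \<le> s" "f \<in> besov_space p q s" for f :: "real^'n \<Rightarrow> real"
    using besov_space_constant[OF p q s _ that(2)] that(1) unfolding eqs AE_unit_cube_iff by blast
  have 5: "False" if "s = d * (1 / p - 1) \<and> (d - 1) / d < p \<and> p < 1 \<and> 1 < q" "h \<in> haar_system"
    "bounded_functional (besov_space p q s) (besov_norm p q s) \<phi>" "\<forall>g \<in> haar_span. \<phi> g = haar_coeff h g"
    for h :: "real^'n \<Rightarrow> real" and \<phi>
    using that(1) unfolding eqs by (intro haar_coeff_not_bounded[OF p(1) _ _ s _ _ that(2,3)]) (use that(4) in auto)
  have 6: "\<not> uniformly_bounded (besov_space p q s) (besov_norm p q s) (haar_partial_sum e)"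
    if "s = d * (1 / p - 1) \<and> (d - 1) / d < p \<and> p < 1 \<and> p < q \<and> q \<le> 1" "natural_enumeration e" for e :: "nat \<Rightarrow> real^'n \<Rightarrow> real"
    using that(1) unfolding eqs(1-5,7) by (intro partial_sums_not_uniformly_bounded(1)[OF p(1) _ _ _ s _ _ that(2)]) auto
  show ?thesis using 1 2 3 4 5 6 by blast
qed

end
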